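(* Let $(\mathcal E,\rho)$ be a Polish space with metric $\rho$. For $\varepsilon>0$ let $\Gamma^\varepsilon$ be a measurable mapping from $C([0,T];\mathbb{R}^\infty)$ into $\mathcal E$ and set $X^\varepsilon:=\Gamma^\varepsilon(B(\cdot))$. Suppose that there exists a measurable map $\Gamma^0:C([0,T];\mathbb{R}^\infty)\to\mathcal E$ such that (i) for every $N<+\infty$, any family $\{k^\varepsilon;\varepsilon>0\}\subset\tilde S_N$ and any $\delta>0$, $$\lim_{\varepsilon\to0}P\big(\rho(Y^\varepsilon,Z^\varepsilon)>\delta\big)=0,$$ where $Y^\varepsilon=\Gamma^\varepsilon\left(B(\cdot)+\frac{1}{\sqrt\varepsilon}\int_0^\cdot k^\varepsilon(s)ds\right)$ and $Z^\varepsilon=\Gamma^0\left(\int_0^\cdot k^\varepsilon(s)ds\right)$; (ii) for every $N<+\infty$ and any family $\{k^\varepsilon;\varepsilon>0\}\subset S_N$ such that $k^\varepsilon$ converges weakly in $K$ to some element $k$ as $\varepsilon\to0$, $\Gamma^0\left(\int_0^\cdot k^\varepsilon(s)ds\right)$ converges to $\Gamma^0\left(\int_0^\cdot k(s)ds\right)$ in $\mathcal E$. Then the family $\{X^\varepsilon\}_{\varepsilon>0}$ satisfies, as $\varepsilon\to0$, a large deviation principle in $\mathcal E$ with the rate function $$I(g):=\inf_{\{k\in K;\ g=\Gamma^0(\int_0^\cdot k(s)ds)\}}\left\{\frac12\int_0^T\|k(s)\|_{l^2}^2ds\right\},\qquad g\in\mathcal E,$$ with the convention $\inf\emptyset=\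infty$.
   Context: $T>0$. $B=(B^1,B^2,\dots)$ is a sequence of independent real standard Brownian motions on $[0,T]$, defined on a probability space $(\Omega,\mathcal F,P)$, regarded as a random element of $C([0,T];\mathbb{R}^\infty)$; $\{\mathcal F_t\}$ is the augmented filtration generated by $B$. $l^2$ is the Hilbert space of square-summable real sequences and $K:=L^2([0,T];l^2)$. $S_N=\{k\in K:\int_0^T\|k(s)\|_{l^2}^2ds\le N\}$, endowed with the weak topology of $K$ (a compact Polish space). $\tilde K$ is the class of $l^2$-valued $\{\mathcal F_t\}$-predictable processes with paths in $K$ a.s., and $\tilde S_N=\{\phi\in\tilde K:\phi(\omega)\in S_N\ P\text{-a.s.}\}$. A rate function on $\mathcal E$ is a function $I:\mathcal E\to[0,\infty]$ such that $\{x\in\mathcal E:I(x)\le M\}$ is compact for each $M<\infty$. A family $\{X^\varepsilon\}$ of $\mathcal E$-valued random elements satisfies a large deviation principle on $\mathcal E$ with rate function $I$ if $\limsup_{\varepsilon\to0}\varepsilon\log P(X^\varepsilon\in F)\le-\inf_{x\in F}I(x)$ for each closed $F\subset\mathcal E$ and $\liminf_{\varepsilon\to0}\varepsilon\log P(X^\varepsilon\in G)\ge-\inf_{x\in G}I(x)$ for each open $G\subset\mathcal E$. *)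

theory Defs
  imports "HOL-Probability.Probability"
begin

section \<open>The Hilbert space of square-summable real sequences\<close>

typedef l2 = "{x :: nat \<Rightarrow> real. summable (\<lambda>i. (x i)\<^sup>2)}"
  morphisms l2_seq Abs_l2
  by (rule exI[of _ "\<lambda>_. 0"]) simp

setup_lifting type_definition_l2

lemma summable_l2_seq: "summable (\<lambda>i. (l2_seq x i)\<^sup>2)"
  using l2_seq[of x] by simp

lemma l2_eqI: "(\<And>i. l2_seq x i = l2_seq y i) \<Longrightarrow> x = y"
  by (metis ext l2_seq_inject)

lemma summable_sq_mult:
  fixes x y :: "nat \<Rightarrow> real"
  assumes "summable (\<lambda>i. (x i)\<^sup>2)" "summable (\<lambda>i. (y i)\<^sup>2)"
  shows "summable (\<lambda>i. x i * y i)"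
proof (rule summable_comparison_test'[where N = 0])
  show "summable (\<lambda>i. (x i)\<^sup>2 + (y i)\<^sup>2)" using assms by (rule summable_add)
  show "norm (x n * y n) \<le> (x n)\<^sup>2 + (y n)\<^sup>2" for n
  proof -
    have "0 \<le> (\<bar>x n\<bar> - \<bar>y n\<bar>)\<^sup>2" by simp
    then have "2 * (\<bar>x n\<bar> * \<bar>y n\<bar>) \<le> (x n)\<^sup>2 + (y n)\<^sup>2"
      by (simp add: power2_diff)
    moreover have "0 \<le> \<bar>x n\<bar> * \<bar>y n\<bar>" by simp
    ultimately have "\<bar>x n\<bar> * \<bar>y n\<bar> \<le> (x n)\<^sup>2 + (y n)\<^sup>2" by linarith
    then show ?thesis by (simp add: abs_mult)
  qed
qed

lemma summable_sq_add:
  fixes x y :: "nat \<Rightarrow> real"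
  assumes "summable (\<lambda>i. (x i)\<^sup>2)" "summable (\<lambda>i. (y i)\<^sup>2)"
  shows "summable (\<lambda>i. (x i + y i)\<^sup>2)"
proof -
  have "summable (\<lambda>i. (x i)\<^sup>2 + (y i)\<^sup>2 + 2 * (x i * y i))"
    using assms summable_sq_mult[OF assms] by (intro summable_add summable_mult)
  then show ?thesis by (simp add: power2_sum mult.assoc)
qed

instantiation l2 :: real_vector
begin

lift_definition zero_l2 :: l2 is "\<lambda>_. 0" by simp
lift_definition plus_l2 :: "l2 \<Rightarrow> l2 \<Rightarrow> l2" is "\<lambda>x y i. x i + y i"
  by (rule summable_sq_add)
lift_definition uminus_l2 :: "l2 \<Rightarrow> l2" is "\<lambda>x i. - x i" by simp
lift_definition minus_l2 :: "l2 \<Rightarrow> l2 \<Rightarrow> l2" is "\<lambda>x y i. x i - y i"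
  using summable_sq_add[of _ "\<lambda>i. - y i" for y] by fastforce
lift_definition scaleR_l2 :: "real \<Rightarrow> l2 \<Rightarrow> l2" is "\<lambda>r x i. r * x i"
  by (simp add: power_mult_distrib summable_mult)

instance
  by standard (transfer; simp add: algebra_simps)+

end

instantiation l2 :: real_inner
begin

definition inner_l2 :: "l2 \<Rightarrow> l2 \<Rightarrow> real"
  where "inner_l2 x y = (\<Sum>i. l2_seq x i * l2_seq y i)"
definition norm_l2 :: "l2 \<Rightarrow> real"
  where "norm_l2 x = sqrt (\<Sum>i. (l2_seq x i)\<^sup>2)"
definition sgn_l2 :: "l2 \<Rightarrow> l2"
  where "sgn_l2 x = inverse (norm x) *\<^sub>R x"
definition dist_l2 :: "l2 \<Rightarrow> l2 \<Rightarrow> real"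
  where "dist_l2 x y = norm (x - y)"
definition uniformity_l2 :: "(l2 \<times> l2) filter"
  where "uniformity_l2 = (INF e\<in>{0<..}. principal {(x, y). dist x y < e})"
definition open_l2 :: "l2 set \<Rightarrow> bool"
  where "open_l2 U \<longleftrightarrow> (\<forall>x\<in>U. eventually (\<lambda>(x', y). x' = x \<longrightarrow> y \<in> U) uniformity)"

lemma summable_l2_inner: "summable (\<lambda>i. l2_seq x i * l2_seq y i)"
  by (rule summable_sq_mult) (rule summable_l2_seq)+

instance
proof
  fix x y z :: l2 and r :: real
  show "inner x y = inner y x" by (simp add: inner_l2_def mult.commute)
  show "inner (x + y) z = inner x z + inner y z"
    by (simp add: inner_l2_def plus_l2.rep_eq distrib_right suminf_add summable_l2_inner)
  show "inner (r *\<^sub>R x) y = r * inner x y"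
    by (simp add: inner_l2_def scaleR_l2.rep_eq mult.assoc suminf_mult summable_l2_inner)
  show "0 \<le> inner x x"
    by (simp add: inner_l2_def suminf_nonneg summable_l2_inner)
  show "inner x x = 0 \<longleftrightarrow> x = 0"
  proof
    assume "inner x x = 0"
    then have "\<forall>i. l2_seq x i * l2_seq x i = 0"
      using suminf_eq_zero_iff[OF summable_l2_inner[of x x]] by (simp add: inner_l2_def)
    then show "x = 0" by (intro l2_eqI) (simp add: zero_l2.rep_eq)
  qed (simp add: inner_l2_def zero_l2.rep_eq)
  show "norm x = sqrt (inner x x)"
    by (simp add: norm_l2_def inner_l2_def power2_eq_square)
qed (simp_all add: sgn_l2_def dist_l2_def uniformity_l2_def open_l2_def)

end

lemma norm_l2_sq: "(norm (x :: l2))\<^sup>2 = (\<Sum>i. (l2_seq x i)\<^sup>2)"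
  by (simp add: norm_l2_def suminf_nonneg summable_l2_seq)

lemma l2_partial_sum_le: "(\<Sum>i<n. (l2_seq x i)\<^sup>2) \<le> (norm x)\<^sup>2"
  unfolding norm_l2_sq by (rule sum_le_suminf) (simp_all add: summable_l2_seq)

lemma l2_norm_leI:
  assumes "0 \<le> c" "\<And>n. (\<Sum>i<n. (l2_seq x i)\<^sup>2) \<le> c\<^sup>2"
  shows "norm x \<le> c"
proof -
  have "(norm x)\<^sup>2 \<le> c\<^sup>2" unfolding norm_l2_sq
    by (rule suminf_le_const[OF summable_l2_seq assms(2)])
  then show ?thesis using assms(1) by (rule power2_le_imp_le)
qed

lemma l2_seq_le_norm: "\<bar>l2_seq x i\<bar> \<le> norm x"
proof -
  have "(l2_seq x i)\<^sup>2 \<le> (\<Sum>j<Suc i. (l2_seq x j)\<^sup>2)"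
    by (simp add: sum_nonneg)
  also have "\<dots> \<le> (norm x)\<^sup>2" by (rule l2_partial_sum_le)
  finally have "\<bar>l2_seq x i\<bar>\<^sup>2 \<le> (norm x)\<^sup>2" by simp
  then show ?thesis by (rule power2_le_imp_le) simp
qed

instance l2 :: complete_space
proof
  fix u :: "nat \<Rightarrow> l2"
  assume u: "Cauchy u"
  have "Cauchy (\<lambda>n. l2_seq (u n) i)" for i
  proof (rule metric_CauchyI)
    fix e :: real assume "0 < e"
    then obtain N where N: "\<And>m n. m \<ge> N \<Longrightarrow> n \<ge> N \<Longrightarrow> dist (u m) (u n) < e"
      using u by (meson metric_CauchyD)
    show "\<exists>N. \<forall>m\<ge>N. \<forall>n\<ge>N. dist (l2_seq (u m) i) (l2_seq (u n) i) < e"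
    proof (intro exI allI impI)
      fix m n assume "N \<le> m" "N \<le> n"
      have "dist (l2_seq (u m) i) (l2_seq (u n) i) = \<bar>l2_seq (u m - u n) i\<bar>"
        by (simp add: dist_real_def minus_l2.rep_eq)
      also have "\<dots> \<le> dist (u m) (u n)" by (simp add: dist_norm l2_seq_le_norm)
      also have "\<dots> < e" by (rule N) fact+
      finally show "dist (l2_seq (u m) i) (l2_seq (u n) i) < e" .
    qed
  qed
  then have "\<forall>i. \<exists>l. (\<lambda>n. l2_seq (u n) i) \<longlonglongrightarrow> l"
    by (simp add: Cauchy_convergent_iff convergent_def)
  then obtain x where x: "\<And>i. (\<lambda>n. l2_seq (u n) i) \<longlonglongrightarrow> x i" by metis
  have bound: "(\<Sum>i<j. (l2_seq (u m) i - x i)\<^sup>2) \<le> e\<^sup>2"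
    if N: "\<And>m n. m \<ge> N \<Longrightarrow> n \<ge> N \<Longrightarrow> dist (u m) (u n) < e" and "N \<le> m" for e N m j
  proof (rule LIMSEQ_le_const2)
    show "(\<lambda>n. \<Sum>i<j. (l2_seq (u m) i - l2_seq (u n) i)\<^sup>2) \<longlonglongrightarrow> (\<Sum>i<j. (l2_seq (u m) i - x i)\<^sup>2)"
      by (intro tendsto_intros x)
    show "\<exists>N. \<forall>n\<ge>N. (\<Sum>i<j. (l2_seq (u m) i - l2_seq (u n) i)\<^sup>2) \<le> e\<^sup>2"
    proof (intro exI allI impI)
      fix n assume "N \<le> n"
      have "(\<Sum>i<j. (l2_seq (u m) i - l2_seq (u n) i)\<^sup>2) \<le> (norm (u m - u n))\<^sup>2"
        using l2_partial_sum_le[of "u m - u n" j] by (simp add: minus_l2.rep_eq)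
      also have "\<dots> \<le> e\<^sup>2"
        using N[OF \<open>N \<le> m\<close> \<open>N \<le> n\<close>] by (intro power_mono) (simp_all add: dist_norm)
      finally show "(\<Sum>i<j. (l2_seq (u m) i - l2_seq (u n) i)\<^sup>2) \<le> e\<^sup>2" .
    qed
  qed
  have summ: "summable (\<lambda>i. (l2_seq (u m) i - x i)\<^sup>2)"
    if "\<And>m n. m \<ge> N \<Longrightarrow> n \<ge> N \<Longrightarrow> dist (u m) (u n) < e" "N \<le> m" for e N m
    by (rule summableI_nonneg_bounded) (simp, rule bound[OF that])
  obtain N1 where N1: "\<And>m n. m \<ge> N1 \<Longrightarrow> n \<ge> N1 \<Longrightarrow> dist (u m) (u n) < 1"
    using u by (meson metric_CauchyD zero_less_one)
  have "summable (\<lambda>i. (- (l2_seq (u N1) i - x i))\<^sup>2)"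
    unfolding power2_minus by (rule summ[OF N1 order_refl])
  from summable_sq_add[OF summable_l2_seq[of "u N1"] this]
  have sx: "summable (\<lambda>i. (x i)\<^sup>2)" by simp
  define X where "X = Abs_l2 x"
  have X: "l2_seq X = x" unfolding X_def by (rule Abs_l2_inverse) (simp add: sx)
  have "u \<longlonglongrightarrow> X"
  proof (rule metric_LIMSEQ_I)
    fix r :: real assume "0 < r"
    then have "0 < r / 2" by simp
    then obtain N where N: "\<And>m n. m \<ge> N \<Longrightarrow> n \<ge> N \<Longrightarrow> dist (u m) (u n) < r / 2"
      using u by (meson metric_CauchyD)
    show "\<exists>N. \<forall>n\<ge>N. dist (u n) X < r"
    proof (intro exI allI impI)
      fix n assume n: "N \<le> n"
      have "norm (u n - X) \<le> r / 2"
        using bound[OF N n] \<open>0 < r\<close> by (intro l2_norm_leI) (simp_all add: minus_l2.rep_eq X)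
      then show "dist (u n) X < r" using \<open>0 < r\<close> by (simp add: dist_norm)
    qed
  qed
  then show "convergent u" by (rule convergentI)
qed

instance l2 :: banach ..

lemma l2_finite_rational_dense:
  fixes x :: l2
  assumes "0 < e"
  shows "\<exists>xs :: rat list. \<exists>y. l2_seq y = (\<lambda>i. if i < length xs then of_rat (xs ! i) else 0)
           \<and> dist y x < e"
proof -
  define c where "c = e / 2"
  have c: "0 < c" using assms by (simp add: c_def)
  obtain n where n: "\<And>m. n \<le> m \<Longrightarrow> (\<Sum>i\<in>{n..<m}. (l2_seq x i)\<^sup>2) < c\<^sup>2 / 2"
  proof -
    from c have "0 < c\<^sup>2 / 2" by simp
    with summable_l2_seq[of x] obtain N where
      N: "\<And>m n. N \<le> m \<Longrightarrow> norm (\<Sum>i\<in>{m..<n}. (l2_seq x i)\<^sup>2) < c\<^sup>2 / 2"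
      unfolding summable_Cauchy by metis
    show ?thesis
    proof (rule that)
      fix m
      show "(\<Sum>i\<in>{N..<m}. (l2_seq x i)\<^sup>2) < c\<^sup>2 / 2"
        using N[OF order_refl, of m] by (simp add: sum_nonneg)
    qed
  qed
  define d where "d = c\<^sup>2 / (2 * (real n + 1))"
  have d: "0 < d" using c by (simp add: d_def)
  have "\<exists>q :: rat. (of_rat q - l2_seq x i)\<^sup>2 < d" for i
  proof -
    obtain q where q: "l2_seq x i < of_rat q" "of_rat q < l2_seq x i + sqrt d"
      using of_rat_dense[of "l2_seq x i" "l2_seq x i + sqrt d"] d by auto
    have "(of_rat q - l2_seq x i)\<^sup>2 < (sqrt d)\<^sup>2"
      using q by (intro power_strict_mono) auto
    then show ?thesis using d by auto
  qed
  then obtain q :: "nat \<Rightarrow> rat" where q: "\<And>i. (of_rat (q i) - l2_seq x i)\<^sup>2 < d" by metis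
  define ys where "ys = map q [0..<n]"
  let ?s = "\<lambda>i. if i < length ys then of_rat (ys ! i) else (0 :: real)"
  have "summable (\<lambda>i. (?s i)\<^sup>2)"
    by (rule summable_finite[of "{..<n}"]) (auto simp: ys_def)
  then have y: "l2_seq (Abs_l2 ?s) = ?s" by (intro Abs_l2_inverse) simp
  define z where "z = Abs_l2 ?s"
  have z: "l2_seq z i = (if i < n then of_rat (q i) else 0)" for i
    unfolding z_def y by (simp add: ys_def)
  have "norm (z - x) \<le> c"
  proof (rule l2_norm_leI)
    fix m
    have "(\<Sum>i<m. (l2_seq (z - x) i)\<^sup>2) \<le> (\<Sum>i<n + m. (l2_seq (z - x) i)\<^sup>2)"
      by (rule sum_mono2) auto
    also have "\<dots> = (\<Sum>i<n. (l2_seq (z - x) i)\<^sup>2)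
        + (\<Sum>i\<in>{n..<n + m}. (l2_seq (z - x) i)\<^sup>2)"
      by (simp add: lessThan_atLeast0 sum.atLeastLessThan_concat)
    also have "(\<Sum>i<n. (l2_seq (z - x) i)\<^sup>2) \<le> (\<Sum>i<n. d)"
      by (intro sum_mono) (auto simp: minus_l2.rep_eq z intro: less_imp_le q)
    also have "(\<Sum>i<n. d) \<le> c\<^sup>2 / 2"
      using c by (simp add: d_def field_simps)
    also have "(\<Sum>i\<in>{n..<n + m}. (l2_seq (z - x) i)\<^sup>2) = (\<Sum>i\<in>{n..<n + m}. (l2_seq x i)\<^sup>2)"
      by (intro sum.cong) (auto simp: minus_l2.rep_eq z)
    also have "\<dots> \<le> c\<^sup>2 / 2" using n[of "n + m"] by simp
    finally show "(\<Sum>i<m. (l2_seq (z - x) i)\<^sup>2) \<le> c\<^sup>2" by simp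
  qed (use c in simp)
  then have "dist (z) x < e" using assms by (simp add: dist_norm c_def)
  with y[folded z_def] show ?thesis by blast
qed

instance l2 :: second_countable_topology
proof
  define D :: "l2 set" where
    "D = (\<lambda>xs :: rat list. Abs_l2 (\<lambda>i. if i < length xs then of_rat (xs ! i) else 0)) ` UNIV"
  have D: "\<exists>y\<in>D. dist y x < e" if e: "0 < e" for x :: l2 and e
  proof -
    obtain xs :: "rat list" and y where
      y: "l2_seq y = (\<lambda>i. if i < length xs then of_rat (xs ! i) else 0)" "dist y x < e"
      using l2_finite_rational_dense[OF e] by blast
    have "y = Abs_l2 (\<lambda>i. if i < length xs then of_rat (xs ! i) else 0)"
      using y(1) by (metis l2_seq_inverse)
    with y(2) show ?thesis by (auto simp: D_def)
  qed
  define \<B> where "\<B> = (\<lambda>(y, n). ball y (1 / real (Suc n))) ` (D \<times> UNIV)"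
  have "countable \<B>" by (simp add: \<B>_def D_def)
  moreover have "topological_basis \<B>"
  proof (rule topological_basisI)
    show "open B" if "B \<in> \<B>" for B using that by (auto simp: \<B>_def)
    fix U :: "l2 set" and x assume "open U" "x \<in> U"
    then obtain e where e: "0 < e" "ball x e \<subseteq> U" by (meson openE)
    obtain n where n: "1 / real (Suc n) < e / 2"
      using e(1) by (metis half_gt_zero nat_approx_posE)
    obtain y where y: "y \<in> D" "dist y x < 1 / real (Suc n)"
      using D[of "1 / real (Suc n)" x] by auto
    have "ball y (1 / real (Suc n)) \<subseteq> ball x e"
    proof
      fix z assume "z \<in> ball y (1 / real (Suc n))"
      then have "dist y z < 1 / real (Suc n)" by simp
      then show "z \<in> ball x e"
        using dist_triangle[of x z y] y(2) n by (simp add: dist_commute)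
    qed
    then show "\<exists>B\<in>\<B>. x \<in> B \<and> B \<subseteq> U"
      using y e(2) by (intro bexI[of _ "ball y (1 / real (Suc n))"]) (auto simp: \<B>_def)
  qed
  ultimately show "\<exists>B :: l2 set set. countable B \<and> open = generate_topology B"
    using topological_basis_imp_subbasis by blast
qed

section \<open>The space $K = L^2([0,T]; l^2)$, its weak convergence, and primitives\<close>

text \<open>Elements of \<open>K\<close> are handled through representatives; only their values on \<open>{0..T}\<close> up to
  Lebesgue-null sets matter in everything below.\<close>

definition L2_space :: "real \<Rightarrow> (real \<Rightarrow> l2) set" where
  "L2_space T = {k. set_borel_measurable lborel {0..T} k \<and>
                    set_integrable lborel {0..T} (\<lambda>s. (norm (k s))\<^sup>2)}"

definition L2_inner :: "real \<Rightarrow> (real \<Rightarrow> l2) \<Rightarrow> (real \<Rightarrow> l2) \<Rightarrow> real" where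
  "L2_inner T k h = (LINT s:{0..T}|lborel. inner (k s) (h s))"

definition L2_energy :: "real \<Rightarrow> (real \<Rightarrow> l2) \<Rightarrow> real" where
  "L2_energy T k = (LINT s:{0..T}|lborel. (norm (k s))\<^sup>2)"

definition L2_ball :: "real \<Rightarrow> real \<Rightarrow> (real \<Rightarrow> l2) set" where
  "L2_ball T N = {k \<in> L2_space T. L2_energy T k \<le> N}"

definition L2_weak_tendsto ::
  "real \<Rightarrow> ('i \<Rightarrow> real \<Rightarrow> l2) \<Rightarrow> (real \<Rightarrow> l2) \<Rightarrow> 'i filter \<Rightarrow> bool" where
  "L2_weak_tendsto T k k0 F \<longleftrightarrow>
     (\<forall>h\<in>L2_space T. ((\<lambda>i. L2_inner T (k i) h) \<longlongrightarrow> L2_inner T k0 h) F)"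

definition primitive :: "real \<Rightarrow> (real \<Rightarrow> l2) \<Rightarrow> real \<Rightarrow> nat \<Rightarrow> real" where
  "primitive T k = (\<lambda>t\<in>{0..T}. l2_seq (LINT s:{0..t}|lborel. k s))"

section \<open>The path space $C([0,T]; \mathbb{R}^\infty)$\<close>

text \<open>The metric on \<open>nat \<Rightarrow> real\<close> is the library's metric for the product topology, so
  \<open>cfunspace\<close> carries the topology of uniform convergence on \<open>[0,T]\<close>. Its points are
  extensional: undefined outside \<open>{0..T}\<close>.\<close>

definition path_metric :: "real \<Rightarrow> (real \<Rightarrow> nat \<Rightarrow> real) metric" where
  "path_metric T = cfunspace (top_of_set {0..T}) euclidean_metric"

definition path_space :: "real \<Rightarrow> (real \<Rightarrow> nat \<Rightarrow> real) measure" where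
  "path_space T = sigma (mspace (path_metric T)) {U. openin (mtopology_of (path_metric T)) U}"

section \<open>Brownian motions\<close>

definition standard_BM :: "'w measure \<Rightarrow> real \<Rightarrow> (real \<Rightarrow> 'w \<Rightarrow> real) \<Rightarrow> bool" where
  "standard_BM M T W \<longleftrightarrow>
     (\<forall>t\<in>{0..T}. W t \<in> borel_measurable M) \<and>
     (AE \<omega> in M. W 0 \<omega> = 0) \<and>
     (\<forall>\<omega>\<in>space M. continuous_on {0..T} (\<lambda>t. W t \<omega>)) \<and>
     (\<forall>s t. 0 \<le> s \<and> s < t \<and> t \<le> T \<longrightarrow>
        distributed M lborel (\<lambda>\<omega>. W t \<omega> - W s \<omega>) (normal_density 0 (sqrt (t - s)))) \<and>
     (\<forall>(n::nat) \<tau>. mono_on {..n} \<tau> \<and> \<tau> ` {..n} \<subseteq> {0..T} \<longrightarrow>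
        prob_space.indep_vars M (\<lambda>_. borel) (\<lambda>i \<omega>. W (\<tau> (Suc i)) \<omega> - W (\<tau> i) \<omega>) {..<n})"

definition independent_BMs :: "'w measure \<Rightarrow> real \<Rightarrow> (nat \<Rightarrow> real \<Rightarrow> 'w \<Rightarrow> real) \<Rightarrow> bool" where
  "independent_BMs M T B \<longleftrightarrow>
     (\<forall>i. standard_BM M T (B i)) \<and>
     prob_space.indep_vars M (\<lambda>_. Pi\<^sub>M {0..T} (\<lambda>_. borel)) (\<lambda>i \<omega>. \<lambda>t\<in>{0..T}. B i t \<omega>) UNIV"

definition BM_path :: "real \<Rightarrow> (nat \<Rightarrow> real \<Rightarrow> 'w \<Rightarrow> real) \<Rightarrow> 'w \<Rightarrow> real \<Rightarrow> nat \<Rightarrow> real" where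
  "BM_path T B \<omega> = (\<lambda>t\<in>{0..T}. \<lambda>i. B i t \<omega>)"

definition shifted_BM_path ::
  "real \<Rightarrow> (nat \<Rightarrow> real \<Rightarrow> 'w \<Rightarrow> real) \<Rightarrow> real \<Rightarrow> (real \<Rightarrow> l2) \<Rightarrow> 'w \<Rightarrow> real \<Rightarrow> nat \<Rightarrow> real" where
  "shifted_BM_path T B \<epsilon> k \<omega> =
     (\<lambda>t\<in>{0..T}. \<lambda>i. B i t \<omega> + 1 / sqrt \<epsilon> * primitive T k t i)"

section \<open>Predictable processes\<close>

text \<open>The null sets used for the augmentation are those of the completion: \<open>M\<close> itself is not
  assumed to be complete.\<close>

definition augmented_filtration ::
  "'w measure \<Rightarrow> (nat \<Rightarrow> real \<Rightarrow> 'w \<Rightarrow> real) \<Rightarrow> real \<Rightarrow> 'w measure" where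
  "augmented_filtration M B t =
     sigma (space M)
       ({B i s -` A \<inter> space M | i s A. s \<in> {0..t} \<and> A \<in> sets borel} \<union> null_sets (completion M))"

definition predictable_sigma :: "real \<Rightarrow> 'w set \<Rightarrow> (real \<Rightarrow> 'w measure) \<Rightarrow> (real \<times> 'w) measure" where
  "predictable_sigma T \<Omega> F =
     sigma ({0..T} \<times> \<Omega>)
       ({{0} \<times> A | A. A \<in> sets (F 0)} \<union>
        {{s<..t} \<times> A | s t A. 0 \<le> s \<and> s < t \<and> t \<le> T \<and> A \<in> sets (F s)})"

definition L2_controls ::
  "'w measure \<Rightarrow> real \<Rightarrow> (nat \<Rightarrow> real \<Rightarrow> 'w \<Rightarrow> real) \<Rightarrow> (real \<Rightarrow> 'w \<Rightarrow> l2) set" where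
  "L2_controls M T B =
     {\<phi>. (\<lambda>(t, \<omega>). \<phi> t \<omega>) \<in> borel_measurable (predictable_sigma T (space M) (augmented_filtration M B)) \<and>
         (AE \<omega> in M. (\<lambda>t. \<phi> t \<omega>) \<in> L2_space T)}"

definition bounded_controls ::
  "'w measure \<Rightarrow> real \<Rightarrow> (nat \<Rightarrow> real \<Rightarrow> 'w \<Rightarrow> real) \<Rightarrow> real \<Rightarrow> (real \<Rightarrow> 'w \<Rightarrow> l2) set" where
  "bounded_controls M T B N =
     {\<phi> \<in> L2_controls M T B. AE \<omega> in M. (\<lambda>t. \<phi> t \<omega>) \<in> L2_ball T N}"

section \<open>Large deviation principles\<close>

definition rate_function :: "('e::topological_space \<Rightarrow> ennreal) \<Rightarrow> bool" where
  "rate_function I \<longleftrightarrow> (\<forall>L<\<infinity>. compact {x. I x \<le> L})"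

text \<open>The library's \<open>ln 0\<close> is \<open>0\<close>, whereas \<open>log P(X \<in> A)\<close> has to be \<open>-\<infinity>\<close> for null events.\<close>

definition ext_ln :: "real \<Rightarrow> ereal" where
  "ext_ln p = (if p = 0 then -\<infinity> else ereal (ln p))"

definition satisfies_LDP ::
  "'w measure \<Rightarrow> (real \<Rightarrow> 'w \<Rightarrow> 'e::topological_space) \<Rightarrow> ('e \<Rightarrow> ennreal) \<Rightarrow> bool" where
  "satisfies_LDP M X I \<longleftrightarrow>
     (\<forall>\<epsilon>>0. X \<epsilon> \<in> borel_measurable M) \<and>
     rate_function I \<and>
     (\<forall>F. closed F \<longrightarrow>
        Limsup (at_right 0) (\<lambda>\<epsilon>. ereal \<epsilon> * ext_ln (measure M {\<omega> \<in> space M. X \<epsilon> \<omega> \<in> F}))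
          \<le> - (INF x\<in>F. enn2ereal (I x))) \<and>
     (\<forall>G. open G \<longrightarrow>
        - (INF x\<in>G. enn2ereal (I x))
          \<le> Liminf (at_right 0) (\<lambda>\<epsilon>. ereal \<epsilon> * ext_ln (measure M {\<omega> \<in> space M. X \<epsilon> \<omega> \<in> G})))"

end

theory Submission
  imports Defs "HOL-Library.Diagonal_Subsequence"
begin

text \<open>
  No stochastic integral is needed. For the upper bound let \<open>A\<close> be a set of paths with
  \<open>P(B \<in> A) = p > 0\<close>. A smooth cylinder function \<open>F\<close> close to the indicator of \<open>A\<close> and bounded
  away from \<open>0\<close> has conditional expectations \<open>M\<^sub>i\<close> along a fine dyadic grid, and the piecewise
  constant feedback drift \<open>\<nabla> log M\<^sub>i\<close> is nearly optimal in the variational formula: with \<open>Y\<close> the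
  drifted Brownian motion and \<open>H\<close> the mean energy of the drift,
  \<open>H - E log F(Y) \<le> - log E F(B) + O(h)\<close> for mesh size \<open>h\<close>. Hence with probability bounded
  below \<open>Y\<close> lies in \<open>A\<close> while the drift has energy at most slightly more than \<open>log (1/p)\<close>; a discrete Girsanov identity
  and the resulting entropy bound control what happens where \<open>F\<close> and the indicator differ.
  Condition (i) then produces elements of a ball of \<open>K\<close> whose skeletons approach a closed set of large
  probability, and weak compactness together with (ii) concludes. The lower bound applies the same
  entropy bound to deterministic dyadic step controls.
\<close>

section \<open>Finite Gaussian families and drift\<close>

text \<open>There are about \<open>T / h\<close> time steps, so each may lose only order
  \<open>h\<^sup>2\<close>; this forces a second-order expansion of a logarithm whose remainder is
  controlled together with its exponential moments. Since the logarithm of an indicator can be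
  infinite, the functional is \<open>\<kappa> + (1 - \<kappa>) * f\<close> with \<open>f\<close>
  smooth and \<open>\<kappa>\<close> fixed before \<open>f\<close>; the set where \<open>f\<close>
  and the indicator disagree is rare for \<open>B\<close>, but rarity is wanted along the drifted
  path. The energy of the feedback drift is controlled in mean only, whereas (i) speaks of controls
  with a sure bound, so the drift is stopped at an energy level \<open>R\<close>; the event is still
  reached with probability about \<open>1 - ln (1 / p) / R\<close> or more. With
  \<open>p \<ge> exp (- a' / \<epsilon>)\<close> and \<open>R = a / \<epsilon>\<close>,
  \<open>a' < a\<close>, this stays positive uniformly in \<open>\<epsilon>\<close>, while the
  exceptional probability in (i) vanishes: a single sample point then yields a deterministic
  control. All controls are dyadic step functions in finitely many components, so Girsanov reduces
  to translating Gaussian coordinates one at a time.\<close>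

locale gaussian_family = prob_space M for M :: "'w measure" +
  fixes Z :: "'w \<Rightarrow> 'i::countable \<Rightarrow> real" and J :: "'i set" and h :: real
  assumes h_pos: "0 < h" and finite_J: "finite J"
    and indep: "indep_vars (\<lambda>_. borel) (\<lambda>q \<omega>. Z \<omega> q) J"
    and normal: "\<And>q. q \<in> J \<Longrightarrow> distributed M lborel (\<lambda>\<omega>. Z \<omega> q) (normal_density 0 (sqrt h))"
    and zero: "\<And>q \<omega>. q \<notin> J \<Longrightarrow> Z \<omega> q = 0"
begin

lemma measurable_coord[measurable]: "(\<lambda>\<omega>. Z \<omega> q) \<in> borel_measurable M"
proof (cases "q \<in> J")
  case True
  then show ?thesis using normal by (auto simp: distributed_def)
qed (simp add: zero)

lemma measurable_Z[measurable]: "Z \<in> borel_measurable M"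
  by (rule measurable_coordinatewise_then_product) simp

text \<open>The coordinates inside and outside \<open>C\<close> are independent, so redrawing those
  in \<open>C\<close> from an independent copy keeps the law of \<open>Z\<close>. Integrating over
  the copy alone is thus conditional expectation given the coordinates outside \<open>C\<close>, in
  concrete form.\<close>

lemma distr_resample:
  "distr (M \<Otimes>\<^sub>M M) borel (\<lambda>(\<omega>, \<omega>') q. if q \<in> C then Z \<omega>' q else Z \<omega> q) = distr M borel Z"
proof -
  define A where "A = J - C"
  define D where "D = J \<inter> C"
  let ?P = "Pi\<^sub>M A (\<lambda>_. borel :: real measure)" and ?Q = "Pi\<^sub>M D (\<lambda>_. borel :: real measure)"
  let ?X = "\<lambda>\<omega>. restrict (Z \<omega>) A" and ?Y = "\<lambda>\<omega>. restrict (Z \<omega>) D"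
  let ?g = "\<lambda>(x, y) q. if q \<in> D then y q else if q \<in> A then x q else (0 :: real)"
  have "indep_var ?P ?X ?Q ?Y"
    using indep_var_restrict[OF indep, of A D] by (auto simp: A_def D_def)
  then have rv[measurable]: "?X \<in> M \<rightarrow>\<^sub>M ?P" "?Y \<in> M \<rightarrow>\<^sub>M ?Q"
    and eq: "distr M ?P ?X \<Otimes>\<^sub>M distr M ?Q ?Y = distr M (?P \<Otimes>\<^sub>M ?Q) (\<lambda>\<omega>. (?X \<omega>, ?Y \<omega>))"
    unfolding indep_var_distribution_eq by auto
  have g[measurable]: "?g \<in> borel_measurable (?P \<Otimes>\<^sub>M ?Q)"
  proof (rule measurable_coordinatewise_then_product)
    fix q show "(\<lambda>z. (case z of (x, y) \<Rightarrow> \<lambda>q. if q \<in> D then y q else if q \<in> A then x q else 0) q)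
      \<in> borel_measurable (?P \<Otimes>\<^sub>M ?Q)"
    by (cases "q \<in> D"; cases "q \<in> A") (auto simp: case_prod_beta intro: measurable_compose[OF measurable_fst] measurable_compose[OF measurable_snd])
  qed
  interpret Y: prob_space "distr M ?Q ?Y" by (rule prob_space_distr) simp
  have "distr M borel Z = distr M borel (\<lambda>\<omega>. ?g (?X \<omega>, ?Y \<omega>))"
    by (intro distr_cong refl) (auto simp: A_def D_def zero fun_eq_iff)
  also have "\<dots> = distr (distr M (?P \<Otimes>\<^sub>M ?Q) (\<lambda>\<omega>. (?X \<omega>, ?Y \<omega>))) borel ?g"
    by (subst distr_distr) (auto simp: comp_def)
  also have "\<dots> = distr (distr M ?P ?X \<Otimes>\<^sub>M distr M ?Q ?Y) borel ?g" by (simp only: eq)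
  also have "distr M ?P ?X \<Otimes>\<^sub>M distr M ?Q ?Y = distr (M \<Otimes>\<^sub>M M) (?P \<Otimes>\<^sub>M ?Q) (\<lambda>(x, y). (?X x, ?Y y))"
    by (rule pair_measure_distr) (auto intro: Y.sigma_finite_measure)
  also have "distr \<dots> borel ?g = distr (M \<Otimes>\<^sub>M M) borel (?g \<circ> (\<lambda>(x, y). (?X x, ?Y y)))"
    by (rule distr_distr) (simp_all add: split_beta')
  also have "\<dots> = distr (M \<Otimes>\<^sub>M M) borel (\<lambda>(\<omega>, \<omega>') q. if q \<in> C then Z \<omega>' q else Z \<omega> q)"
    by (intro distr_cong refl) (auto simp: fun_eq_iff A_def D_def zero)
  finally show ?thesis by simp
qed

lemma measurable_resample[measurable]:
  "(\<lambda>(\<omega>, \<omega>') q. if q \<in> C then Z \<omega>' q else Z \<omega> q) \<in> borel_measurable (M \<Otimes>\<^sub>M M)"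
  by (rule measurable_coordinatewise_then_product) (simp add: case_prod_beta)

lemma nn_integral_resample:
  assumes [measurable]: "f \<in> borel_measurable borel"
  shows "(\<integral>\<^sup>+\<omega>. f (Z \<omega>) \<partial>M) = (\<integral>\<^sup>+\<omega>. \<integral>\<^sup>+\<omega>'. f (\<lambda>q. if q \<in> C then Z \<omega>' q else Z \<omega> q) \<partial>M \<partial>M)"
proof -
  have "(\<integral>\<^sup>+\<omega>. f (Z \<omega>) \<partial>M) = (\<integral>\<^sup>+y. f y \<partial>distr M borel Z)"
    by (simp add: nn_integral_distr)
  also have "\<dots> = (\<integral>\<^sup>+z. f (case z of (\<omega>, \<omega>') \<Rightarrow> \<lambda>q. if q \<in> C then Z \<omega>' q else Z \<omega> q) \<partial>(M \<Otimes>\<^sub>M M))"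
    by (subst distr_resample[of C, symmetric]) (simp add: nn_integral_distr)
  also have "\<dots> = (\<integral>\<^sup>+\<omega>. \<integral>\<^sup>+\<omega>'. f (\<lambda>q. if q \<in> C then Z \<omega>' q else Z \<omega> q) \<partial>M \<partial>M)"
    by (subst nn_integral_fst[symmetric]) auto
  finally show ?thesis .
qed

lemma integral_resample:
  fixes f :: "('i \<Rightarrow> real) \<Rightarrow> real"
  assumes [measurable]: "f \<in> borel_measurable borel" and int: "integrable M (\<lambda>\<omega>. f (Z \<omega>))"
  shows "(\<integral>\<omega>. f (Z \<omega>) \<partial>M) = (\<integral>\<omega>. \<integral>\<omega>'. f (\<lambda>q. if q \<in> C then Z \<omega>' q else Z \<omega> q) \<partial>M \<partial>M)" (is "_ = ?r")
    and "integrable M (\<lambda>\<omega>. \<integral>\<omega>'. f (\<lambda>q. if q \<in> C then Z \<omega>' q else Z \<omega> q) \<partial>M)"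
proof -
  interpret P: pair_sigma_finite M M ..
  have int': "integrable (distr M borel Z) f"
    using int by (subst integrable_distr_eq) auto
  have *: "integrable (M \<Otimes>\<^sub>M M) (\<lambda>(\<omega>, \<omega>'). f (\<lambda>q. if q \<in> C then Z \<omega>' q else Z \<omega> q))"
    using int'[folded distr_resample[of C]] by (subst (asm) integrable_distr_eq) (simp_all add: split_beta')
  have "(\<integral>\<omega>. f (Z \<omega>) \<partial>M) = (\<integral>y. f y \<partial>distr M borel Z)"
    by (simp add: integral_distr)
  also have "\<dots> = (\<integral>z. f (case z of (\<omega>, \<omega>') \<Rightarrow> \<lambda>q. if q \<in> C then Z \<omega>' q else Z \<omega> q) \<partial>(M \<Otimes>\<^sub>M M))"
    by (subst distr_resample[of C, symmetric]) (simp add: integral_distr)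
  also have "\<dots> = ?r"
    using P.integral_fst'[OF *] by (simp only: split_beta' fst_conv snd_conv)
  finally show "(\<integral>\<omega>. f (Z \<omega>) \<partial>M) = ?r" .
  show "integrable M (\<lambda>\<omega>. \<integral>\<omega>'. f (\<lambda>q. if q \<in> C then Z \<omega>' q else Z \<omega> q) \<partial>M)"
    using P.integrable_fst'[OF *] by (simp only: split_beta' fst_conv snd_conv)
qed

text \<open>Completing the square, the weight turns the centred Gaussian density at \<open>x\<close>
  into the density at \<open>x + h * v\<close>; translation invariance of Lebesgue measure does the
  rest. This is the one-dimensional Cameron-Martin formula.\<close>

lemma nn_integral_shift_coord:
  assumes [measurable]: "g \<in> borel_measurable borel" and q: "q \<in> J"
  shows "(\<integral>\<^sup>+\<omega>. g (Z \<omega> q + h * v) * ennreal (exp (- v * Z \<omega> q - h * v\<^sup>2 / 2)) \<partial>M) = (\<integral>\<^sup>+\<omega>. g (Z \<omega> q) \<partial>M)"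
proof -
  let ?n = "normal_density 0 (sqrt h)"
  have n: "?n x * exp (- v * x - h * v\<^sup>2 / 2) = ?n (x + h * v)" for x
  proof -
    have "- (x\<^sup>2) / (2 * h) + (- v * x - h * v\<^sup>2 / 2) = - ((x + h * v)\<^sup>2) / (2 * h)"
      using h_pos by (simp add: field_simps power2_eq_square)
    then show ?thesis using h_pos by (simp add: normal_density_def exp_add[symmetric])
  qed
  have "(\<integral>\<^sup>+\<omega>. g (Z \<omega> q + h * v) * ennreal (exp (- v * Z \<omega> q - h * v\<^sup>2 / 2)) \<partial>M)
      = (\<integral>\<^sup>+x. ?n x * (g (x + h * v) * ennreal (exp (- v * x - h * v\<^sup>2 / 2))) \<partial>lborel)"
    by (subst distributed_nn_integral[OF normal[OF q]]) auto
  also have "\<dots> = (\<integral>\<^sup>+x. ennreal (?n (x + h * v)) * g (x + h * v) \<partial>lborel)"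
    by (intro nn_integral_cong) (simp add: n[symmetric] ennreal_mult ac_simps)
  also have "\<dots> = (\<integral>\<^sup>+x. ennreal (?n x) * g x \<partial>lborel)"
    using nn_integral_real_affine[of "\<lambda>x. ennreal (?n x) * g x" 1 "h * v"] by (simp add: add.commute)
  also have "\<dots> = (\<integral>\<^sup>+\<omega>. g (Z \<omega> q) \<partial>M)"
    by (subst distributed_nn_integral[OF normal[OF q]]) auto
  finally show ?thesis .
qed

text \<open>The drift may be random as long as it does not read coordinate \<open>q\<close>:
  redrawing \<open>q\<close> alone freezes \<open>v\<close>, and the deterministic translation
  formula applies under the outer integral.\<close>

lemma nn_integral_shift_one:
  fixes v :: "('i \<Rightarrow> real) \<Rightarrow> real"
  assumes [measurable]: "f \<in> borel_measurable borel" "v \<in> borel_measurable borel" and q: "q \<in> J"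
    and v: "\<And>y x. v (y(q := x)) = v y"
  shows "(\<integral>\<^sup>+\<omega>. f ((Z \<omega>)(q := Z \<omega> q + h * v (Z \<omega>))) * ennreal (exp (- v (Z \<omega>) * Z \<omega> q - h * (v (Z \<omega>))\<^sup>2 / 2)) \<partial>M)
    = (\<integral>\<^sup>+\<omega>. f (Z \<omega>) \<partial>M)"
proof -
  have upd: "(\<lambda>x. x(q := t x)) \<in> borel_measurable (borel :: ('i \<Rightarrow> real) measure)" if [measurable]: "t \<in> borel_measurable borel" for t
    by (rule measurable_coordinatewise_then_product) (simp add: fun_upd_def)
  have upd2: "(\<lambda>x. y(q := x)) \<in> borel_measurable (borel :: real measure)" for y :: "'i \<Rightarrow> real"
    by (rule measurable_coordinatewise_then_product) (simp add: fun_upd_def)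
  define F where "F y = f (y(q := y q + h * v y)) * ennreal (exp (- v y * y q - h * (v y)\<^sup>2 / 2))" for y
  have [measurable]: "F \<in> borel_measurable borel"
    unfolding F_def using measurable_compose[OF upd assms(1)] by measurable
  have eq: "(\<lambda>q'. if q' \<in> {q} then Z \<omega>' q' else Z \<omega> q') = (Z \<omega>)(q := Z \<omega>' q)" for \<omega> \<omega>'
    by auto
  have "(\<integral>\<^sup>+\<omega>. F (Z \<omega>) \<partial>M) = (\<integral>\<^sup>+\<omega>. \<integral>\<^sup>+\<omega>'. F ((Z \<omega>)(q := Z \<omega>' q)) \<partial>M \<partial>M)"
    unfolding eq[symmetric] by (rule nn_integral_resample) simp
  also have "\<dots> = (\<integral>\<^sup>+\<omega>. \<integral>\<^sup>+\<omega>'. f ((Z \<omega>)(q := Z \<omega>' q + h * v (Z \<omega>)))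
      * ennreal (exp (- v (Z \<omega>) * Z \<omega>' q - h * (v (Z \<omega>))\<^sup>2 / 2)) \<partial>M \<partial>M)"
    by (simp add: F_def v)
  also have "\<dots> = (\<integral>\<^sup>+\<omega>. \<integral>\<^sup>+\<omega>'. f ((Z \<omega>)(q := Z \<omega>' q)) \<partial>M \<partial>M)"
    by (intro nn_integral_cong nn_integral_shift_coord[OF _ q, where g = "\<lambda>x. f ((Z _)(q := x))"]
          measurable_compose[OF upd2 assms(1)])
  also have "\<dots> = (\<integral>\<^sup>+\<omega>. f (Z \<omega>) \<partial>M)"
    unfolding eq[symmetric] by (rule nn_integral_resample[symmetric]) simp
  finally show ?thesis by (simp add: F_def)
qed

text \<open>Induction by rank: the inserted coordinate \<open>q\<close> has the highest rank, so no
  drift present, not even \<open>c q\<close>, reads it. Translating \<open>q\<close> therefore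
  leaves all other drifts and weights unchanged, and the remaining factor \<open>G\<close> is the
  integrand for the smaller set. Ties in rank are allowed, so the coordinates of one time block may
  share a rank.\<close>

lemma girsanov:
  fixes c :: "'i \<Rightarrow> ('i \<Rightarrow> real) \<Rightarrow> real" and rk :: "'i \<Rightarrow> nat"
  assumes c[measurable]: "\<And>q. c q \<in> borel_measurable borel"
    and fin: "finite Q" and Q: "Q \<subseteq> J"
    and dep: "\<And>q r y x. q \<in> Q \<Longrightarrow> r \<in> Q \<Longrightarrow> rk r \<le> rk q \<Longrightarrow> c r (y(q := x)) = c r y"
    and f[measurable]: "f \<in> borel_measurable borel"
  shows "(\<integral>\<^sup>+\<omega>. f (\<lambda>q. Z \<omega> q + (if q \<in> Q then h * c q (Z \<omega>) else 0))
      * ennreal (exp (- (\<Sum>q\<in>Q. c q (Z \<omega>) * Z \<omega> q) - h / 2 * (\<Sum>q\<in>Q. (c q (Z \<omega>))\<^sup>2))) \<partial>M)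
    = (\<integral>\<^sup>+\<omega>. f (Z \<omega>) \<partial>M)"
  using fin Q dep
proof (induction Q rule: finite_ranking_induct[where f = rk])
  case empty
  then show ?case by simp
next
  case (insert q Q)
  have [simp]: "q \<in> J" using insert by auto
  show ?case
  proof (cases "q \<in> Q")
    case True
    then show ?thesis using insert by (simp add: insert_absorb)
  next
    case False
    have dep: "c r (y(q := x)) = c r y" if "r \<in> Q \<or> r = q" for r y x
      by (rule insert.prems(2)) (use that insert.hyps(2) in auto)
    define G where "G y = f (\<lambda>q. y q + (if q \<in> Q then h * c q y else 0))
      * ennreal (exp (- (\<Sum>q\<in>Q. c q y * y q) - h / 2 * (\<Sum>q\<in>Q. (c q y)\<^sup>2)))" for y
    have m: "(\<lambda>y q. y q + (if q \<in> Q then h * c q y else 0)) \<in> borel_measurable borel"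
      by (rule measurable_coordinatewise_then_product) simp
    have [measurable]: "G \<in> borel_measurable borel"
      unfolding G_def using measurable_compose[OF m f] by measurable
    have G: "G (y(q := y q + h * c q y)) * ennreal (exp (- c q y * y q - h * (c q y)\<^sup>2 / 2))
       = f (\<lambda>r. y r + (if r \<in> insert q Q then h * c r y else 0))
      * ennreal (exp (- (\<Sum>q\<in>insert q Q. c q y * y q) - h / 2 * (\<Sum>q\<in>insert q Q. (c q y)\<^sup>2)))" for y
    proof -
      let ?y = "y(q := y q + h * c q y)"
      have "(\<lambda>r. ?y r + (if r \<in> Q then h * c r ?y else 0)) = (\<lambda>r. y r + (if r \<in> insert q Q then h * c r y else 0))"
        using False by (auto simp: fun_eq_iff dep)
      moreover have "(\<Sum>r\<in>Q. c r ?y * ?y r) = (\<Sum>r\<in>Q. c r y * y r)"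
        using False by (intro sum.cong) (auto simp: dep)
      moreover have "(\<Sum>r\<in>Q. (c r ?y)\<^sup>2) = (\<Sum>r\<in>Q. (c r y)\<^sup>2)"
        by (intro sum.cong) (auto simp: dep)
      ultimately show ?thesis
        using False insert.hyps unfolding G_def
        by (simp add: mult.assoc ennreal_mult[symmetric] exp_add[symmetric] algebra_simps)
    qed
    have "(\<integral>\<^sup>+\<omega>. G ((Z \<omega>)(q := Z \<omega> q + h * c q (Z \<omega>)))
          * ennreal (exp (- c q (Z \<omega>) * Z \<omega> q - h * (c q (Z \<omega>))\<^sup>2 / 2)) \<partial>M) = (\<integral>\<^sup>+\<omega>. G (Z \<omega>) \<partial>M)"
      by (rule nn_integral_shift_one) (auto simp: dep dep[unfolded fun_upd_def])
    also have "\<dots> = (\<integral>\<^sup>+\<omega>. f (Z \<omega>) \<partial>M)"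
      unfolding G_def using insert by auto
    finally show ?thesis unfolding G .
  qed
qed

end

section \<open>Elementary bounds for logarithm and exponential; Gaussian exponential moments\<close>

lemma ln_remainder_bound:
  fixes a b c :: real
  assumes "0 < c" "c \<le> a" "c \<le> b"
  shows "\<bar>ln b - ln a - (b - a) / a\<bar> \<le> (b - a)\<^sup>2 / c\<^sup>2"
proof -
  have a: "0 < a" and b: "0 < b" using assms by auto
  \<comment> \<open>Applying \<open>ln t \<le> t - 1\<close> to \<open>b / a\<close> and to
    \<open>a / b\<close> brackets the difference of logarithms; the gap between the two brackets is
    already quadratic in \<open>b - a\<close>.\<close>
  have "ln b - ln a \<le> b / a - 1"
    using a b ln_le_minus_one[of "b / a"] by (simp add: ln_div)
  moreover have "ln a - ln b \<le> a / b - 1"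
    using a b ln_le_minus_one[of "a / b"] by (simp add: ln_div)
  ultimately have "\<bar>ln b - ln a - (b - a) / a\<bar> \<le> (b - a) / a - (b - a) / b"
    using a b by (simp add: diff_divide_distrib)
  also have "\<dots> = (b - a)\<^sup>2 / (a * b)"
    using a b by (simp add: field_simps power2_eq_square)
  also have "\<dots> \<le> (b - a)\<^sup>2 / c\<^sup>2"
    using assms by (intro divide_left_mono) (auto simp: power2_eq_square intro!: mult_mono mult_pos_pos)
  finally show ?thesis .
qed

lemma exp_le_quadratic: "exp x \<le> 1 + x + x\<^sup>2 * exp (max x 0)" for x :: real
proof -
  obtain t where t: "\<bar>t\<bar> \<le> \<bar>x\<bar>" and eq: "exp x = (\<Sum>m<2. x ^ m / fact m) + exp t / fact 2 * x ^ 2"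
    using Maclaurin_exp_le[of x 2] by blast
  have "exp t * x\<^sup>2 / 2 \<le> x\<^sup>2 * exp (max x 0)" if "0 \<le> x"
  proof -
    have "exp t \<le> exp (max x 0)" using t that by simp
    then have "exp t * x\<^sup>2 \<le> exp (max x 0) * x\<^sup>2" by (rule mult_right_mono) simp
    moreover have "0 \<le> exp (max x 0) * x\<^sup>2" by simp
    ultimately show ?thesis by (subst mult.commute[of "x\<^sup>2"]) linarith
  qed
  \<comment> \<open>Since \<open>exp (- x) \<ge> 1 - x\<close>, it is enough that
    \<open>(1 + x + x\<^sup>2) * (1 - x) = 1 - x ^ 3\<close> is at least 1, which holds for negative
    \<open>x\<close>.\<close>
  moreover have "exp x \<le> 1 + x + x\<^sup>2" if "x < 0"
  proof -
    have "(1 + x + x\<^sup>2) * (1 + (- x)) \<le> (1 + x + x\<^sup>2) * exp (- x)"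
    proof (rule mult_left_mono)
      show "1 + - x \<le> exp (- x)" by (rule exp_ge_add_one_self)
      have "0 \<le> (1 + 2 * x)\<^sup>2 + 3" by simp
      then show "0 \<le> 1 + x + x\<^sup>2" by (simp add: power2_eq_square algebra_simps)
    qed
    moreover have "(1 + x + x\<^sup>2) * (1 + (- x)) = 1 - x ^ 3"
      by (simp add: algebra_simps power2_eq_square power3_eq_cube)
    moreover have "x ^ 3 \<le> 0" using that by (simp add: power_le_zero_eq)
    ultimately have "1 \<le> (1 + x + x\<^sup>2) * exp (- x)" by linarith
    then show ?thesis by (simp add: exp_minus field_simps)
  qed
  ultimately show ?thesis using eq by (cases "0 \<le> x") (auto simp: numeral_2_eq_2 max_def)
qed

lemma power4_le_exp: "x ^ 4 \<le> 24 * exp x" if "0 \<le> x" for x :: real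
proof -
  obtain t where "exp x = (\<Sum>m<5. x ^ m / fact m) + exp t / fact 5 * x ^ 5"
    using Maclaurin_exp_le[of x 5] by blast
  then have "(\<Sum>k<5. x ^ k / fact k) \<le> exp x" using that by simp
  moreover have "x ^ 4 / 24 \<le> (\<Sum>k<5. x ^ k / fact k)"
    using that by (simp add: eval_nat_numeral lessThan_Suc)
  ultimately show ?thesis by simp
qed

context gaussian_family
begin

lemma expectation_coord: "integrable M (\<lambda>\<omega>. Z \<omega> q)" "expectation (\<lambda>\<omega>. Z \<omega> q) = 0"
proof -
  have "integrable M (\<lambda>\<omega>. Z \<omega> q) \<and> expectation (\<lambda>\<omega>. Z \<omega> q) = 0"
  proof (cases "q \<in> J")
    case True
    have s: "0 < sqrt h" using h_pos by simp
    have "has_bochner_integral lborel (\<lambda>x. normal_density 0 (sqrt h) x * x) 0"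
      by (rule normal_moment_nz_1[OF s])
    then show ?thesis
      using distributed_integrable[OF normal[OF True], of "\<lambda>x. x"] distributed_integral[OF normal[OF True], of "\<lambda>x. x"]
      by (auto simp: has_bochner_integral_iff normal_density_nonneg)
  qed (simp add: zero)
  then show "integrable M (\<lambda>\<omega>. Z \<omega> q)" "expectation (\<lambda>\<omega>. Z \<omega> q) = 0" by auto
qed

text \<open>The Gaussian moment generating function is the translation formula for the constant
  function 1, with \<open>v = - \<alpha> / sqrt h\<close>.\<close>

lemma nn_integral_exp_coord:
  assumes q: "q \<in> J"
  shows "(\<integral>\<^sup>+\<omega>. ennreal (exp (\<alpha> * (Z \<omega> q / sqrt h))) \<partial>M) = ennreal (exp (\<alpha>\<^sup>2 / 2))"
proof -
  have s: "sqrt h * sqrt h = h" using h_pos by simp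
  have "(\<integral>\<^sup>+\<omega>. ennreal (exp (\<alpha> * (Z \<omega> q / sqrt h))) \<partial>M)
    = (\<integral>\<^sup>+\<omega>. ennreal (exp (\<alpha>\<^sup>2 / 2)) * (1 * ennreal (exp (- (- \<alpha> / sqrt h) * Z \<omega> q - h * (- \<alpha> / sqrt h)\<^sup>2 / 2))) \<partial>M)"
    using h_pos by (intro nn_integral_cong) (simp add: ennreal_mult[symmetric] exp_add[symmetric] power_divide field_simps)
  also have "\<dots> = ennreal (exp (\<alpha>\<^sup>2 / 2)) * 1"
    using nn_integral_shift_coord[OF _ q, of "\<lambda>_. 1" "- \<alpha> / sqrt h"]
    by (subst nn_integral_cmult) (auto simp: emeasure_space_1)
  finally show ?thesis by simp
qed

text \<open>Independence factorizes the integral, and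
  \<open>exp \<bar>x\<bar> \<le> exp x + exp (- x)\<close> costs the factor 2 per coordinate. The
  coordinates are normalized by \<open>sqrt h\<close>, so the bound is free of
  \<open>h\<close>.\<close>

lemma nn_integral_exp_abs_prod:
  assumes Q: "Q \<subseteq> J" and \<alpha>: "0 \<le> \<alpha>"
  shows "(\<integral>\<^sup>+\<omega>. ennreal (exp (\<alpha> * (\<Sum>q\<in>Q. \<bar>Z \<omega> q / sqrt h\<bar>))) \<partial>M) \<le> ennreal ((2 * exp (\<alpha>\<^sup>2 / 2)) ^ card Q)"
proof -
  have fin: "finite Q" using Q finite_J by (rule finite_subset)
  have "indep_vars (\<lambda>_. borel) (\<lambda>q \<omega>. Z \<omega> q) Q" by (rule indep_vars_subset[OF indep Q])
  then have ind: "indep_vars (\<lambda>_. borel) (\<lambda>q \<omega>. ennreal (exp (\<alpha> * \<bar>Z \<omega> q / sqrt h\<bar>))) Q"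
    by (rule indep_vars_compose2) simp
  have "(\<integral>\<^sup>+\<omega>. ennreal (exp (\<alpha> * (\<Sum>q\<in>Q. \<bar>Z \<omega> q / sqrt h\<bar>))) \<partial>M)
    = (\<integral>\<^sup>+\<omega>. (\<Prod>q\<in>Q. ennreal (exp (\<alpha> * \<bar>Z \<omega> q / sqrt h\<bar>))) \<partial>M)"
    using fin by (intro nn_integral_cong) (simp add: sum_distrib_left exp_sum prod_ennreal)
  also have "\<dots> = (\<Prod>q\<in>Q. \<integral>\<^sup>+\<omega>. ennreal (exp (\<alpha> * \<bar>Z \<omega> q / sqrt h\<bar>)) \<partial>M)"
    by (rule indep_vars_nn_integral[OF fin ind]) auto
  also have "\<dots> \<le> (\<Prod>q\<in>Q. ennreal (2 * exp (\<alpha>\<^sup>2 / 2)))"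
  proof (rule prod_mono_ennreal)
    fix q assume q: "q \<in> Q"
    have "(\<integral>\<^sup>+\<omega>. ennreal (exp (\<alpha> * \<bar>Z \<omega> q / sqrt h\<bar>)) \<partial>M)
      \<le> (\<integral>\<^sup>+\<omega>. ennreal (exp (\<alpha> * (Z \<omega> q / sqrt h))) + ennreal (exp ((- \<alpha>) * (Z \<omega> q / sqrt h))) \<partial>M)"
      by (intro nn_integral_mono) (auto simp: abs_if ennreal_plus[symmetric] simp del: ennreal_plus intro!: ennreal_leI)
    also have "\<dots> = ennreal (exp (\<alpha>\<^sup>2 / 2)) + ennreal (exp (\<alpha>\<^sup>2 / 2))"
      using nn_integral_exp_coord[of q \<alpha>] nn_integral_exp_coord[of q "- \<alpha>"] q Q
      by (subst nn_integral_add) (auto simp: subset_eq)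
    also have "\<dots> = ennreal (2 * exp (\<alpha>\<^sup>2 / 2))"
      by (simp add: ennreal_plus[symmetric] del: ennreal_plus)
    finally show "(\<integral>\<^sup>+\<omega>. ennreal (exp (\<alpha> * \<bar>Z \<omega> q / sqrt h\<bar>)) \<partial>M) \<le> ennreal (2 * exp (\<alpha>\<^sup>2 / 2))" .
  qed
  also have "\<dots> = ennreal ((2 * exp (\<alpha>\<^sup>2 / 2)) ^ card Q)"
    by (simp add: ennreal_power)
  finally show ?thesis .
qed

end

text \<open>Coordinates are pairs of a time block and a component of the noise; \<open>G\<close>
  plays the role of the partial derivatives of \<open>F\<close>. The smoothness conditions perturb
  one time block at a time because the drift is chosen block by block. \<open>C\<close> and
  \<open>\<kappa>\<close> will be the same on every grid, and \<open>m\<close> is chosen large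
  depending on them.\<close>

locale gaussian_drift = gaussian_family M Z "{..<m} \<times> {..<n}" h
  for M :: "'w measure" and Z :: "'w \<Rightarrow> nat \<times> nat \<Rightarrow> real" and m n :: nat and h :: real +
  fixes F :: "(nat \<times> nat \<Rightarrow> real) \<Rightarrow> real" and G :: "nat \<Rightarrow> nat \<Rightarrow> (nat \<times> nat \<Rightarrow> real) \<Rightarrow> real"
    and C \<kappa> :: real
  assumes h_le: "h \<le> 1" and \<kappa>: "0 < \<kappa>" and C: "0 \<le> C"
    and F[measurable]: "F \<in> borel_measurable borel" and G[measurable]: "\<And>i b. G i b \<in> borel_measurable borel"
    and F_ge: "\<And>y. \<kappa> \<le> F y" and F_le: "\<And>y. F y \<le> 1"
    and G_le: "\<And>i b y. \<bar>G i b y\<bar> \<le> C"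
    and F_lip: "\<And>i y v. i < m \<Longrightarrow>
      \<bar>F (\<lambda>(a, b). y (a, b) + (if a = i \<and> b < n then v b else 0)) - F y\<bar> \<le> C * (\<Sum>b<n. \<bar>v b\<bar>)"
    and F_deriv: "\<And>i y v. i < m \<Longrightarrow>
      \<bar>F (\<lambda>(a, b). y (a, b) + (if a = i \<and> b < n then v b else 0)) - F y - (\<Sum>b<n. G i b y * v b)\<bar>
        \<le> C * (\<Sum>b<n. \<bar>v b\<bar>)\<^sup>2"
begin

text \<open>Averaging over an independent second argument turns \<open>past\<close> into
  conditioning on the blocks before \<open>i\<close>, and \<open>base\<close> into the same with
  block \<open>i\<close> put at 0, the expansion point for that block.\<close>

definition past :: "nat \<Rightarrow> (nat \<times> nat \<Rightarrow> real) \<Rightarrow> (nat \<times> nat \<Rightarrow> real) \<Rightarrow> nat \<times> nat \<Rightarrow> real" where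
  "past i y z = (\<lambda>(a, b). if a < i then y (a, b) else z (a, b))"

definition base :: "nat \<Rightarrow> (nat \<times> nat \<Rightarrow> real) \<Rightarrow> (nat \<times> nat \<Rightarrow> real) \<Rightarrow> nat \<times> nat \<Rightarrow> real" where
  "base i y z = (\<lambda>(a, b). if a < i then y (a, b) else if a = i then 0 else z (a, b))"

definition set_block :: "nat \<Rightarrow> (nat \<times> nat \<Rightarrow> real) \<Rightarrow> (nat \<Rightarrow> real) \<Rightarrow> nat \<times> nat \<Rightarrow> real" where
  "set_block i y v = (\<lambda>(a, b). if a = i then (if b < n then v b else 0) else y (a, b))"

text \<open>At the noise itself this is the martingale of conditional expectations of
  \<open>F\<close> given the blocks before \<open>i\<close>; as a function it can also be evaluated
  along a drifted path.\<close>

definition mart :: "nat \<Rightarrow> (nat \<times> nat \<Rightarrow> real) \<Rightarrow> real" where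
  "mart i y = expectation (\<lambda>\<omega>. F (past i y (Z \<omega>)))"

definition mart0 :: "nat \<Rightarrow> (nat \<times> nat \<Rightarrow> real) \<Rightarrow> real" where
  "mart0 i y = expectation (\<lambda>\<omega>. F (base i y (Z \<omega>)))"

definition grad :: "nat \<Rightarrow> nat \<Rightarrow> (nat \<times> nat \<Rightarrow> real) \<Rightarrow> real" where
  "grad i b y = expectation (\<lambda>\<omega>. G i b (base i y (Z \<omega>)))"

text \<open>The gradient at 0, in block \<open>i\<close>, of \<open>ln (mart (Suc i))\<close>. It
  reads only blocks before \<open>i\<close>, and dividing by \<open>mart0\<close> rather than by
  \<open>mart i\<close> makes it the exact linear term of the expansion below.\<close>

definition feedback :: "nat \<Rightarrow> nat \<Rightarrow> (nat \<times> nat \<Rightarrow> real) \<Rightarrow> real" where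
  "feedback i b y = grad i b y / mart0 i y"

lemma measurable_apply[measurable]: "(\<lambda>y. y q) \<in> borel_measurable (borel :: (nat \<times> nat \<Rightarrow> real) measure)"
  by (rule measurable_product_then_coordinatewise) simp

lemma measurable_past[measurable (raw)]:
  "f \<in> borel_measurable N \<Longrightarrow> g \<in> borel_measurable N \<Longrightarrow> (\<lambda>x. past i (f x) (g x)) \<in> borel_measurable N"
proof (rule measurable_coordinatewise_then_product)
  fix q assume [measurable]: "f \<in> borel_measurable N" "g \<in> borel_measurable N"
  have "(\<lambda>x. f x q) \<in> borel_measurable N" "(\<lambda>x. g x q) \<in> borel_measurable N" by simp_all
  then show "(\<lambda>x. past i (f x) (g x) q) \<in> borel_measurable N"
    by (cases q) (auto simp: past_def)
qed

lemma measurable_base[measurable (raw)]: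
  "f \<in> borel_measurable N \<Longrightarrow> g \<in> borel_measurable N \<Longrightarrow> (\<lambda>x. base i (f x) (g x)) \<in> borel_measurable N"
proof (rule measurable_coordinatewise_then_product)
  fix q assume [measurable]: "f \<in> borel_measurable N" "g \<in> borel_measurable N"
  have "(\<lambda>x. f x q) \<in> borel_measurable N" "(\<lambda>x. g x q) \<in> borel_measurable N" by simp_all
  then show "(\<lambda>x. base i (f x) (g x) q) \<in> borel_measurable N"
    by (cases q) (auto simp: base_def)
qed

lemma measurable_set_block[measurable (raw)]:
  assumes [measurable]: "f \<in> borel_measurable N" and g: "\<And>b. (\<lambda>x. g x b) \<in> borel_measurable N"
  shows "(\<lambda>x. set_block i (f x) (g x)) \<in> borel_measurable N"
proof (rule measurable_coordinatewise_then_product)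
  fix q
  have "(\<lambda>x. f x q) \<in> borel_measurable N" by simp
  then show "(\<lambda>x. set_block i (f x) (g x) q) \<in> borel_measurable N"
    using g by (cases q) (auto simp: set_block_def)
qed

lemma measurable_mart[measurable]: "mart i \<in> borel_measurable borel"
  and measurable_mart0[measurable]: "mart0 i \<in> borel_measurable borel"
  and measurable_grad[measurable]: "grad i b \<in> borel_measurable borel"
  unfolding mart_def[abs_def] mart0_def[abs_def] grad_def[abs_def]
  by (rule borel_measurable_lebesgue_integral, measurable)+

lemma measurable_feedback[measurable]: "feedback i b \<in> borel_measurable borel"
  unfolding feedback_def[abs_def] by measurable

lemma integrable_bounded: "(f :: 'w \<Rightarrow> real) \<in> borel_measurable M \<Longrightarrow> (\<And>\<omega>. \<bar>f \<omega>\<bar> \<le> c) \<Longrightarrow> integrable M f"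
  by (rule integrable_const_bound[where B = c]) auto

lemma abs_F_le: "\<bar>F y\<bar> \<le> 1"
  using F_ge[of y] F_le[of y] \<kappa> by auto

lemma integrable_F: "f \<in> borel_measurable M \<Longrightarrow> integrable M (\<lambda>\<omega>. F (f \<omega>))"
  by (rule integrable_bounded[where c = 1]) (auto intro: abs_F_le)

lemma integrable_G: "f \<in> borel_measurable M \<Longrightarrow> integrable M (\<lambda>\<omega>. G i b (f \<omega>))"
  by (rule integrable_bounded[where c = C]) (auto intro: G_le)

lemma abs_expectation_le:
  fixes f :: "'w \<Rightarrow> real"
  assumes "integrable M f" "\<And>\<omega>. \<bar>f \<omega>\<bar> \<le> c"
  shows "\<bar>expectation f\<bar> \<le> c"
proof -
  have "\<bar>expectation f\<bar> \<le> expectation (\<lambda>\<omega>. \<bar>f \<omega>\<bar>)" by (rule integral_abs_bound)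
  also have "\<dots> \<le> c" by (rule integral_le_const) (use assms in auto)
  finally show ?thesis .
qed

lemma mart_bounds: "\<kappa> \<le> mart i y" "mart i y \<le> 1"
  and mart0_bounds: "\<kappa> \<le> mart0 i y" "mart0 i y \<le> 1"
  unfolding mart_def mart0_def
  by (rule integral_ge_const[OF integrable_F] integral_le_const[OF integrable_F], measurable, simp add: F_ge F_le)+

lemma abs_grad_le: "\<bar>grad i b y\<bar> \<le> C"
  unfolding grad_def by (rule abs_expectation_le[OF integrable_G G_le]) measurable

lemma abs_feedback_le: "\<bar>feedback i b y\<bar> \<le> C / \<kappa>"
  unfolding feedback_def abs_divide
  using mart0_bounds(1)[of i y] \<kappa> C by (intro frac_le abs_grad_le) auto

lemma mart_set_block:
  "mart (Suc i) (set_block i y v) = expectation (\<lambda>\<omega>. F (\<lambda>(a, b). base i y (Z \<omega>) (a, b) + (if a = i \<and> b < n then v b else 0)))"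
  unfolding mart_def
  by (intro Bochner_Integration.integral_cong refl arg_cong[where f = F])
     (auto simp: past_def set_block_def base_def fun_eq_iff)

lemma measurable_add_block:
  fixes f :: "'x \<Rightarrow> nat \<times> nat \<Rightarrow> real"
  assumes [measurable]: "f \<in> borel_measurable N"
  shows "(\<lambda>x. \<lambda>(a, b). f x (a, b) + (if a = i \<and> b < n then v b else 0)) \<in> borel_measurable N"
  by (rule measurable_coordinatewise_then_product) (simp add: case_prod_beta)

lemma integrable_base:
  shows "integrable M (\<lambda>\<omega>. F (\<lambda>(a, b). base i y (Z \<omega>) (a, b) + (if a = i \<and> b < n then v b else 0)))"
    and "integrable M (\<lambda>\<omega>. F (base i y (Z \<omega>)))" and "integrable M (\<lambda>\<omega>. G j b (base i y (Z \<omega>)))"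
  by (rule integrable_F measurable_add_block integrable_G measurable_base borel_measurable_const measurable_Z)+

lemma mart_lip:
  assumes "i < m"
  shows "\<bar>mart (Suc i) (set_block i y v) - mart0 i y\<bar> \<le> C * (\<Sum>b<n. \<bar>v b\<bar>)"
  unfolding mart_set_block mart0_def Bochner_Integration.integral_diff[OF integrable_base(1,2), symmetric]
  by (rule abs_expectation_le[OF Bochner_Integration.integrable_diff[OF integrable_base(1,2)] F_lip[OF assms]])

lemma mart_deriv:
  assumes "i < m"
  shows "\<bar>mart (Suc i) (set_block i y v) - mart0 i y - (\<Sum>b<n. grad i b y * v b)\<bar> \<le> C * (\<Sum>b<n. \<bar>v b\<bar>)\<^sup>2"
proof -
  have int: "integrable M (\<lambda>\<omega>. \<Sum>b<n. G i b (base i y (Z \<omega>)) * v b)"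
    by (intro Bochner_Integration.integrable_sum integrable_mult_left integrable_base)
  have lin: "(\<Sum>b<n. grad i b y * v b) = expectation (\<lambda>\<omega>. \<Sum>b<n. G i b (base i y (Z \<omega>)) * v b)"
    unfolding grad_def
    by (subst Bochner_Integration.integral_sum)
       (simp_all add: integrable_base(3))
  show ?thesis
    unfolding mart_set_block mart0_def lin Bochner_Integration.integral_diff[OF integrable_base(1,2), symmetric]
      Bochner_Integration.integral_diff[OF Bochner_Integration.integrable_diff[OF integrable_base(1,2)] int, symmetric]
    by (rule abs_expectation_le[OF Bochner_Integration.integrable_diff[OF Bochner_Integration.integrable_diff[OF integrable_base(1,2)] int]
          F_deriv[OF assms]])
qed

text \<open>First-order Taylor remainder of \<open>ln (mart (Suc i))\<close> in block
  \<open>i\<close> around 0.\<close>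

definition rem :: "nat \<Rightarrow> (nat \<times> nat \<Rightarrow> real) \<Rightarrow> (nat \<Rightarrow> real) \<Rightarrow> real" where
  "rem i y v = ln (mart (Suc i) (set_block i y v)) - ln (mart0 i y) - (\<Sum>b<n. feedback i b y * v b)"

text \<open>One term is the second-order error of \<open>mart (Suc i)\<close> divided by
  \<open>mart0 i\<close>, the other that of the logarithm, where \<open>mart_lip\<close> bounds the
  increment.\<close>

lemma abs_rem_le:
  assumes "i < m"
  shows "\<bar>rem i y v\<bar> \<le> (C / \<kappa> + C\<^sup>2 / \<kappa>\<^sup>2) * (\<Sum>b<n. \<bar>v b\<bar>)\<^sup>2"
proof -
  define s where "s = (\<Sum>b<n. \<bar>v b\<bar>)"
  have s: "0 \<le> s" by (simp add: s_def sum_nonneg)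
  define p q where "p = mart (Suc i) (set_block i y v)" and "q = mart0 i y"
  have pq: "\<kappa> \<le> p" "\<kappa> \<le> q" by (simp_all add: p_def q_def mart_bounds mart0_bounds)
  have lin: "(\<Sum>b<n. feedback i b y * v b) = (\<Sum>b<n. grad i b y * v b) / q"
    by (simp add: feedback_def q_def sum_divide_distrib)
  have "rem i y v = (ln p - ln q - (p - q) / q) + (p - q - (\<Sum>b<n. grad i b y * v b)) / q"
    unfolding rem_def lin p_def[symmetric] q_def[symmetric] by (simp add: diff_divide_distrib)
  also have "\<bar>\<dots>\<bar> \<le> \<bar>ln p - ln q - (p - q) / q\<bar> + \<bar>(p - q - (\<Sum>b<n. grad i b y * v b)) / q\<bar>"
    by (rule abs_triangle_ineq)
  also have "\<bar>ln p - ln q - (p - q) / q\<bar> \<le> (p - q)\<^sup>2 / \<kappa>\<^sup>2"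
    by (rule ln_remainder_bound[OF \<kappa> pq(2) pq(1)])
  also have "(p - q)\<^sup>2 / \<kappa>\<^sup>2 \<le> (C * s)\<^sup>2 / \<kappa>\<^sup>2"
  proof (rule divide_right_mono)
    have "\<bar>p - q\<bar> \<le> C * s" unfolding p_def q_def s_def by (rule mart_lip[OF assms])
    then show "(p - q)\<^sup>2 \<le> (C * s)\<^sup>2" using C s by (intro abs_le_square_iff[THEN iffD1]) simp
  qed simp
  also have "\<bar>(p - q - (\<Sum>b<n. grad i b y * v b)) / q\<bar> \<le> (C * s\<^sup>2) / \<kappa>"
    unfolding abs_divide
  proof (rule frac_le)
    show "\<bar>p - q - (\<Sum>b<n. grad i b y * v b)\<bar> \<le> C * s\<^sup>2"
      unfolding p_def q_def s_def by (rule mart_deriv[OF assms])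
  qed (use C \<kappa> pq in auto)
  finally show ?thesis by (simp add: s_def algebra_simps)
qed

text \<open>Only the upper side of the remainder is exponentiated later, and linear growth keeps its
  Gaussian exponential moments finite whatever the constants are.\<close>

lemma rem_le: "rem i y v \<le> ln (1 / \<kappa>) + C / \<kappa> * (\<Sum>b<n. \<bar>v b\<bar>)"
proof -
  have "ln (mart (Suc i) (set_block i y v)) \<le> 0"
    using mart_bounds[of "Suc i" "set_block i y v"] \<kappa> by simp
  moreover have "ln \<kappa> \<le> ln (mart0 i y)"
    using mart0_bounds[of i y] \<kappa> by simp
  moreover have "\<bar>\<Sum>b<n. feedback i b y * v b\<bar> \<le> C / \<kappa> * (\<Sum>b<n. \<bar>v b\<bar>)"
    unfolding sum_distrib_left
    by (rule order.trans[OF sum_abs]) (auto simp: abs_mult simp del: times_divide_eq_left intro!: sum_mono mult_right_mono abs_feedback_le)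
  ultimately show ?thesis using \<kappa> unfolding rem_def by (simp add: ln_div)
qed

end

section \<open>The one-step estimate and the closed-loop control\<close>

context gaussian_drift
begin

text \<open>The factors come from squaring \<open>abs_rem_le\<close>, from
  \<open>x ^ 4 \<le> 24 * exp x\<close> and \<open>exp (ln (1 / \<kappa>))\<close>, and from the
  exponential moments of \<open>n\<close> normalized, shifted increments at
  \<open>\<alpha> = 1 + C / \<kappa>\<close>. Neither \<open>h\<close> nor \<open>m\<close> occurs,
  so the constant is fixed before the mesh.\<close>

definition rem_const :: real where
  "rem_const = (C / \<kappa> + C\<^sup>2 / \<kappa>\<^sup>2)\<^sup>2 * 24 / \<kappa>
     * (2 * exp ((1 + C / \<kappa>)\<^sup>2 / 2) * exp ((1 + C / \<kappa>) * (C / \<kappa>))) ^ n"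

lemma rem_const_nonneg: "0 \<le> rem_const"
  unfolding rem_const_def using \<kappa> by simp

text \<open>\<open>W\<close> is of order one, while the displacement \<open>s\<close> is at most
  \<open>sqrt h * W\<close>. The squared remainder is of fourth order in \<open>s\<close>, which
  releases the factor \<open>h\<^sup>2\<close>; the remaining powers of \<open>W\<close> and the
  exponential of the positive part are absorbed in
  \<open>exp ((1 + C / \<kappa>) * W)\<close>.\<close>

lemma rem_sq_exp_le:
  assumes i: "i < m" and u: "\<And>b. \<bar>u b\<bar> \<le> C / \<kappa>"
  shows "(rem i y (\<lambda>b. z b + h * u b))\<^sup>2 * exp (max (rem i y (\<lambda>b. z b + h * u b)) 0)
    \<le> (C / \<kappa> + C\<^sup>2 / \<kappa>\<^sup>2)\<^sup>2 * 24 / \<kappa> * exp ((1 + C / \<kappa>) * (C / \<kappa>)) ^ n * h\<^sup>2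
      * exp ((1 + C / \<kappa>) * (\<Sum>b<n. \<bar>z b / sqrt h\<bar>))"
proof -
  define L where "L = C / \<kappa>"
  define K where "K = C / \<kappa> + C\<^sup>2 / \<kappa>\<^sup>2"
  define W where "W = (\<Sum>b<n. \<bar>z b / sqrt h\<bar> + L)"
  define s where "s = (\<Sum>b<n. \<bar>z b + h * u b\<bar>)"
  have L: "0 \<le> L" using C \<kappa> by (simp add: L_def)
  have K: "0 \<le> K" using C \<kappa> by (simp add: K_def)
  have W: "0 \<le> W" using L by (auto simp: W_def intro!: sum_nonneg add_nonneg_nonneg)
  have s0: "0 \<le> s" by (auto simp: s_def intro!: sum_nonneg)
  have sh: "0 < sqrt h" "sqrt h \<le> 1" using h_pos h_le by auto
  have hs: "h = sqrt h * sqrt h" using h_pos by simp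
  have sW: "s \<le> sqrt h * W"
    unfolding s_def W_def sum_distrib_left
  proof (rule sum_mono)
    fix b
    have "\<bar>z b + h * u b\<bar> \<le> \<bar>z b\<bar> + h * \<bar>u b\<bar>"
      using h_pos by (simp add: abs_mult order.trans[OF abs_triangle_ineq])
    also have "h * \<bar>u b\<bar> \<le> sqrt h * L"
    proof -
      have "h * \<bar>u b\<bar> = sqrt h * (sqrt h * \<bar>u b\<bar>)" using hs by (metis mult.assoc)
      also have "\<dots> \<le> sqrt h * (1 * L)"
        using sh u[of b] by (intro mult_left_mono mult_mono) (auto simp: L_def)
      finally show ?thesis by simp
    qed
    finally show "\<bar>z b + h * u b\<bar> \<le> sqrt h * (\<bar>z b / sqrt h\<bar> + L)"
      using sh by (simp add: distrib_left abs_divide)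
  qed
  define r where "r = rem i y (\<lambda>b. z b + h * u b)"
  have r1: "\<bar>r\<bar> \<le> K * s\<^sup>2" unfolding r_def K_def s_def by (rule abs_rem_le[OF i])
  have r2: "r \<le> ln (1 / \<kappa>) + L * s" unfolding r_def L_def s_def by (rule rem_le)
  have \<kappa>1: "\<kappa> \<le> 1" using F_ge[of undefined] F_le[of undefined] by linarith
  have s4: "s ^ 4 \<le> h\<^sup>2 * (24 * exp W)"
  proof -
    have "s ^ 4 \<le> (sqrt h * W) ^ 4" using sW s0 by (rule power_mono)
    also have "\<dots> = h\<^sup>2 * W ^ 4"
    proof -
      have "sqrt h ^ 4 = (sqrt h ^ 2) ^ 2" by (simp only: power_mult[symmetric]) simp
      then show ?thesis using h_pos by (simp add: power_mult_distrib)
    qed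
    also have "\<dots> \<le> h\<^sup>2 * (24 * exp W)"
      using power4_le_exp[OF W] by (intro mult_left_mono) auto
    finally show ?thesis .
  qed
  have "r\<^sup>2 \<le> (K * s\<^sup>2)\<^sup>2" using r1 by (intro abs_le_square_iff[THEN iffD1]) (simp add: K)
  also have "\<dots> = K\<^sup>2 * s ^ 4" by (simp add: power_mult_distrib power_mult[symmetric])
  also have "\<dots> \<le> K\<^sup>2 * (h\<^sup>2 * (24 * exp W))" using s4 by (intro mult_left_mono) auto
  finally have rsq: "r\<^sup>2 \<le> K\<^sup>2 * (h\<^sup>2 * (24 * exp W))" .
  have "s \<le> W" using sW mult_right_mono[OF sh(2) W] by simp
  then have "L * s \<le> L * W" using L by (rule mult_left_mono)
  moreover have "0 \<le> ln (1 / \<kappa>)" using \<kappa> \<kappa>1 by simp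
  ultimately have "max r 0 \<le> ln (1 / \<kappa>) + L * W"
    using r2 L W mult_nonneg_nonneg[OF L W] by linarith
  then have "exp (max r 0) \<le> exp (ln (1 / \<kappa>) + L * W)" by simp
  also have "\<dots> = exp (L * W) / \<kappa>" using \<kappa> by (simp add: exp_add exp_minus ln_div divide_inverse mult.commute)
  finally have "r\<^sup>2 * exp (max r 0) \<le> (K\<^sup>2 * (h\<^sup>2 * (24 * exp W))) * (exp (L * W) / \<kappa>)"
    using rsq by (intro mult_mono) auto
  also have "\<dots> = K\<^sup>2 * 24 / \<kappa> * h\<^sup>2 * exp ((1 + L) * W)"
    by (simp add: distrib_right exp_add)
  also have "(1 + L) * W = (1 + L) * (\<Sum>b<n. \<bar>z b / sqrt h\<bar>) + real n * ((1 + L) * L)"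
    by (simp add: W_def sum.distrib distrib_left)
  also have "exp \<dots> = exp ((1 + L) * (\<Sum>b<n. \<bar>z b / sqrt h\<bar>)) * exp ((1 + L) * L) ^ n"
    by (simp add: exp_add exp_of_nat_mult)
  finally show ?thesis by (simp add: r_def K_def L_def ac_simps)
qed

text \<open>After shifting the block by its drift \<open>h u\<close>, the exponent is \<open>ln (mart0 i y)\<close> plus a remainder of
  order \<open>h\<close>, so its logarithmic moment generating function exceeds its mean only by order \<open>h\<^sup>2\<close>.\<close>

lemma one_step:
  assumes i: "i < m"
  shows "ln (mart i y) + h / 2 * (\<Sum>b<n. (feedback i b y)\<^sup>2) - rem_const * h\<^sup>2
    \<le> expectation (\<lambda>\<omega>. ln (mart (Suc i) (set_block i y (\<lambda>b. Z \<omega> (i, b) + h * feedback i b y))))"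
proof -
  define u where "u b = feedback i b y" for b
  define S where "S = (\<Sum>b<n. (u b)\<^sup>2)"
  define f where "f v = mart (Suc i) (set_block i y v)" for v
  define v where "v \<omega> b = Z \<omega> (i, b) + h * u b" for \<omega> b
  define r where "r \<omega> = rem i y (v \<omega>)" for \<omega>
  define q where "q = mart0 i y"
  have q: "\<kappa> \<le> q" "q \<le> 1" by (simp_all add: q_def mart0_bounds)
  have f_pos: "0 < f x" for x using mart_bounds(1)[of "Suc i" "set_block i y x"] \<kappa> by (simp add: f_def)
  have ub: "\<bar>u b\<bar> \<le> C / \<kappa>" for b by (simp add: u_def abs_feedback_le)
  have v_meas[measurable]: "(\<lambda>\<omega>. v \<omega> b) \<in> borel_measurable M" for b by (simp add: v_def)
  have fv[measurable]: "(\<lambda>\<omega>. f (v \<omega>)) \<in> borel_measurable M"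
    unfolding f_def by (intro measurable_compose[OF _ measurable_mart] measurable_set_block) simp_all
  have r_meas[measurable]: "r \<in> borel_measurable M"
    unfolding r_def rem_def f_def[symmetric] by measurable
  have ln_f_le: "\<bar>ln (f x)\<bar> \<le> ln (1 / \<kappa>)" for x
    using mart_bounds[of "Suc i" "set_block i y x"] \<kappa> by (simp add: f_def ln_div)
  have Q: "{i} \<times> {..<n} \<subseteq> {..<m} \<times> {..<n}" using i by auto
  have Q_sum: "(\<Sum>q\<in>{i} \<times> {..<n}. g q) = (\<Sum>b<n. g (i, b))" for g :: "nat \<times> nat \<Rightarrow> real"
  proof -
    have "{i} \<times> {..<n} = Pair i ` {..<n}" by auto
    then show ?thesis by (simp add: sum.reindex inj_on_def)
  qed
  have r_int: "integrable M r"
    unfolding r_def rem_def f_def[symmetric] v_def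
    by (intro Bochner_Integration.integrable_diff Bochner_Integration.integrable_sum integrable_mult_right
        Bochner_Integration.integrable_add expectation_coord integrable_const
        integrable_bounded[where c = "ln (1 / \<kappa>)"] ln_f_le)
       (simp_all add: v_def[symmetric])
  define K where "K = (C / \<kappa> + C\<^sup>2 / \<kappa>\<^sup>2)\<^sup>2 * 24 / \<kappa> * exp ((1 + C / \<kappa>) * (C / \<kappa>)) ^ n * h\<^sup>2"
  have K: "0 \<le> K" using \<kappa> by (simp add: K_def)
  have L: "0 \<le> 1 + C / \<kappa>" using C \<kappa> by simp
  have pt: "(r \<omega>)\<^sup>2 * exp (max (r \<omega>) 0) \<le> K * exp ((1 + C / \<kappa>) * (\<Sum>q\<in>{i} \<times> {..<n}. \<bar>Z \<omega> q / sqrt h\<bar>))" for \<omega>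
    unfolding r_def v_def K_def Q_sum by (rule rem_sq_exp_le[OF i ub])
  have nn: "(\<integral>\<^sup>+\<omega>. ennreal ((r \<omega>)\<^sup>2 * exp (max (r \<omega>) 0)) \<partial>M) \<le> ennreal (rem_const * h\<^sup>2)"
  proof -
    have "(\<integral>\<^sup>+\<omega>. ennreal ((r \<omega>)\<^sup>2 * exp (max (r \<omega>) 0)) \<partial>M)
      \<le> (\<integral>\<^sup>+\<omega>. ennreal K * ennreal (exp ((1 + C / \<kappa>) * (\<Sum>q\<in>{i} \<times> {..<n}. \<bar>Z \<omega> q / sqrt h\<bar>))) \<partial>M)"
      unfolding ennreal_mult'[OF K, symmetric] by (intro nn_integral_mono ennreal_leI pt)
    also have "\<dots> = ennreal K * (\<integral>\<^sup>+\<omega>. ennreal (exp ((1 + C / \<kappa>) * (\<Sum>q\<in>{i} \<times> {..<n}. \<bar>Z \<omega> q / sqrt h\<bar>))) \<partial>M)"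
      by (rule nn_integral_cmult) simp
    also have "\<dots> \<le> ennreal K * ennreal ((2 * exp ((1 + C / \<kappa>)\<^sup>2 / 2)) ^ card ({i} \<times> {..<n}))"
      by (intro mult_left_mono nn_integral_exp_abs_prod Q L) simp
    also have "\<dots> = ennreal (rem_const * h\<^sup>2)"
      using K by (simp add: ennreal_mult[symmetric] K_def rem_const_def power_mult_distrib ac_simps)
    finally show ?thesis .
  qed
  have r2_int: "integrable M (\<lambda>\<omega>. (r \<omega>)\<^sup>2 * exp (max (r \<omega>) 0))"
    by (rule integrableI_nonneg) (use nn in \<open>auto simp: top.not_eq_extremum[symmetric] top_unique\<close>)
  have r2_le: "expectation (\<lambda>\<omega>. (r \<omega>)\<^sup>2 * exp (max (r \<omega>) 0)) \<le> rem_const * h\<^sup>2"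
    using nn rem_const_nonneg by (subst (asm) nn_integral_eq_integral[OF r2_int]) auto
  \<comment> \<open>Redrawing every block except \<open>i\<close> splits the average: the blocks
    after \<open>i\<close> are integrated inside \<open>mart (Suc i)\<close>, block \<open>i\<close>
    outside.\<close>
  have split: "mart i y = expectation (\<lambda>\<omega>. f (\<lambda>b. Z \<omega> (i, b)))"
  proof -
    have "mart i y = expectation (\<lambda>\<omega>. expectation (\<lambda>\<omega>'. F (past i y (\<lambda>q. if q \<in> {q. fst q \<noteq> i} then Z \<omega>' q else Z \<omega> q))))"
      unfolding mart_def
      by (rule integral_resample(1)) (auto intro!: integrable_F)
    also have "\<dots> = expectation (\<lambda>\<omega>. f (\<lambda>b. Z \<omega> (i, b)))"
      unfolding f_def mart_def
      by (intro Bochner_Integration.integral_cong refl arg_cong[where f = F])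
         (auto simp: past_def set_block_def fun_eq_iff zero)
    finally show ?thesis .
  qed
  \<comment> \<open>For fixed \<open>y\<close> the drift \<open>u\<close> is a constant vector, so
    this is Girsanov with constant coefficients on block \<open>i\<close>.\<close>
  have gir: "expectation (\<lambda>\<omega>. f (v \<omega>) * exp (- (\<Sum>b<n. u b * Z \<omega> (i, b)) - h / 2 * S)) = mart i y"
  proof (rule integral_eq_nn_integral[THEN trans])
    let ?g = "\<lambda>z. ennreal (f (\<lambda>b. z (i, b)))"
    have meas: "?g \<in> borel_measurable borel"
      unfolding f_def by (intro measurable_compose[OF _ measurable_ennreal] measurable_compose[OF _ measurable_mart] measurable_set_block) simp_all
    have "(\<integral>\<^sup>+\<omega>. ennreal (f (v \<omega>) * exp (- (\<Sum>b<n. u b * Z \<omega> (i, b)) - h / 2 * S)) \<partial>M)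
      = (\<integral>\<^sup>+\<omega>. ?g (\<lambda>q. Z \<omega> q + (if q \<in> {i} \<times> {..<n} then h * u (snd q) else 0)) *
          ennreal (exp (- (\<Sum>q\<in>{i} \<times> {..<n}. u (snd q) * Z \<omega> q) - h / 2 * (\<Sum>q\<in>{i} \<times> {..<n}. (u (snd q))\<^sup>2))) \<partial>M)"
    proof (intro nn_integral_cong)
      fix \<omega>
      have "f (v \<omega>) = f (\<lambda>b. Z \<omega> (i, b) + (if (i, b) \<in> {i} \<times> {..<n} then h * u (snd (i, b)) else 0))"
        unfolding f_def by (rule arg_cong[where f = "mart (Suc i)"]) (auto simp: set_block_def v_def fun_eq_iff)
      then show "ennreal (f (v \<omega>) * exp (- (\<Sum>b<n. u b * Z \<omega> (i, b)) - h / 2 * S))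
        = ?g (\<lambda>q. Z \<omega> q + (if q \<in> {i} \<times> {..<n} then h * u (snd q) else 0)) *
          ennreal (exp (- (\<Sum>q\<in>{i} \<times> {..<n}. u (snd q) * Z \<omega> q) - h / 2 * (\<Sum>q\<in>{i} \<times> {..<n}. (u (snd q))\<^sup>2)))"
        using f_pos by (simp add: Q_sum S_def ennreal_mult less_imp_le)
    qed
    also have "\<dots> = (\<integral>\<^sup>+\<omega>. ?g (Z \<omega>) \<partial>M)"
      by (rule girsanov[where c = "\<lambda>q y. u (snd q)" and rk = fst]) (use Q meas in auto)
    also have "\<dots> = ennreal (expectation (\<lambda>\<omega>. f (\<lambda>b. Z \<omega> (i, b))))"
    proof (rule nn_integral_eq_integral)
      have "(\<lambda>\<omega>. f (\<lambda>b. Z \<omega> (i, b))) \<in> borel_measurable M"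
        unfolding f_def by (intro measurable_compose[OF _ measurable_mart] measurable_set_block) simp_all
      then show "integrable M (\<lambda>\<omega>. f (\<lambda>b. Z \<omega> (i, b)))"
        by (rule integrable_bounded[where c = 1]) (use f_pos mart_bounds(2) in \<open>auto simp: f_def abs_of_pos\<close>)
    qed (use f_pos in \<open>auto intro: less_imp_le\<close>)
    also have "\<dots> = ennreal (mart i y)" by (simp only: split)
    finally show "enn2real (\<integral>\<^sup>+\<omega>. ennreal (f (v \<omega>) * exp (- (\<Sum>b<n. u b * Z \<omega> (i, b)) - h / 2 * S)) \<partial>M) = mart i y"
      using mart_bounds(1)[of i y] \<kappa> by simp
  qed (use f_pos in \<open>auto intro!: less_imp_le mult_pos_pos\<close>)
  have ln_f: "ln (f (v \<omega>)) = ln q + r \<omega> + (\<Sum>b<n. u b * Z \<omega> (i, b)) + h * S" for \<omega>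
    by (simp add: r_def rem_def f_def q_def u_def v_def S_def distrib_left sum.distrib sum_distrib_left power2_eq_square ac_simps)
  \<comment> \<open>With the drift equal to the log-gradient the noise terms cancel: only
    \<open>ln q + h / 2 * S\<close> and the small remainder stay in the exponent.\<close>
  have fexp: "f (v \<omega>) * exp (- (\<Sum>b<n. u b * Z \<omega> (i, b)) - h / 2 * S) = q * exp (h / 2 * S) * exp (r \<omega>)" for \<omega>
  proof -
    have "f (v \<omega>) = exp (ln (f (v \<omega>)))" using f_pos by simp
    then have "f (v \<omega>) * exp (- (\<Sum>b<n. u b * Z \<omega> (i, b)) - h / 2 * S)
      = exp (ln (f (v \<omega>)) + (- (\<Sum>b<n. u b * Z \<omega> (i, b)) - h / 2 * S))"
      by (subst exp_add) (simp add: f_pos)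
    also have "\<dots> = exp (ln q + h / 2 * S + r \<omega>)"
      by (simp add: ln_f)
    also have "\<dots> = q * exp (h / 2 * S) * exp (r \<omega>)"
      using q \<kappa> by (simp add: exp_add)
    finally show ?thesis .
  qed
  have exp_r: "expectation (\<lambda>\<omega>. exp (r \<omega>)) \<le> 1 + expectation r + rem_const * h\<^sup>2"
  proof -
    have "expectation (\<lambda>\<omega>. exp (r \<omega>)) \<le> expectation (\<lambda>\<omega>. 1 + r \<omega> + (r \<omega>)\<^sup>2 * exp (max (r \<omega>) 0))"
      by (rule integral_mono') (auto intro!: Bochner_Integration.integrable_add r_int r2_int exp_le_quadratic
            order_trans[OF exp_ge_zero exp_le_quadratic])
    also have "\<dots> = 1 + expectation r + expectation (\<lambda>\<omega>. (r \<omega>)\<^sup>2 * exp (max (r \<omega>) 0))"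
      by (simp add: r_int r2_int prob_space)
    finally show ?thesis using r2_le by simp
  qed
  have m_eq: "mart i y = q * exp (h / 2 * S) * expectation (\<lambda>\<omega>. exp (r \<omega>))"
    using gir unfolding fexp by simp
  have pos: "0 < expectation (\<lambda>\<omega>. exp (r \<omega>))"
  proof -
    have "0 < mart i y" using mart_bounds(1)[of i y] \<kappa> by linarith
    then show ?thesis unfolding m_eq by (rule zero_less_mult_pos) (use q \<kappa> in simp)
  qed
  have "ln (mart i y) = ln q + h / 2 * S + ln (expectation (\<lambda>\<omega>. exp (r \<omega>)))"
    unfolding m_eq using q \<kappa> pos by (simp add: ln_mult)
  also have "\<dots> \<le> ln q + h / 2 * S + (expectation r + rem_const * h\<^sup>2)"
    using ln_le_minus_one[OF pos] exp_r by simp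
  finally have 1: "ln (mart i y) \<le> ln q + h / 2 * S + (expectation r + rem_const * h\<^sup>2)" .
  \<comment> \<open>Without the weight the energy enters as \<open>h * S\<close>, with it as
    \<open>h / 2 * S\<close>; the difference is the energy term of the claim.\<close>
  have "expectation (\<lambda>\<omega>. ln (f (v \<omega>))) = ln q + expectation r + h * S"
    unfolding ln_f by (simp add: r_int expectation_coord prob_space)
  then show ?thesis using 1
    by (simp add: f_def v_def[abs_def] u_def S_def)
qed

text \<open>Closed loop: the drift of block \<open>i\<close> is computed from the earlier blocks
  after they have been drifted themselves; in \<open>drifted i\<close> the blocks from
  \<open>i\<close> on are still raw noise.\<close>

primrec drifted :: "nat \<Rightarrow> (nat \<times> nat \<Rightarrow> real) \<Rightarrow> nat \<times> nat \<Rightarrow> real" where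
  "drifted 0 z = z"
| "drifted (Suc i) z = (\<lambda>q. if fst q = i \<and> snd q < n then z q + h * feedback i (snd q) (drifted i z) else drifted i z q)"

text \<open>The feedback as a function of the raw increments, the form in which Girsanov and
  adaptedness are stated.\<close>

definition control :: "nat \<times> nat \<Rightarrow> (nat \<times> nat \<Rightarrow> real) \<Rightarrow> real" where
  "control q z = feedback (fst q) (snd q) (drifted (fst q) z)"

lemma drifted_eq: "drifted i z q = z q + (if fst q < i \<and> snd q < n then h * control q z else 0)"
  by (induction i) (auto simp: control_def less_Suc_eq)

lemma measurable_drifted[measurable]: "drifted i \<in> borel_measurable borel"
proof (induction i)
  case 0
  then show ?case by (simp add: id_def[symmetric] cong: measurable_cong)
next
  case (Suc i)
  note [measurable] = Suc
  have "(\<lambda>z. feedback i b (drifted i z)) \<in> borel_measurable borel" for b by measurable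
  moreover have "(\<lambda>z. drifted i z q) \<in> borel_measurable borel" for q by measurable
  ultimately show ?case
    by (intro measurable_coordinatewise_then_product) simp
qed

lemma measurable_control[measurable]: "control q \<in> borel_measurable borel"
  unfolding control_def[abs_def] by measurable

lemma feedback_cong:
  assumes "\<And>a b. a < i \<Longrightarrow> y (a, b) = y' (a, b)"
  shows "feedback i b y = feedback i b y'"
proof -
  have "base i y z = base i y' z" for z using assms by (auto simp: base_def fun_eq_iff)
  then show ?thesis by (simp add: feedback_def grad_def mart0_def)
qed

lemma drifted_cong:
  assumes "\<And>a b. a < i \<Longrightarrow> z (a, b) = z' (a, b)" "fst q < i"
  shows "drifted i z q = drifted i z' q"
  using assms
proof (induction i arbitrary: q)
  case (Suc i)
  have "feedback i b (drifted i z) = feedback i b (drifted i z')" for b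
    by (rule feedback_cong) (use Suc in auto)
  moreover have "drifted i z q = drifted i z' q" if "fst q < i" using Suc that by auto
  moreover have "drifted i z q = z q" "drifted i z' q = z' q" if "fst q = i" using that by (simp_all add: drifted_eq)
  ultimately show ?case using Suc.prems by (cases q) (auto simp: less_Suc_eq)
qed simp

lemma control_cong:
  assumes "\<And>a b. a < fst q \<Longrightarrow> z (a, b) = z' (a, b)"
  shows "control q z = control q z'"
  unfolding control_def by (intro feedback_cong drifted_cong) (use assms in auto)

lemma abs_control_le: "\<bar>control q z\<bar> \<le> C / \<kappa>"
  unfolding control_def by (rule abs_feedback_le)

lemma integrable_ln_mart:
  assumes [measurable]: "f \<in> borel_measurable N" and N: "finite_measure N"
  shows "integrable N (\<lambda>\<omega>. ln (mart i (f \<omega>)))"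
proof (rule finite_measure.integrable_const_bound[OF N, where B = "ln (1 / \<kappa>)"])
  have "\<bar>ln (mart i y)\<bar> \<le> ln (1 / \<kappa>)" for y
    using mart_bounds[of i y] \<kappa> by (simp add: ln_div)
  then show "AE \<omega> in N. norm (ln (mart i (f \<omega>))) \<le> ln (1 / \<kappa>)" by auto
qed measurable

lemma integrable_control_sq: "integrable M (\<lambda>\<omega>. (control q (Z \<omega>))\<^sup>2)"
proof (rule integrable_bounded[where c = "(C / \<kappa>)\<^sup>2"])
  show "\<bar>(control q (Z \<omega>))\<^sup>2\<bar> \<le> (C / \<kappa>)\<^sup>2" for \<omega>
    using abs_control_le[of q "Z \<omega>"] C \<kappa> by (simp add: abs_le_square_iff[symmetric])
qed measurable

text \<open>Redraw block \<open>i\<close> only. Everything computed from earlier blocks is then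
  frozen, the inner average obeys the one-step estimate at
  \<open>y = drifted i (Z \<omega>)\<close>, and the outer average integrates it.\<close>

lemma potential_step:
  assumes i: "i < m"
  shows "expectation (\<lambda>\<omega>. ln (mart i (drifted i (Z \<omega>)))) + h / 2 * (\<Sum>b<n. expectation (\<lambda>\<omega>. (control (i, b) (Z \<omega>))\<^sup>2)) - rem_const * h\<^sup>2
    \<le> expectation (\<lambda>\<omega>. ln (mart (Suc i) (drifted (Suc i) (Z \<omega>))))"
proof -
  define f where "f z = ln (mart (Suc i) (set_block i (drifted i z) (\<lambda>b. z (i, b) + h * feedback i b (drifted i z))))" for z
  have meas: "(\<lambda>z. set_block i (drifted i z) (\<lambda>b. z (i, b) + h * feedback i b (drifted i z))) \<in> borel_measurable borel"
    by (intro measurable_set_block) measurable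
  have f[measurable]: "f \<in> borel_measurable borel"
    unfolding f_def using meas by measurable
  have f_int: "integrable M (\<lambda>\<omega>. f (Z \<omega>))"
    unfolding f_def by (intro integrable_ln_mart measurable_compose[OF measurable_Z meas] finite_measure_axioms)
  have eq: "mart (Suc i) (drifted (Suc i) (Z \<omega>)) = mart (Suc i) (set_block i (drifted i (Z \<omega>)) (\<lambda>b. Z \<omega> (i, b) + h * feedback i b (drifted i (Z \<omega>))))" for \<omega>
    unfolding mart_def
    by (intro Bochner_Integration.integral_cong refl arg_cong[where f = F])
       (auto simp: past_def set_block_def fun_eq_iff drifted_eq zero control_def)
  have inner: "f (\<lambda>q. if q \<in> {i} \<times> UNIV then Z \<omega>' q else Z \<omega> q)
    = ln (mart (Suc i) (set_block i (drifted i (Z \<omega>)) (\<lambda>b. Z \<omega>' (i, b) + h * feedback i b (drifted i (Z \<omega>)))))" for \<omega> \<omega>'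
  proof -
    let ?z = "\<lambda>q. if q \<in> {i} \<times> UNIV then Z \<omega>' q else Z \<omega> q"
    have d: "drifted i ?z (a, b) = drifted i (Z \<omega>) (a, b)" if "a < i" for a b
      by (rule drifted_cong) (use that in auto)
    have "feedback i b (drifted i ?z) = feedback i b (drifted i (Z \<omega>))" for b
      by (rule feedback_cong) (rule d)
    then show ?thesis
      unfolding f_def mart_def
      by (intro arg_cong[where f = ln] Bochner_Integration.integral_cong refl arg_cong[where f = F])
         (auto simp: past_def set_block_def fun_eq_iff d)
  qed
  have "expectation (\<lambda>\<omega>. ln (mart i (drifted i (Z \<omega>)))) + h / 2 * (\<Sum>b<n. expectation (\<lambda>\<omega>. (control (i, b) (Z \<omega>))\<^sup>2)) - rem_const * h\<^sup>2
    = expectation (\<lambda>\<omega>. ln (mart i (drifted i (Z \<omega>))) + h / 2 * (\<Sum>b<n. (control (i, b) (Z \<omega>))\<^sup>2) - rem_const * h\<^sup>2)"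
    using integrable_ln_mart[OF measurable_compose[OF measurable_Z measurable_drifted] finite_measure_axioms]
    by (simp add: integrable_control_sq prob_space)
  also have "\<dots> \<le> expectation (\<lambda>\<omega>. expectation (\<lambda>\<omega>'. f (\<lambda>q. if q \<in> {i} \<times> UNIV then Z \<omega>' q else Z \<omega> q)))"
  proof (rule integral_mono)
    show "integrable M (\<lambda>\<omega>. expectation (\<lambda>\<omega>'. f (\<lambda>q. if q \<in> {i} \<times> UNIV then Z \<omega>' q else Z \<omega> q)))"
      by (rule integral_resample(2)[OF f f_int])
    show "integrable M (\<lambda>\<omega>. ln (mart i (drifted i (Z \<omega>))) + h / 2 * (\<Sum>b<n. (control (i, b) (Z \<omega>))\<^sup>2) - rem_const * h\<^sup>2)"
      using integrable_ln_mart[OF measurable_compose[OF measurable_Z measurable_drifted] finite_measure_axioms]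
      by (simp add: integrable_control_sq)
    show "ln (mart i (drifted i (Z \<omega>))) + h / 2 * (\<Sum>b<n. (control (i, b) (Z \<omega>))\<^sup>2) - rem_const * h\<^sup>2
      \<le> expectation (\<lambda>\<omega>'. f (\<lambda>q. if q \<in> {i} \<times> UNIV then Z \<omega>' q else Z \<omega> q))" for \<omega>
      unfolding inner using one_step[OF i, of "drifted i (Z \<omega>)"] by (simp add: control_def)
  qed
  also have "\<dots> = expectation (\<lambda>\<omega>. f (Z \<omega>))"
    by (rule integral_resample(1)[OF f f_int, symmetric])
  also have "\<dots> = expectation (\<lambda>\<omega>. ln (mart (Suc i) (drifted (Suc i) (Z \<omega>))))"
    unfolding eq by (simp add: f_def)
  finally show ?thesis .
qed

text \<open>Telescoping \<open>potential_step\<close>: at block 0 the potential is the logarithm of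
  the mean, at block \<open>m\<close> it is \<open>ln F\<close> of the fully drifted noise. In the
  application \<open>m * h = T\<close>, so the total loss is of order \<open>h\<close>.\<close>

lemma control_near_optimal:
  "ln (expectation (\<lambda>\<omega>. F (Z \<omega>))) + h / 2 * (\<Sum>q\<in>{..<m} \<times> {..<n}. expectation (\<lambda>\<omega>. (control q (Z \<omega>))\<^sup>2)) - real m * (rem_const * h\<^sup>2)
    \<le> expectation (\<lambda>\<omega>. ln (F (\<lambda>q. Z \<omega> q + (if q \<in> {..<m} \<times> {..<n} then h * control q (Z \<omega>) else 0))))"
proof -
  have "i \<le> m \<Longrightarrow> ln (expectation (\<lambda>\<omega>. F (Z \<omega>))) + h / 2 * (\<Sum>a<i. \<Sum>b<n. expectation (\<lambda>\<omega>. (control (a, b) (Z \<omega>))\<^sup>2)) - real i * (rem_const * h\<^sup>2)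
    \<le> expectation (\<lambda>\<omega>. ln (mart i (drifted i (Z \<omega>))))" for i
  proof (induction i)
    case 0
    have "mart 0 y = expectation (\<lambda>\<omega>. F (Z \<omega>))" for y
      by (simp add: mart_def past_def case_prod_eta)
    then show ?case by (simp add: prob_space)
  next
    case (Suc i)
    then show ?case using potential_step[of i] by (simp add: algebra_simps)
  qed
  from this[of m] have "ln (expectation (\<lambda>\<omega>. F (Z \<omega>))) + h / 2 * (\<Sum>q\<in>{..<m} \<times> {..<n}. expectation (\<lambda>\<omega>. (control q (Z \<omega>))\<^sup>2)) - real m * (rem_const * h\<^sup>2)
    \<le> expectation (\<lambda>\<omega>. ln (mart m (drifted m (Z \<omega>))))"
    by (simp add: sum.cartesian_product split_beta)
  moreover have "mart m (drifted m (Z \<omega>)) = F (\<lambda>q. Z \<omega> q + (if q \<in> {..<m} \<times> {..<n} then h * control q (Z \<omega>) else 0))" for \<omega>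
  proof -
    have "past m (drifted m (Z \<omega>)) z = (\<lambda>q. Z \<omega> q + (if q \<in> {..<m} \<times> {..<n} then h * control q (Z \<omega>) else 0))"
      if "\<And>q. q \<notin> {..<m} \<times> {..<n} \<Longrightarrow> z q = 0" for z
      using that by (auto simp: past_def fun_eq_iff drifted_eq zero)
    then show ?thesis by (simp add: mart_def zero prob_space)
  qed
  ultimately show ?thesis by simp
qed

end

section \<open>Weak compactness in $L^2$\<close>

definition square_integrable :: "'a measure \<Rightarrow> ('a \<Rightarrow> 'b::{real_inner, banach, second_countable_topology}) set" where
  "square_integrable N = {k \<in> borel_measurable N. integrable N (\<lambda>s. (norm (k s))\<^sup>2)}"

text \<open>Taken on representatives, hence only positive semidefinite: a function with
  \<open>ip N k k = 0\<close> need not vanish everywhere.\<close>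

definition ip :: "'a measure \<Rightarrow> ('a \<Rightarrow> 'b::{real_inner, banach, second_countable_topology}) \<Rightarrow> ('a \<Rightarrow> 'b) \<Rightarrow> real" where
  "ip N k h = (\<integral>s. inner (k s) (h s) \<partial>N)"

lemma square_integrableD:
  "k \<in> square_integrable N \<Longrightarrow> k \<in> borel_measurable N"
  "k \<in> square_integrable N \<Longrightarrow> integrable N (\<lambda>s. (norm (k s))\<^sup>2)"
  by (auto simp: square_integrable_def)

lemma inner_le_squares: "\<bar>inner x y\<bar> \<le> ((norm x)\<^sup>2 + (norm y)\<^sup>2) / 2"
proof -
  have "0 \<le> (norm x - norm y)\<^sup>2" by simp
  then show ?thesis using Cauchy_Schwarz_ineq2[of x y] by (simp add: power2_diff)
qed

lemma integrable_inner:
  assumes "k \<in> square_integrable N" "h \<in> square_integrable N"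
  shows "integrable N (\<lambda>s. inner (k s) (h s))"
proof (rule Bochner_Integration.integrable_bound)
  show "integrable N (\<lambda>s. ((norm (k s))\<^sup>2 + (norm (h s))\<^sup>2) / 2)"
    using assms[THEN square_integrableD(2)] by simp
  show "(\<lambda>s. inner (k s) (h s)) \<in> borel_measurable N"
    using assms[THEN square_integrableD(1)] by simp
  show "AE s in N. norm (inner (k s) (h s)) \<le> norm (((norm (k s))\<^sup>2 + (norm (h s))\<^sup>2) / 2)"
    using inner_le_squares by (auto intro: order.trans)
qed

lemma square_integrable_scaleR:
  "k \<in> square_integrable N \<Longrightarrow> (\<lambda>s. c *\<^sub>R k s) \<in> square_integrable N"
  by (auto simp: square_integrable_def power_mult_distrib)

lemma square_integrable_add:
  assumes "k \<in> square_integrable N" "h \<in> square_integrable N"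
  shows "(\<lambda>s. k s + h s) \<in> square_integrable N"
  using assms integrable_inner[OF assms]
  by (auto simp: square_integrable_def power2_norm_eq_inner inner_add_left inner_add_right inner_commute)

lemma square_integrable_diff:
  assumes "k \<in> square_integrable N" "h \<in> square_integrable N"
  shows "(\<lambda>s. k s - h s) \<in> square_integrable N"
  using square_integrable_add[OF assms(1) square_integrable_scaleR[OF assms(2), of "-1"]] by simp

lemma ip_commute: "ip N k h = ip N h k"
  by (simp add: ip_def inner_commute)

lemma ip_add:
  assumes "k \<in> square_integrable N" "g \<in> square_integrable N" "h \<in> square_integrable N"
  shows "ip N (\<lambda>s. k s + g s) h = ip N k h + ip N g h"
  unfolding ip_def by (simp add: inner_add_left integrable_inner assms)

lemma ip_scaleR: "ip N (\<lambda>s. c *\<^sub>R k s) h = c * ip N k h"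
  unfolding ip_def by simp

lemma ip_diff:
  assumes "k \<in> square_integrable N" "g \<in> square_integrable N" "h \<in> square_integrable N"
  shows "ip N (\<lambda>s. k s - g s) h = ip N k h - ip N g h"
  unfolding ip_def by (simp add: inner_diff_left integrable_inner assms)

lemma ip_self_nonneg: "0 \<le> ip N k k"
  unfolding ip_def by simp

lemma ip_self: "ip N k k = (\<integral>s. (norm (k s))\<^sup>2 \<partial>N)"
  by (simp add: ip_def power2_norm_eq_inner)

lemma ip_diff_self:
  assumes "k \<in> square_integrable N" "h \<in> square_integrable N"
  shows "ip N (\<lambda>s. k s - h s) (\<lambda>s. k s - h s) = ip N k k - 2 * ip N k h + ip N h h"
proof -
  have d: "(\<lambda>s. k s - h s) \<in> square_integrable N" by (rule square_integrable_diff[OF assms])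
  show ?thesis
    using ip_diff[OF assms d] ip_diff[OF assms assms(1)] ip_diff[OF assms assms(2)]
    by (simp add: ip_commute[of N k "\<lambda>s. k s - h s"] ip_commute[of N h "\<lambda>s. k s - h s"] ip_commute[of N h k])
qed

lemma ip_midpoint:
  assumes "k \<in> square_integrable N" "h \<in> square_integrable N"
  shows "4 * ip N (\<lambda>s. (1 / 2) *\<^sub>R (k s + h s)) (\<lambda>s. (1 / 2) *\<^sub>R (k s + h s))
    = 2 * ip N k k + 2 * ip N h h - ip N (\<lambda>s. k s - h s) (\<lambda>s. k s - h s)"
proof -
  have p: "(\<lambda>s. k s + h s) \<in> square_integrable N" by (rule square_integrable_add[OF assms])
  have "4 * ip N (\<lambda>s. (1 / 2) *\<^sub>R (k s + h s)) (\<lambda>s. (1 / 2) *\<^sub>R (k s + h s)) = ip N (\<lambda>s. k s + h s) (\<lambda>s. k s + h s)"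
    by (simp add: ip_def del: scaleR_add_right)
  also have "\<dots> = ip N k k + 2 * ip N k h + ip N h h"
    using ip_add[OF assms p] ip_add[OF assms assms(1)] ip_add[OF assms assms(2)]
    by (simp add: ip_commute[of N k "\<lambda>s. k s + h s"] ip_commute[of N h "\<lambda>s. k s + h s"] ip_commute[of N h k])
  finally show ?thesis unfolding ip_diff_self[OF assms] by simp
qed

lemma ip_Cauchy_Schwarz:
  assumes "k \<in> square_integrable N" "h \<in> square_integrable N"
  shows "(ip N k h)\<^sup>2 \<le> ip N k k * ip N h h"
proof -
  have *: "0 \<le> ip N k k - 2 * t * ip N k h + t\<^sup>2 * ip N h h" for t
  proof -
    have "0 \<le> ip N (\<lambda>s. k s - t *\<^sub>R h s) (\<lambda>s. k s - t *\<^sub>R h s)" by (rule ip_self_nonneg)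
    then show ?thesis
      by (simp add: ip_diff_self assms square_integrable_scaleR ip_scaleR ip_commute[of N _ "\<lambda>s. t *\<^sub>R h s"]
          ip_commute[of N h k] power2_eq_square mult.assoc)
  qed
  show ?thesis
  proof (cases "ip N h h = 0")
    case True
    have "ip N k h = 0"
    proof (rule ccontr)
      assume "ip N k h \<noteq> 0"
      \<comment> \<open>This value of \<open>t\<close> makes the affine expression equal to
        \<open>- 1\<close>.\<close>
      then show False using *[of "(ip N k k + 1) / (2 * ip N k h)"] True by (simp add: field_simps)
    qed
    then show ?thesis using True by simp
  next
    case False
    then have pos: "0 < ip N h h" using ip_self_nonneg[of N h] by simp
    have "0 \<le> (ip N k k - 2 * (ip N k h / ip N h h) * ip N k h + (ip N k h / ip N h h)\<^sup>2 * ip N h h) * ip N h h"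
      using *[of "ip N k h / ip N h h"] pos by (intro mult_nonneg_nonneg) auto
    also have "\<dots> = ip N k k * ip N h h - (ip N k h)\<^sup>2"
      using pos by (simp add: field_simps power2_eq_square)
    finally show ?thesis by simp
  qed
qed

lemma ip_tendsto:
  assumes f: "\<And>n. f n \<in> square_integrable N" and x: "x \<in> square_integrable N" and h: "h \<in> square_integrable N"
    and lim: "(\<lambda>n. ip N (\<lambda>s. f n s - x s) (\<lambda>s. f n s - x s)) \<longlonglongrightarrow> 0"
  shows "(\<lambda>n. ip N (f n) h) \<longlonglongrightarrow> ip N x h"
proof (rule LIM_zero_cancel, rule Lim_null_comparison)
  have "(\<lambda>n. sqrt (ip N (\<lambda>s. f n s - x s) (\<lambda>s. f n s - x s) * ip N h h)) \<longlonglongrightarrow> sqrt (0 * ip N h h)"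
    by (intro tendsto_intros lim)
  then show "(\<lambda>n. sqrt (ip N (\<lambda>s. f n s - x s) (\<lambda>s. f n s - x s) * ip N h h)) \<longlonglongrightarrow> 0" by simp
  show "\<forall>\<^sub>F n in sequentially. norm (ip N (f n) h - ip N x h) \<le> sqrt (ip N (\<lambda>s. f n s - x s) (\<lambda>s. f n s - x s) * ip N h h)"
    unfolding ip_diff[OF f x h, symmetric]
    using real_sqrt_le_mono[OF ip_Cauchy_Schwarz[OF square_integrable_diff[OF f x] h]]
    by (intro always_eventually allI) (simp only: real_sqrt_abs real_norm_def)
qed

context finite_measure
begin

lemma square_integrable_integrable:
  assumes "k \<in> square_integrable M"
  shows "integrable M k" "(\<integral>s. norm (k s) \<partial>M)\<^sup>2 \<le> measure M (space M) * ip M k k"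
proof -
  have nk: "(\<lambda>s. norm (k s)) \<in> square_integrable M"
    using assms by (auto simp: square_integrable_def)
  have one: "(\<lambda>s. 1 :: real) \<in> square_integrable M" by (auto simp: square_integrable_def)
  have "integrable M (\<lambda>s. norm (k s))"
    using integrable_inner[OF nk one] by simp
  then show "integrable M k" using assms by (auto simp: square_integrable_def intro: integrable_norm_cancel)
  show "(\<integral>s. norm (k s) \<partial>M)\<^sup>2 \<le> measure M (space M) * ip M k k"
    using ip_Cauchy_Schwarz[OF nk one] by (simp add: ip_def power2_norm_eq_inner[symmetric] power2_eq_square mult.commute)
qed

text \<open>Riesz-Fischer: along a subsequence with squared distances at most
  \<open>(1 / 4) ^ j\<close> the increments have summable first norms because the measure is finite,
  which gives a pointwise limit almost everywhere; Fatou's lemma then bounds the distance to that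
  limit.\<close>

lemma square_integrable_complete:
  fixes f :: "nat \<Rightarrow> 'a \<Rightarrow> 'b::{real_inner, banach, second_countable_topology}"
  assumes f: "\<And>n. f n \<in> square_integrable M"
    and Cauchy: "\<And>e. 0 < e \<Longrightarrow> \<exists>N. \<forall>m\<ge>N. \<forall>n\<ge>N. ip M (\<lambda>s. f m s - f n s) (\<lambda>s. f m s - f n s) \<le> e"
  shows "\<exists>x\<in>square_integrable M. (\<lambda>n. ip M (\<lambda>s. f n s - x s) (\<lambda>s. f n s - x s)) \<longlonglongrightarrow> 0"
proof -
  define d where "d m n = ip M (\<lambda>s. f m s - f n s) (\<lambda>s. f m s - f n s)" for m n
  have df: "(\<lambda>s. f m s - f n s) \<in> square_integrable M" for m n by (rule square_integrable_diff[OF f f])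
  have "\<forall>j. \<exists>N. \<forall>m\<ge>N. \<forall>n\<ge>N. d m n \<le> (1 / 4) ^ j" using Cauchy by (simp add: d_def)
  then obtain R where R: "\<And>j m n. R j \<le> m \<Longrightarrow> R j \<le> n \<Longrightarrow> d m n \<le> (1 / 4) ^ j" by metis
  \<comment> \<open>The sum dominates every earlier threshold, so both \<open>r j\<close> and
    \<open>r (Suc j)\<close> lie beyond \<open>R j\<close>; the summand \<open>j\<close> makes
    \<open>r j\<close> tend to infinity.\<close>
  define r where "r j = j + (\<Sum>i\<le>j. R i)" for j
  have r: "R j \<le> r j" "R j \<le> r (Suc j)" for j
    using member_le_sum[of j "{..j}" R] by (simp_all add: r_def)
  define g where "g j s = f (r (Suc j)) s - f (r j) s" for j s
  have gs: "g j \<in> square_integrable M" for j unfolding g_def by (rule df)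
  have g_int: "(\<integral>s. norm (g j s) \<partial>M) \<le> sqrt (measure M (space M)) * (1 / 2) ^ j" for j
  proof -
    have "(\<integral>s. norm (g j s) \<partial>M)\<^sup>2 \<le> measure M (space M) * ip M (g j) (g j)"
      by (rule square_integrable_integrable(2)[OF gs])
    also have "\<dots> \<le> measure M (space M) * (1 / 4) ^ j"
      using R[OF r(2)[of j] r(1)[of j]] unfolding d_def g_def by (intro mult_left_mono) auto
    also have "\<dots> = (sqrt (measure M (space M)) * (1 / 2) ^ j)\<^sup>2"
      by (simp add: power_mult_distrib power_mult[symmetric] mult.commute[of j 2] power_mult power_divide)
    finally show ?thesis by (rule power2_le_imp_le) simp
  qed
  have "(\<integral>\<^sup>+s. (\<Sum>j. ennreal (norm (g j s))) \<partial>M) = (\<Sum>j. \<integral>\<^sup>+s. ennreal (norm (g j s)) \<partial>M)"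
    using square_integrableD(1)[OF gs] by (intro nn_integral_suminf) simp
  also have "\<dots> = (\<Sum>j. ennreal (\<integral>s. norm (g j s) \<partial>M))"
    using square_integrable_integrable(1)[OF gs] by (intro suminf_cong nn_integral_eq_integral) auto
  also have "\<dots> \<le> (\<Sum>j. ennreal (sqrt (measure M (space M)) * (1 / 2) ^ j))"
    by (intro suminf_le ennreal_leI g_int) auto
  also have "\<dots> = ennreal (\<Sum>j. sqrt (measure M (space M)) * (1 / 2) ^ j)"
    by (rule suminf_ennreal2) (auto intro: summable_mult summable_geometric)
  also have "\<dots> < \<infinity>" by simp
  finally have "AE s in M. (\<Sum>j. ennreal (norm (g j s))) \<noteq> \<infinity>"
    using square_integrableD(1)[OF gs] by (intro nn_integral_noteq_infinite) auto
  then have conv: "AE s in M. convergent (\<lambda>j. f (r j) s)"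
  proof eventually_elim
    case (elim s)
    then have "summable (\<lambda>j. norm (g j s))" by (intro summable_suminf_not_top) auto
    then have "summable (\<lambda>j. g j s)" by (rule summable_norm_cancel)
    then have "convergent (\<lambda>n. \<Sum>j<n. g j s)" by (simp add: summable_iff_convergent)
    moreover have "(\<Sum>j<n. g j s) = f (r n) s - f (r 0) s" for n
      unfolding g_def by (rule sum_lessThan_telescope)
    ultimately have "convergent (\<lambda>n. (f (r n) s - f (r 0) s) + f (r 0) s)"
      by (intro convergent_add convergent_const) simp
    then show ?case by simp
  qed
  define x where "x s = lim (\<lambda>j. f (r j) s)" for s
  have x_meas[measurable]: "x \<in> borel_measurable M"
    unfolding x_def using square_integrableD(1)[OF f] by (intro borel_measurable_lim_metric)
  have [measurable]: "f n \<in> borel_measurable M" for n by (rule square_integrableD(1)[OF f])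
  have lim: "AE s in M. (\<lambda>j. f (r j) s) \<longlonglongrightarrow> x s"
    using conv by eventually_elim (simp add: x_def convergent_LIMSEQ_iff)
  have key: "(\<integral>\<^sup>+s. ennreal ((norm (f n s - x s))\<^sup>2) \<partial>M) \<le> ennreal e" if "\<forall>m\<ge>N. \<forall>n\<ge>N. d m n \<le> e" "N \<le> n" for N n e
  proof -
    have "(\<integral>\<^sup>+s. ennreal ((norm (f n s - x s))\<^sup>2) \<partial>M) = (\<integral>\<^sup>+s. liminf (\<lambda>j. ennreal ((norm (f n s - f (r j) s))\<^sup>2)) \<partial>M)"
    proof (rule nn_integral_cong_AE)
      show "AE s in M. ennreal ((norm (f n s - x s))\<^sup>2) = liminf (\<lambda>j. ennreal ((norm (f n s - f (r j) s))\<^sup>2))"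
        using lim
      proof eventually_elim
        case (elim s)
        have "(\<lambda>j. ennreal ((norm (f n s - f (r j) s))\<^sup>2)) \<longlonglongrightarrow> ennreal ((norm (f n s - x s))\<^sup>2)"
          by (intro tendsto_ennrealI tendsto_intros elim)
        then show ?case by (intro lim_imp_Liminf[symmetric] trivial_limit_sequentially)
      qed
    qed
    also have "\<dots> \<le> liminf (\<lambda>j. \<integral>\<^sup>+s. ennreal ((norm (f n s - f (r j) s))\<^sup>2) \<partial>M)"
      by (rule nn_integral_liminf) simp
    also have "\<dots> = liminf (\<lambda>j. ennreal (d n (r j)))"
      using square_integrableD(2)[OF df] by (simp add: d_def ip_self nn_integral_eq_integral)
    also have "\<dots> \<le> ennreal e"
    proof (rule Liminf_le)
      show "\<forall>\<^sub>F j in sequentially. ennreal (d n (r j)) \<le> ennreal e"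
      proof (rule eventually_sequentiallyI)
        fix j assume "N \<le> j"
        then have "N \<le> r j" by (simp add: r_def)
        then show "ennreal (d n (r j)) \<le> ennreal e" using that by (intro ennreal_leI) auto
      qed
    qed simp
    finally show ?thesis .
  qed
  have int: "(\<lambda>s. f n s - x s) \<in> square_integrable M" if "\<forall>m\<ge>N. \<forall>n\<ge>N. d m n \<le> e" "N \<le> n" for N n e
    using key[OF that] unfolding square_integrable_def
    by (auto intro!: integrableI_nonneg simp: top_unique less_top[symmetric])
  obtain N0 where N0: "\<forall>m\<ge>N0. \<forall>n\<ge>N0. d m n \<le> 1" using Cauchy[of 1] unfolding d_def by auto
  have xs: "x \<in> square_integrable M"
    using square_integrable_diff[OF f[of N0] int[OF N0, of N0]] by simp
  have "(\<lambda>n. ip M (\<lambda>s. f n s - x s) (\<lambda>s. f n s - x s)) \<longlonglongrightarrow> 0"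
  proof (rule LIMSEQ_I)
    fix e :: real assume e: "0 < e"
    then obtain N where N: "\<forall>m\<ge>N. \<forall>n\<ge>N. d m n \<le> e / 2" using Cauchy[of "e / 2"] unfolding d_def by auto
    show "\<exists>N. \<forall>n\<ge>N. norm (ip M (\<lambda>s. f n s - x s) (\<lambda>s. f n s - x s) - 0) < e"
    proof (intro exI allI impI)
      fix n assume n: "N \<le> n"
      have "ennreal (ip M (\<lambda>s. f n s - x s) (\<lambda>s. f n s - x s)) \<le> ennreal (e / 2)"
        using key[OF N n] square_integrableD(2)[OF int[OF N n]]
        by (simp add: ip_self nn_integral_eq_integral)
      then show "norm (ip M (\<lambda>s. f n s - x s) (\<lambda>s. f n s - x s) - 0) < e"
        using e ip_self_nonneg[of M "\<lambda>s. f n s - x s"] by (simp add: ennreal_le_iff)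
    qed
  qed
  then show ?thesis using xs by blast
qed

end

text \<open>Midpoint combinations suffice: the parallelogram identity makes almost minimal elements of the
  hulls of the tails a Cauchy sequence, whose limit is the only candidate for a weak limit.\<close>

inductive_set dyadic_hull :: "(nat \<Rightarrow> 'a \<Rightarrow> 'b::real_vector) \<Rightarrow> nat \<Rightarrow> ('a \<Rightarrow> 'b) set" for z N where
  base: "N \<le> n \<Longrightarrow> z n \<in> dyadic_hull z N"
| mid: "f \<in> dyadic_hull z N \<Longrightarrow> g \<in> dyadic_hull z N \<Longrightarrow> (\<lambda>s. (1 / 2) *\<^sub>R (f s + g s)) \<in> dyadic_hull z N"

lemma dyadic_hull_antimono: "f \<in> dyadic_hull z N' \<Longrightarrow> N \<le> N' \<Longrightarrow> f \<in> dyadic_hull z N"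
  by (induction rule: dyadic_hull.induct) (auto intro: dyadic_hull.intros)

lemma dyadic_hull_square_integrable:
  assumes "\<And>n. z n \<in> square_integrable M" "f \<in> dyadic_hull z N"
  shows "f \<in> square_integrable M"
  using assms(2) by induction (auto intro: assms(1) square_integrable_scaleR square_integrable_add)

lemma dyadic_hull_energy_le:
  assumes z: "\<And>n. z n \<in> square_integrable M" "\<And>n. ip M (z n) (z n) \<le> C" and f: "f \<in> dyadic_hull z N"
  shows "ip M f f \<le> C"
  using f
proof induction
  case (mid f g)
  have fg: "f \<in> square_integrable M" "g \<in> square_integrable M"
    using mid z(1) by (auto intro: dyadic_hull_square_integrable)
  show ?case using ip_midpoint[OF fg] ip_self_nonneg[of M "\<lambda>s. f s - g s"] mid.IH by linarith
qed (auto intro: z)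

lemma dyadic_hull_ip_near:
  assumes z: "\<And>n. z n \<in> square_integrable M" and h: "h \<in> square_integrable M"
    and e: "\<And>n. N \<le> n \<Longrightarrow> \<bar>ip M (z n) h - L\<bar> \<le> e" and f: "f \<in> dyadic_hull z N"
  shows "\<bar>ip M f h - L\<bar> \<le> e"
  using f
proof induction
  case (mid f g)
  have fg: "f \<in> square_integrable M" "g \<in> square_integrable M"
    using mid z by (auto intro: dyadic_hull_square_integrable)
  have "ip M (\<lambda>s. (1 / 2) *\<^sub>R (f s + g s)) h = (ip M f h + ip M g h) / 2"
    by (simp add: ip_scaleR ip_add[OF fg h] del: scaleR_add_right)
  then show ?case using mid.IH by (simp add: abs_le_iff field_simps)
qed (auto intro: e)

context finite_measure
begin

lemma hull_limit:
  fixes z :: "nat \<Rightarrow> 'a \<Rightarrow> 'b::{real_inner, banach, second_countable_topology}"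
  assumes z: "\<And>n. z n \<in> square_integrable M" "\<And>n. ip M (z n) (z n) \<le> C"
  shows "\<exists>x f. x \<in> square_integrable M \<and> (\<forall>N. f N \<in> dyadic_hull z N)
    \<and> (\<lambda>n. ip M (\<lambda>s. f n s - x s) (\<lambda>s. f n s - x s)) \<longlonglongrightarrow> 0"
proof -
  define E where "E N = (\<lambda>f. ip M f f) ` dyadic_hull z N" for N
  define d where "d N = Inf (E N)" for N
  have ne: "E N \<noteq> {}" for N unfolding E_def using dyadic_hull.base[of N N z] by blast
  have bdd: "bdd_below (E N)" for N unfolding E_def by (rule bdd_belowI[of _ 0]) (auto simp: ip_self_nonneg)
  have d_le: "d N \<le> ip M f f" if "f \<in> dyadic_hull z N" for f N
    unfolding d_def using bdd that by (intro cInf_lower) (auto simp: E_def)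
  have "\<exists>f\<in>dyadic_hull z N. ip M f f < d N + 1 / real (Suc N)" for N
  proof -
    have "Inf (E N) < d N + 1 / real (Suc N)" by (simp add: d_def)
    then obtain y where "y \<in> E N" "y < d N + 1 / real (Suc N)"
      using cInf_lessD[OF ne] by blast
    then show ?thesis by (auto simp: E_def)
  qed
  then obtain f where f: "\<And>N. f N \<in> dyadic_hull z N" "\<And>N. ip M (f N) (f N) < d N + 1 / real (Suc N)"
    by metis
  have fs: "f N \<in> square_integrable M" for N by (rule dyadic_hull_square_integrable[OF z(1) f(1)])
  have d_mono: "d N \<le> d N'" if "N \<le> N'" for N N'
    unfolding d_def using that ne bdd by (intro cInf_superset_mono) (auto simp: E_def intro: dyadic_hull_antimono)
  have d_C: "d N \<le> C" for N using d_le[OF f(1)] dyadic_hull_energy_le[OF z f(1)] by (rule order.trans)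
  have "incseq d" using d_mono by (auto simp: incseq_def)
  then have "convergent d" using incseq_convergent[of d C] d_C unfolding convergent_def by blast
  then have "Cauchy d" by (rule convergent_Cauchy)
  have diff: "ip M (\<lambda>s. f N s - f N' s) (\<lambda>s. f N s - f N' s) \<le> 2 * \<bar>d N' - d N\<bar> + 4 * (1 / real (Suc N))" if "N \<le> N'" for N N'
  proof -
    have "d N \<le> ip M (\<lambda>s. (1 / 2) *\<^sub>R (f N s + f N' s)) (\<lambda>s. (1 / 2) *\<^sub>R (f N s + f N' s))"
      by (intro d_le dyadic_hull.mid f dyadic_hull_antimono[OF f(1) that])
    moreover have "1 / real (Suc N') \<le> 1 / real (Suc N)" using that by (intro divide_left_mono) auto
    moreover have "4 * q = 2 * a + 2 * b - c \<Longrightarrow> p \<le> q \<Longrightarrow> v \<le> u \<Longrightarrow> a < p + u \<Longrightarrow> b < p' + v \<Longrightarrow> c \<le> 2 * \<bar>p' - p\<bar> + 4 * u"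
      for a b c p p' q u v :: real using abs_ge_self[of "p' - p"] by argo
    ultimately show ?thesis
      using ip_midpoint[OF fs fs, of N N'] f(2)[of N] f(2)[of N'] by blast
  qed
  have "\<exists>N0. \<forall>m\<ge>N0. \<forall>n\<ge>N0. ip M (\<lambda>s. f m s - f n s) (\<lambda>s. f m s - f n s) \<le> e" if e: "0 < e" for e
  proof -
    obtain N1 where N1: "\<And>m n. N1 \<le> m \<Longrightarrow> N1 \<le> n \<Longrightarrow> \<bar>d m - d n\<bar> < e / 4"
      using CauchyD[OF \<open>Cauchy d\<close>, of "e / 4"] e by (auto simp: real_norm_def)
    obtain N2 where N2: "1 / real (Suc N2) < e / 8" using e by (metis nat_approx_posE zero_less_divide_iff zero_less_numeral)
    have *: "ip M (\<lambda>s. f m s - f n s) (\<lambda>s. f m s - f n s) \<le> e" if "max N1 N2 \<le> m" "m \<le> n" for m n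
    proof -
      have "1 / real (Suc m) \<le> 1 / real (Suc N2)" using that by (intro divide_left_mono) auto
      then show ?thesis using diff[OF that(2)] N1[of n m] N2 that by simp
    qed
    have sym: "ip M (\<lambda>s. f m s - f n s) (\<lambda>s. f m s - f n s) = ip M (\<lambda>s. f n s - f m s) (\<lambda>s. f n s - f m s)" for m n
      by (simp add: ip_self norm_minus_commute)
    show ?thesis
    proof (intro exI allI impI)
      fix m n assume "max N1 N2 \<le> m" "max N1 N2 \<le> n"
      then show "ip M (\<lambda>s. f m s - f n s) (\<lambda>s. f m s - f n s) \<le> e"
        using *[of m n] *[of n m] sym[of m n] by (cases "m \<le> n") auto
    qed
  qed
  from square_integrable_complete[OF fs this] show ?thesis using f(1) by blast
qed

text \<open>Hull elements average members of the tail, so they inherit a scalar limit along the tail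
  with the same error, and so does their strong limit.\<close>

lemma hull_limit_ip:
  fixes z :: "nat \<Rightarrow> 'a \<Rightarrow> 'b::{real_inner, banach, second_countable_topology}"
  assumes z: "\<And>n. z n \<in> square_integrable M" and x: "x \<in> square_integrable M" and h: "h \<in> square_integrable M"
    and f: "\<And>N. f N \<in> dyadic_hull z N" and lim: "(\<lambda>n. ip M (\<lambda>s. f n s - x s) (\<lambda>s. f n s - x s)) \<longlonglongrightarrow> 0"
    and L: "(\<lambda>n. ip M (z n) h) \<longlonglongrightarrow> L"
  shows "ip M x h = L"
proof (rule LIMSEQ_unique)
  show "(\<lambda>n. ip M (f n) h) \<longlonglongrightarrow> ip M x h"
    by (rule ip_tendsto[OF dyadic_hull_square_integrable[OF z f] x h lim])
  show "(\<lambda>n. ip M (f n) h) \<longlonglongrightarrow> L"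
  proof (rule LIMSEQ_I)
    fix r :: real assume r: "0 < r"
    then obtain N where N: "\<And>n. N \<le> n \<Longrightarrow> \<bar>ip M (z n) h - L\<bar> < r / 2"
      using LIMSEQ_D[OF L, of "r / 2"] by auto
    show "\<exists>N. \<forall>n\<ge>N. norm (ip M (f n) h - L) < r"
    proof (intro exI allI impI)
      fix n assume n: "N \<le> n"
      have "\<bar>ip M (f n) h - L\<bar> \<le> r / 2"
        by (rule dyadic_hull_ip_near[OF z h _ f]) (use N n in \<open>force intro: less_imp_le\<close>)
      then show "norm (ip M (f n) h - L) < r" using r by simp
    qed
  qed
qed

text \<open>The diagonal subsequence makes \<open>ip\<close> converge only against the
  \<open>k m\<close>. For a general \<open>h\<close>, a scalar limit along a further subsequence is
  \<open>ip M x' h\<close> for a second hull limit \<open>x'\<close>; the difference of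
  \<open>x\<close> and \<open>x'\<close> is orthogonal to all \<open>k m\<close>, hence to both hull
  limits and to itself, so both candidates give the same value.\<close>

theorem weak_sequential_compactness:
  fixes k :: "nat \<Rightarrow> 'a \<Rightarrow> 'b::{real_inner, banach, second_countable_topology}"
  assumes k: "\<And>n. k n \<in> square_integrable M" "\<And>n. ip M (k n) (k n) \<le> C"
  shows "\<exists>r x. strict_mono (r :: nat \<Rightarrow> nat) \<and> x \<in> square_integrable M \<and> ip M x x \<le> C \<and>
    (\<forall>h\<in>square_integrable M. (\<lambda>n. ip M (k (r n)) h) \<longlonglongrightarrow> ip M x h)"
proof -
  have C: "0 \<le> C" using k(2)[of 0] ip_self_nonneg[of M "k 0"] by simp
  have bounded: "\<bar>ip M (k n) h\<bar> \<le> (C + ip M h h) / 2" if h: "h \<in> square_integrable M" for n h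
  proof -
    have g: "ip M (k n) (\<lambda>s. (- 1) *\<^sub>R h s) = - ip M (k n) h"
      "ip M (\<lambda>s. (- 1) *\<^sub>R h s) (\<lambda>s. (- 1) *\<^sub>R h s) = ip M h h" by (simp_all add: ip_def)
    have "2 * ip M (k n) h \<le> C + ip M h h"
      using ip_self_nonneg[of M "\<lambda>s. k n s - h s"] k(2)[of n] unfolding ip_diff_self[OF k(1) h] by simp
    moreover have "- (2 * ip M (k n) h) \<le> C + ip M h h"
      using ip_self_nonneg[of M "\<lambda>s. k n s - (- 1) *\<^sub>R h s"] k(2)[of n]
      unfolding ip_diff_self[OF k(1) square_integrable_scaleR[OF h]] g by simp
    ultimately show ?thesis by (simp add: abs_le_iff)
  qed
  have sub: "\<exists>r. strict_mono (r :: nat \<Rightarrow> nat) \<and> convergent (\<lambda>n. ip M (k (s (r n))) h)"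
    if h: "h \<in> square_integrable M" for s :: "nat \<Rightarrow> nat" and h
  proof -
    have "Bseq (\<lambda>n. ip M (k (s n)) h)"
      by (rule BseqI'[where K = "(C + ip M h h) / 2"]) (simp only: real_norm_def bounded[OF h])
    then have "bounded (range (\<lambda>n. ip M (k (s n)) h))" by (simp add: Bseq_eq_bounded)
    then obtain l r where "strict_mono (r :: nat \<Rightarrow> nat)" "((\<lambda>n. ip M (k (s n)) h) \<circ> r) \<longlonglongrightarrow> l"
      using bounded_imp_convergent_subsequence by blast
    then show ?thesis by (auto simp: comp_def convergent_def)
  qed
  interpret subseqs "\<lambda>m s. convergent (\<lambda>n. ip M (k (s n)) (k m))"
    using sub[OF k(1)] by unfold_locales (auto simp: comp_def)
  define r where "r = diagseq"
  have r: "strict_mono r" unfolding r_def by (rule subseq_diagseq)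
  have conv: "convergent (\<lambda>n. ip M (k (r n)) (k m))" for m
  proof -
    have "convergent (\<lambda>n. ip M (k ((diagseq \<circ> ((+) (Suc m))) n)) (k m))"
    proof (rule diagseq_holds)
      fix r s :: "nat \<Rightarrow> nat" and m assume "strict_mono r" "convergent (\<lambda>n. ip M (k (s n)) (k m))"
      then show "convergent (\<lambda>n. ip M (k ((s \<circ> r) n)) (k m))"
        using convergent_subseq_convergent[of "\<lambda>n. ip M (k (s n)) (k m)" r] by (simp add: comp_def)
    qed
    then show ?thesis
      unfolding r_def using convergent_ignore_initial_segment[of "\<lambda>n. ip M (k (diagseq n)) (k m)" "Suc m"]
      by (simp add: comp_def add.commute)
  qed
  obtain x f where x: "x \<in> square_integrable M" and f: "\<And>N. f N \<in> dyadic_hull (\<lambda>n. k (r n)) N"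
    and lim: "(\<lambda>n. ip M (\<lambda>s. f n s - x s) (\<lambda>s. f n s - x s)) \<longlonglongrightarrow> 0"
    using hull_limit[of "\<lambda>n. k (r n)" C] k by blast
  have fs: "f N \<in> square_integrable M" for N
    by (rule dyadic_hull_square_integrable[OF k(1) f])
  \<comment> \<open>Expanding the square of \<open>f n - x\<close> bounds
    \<open>ip M (f n) x\<close> by \<open>(C + ip M x x) / 2\<close>, and the left side tends to
    \<open>ip M x x\<close>.\<close>
  have "ip M x x \<le> C"
  proof -
    have "ip M x x \<le> (C + ip M x x) / 2"
    proof (rule LIMSEQ_le_const2[OF ip_tendsto[OF fs x x lim]], intro exI allI impI)
      fix n
      have "0 \<le> ip M (\<lambda>s. f n s - x s) (\<lambda>s. f n s - x s)" by (rule ip_self_nonneg)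
      then show "ip M (f n) x \<le> (C + ip M x x) / 2"
        using dyadic_hull_energy_le[of "\<lambda>n. k (r n)" M C, OF k(1) k(2) f] unfolding ip_diff_self[OF fs x]
        by (simp add: field_simps) (metis add.commute add_left_mono order_trans)
    qed
    then show ?thesis by simp
  qed
  moreover have "(\<lambda>n. ip M (k (r n)) h) \<longlonglongrightarrow> ip M x h" if h: "h \<in> square_integrable M" for h
  proof (rule ccontr)
    assume "\<not> (\<lambda>n. ip M (k (r n)) h) \<longlonglongrightarrow> ip M x h"
    then obtain e where e: "0 < e" "\<And>N. \<exists>n\<ge>N. e \<le> \<bar>ip M (k (r n)) h - ip M x h\<bar>"
      unfolding LIMSEQ_iff by (force simp: not_less)
    then have "infinite {n. e \<le> \<bar>ip M (k (r n)) h - ip M x h\<bar>}"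
      unfolding infinite_nat_iff_unbounded_le by blast
    from infinite_enumerate[OF this] obtain p where p: "strict_mono (p :: nat \<Rightarrow> nat)"
      "\<And>n. e \<le> \<bar>ip M (k (r (p n))) h - ip M x h\<bar>" by auto
    obtain q where q: "strict_mono (q :: nat \<Rightarrow> nat)" "convergent (\<lambda>n. ip M (k ((r \<circ> p) (q n))) h)"
      using sub[OF h] by blast
    define z where "z n = k (r (p (q n)))" for n
    have z: "z n \<in> square_integrable M" "ip M (z n) (z n) \<le> C" for n using k by (simp_all add: z_def)
    obtain L where L: "(\<lambda>n. ip M (z n) h) \<longlonglongrightarrow> L"
      using q(2) by (auto simp: convergent_def z_def)
    obtain x' f' where x': "x' \<in> square_integrable M" and f': "\<And>N. f' N \<in> dyadic_hull z N"
      and lim': "(\<lambda>n. ip M (\<lambda>s. f' n s - x' s) (\<lambda>s. f' n s - x' s)) \<longlonglongrightarrow> 0"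
      using hull_limit[of z C] z by blast
    have f's: "f' N \<in> square_integrable M" for N
      by (rule dyadic_hull_square_integrable[OF z(1) f'])
    define D where "D s = x s - x' s" for s
    have Ds: "D \<in> square_integrable M" unfolding D_def by (rule square_integrable_diff[OF x x'])
    have "ip M D (k m) = 0" for m
    proof -
      obtain l where l: "(\<lambda>n. ip M (k (r n)) (k m)) \<longlonglongrightarrow> l" using conv by (auto simp: convergent_def)
      have "(\<lambda>n. ip M (z n) (k m)) \<longlonglongrightarrow> l"
        using LIMSEQ_subseq_LIMSEQ[OF l strict_mono_o[OF p(1) q(1)]] by (simp add: comp_def z_def)
      then have "ip M x' (k m) = l" by (rule hull_limit_ip[OF z(1) x' k(1) f' lim'])
      moreover have "ip M x (k m) = l" by (rule hull_limit_ip[OF k(1) x k(1) f lim l])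
      ultimately show ?thesis unfolding D_def by (simp add: ip_diff[OF x x' k(1)])
    qed
    then have k0: "\<bar>ip M (k m) D - 0\<bar> \<le> 0" for m by (simp add: ip_commute)
    have "ip M (f N) D = 0" for N
      using dyadic_hull_ip_near[of "\<lambda>n. k (r n)" M D N 0 0, OF k(1) Ds k0 f] by simp
    with ip_tendsto[OF fs x Ds lim] have 1: "ip M x D = 0" by (simp add: LIMSEQ_const_iff)
    have "ip M (f' N) D = 0" for N
      using dyadic_hull_ip_near[of z M D N 0 0, OF z(1) Ds _ f'] k0 by (simp add: z_def)
    with ip_tendsto[OF f's x' Ds lim'] have 2: "ip M x' D = 0" by (simp add: LIMSEQ_const_iff)
    have "ip M D D = 0" using 1 2 ip_diff[OF x x' Ds] by (simp add: D_def[abs_def])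
    then have "ip M D h = 0" using ip_Cauchy_Schwarz[OF Ds h] by simp
    then have "ip M x h = ip M x' h" unfolding D_def by (simp add: ip_diff[OF x x' h])
    also have "\<dots> = L" by (rule hull_limit_ip[OF z(1) x' h f' lim' L])
    finally have xL: "ip M x h = L" .
    have "(\<lambda>n. \<bar>ip M (z n) h - ip M x h\<bar>) \<longlonglongrightarrow> \<bar>L - L\<bar>"
      unfolding xL by (intro tendsto_intros L)
    then have "e \<le> \<bar>L - L\<bar>"
      by (rule LIMSEQ_le_const) (auto simp: z_def p(2))
    then show False using e(1) by simp
  qed
  ultimately show ?thesis using r x by blast
qed

end

section \<open>Measurability of path-valued maps\<close>

lemma dist_seq_eq:
  fixes x y :: "nat \<Rightarrow> real"
  shows "dist x y = (\<Sum>n. (1/2)^n * min \<bar>x (from_nat n) - y (from_nat n)\<bar> 1)"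
    and "summable (\<lambda>n. (1/2)^n * min \<bar>x (from_nat n) - y (from_nat n)\<bar> 1)"
  by (simp add: dist_fun_def dist_real_def)
     (rule summable_comparison_test'[of "\<lambda>n. (1/2)^n"], auto simp: summable_geometric_iff)

text \<open>The product metric is a weighted sum of differences truncated at 1, and truncation is
  subadditive, so coordinatewise bounds add up.\<close>

lemma dist_seq_le_sum:
  fixes x y :: "nat \<Rightarrow> real" and p q :: "'i \<Rightarrow> nat \<Rightarrow> real"
  assumes fin: "finite I" and le: "\<And>j. \<bar>x j - y j\<bar> \<le> (\<Sum>i\<in>I. \<bar>p i j - q i j\<bar>)"
  shows "dist x y \<le> (\<Sum>i\<in>I. dist (p i) (q i))"
proof -
  have min_sum: "min (\<Sum>i\<in>I. a i) 1 \<le> (\<Sum>i\<in>I. min (a i) 1)" if "\<And>i. 0 \<le> a i" for a :: "'i \<Rightarrow> real"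
    using fin
  proof (induction I)
    case (insert i I)
    have "0 \<le> sum a I" by (simp add: that sum_nonneg)
    then show ?case using insert that[of i] by (auto simp: min_def split: if_splits)
  qed simp
  have "dist x y \<le> (\<Sum>n. \<Sum>i\<in>I. (1/2)^n * min \<bar>p i (from_nat n) - q i (from_nat n)\<bar> 1)"
    unfolding dist_seq_eq(1)[of x y]
  proof (rule suminf_le)
    fix n
    have "min \<bar>x (from_nat n) - y (from_nat n)\<bar> 1 \<le> min (\<Sum>i\<in>I. \<bar>p i (from_nat n) - q i (from_nat n)\<bar>) 1"
      using le[of "from_nat n"] by (auto simp: min_def)
    also have "\<dots> \<le> (\<Sum>i\<in>I. min \<bar>p i (from_nat n) - q i (from_nat n)\<bar> 1)"
      by (rule min_sum) simp
    finally show "(1/2)^n * min \<bar>x (from_nat n) - y (from_nat n)\<bar> 1 \<le> (\<Sum>i\<in>I. (1/2)^n * min \<bar>p i (from_nat n) - q i (from_nat n)\<bar> 1)"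
      by (simp add: sum_distrib_left[symmetric] mult_left_mono)
  qed (intro summable_sum dist_seq_eq)+
  also have "\<dots> = (\<Sum>i\<in>I. dist (p i) (q i))"
    unfolding dist_seq_eq(1) by (rule suminf_sum) (rule dist_seq_eq)
  finally show ?thesis .
qed

definition grid :: "real \<Rightarrow> nat \<Rightarrow> nat \<Rightarrow> real" where
  "grid T K i = T * real i / 2 ^ K"

lemma grid_0[simp]: "grid T K 0 = 0" by (simp add: grid_def)

lemma grid_end[simp]: "grid T K (2 ^ K) = T" by (simp add: grid_def)

lemma grid_mono: "0 \<le> T \<Longrightarrow> i \<le> j \<Longrightarrow> grid T K i \<le> grid T K j"
  by (simp add: grid_def divide_right_mono mult_left_mono)

lemma grid_strict_mono: "0 < T \<Longrightarrow> i < j \<Longrightarrow> grid T K i < grid T K j"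
  by (simp add: grid_def divide_strict_right_mono)

lemma grid_Suc: "grid T K (Suc i) = grid T K i + T / 2 ^ K"
  by (simp add: grid_def field_simps)

lemma grid_in: "0 \<le> T \<Longrightarrow> i \<le> 2 ^ K \<Longrightarrow> grid T K i \<in> {0..T}"
  using grid_mono[of T 0 i K] grid_mono[of T i "2 ^ K" K] by simp

lemma grid_refine: "grid T (K + L) (i * 2 ^ L) = grid T K i"
  by (simp add: grid_def power_add)

definition tent :: "nat \<Rightarrow> real \<Rightarrow> real" where
  "tent i s = max 0 (1 - \<bar>s - real i\<bar>)"

lemma tent_bounds: "0 \<le> tent i s" "tent i s \<le> 1"
  by (auto simp: tent_def)

lemma tent_pos_iff:
  assumes "0 \<le> s" "0 < tent i s"
  shows "i = nat \<lfloor>s\<rfloor> \<or> i = Suc (nat \<lfloor>s\<rfloor>)"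
proof -
  have "\<bar>s - real i\<bar> < 1" using assms by (auto simp: tent_def)
  then have "int i = \<lfloor>s\<rfloor> \<or> int i = \<lfloor>s\<rfloor> + 1" using assms by linarith
  then show ?thesis using assms by linarith
qed

lemma sum_tent:
  assumes "0 \<le> s" "s \<le> real N"
  shows "(\<Sum>i\<le>N. tent i s) = 1"
proof -
  define k where "k = nat \<lfloor>s\<rfloor>"
  have k: "real k \<le> s" "s < real k + 1" using assms unfolding k_def by linarith+
  have z: "tent i s = 0" if "i \<noteq> k" "i \<noteq> Suc k" for i
    using tent_pos_iff[of s i] tent_bounds(1)[of i s] that assms unfolding k_def by force
  have kN: "k \<le> N" using k assms by linarith
  have "(\<Sum>i\<le>N. tent i s) = (\<Sum>i\<in>{..N} \<inter> {k, Suc k}. tent i s)"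
    by (rule sum.mono_neutral_right) (auto simp: z)
  also have "\<dots> = 1"
  proof (cases "k = N")
    case True
    then have "{..N} \<inter> {k, Suc k} = {k}" by auto
    moreover have "s = real k" using True k assms by linarith
    ultimately show ?thesis by (simp add: tent_def)
  next
    case False
    then have "{..N} \<inter> {k, Suc k} = {k, Suc k}" using kN by auto
    then show ?thesis using k by (simp add: tent_def)
  qed
  finally show ?thesis .
qed

text \<open>Piecewise linear interpolation of grid values, written with hat functions so that it is
  linear in \<open>v\<close> and depends on finitely many of its rows.\<close>

definition interp :: "real \<Rightarrow> nat \<Rightarrow> (nat \<Rightarrow> nat \<Rightarrow> real) \<Rightarrow> real \<Rightarrow> nat \<Rightarrow> real" where
  "interp T K v = (\<lambda>t\<in>{0..T}. \<lambda>j. \<Sum>i\<le>2 ^ K. tent i (t * 2 ^ K / T) * v i j)"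

lemma mspace_path_metric:
  "mspace (path_metric T) = {f. f \<in> extensional {0..T} \<and> continuous_on {0..T} f}"
proof -
  have "bounded (f ` {0..T})" if "continuous_on {0..T} f" for f :: "real \<Rightarrow> nat \<Rightarrow> real"
    using compact_continuous_image[OF that] compact_imp_bounded by blast
  then show ?thesis
    by (auto simp: path_metric_def)
qed

lemma mdist_path_le:
  assumes "0 \<le> B" "\<And>t. t \<in> {0..T} \<Longrightarrow> dist (f t) (g t) \<le> B"
  shows "mdist (path_metric T) f g \<le> B"
  unfolding path_metric_def by (rule mdist_cfunspace_le) (use assms in auto)

lemma continuous_seqI:
  fixes f :: "'a::topological_space \<Rightarrow> nat \<Rightarrow> real"
  assumes "\<And>j. continuous_on A (\<lambda>t. f t j)"
  shows "continuous_on A f"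
  using assms by (rule continuous_on_coordinatewise_then_product)

lemma interp_in_mspace:
  assumes "0 < T"
  shows "interp T K v \<in> mspace (path_metric T)"
proof -
  have "continuous_on {0..T} (\<lambda>t. \<lambda>j. \<Sum>i\<le>2 ^ K. tent i (t * 2 ^ K / T) * v i j)"
    using assms unfolding tent_def by (intro continuous_seqI continuous_intros) auto
  then have "continuous_on {0..T} (interp T K v)"
    unfolding interp_def by (rule continuous_on_eq) auto
  then show ?thesis by (simp add: mspace_path_metric interp_def)
qed

lemma mdist_interp_le:
  "mdist (path_metric T) (interp T K v) (interp T K v') \<le> (\<Sum>i\<le>2 ^ K. dist (v i) (v' i))"
proof (rule mdist_path_le)
  show "dist (interp T K v t) (interp T K v' t) \<le> (\<Sum>i\<le>2 ^ K. dist (v i) (v' i))" if "t \<in> {0..T}" for t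
  proof (rule dist_seq_le_sum)
    fix j
    have "\<bar>interp T K v t j - interp T K v' t j\<bar> = \<bar>\<Sum>i\<le>2 ^ K. tent i (t * 2 ^ K / T) * (v i j - v' i j)\<bar>"
      using that by (simp add: interp_def sum_subtractf[symmetric] algebra_simps)
    also have "\<dots> \<le> (\<Sum>i\<le>2 ^ K. \<bar>v i j - v' i j\<bar>)"
      by (rule order.trans[OF sum_abs], rule sum_mono)
         (simp add: abs_mult tent_bounds mult_left_le_one_le)
    finally show "\<bar>interp T K v t j - interp T K v' t j\<bar> \<le> (\<Sum>i\<le>2 ^ K. \<bar>v i j - v' i j\<bar>)" .
  qed simp
qed (simp add: sum_nonneg)

text \<open>At any \<open>t\<close> at most two hats are positive, and they sit at grid points
  within one mesh of \<open>t\<close>; by uniform continuity each contributes at most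
  \<open>r / 4\<close>.\<close>

lemma interp_tendsto:
  assumes T: "0 < T" and w: "w \<in> mspace (path_metric T)"
  shows "(\<lambda>K. mdist (path_metric T) (interp T K (\<lambda>i. w (grid T K i))) w) \<longlonglongrightarrow> 0"
proof (rule LIMSEQ_I)
  fix r :: real assume r: "0 < r"
  have "uniformly_continuous_on {0..T} w"
    using w by (intro compact_uniformly_continuous) (auto simp: mspace_path_metric)
  then obtain d where d: "0 < d" "\<And>s t. s \<in> {0..T} \<Longrightarrow> t \<in> {0..T} \<Longrightarrow> dist s t < d \<Longrightarrow> dist (w s) (w t) < r / 4"
    using r unfolding uniformly_continuous_on_def by (metis divide_pos_pos zero_less_numeral)
  have "(\<lambda>K. T * (1 / 2) ^ K) \<longlonglongrightarrow> T * 0"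
    by (intro tendsto_intros LIMSEQ_power_zero) simp
  then obtain N where N: "\<And>K. N \<le> K \<Longrightarrow> T * (1 / 2) ^ K < d"
    using order_tendstoD(2)[of _ 0 sequentially d] d(1) by (auto simp: eventually_sequentially)
  show "\<exists>N. \<forall>K\<ge>N. norm (mdist (path_metric T) (interp T K (\<lambda>i. w (grid T K i))) w - 0) < r"
  proof (intro exI allI impI)
    fix K assume K: "N \<le> K"
    have "mdist (path_metric T) (interp T K (\<lambda>i. w (grid T K i))) w \<le> r / 2"
    proof (rule mdist_path_le)
      fix t assume t: "t \<in> {0..T}"
      define s where "s = t * 2 ^ K / T"
      have s: "0 \<le> s" "s \<le> real (2 ^ K)" using t T by (auto simp: s_def divide_simps)
      define I where "I = {i. i \<le> 2 ^ K \<and> 0 < tent i s}"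
      have fin: "finite I" by (simp add: I_def)
      have "I \<subseteq> {nat \<lfloor>s\<rfloor>, Suc (nat \<lfloor>s\<rfloor>)}"
        using tent_pos_iff[OF s(1)] by (auto simp: I_def)
      then have "card I \<le> card {nat \<lfloor>s\<rfloor>, Suc (nat \<lfloor>s\<rfloor>)}"
        by (intro card_mono) auto
      then have card: "card I \<le> 2" by simp
      have "dist (interp T K (\<lambda>i. w (grid T K i)) t) (w t) \<le> (\<Sum>i\<in>I. dist (w (grid T K i)) (w t))"
      proof (rule dist_seq_le_sum[OF fin])
        fix j
        have "interp T K (\<lambda>i. w (grid T K i)) t j - w t j
          = (\<Sum>i\<le>2 ^ K. tent i s * w (grid T K i) j) - (\<Sum>i\<le>2 ^ K. tent i s) * w t j"
          using t sum_tent[OF s] by (simp add: interp_def s_def)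
        also have "\<dots> = (\<Sum>i\<le>2 ^ K. tent i s * (w (grid T K i) j - w t j))"
          by (simp add: sum_distrib_right sum_subtractf right_diff_distrib)
        also have "\<dots> = (\<Sum>i\<in>I. tent i s * (w (grid T K i) j - w t j))"
          using tent_bounds(1)[of _ s] by (intro sum.mono_neutral_right) (auto simp: I_def less_le)
        also have "\<bar>\<dots>\<bar> \<le> (\<Sum>i\<in>I. \<bar>w (grid T K i) j - w t j\<bar>)"
          by (rule order.trans[OF sum_abs], rule sum_mono)
             (simp add: abs_mult tent_bounds mult_left_le_one_le)
        finally show "\<bar>interp T K (\<lambda>i. w (grid T K i)) t j - w t j\<bar> \<le> (\<Sum>i\<in>I. \<bar>w (grid T K i) j - w t j\<bar>)" .
      qed
      also have "\<dots> \<le> (\<Sum>i\<in>I. r / 4)"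
      proof (rule sum_mono)
        fix i assume i: "i \<in> I"
        have "\<bar>s - real i\<bar> < 1" using i by (auto simp: I_def tent_def)
        moreover have "t - grid T K i = (s - real i) * (T / 2 ^ K)"
          using T by (simp add: s_def grid_def field_simps)
        ultimately have "\<bar>t - grid T K i\<bar> < 1 * (T / 2 ^ K)"
          using T mult_strict_right_mono[of "\<bar>s - real i\<bar>" 1 "T / 2 ^ K"] by (simp add: abs_mult)
        also have "\<dots> < d" using N[OF K] by (simp add: power_one_over)
        finally have "dist (grid T K i) t < d" by (simp add: dist_real_def abs_minus_commute)
        then show "dist (w (grid T K i)) (w t) \<le> r / 4"
          using d(2)[of "grid T K i" t] t i grid_in[of T i K] T by (auto simp: I_def intro: less_imp_le)
      qed
      also have "\<dots> \<le> r / 2" using card r by (simp add: field_simps)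
      finally show "dist (interp T K (\<lambda>i. w (grid T K i)) t) (w t) \<le> r / 2" .
    qed (use r in simp)
    then show "norm (mdist (path_metric T) (interp T K (\<lambda>i. w (grid T K i))) w - 0) < r"
      using r by simp
  qed
qed

text \<open>Membership in an open \<open>U\<close> is positivity of the distance \<open>g\<close> to
  its complement. \<open>g\<close> is 1-Lipschitz, so at an interpolated path it is a continuous
  function of finitely many evaluations, and interpolation converges to the path. Evaluations at
  dyadic times thus decide measurability for the whole Borel sigma-algebra of uniform
  convergence.\<close>

lemma measurable_path_space:
  assumes T: "0 < T" and X: "X \<in> space N \<rightarrow> mspace (path_metric T)"
    and ev: "\<And>K i j. i \<le> 2 ^ K \<Longrightarrow> (\<lambda>\<omega>. X \<omega> (grid T K i) j) \<in> borel_measurable N"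
  shows "X \<in> N \<rightarrow>\<^sub>M path_space T"
  unfolding path_space_def
proof (rule measurable_measure_of[OF _ X])
  show "{U. openin (mtopology_of (path_metric T)) U} \<subseteq> Pow (mspace (path_metric T))"
    using openin_subset by fastforce
  fix U assume "U \<in> {U. openin (mtopology_of (path_metric T)) U}"
  then have U: "openin (mtopology_of (path_metric T)) U" by simp
  let ?S = "mspace (path_metric T)" and ?d = "mdist (path_metric T)"
  interpret D: Metric_space ?S ?d by (rule Metric_space_mspace_mdist)
  have US: "U \<subseteq> ?S" and ball: "\<And>x. x \<in> U \<Longrightarrow> \<exists>r>0. D.mball x r \<subseteq> U"
    using U by (auto simp: mtopology_of_def D.openin_mtopology)
  show "X -` U \<inter> space N \<in> sets N"
  \<comment> \<open>The whole space is treated apart because the infimum defining \<open>g\<close>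
    would then range over the empty set.\<close>
  proof (cases "U = ?S")
    case True
    then have "X -` U \<inter> space N = space N" using X by auto
    then show ?thesis by simp
  next
    case False
    define g where "g w = (INF x\<in>?S - U. ?d w x)" for w
    have ne: "?S - U \<noteq> {}" using False US by auto
    have bdd: "bdd_below (?d w ` (?S - U))" for w by (rule bdd_belowI[of _ 0]) auto
    have g_lip: "\<bar>g w - g w'\<bar> \<le> ?d w w'" if "w \<in> ?S" "w' \<in> ?S" for w w'
    proof -
      have "g w \<le> g w' + ?d w w'" if "w \<in> ?S" "w' \<in> ?S" for w w'
      proof -
        have "g w - ?d w w' \<le> g w'"
          unfolding g_def[of w']
        proof (rule cINF_greatest[OF ne])
          fix x assume x: "x \<in> ?S - U"
          have "g w \<le> ?d w x" unfolding g_def by (rule cINF_lower[OF bdd x])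
          also have "\<dots> \<le> ?d w w' + ?d w' x" using x that by (intro D.triangle) auto
          finally show "g w - ?d w w' \<le> ?d w' x" by simp
        qed
        then show ?thesis by simp
      qed
      from this[OF that] this[OF that(2,1)] show ?thesis by (simp add: D.commute)
    qed
    have g_pos: "w \<in> U \<longleftrightarrow> 0 < g w" if w: "w \<in> ?S" for w
    proof
      assume "w \<in> U"
      then obtain r where r: "0 < r" "D.mball w r \<subseteq> U" using ball by blast
      have "r \<le> g w"
        unfolding g_def
      proof (rule cINF_greatest[OF ne])
        fix x assume "x \<in> ?S - U"
        then have "x \<notin> D.mball w r" using r by auto
        then show "r \<le> ?d w x" using w \<open>x \<in> ?S - U\<close> by (auto simp: D.in_mball)
      qed
      then show "0 < g w" using r by simp
    next
      assume "0 < g w"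
      show "w \<in> U"
      proof (rule ccontr)
        assume "w \<notin> U"
        then have "g w \<le> ?d w w" unfolding g_def using w by (intro cINF_lower[OF bdd]) auto
        then show False using \<open>0 < g w\<close> w by simp
      qed
    qed
    have approx: "(\<lambda>\<omega>. g (interp T K (\<lambda>i. X \<omega> (grid T K i)))) \<in> borel_measurable N" for K
    proof -
      have "continuous_on UNIV (\<lambda>v. g (interp T K v))"
        unfolding continuous_on_eq_continuous_at[OF open_UNIV]
      proof
        fix v :: "nat \<Rightarrow> nat \<Rightarrow> real"
        have c: "isCont (\<lambda>v'. v' i) v" for i
        proof -
          have "continuous_on UNIV (\<lambda>v' :: nat \<Rightarrow> nat \<Rightarrow> real. v' i)"
            by (rule continuous_on_product_coordinates)
          then show ?thesis unfolding continuous_on_eq_continuous_at[OF open_UNIV] by blast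
        qed
        have "((\<lambda>v'. \<Sum>i\<le>2 ^ K. dist (v' i) (v i)) \<longlongrightarrow> (\<Sum>i\<le>2 ^ K. dist (v i) (v i))) (at v)"
          by (intro tendsto_intros c[unfolded isCont_def])
        then have lim: "((\<lambda>v'. \<Sum>i\<le>2 ^ K. dist (v' i) (v i)) \<longlongrightarrow> 0) (at v)" by simp
        have "((\<lambda>v'. g (interp T K v') - g (interp T K v)) \<longlongrightarrow> 0) (at v)"
        proof (rule Lim_null_comparison[OF always_eventually lim], intro allI)
          fix v'
          show "norm (g (interp T K v') - g (interp T K v)) \<le> (\<Sum>i\<le>2 ^ K. dist (v' i) (v i))"
            using g_lip[OF interp_in_mspace[OF T, of K v'] interp_in_mspace[OF T, of K v]] mdist_interp_le[of T K v' v]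
            by simp
        qed
        then show "isCont (\<lambda>v. g (interp T K v)) v"
          unfolding isCont_def by (rule LIM_zero_cancel)
      qed
      then have 1: "(\<lambda>v. g (interp T K v)) \<in> borel_measurable borel"
        by (rule borel_measurable_continuous_onI)
      \<comment> \<open>Entries beyond index \<open>2 ^ K\<close> are set to 0: they do not affect
        \<open>interp\<close>, and measurability of evaluations is known only up to the last grid
        point.\<close>
      have 2: "(\<lambda>\<omega>. \<lambda>i j. if i \<le> 2 ^ K then X \<omega> (grid T K i) j else 0) \<in> borel_measurable N"
      proof (intro measurable_coordinatewise_then_product)
        show "(\<lambda>\<omega>. if i \<le> 2 ^ K then X \<omega> (grid T K i) j else 0) \<in> borel_measurable N" for i j
          by (cases "i \<le> 2 ^ K") (simp_all add: ev)
      qed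
      have "interp T K (\<lambda>i. X \<omega> (grid T K i)) = interp T K (\<lambda>i j. if i \<le> 2 ^ K then X \<omega> (grid T K i) j else 0)" for \<omega>
        by (auto simp: interp_def fun_eq_iff intro!: sum.cong)
      then show ?thesis using measurable_compose[OF 2 1] by simp
    qed
    have lim: "(\<lambda>K. g (interp T K (\<lambda>i. X \<omega> (grid T K i)))) \<longlonglongrightarrow> g (X \<omega>)" if "\<omega> \<in> space N" for \<omega>
    proof -
      have w: "X \<omega> \<in> ?S" using X that by auto
      have "(\<lambda>K. g (interp T K (\<lambda>i. X \<omega> (grid T K i))) - g (X \<omega>)) \<longlonglongrightarrow> 0"
        by (rule Lim_null_comparison[OF always_eventually interp_tendsto[OF T w]])
           (use g_lip[OF interp_in_mspace[OF T] w] in auto)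
      then show ?thesis by (rule LIM_zero_cancel)
    qed
    have [measurable]: "(\<lambda>\<omega>. g (X \<omega>)) \<in> borel_measurable N"
      by (rule borel_measurable_LIMSEQ_real[OF lim approx])
    have "X -` U \<inter> space N = {\<omega>\<in>space N. 0 < g (X \<omega>)}"
      using X g_pos by auto
    then show ?thesis by simp
  qed
qed

lemma space_path_space: "space (path_space T) = mspace (path_metric T)"
  unfolding path_space_def by (rule space_measure_of) (use openin_subset in fastforce)

lemma open_in_path_space: "openin (mtopology_of (path_metric T)) U \<Longrightarrow> U \<in> sets (path_space T)"
  unfolding path_space_def
  by (subst sets_measure_of) (use openin_subset in \<open>fastforce intro: sigma_sets.Basic\<close>)+

lemma measurable_eval[measurable]:
  assumes "t \<in> {0..T}"
  shows "(\<lambda>w. w t j) \<in> borel_measurable (path_space T)"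
proof (rule borel_measurableI)
  fix S :: "real set" assume S: "open S"
  let ?S = "mspace (path_metric T)" and ?d = "mdist (path_metric T)"
  interpret D: Metric_space ?S ?d by (rule Metric_space_mspace_mdist)
  let ?A = "(\<lambda>w. w t j) -` S \<inter> ?S"
  have "openin (mtopology_of (path_metric T)) ?A"
    unfolding mtopology_of_def D.openin_mtopology
  proof (intro conjI allI impI)
    fix w assume w: "w \<in> ?A"
    have "continuous_on UNIV (\<lambda>x :: nat \<Rightarrow> real. x j)" by (rule continuous_on_product_coordinates)
    then have "open ((\<lambda>x :: nat \<Rightarrow> real. x j) -` S)"
      using S by (rule open_vimage[rotated])
    then obtain e where e: "0 < e" "ball (w t) e \<subseteq> (\<lambda>x. x j) -` S"
      using w by (metis (no_types, lifting) IntD1 open_contains_ball vimageE vimageI2)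
    have "D.mball w e \<subseteq> ?A"
    proof
      fix w' assume w': "w' \<in> D.mball w e"
      then have "w \<in> ?S" "w' \<in> ?S" "?d w w' < e" by (simp_all add: D.in_mball)
      then have "dist (w t) (w' t) < e"
        using cfunspace_mdist_lt[of "top_of_set {0..T}" w euclidean_metric w' e t] assms
        unfolding path_metric_def by simp
      then show "w' \<in> ?A" using w' e by (auto simp: subset_eq)
    qed
    then show "\<exists>r>0. D.mball w r \<subseteq> ?A" using e by blast
  qed auto
  then show "(\<lambda>w. w t j) -` S \<inter> space (path_space T) \<in> sets (path_space T)"
    unfolding space_path_space by (rule open_in_path_space)
qed

definition eval_events :: "real \<Rightarrow> (real \<Rightarrow> nat \<Rightarrow> real) set set" where
  "eval_events T = {{w \<in> mspace (path_metric T). w (grid T K i) j \<le> x} | K i j x. i \<le> 2 ^ K}"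

text \<open>The nontrivial inclusion is measurability of the identity map into
  \<open>path_space T\<close>, tested on dyadic evaluations.\<close>

lemma sets_path_space_eq:
  assumes "0 < T"
  shows "sets (path_space T) = sigma_sets (mspace (path_metric T)) (eval_events T)"
proof
  have sub: "eval_events T \<subseteq> Pow (mspace (path_metric T))" by (auto simp: eval_events_def)
  let ?N = "sigma (mspace (path_metric T)) (eval_events T)"
  have sp: "space ?N = mspace (path_metric T)" and st: "sets ?N = sigma_sets (mspace (path_metric T)) (eval_events T)"
    using sub by (simp_all add: space_measure_of sets_measure_of)
  have "(\<lambda>w. w) \<in> ?N \<rightarrow>\<^sub>M path_space T"
  proof (rule measurable_path_space[OF assms])
    fix K i j :: nat assume "i \<le> 2 ^ K"
    then show "(\<lambda>w. w (grid T K i) j) \<in> borel_measurable ?N"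
      unfolding borel_measurable_iff_le sp st
    proof (intro allI sigma_sets.Basic)
      fix a show "{w \<in> mspace (path_metric T). w (grid T K i) j \<le> a} \<in> eval_events T"
        unfolding eval_events_def using \<open>i \<le> 2 ^ K\<close> by blast
    qed
  qed (simp add: sp)
  then show "sets (path_space T) \<subseteq> sigma_sets (mspace (path_metric T)) (eval_events T)"
    using measurable_sets[of "\<lambda>w. w" ?N "path_space T"] sets.sets_into_space[of _ "path_space T"]
    by (fastforce simp: sp st space_path_space Int_absorb2)
  show "sigma_sets (mspace (path_metric T)) (eval_events T) \<subseteq> sets (path_space T)"
    unfolding space_path_space[symmetric]
  proof (rule sets.sigma_sets_subset, safe)
    fix E assume "E \<in> eval_events T"
    then obtain K i j x where "i \<le> 2 ^ K" and E: "E = {w \<in> mspace (path_metric T). w (grid T K i) j \<le> x}"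
      by (auto simp: eval_events_def)
    then have "grid T K i \<in> {0..T}" using assms by (intro grid_in) auto
    then have "(\<lambda>w. w (grid T K i) j) \<in> borel_measurable (path_space T)" by (rule measurable_eval)
    then show "E \<in> sets (path_space T)"
      unfolding E space_path_space[symmetric] by measurable
  qed
qed

section \<open>Dyadic step functions\<close>

definition l2_unit :: "nat \<Rightarrow> l2" where
  "l2_unit j = Abs_l2 (\<lambda>i. if i = j then 1 else 0)"

lemma l2_seq_unit: "l2_seq (l2_unit j) i = (if i = j then 1 else 0)"
proof -
  have "summable (\<lambda>i. (if i = j then 1 else 0 :: real)\<^sup>2)"
    by (rule summable_finite[of "{j}"]) auto
  then show ?thesis unfolding l2_unit_def by (subst Abs_l2_inverse) auto
qed

lemma inner_l2_unit: "inner x (l2_unit j) = l2_seq x j"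
proof -
  have "(\<Sum>i. l2_seq x i * l2_seq (l2_unit j) i) = (\<Sum>i\<in>{j}. l2_seq x i * l2_seq (l2_unit j) i)"
    by (rule suminf_finite) (auto simp: l2_seq_unit)
  then show ?thesis by (simp add: inner_l2_def l2_seq_unit)
qed

lemma inner_l2_units: "inner (l2_unit i) (l2_unit j) = (if i = j then 1 else 0)"
  by (simp add: inner_l2_unit l2_seq_unit)

text \<open>Turns set integrals over \<open>{0..T}\<close> into integrals for a finite measure, the
  setting of the compactness theorem.\<close>

abbreviation horizon :: "real \<Rightarrow> real measure" where
  "horizon T \<equiv> restrict_space lborel {0..T}"

lemma finite_measure_horizon: "finite_measure (horizon T)"
  by (rule finite_measureI) (auto simp: space_restrict_space emeasure_restrict_space emeasure_lborel_Icc_eq)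

lemma L2_space_eq: "L2_space T = square_integrable (horizon T)"
  by (auto simp: L2_space_def square_integrable_def set_borel_measurable_def set_integrable_def
      borel_measurable_restrict_space_iff integrable_restrict_space)

lemma L2_inner_eq: "L2_inner T k h = ip (horizon T) k h"
  by (simp add: L2_inner_def ip_def set_lebesgue_integral_def integral_restrict_space)

lemma L2_energy_eq: "L2_energy T k = ip (horizon T) k k"
  by (simp add: L2_energy_def ip_self set_lebesgue_integral_def integral_restrict_space)

lemma L2_ball_eq: "L2_ball T N = {k \<in> square_integrable (horizon T). ip (horizon T) k k \<le> N}"
  by (simp add: L2_ball_def L2_space_eq L2_energy_eq)

lemma L2_ball_weakly_compact:
  assumes "\<And>n. k n \<in> L2_ball T N"
  shows "\<exists>r x. strict_mono (r :: nat \<Rightarrow> nat) \<and> x \<in> L2_ball T N \<and> L2_weak_tendsto T (\<lambda>n. k (r n)) x sequentially"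
  using finite_measure.weak_sequential_compactness[OF finite_measure_horizon, of k T N] assms
  by (auto simp: L2_ball_eq L2_weak_tendsto_def L2_inner_eq L2_space_eq)

text \<open>The element of \<open>K\<close> that represents the \<open>j\<close>-th component of the
  primitive at time \<open>t\<close>; weak convergence therefore implies pointwise convergence of
  primitives.\<close>

definition window :: "real \<Rightarrow> nat \<Rightarrow> real \<Rightarrow> l2" where
  "window t j s = indicator {0..t} s *\<^sub>R l2_unit j"

lemma square_integrable_indicator:
  assumes "A \<in> sets borel"
  shows "(\<lambda>s. indicator A s *\<^sub>R (c :: l2)) \<in> square_integrable (horizon T)"
proof -
  interpret finite_measure "horizon T" by (rule finite_measure_horizon)
  have [measurable]: "A \<in> sets borel" by (rule assms)
  have m: "(\<lambda>s. indicator A s *\<^sub>R c) \<in> borel_measurable (horizon T)"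
    by (rule measurable_restrict_space1) measurable
  moreover have "integrable (horizon T) (\<lambda>s. (norm (indicator A s *\<^sub>R c))\<^sup>2)"
  proof (rule integrable_const_bound[where B = "(norm c)\<^sup>2"])
    show "AE s in horizon T. norm ((norm (indicator A s *\<^sub>R c))\<^sup>2) \<le> (norm c)\<^sup>2"
      by (auto simp: indicator_def)
    show "(\<lambda>s. (norm (indicator A s *\<^sub>R c))\<^sup>2) \<in> borel_measurable (horizon T)"
      by (intro borel_measurable_power measurable_compose[OF m borel_measurable_norm])
  qed
  ultimately show ?thesis by (simp add: square_integrable_def)
qed

lemma window_L2: "window t j \<in> square_integrable (horizon T)"
  unfolding window_def[abs_def] by (rule square_integrable_indicator) simp

lemma primitive_eq_ip:
  assumes k: "k \<in> L2_space T" and t: "t \<in> {0..T}"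
  shows "primitive T k t j = ip (horizon T) k (window t j)"
proof -
  interpret finite_measure "horizon T" by (rule finite_measure_horizon)
  have "integrable (horizon T) k" using k square_integrable_integrable(1) by (simp add: L2_space_eq)
  then have "set_integrable lborel {0..T} k" by (simp add: set_integrable_def integrable_restrict_space)
  then have int: "set_integrable lborel {0..t} k" by (rule set_integrable_subset) (use t in auto)
  have "primitive T k t j = inner (LINT s:{0..t}|lborel. k s) (l2_unit j)"
    using t by (simp add: primitive_def inner_l2_unit)
  also have "\<dots> = (LINT s|lborel. inner (indicator {0..t} s *\<^sub>R k s) (l2_unit j))"
    unfolding set_lebesgue_integral_def
    by (rule integral_inner_left[symmetric]) (rule int[unfolded set_integrable_def])
  also have "\<dots> = (LINT s|lborel. indicator {0..T} s *\<^sub>R inner (k s) (window t j s))"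
    using t by (intro Bochner_Integration.integral_cong refl) (auto simp: window_def indicator_def)
  also have "\<dots> = ip (horizon T) k (window t j)"
    by (simp add: ip_def integral_restrict_space)
  finally show ?thesis .
qed

text \<open>The window at \<open>t\<close> differs from that at its left grid neighbour by at most
  the mesh in squared norm, so by Cauchy-Schwarz the dyadic values determine the primitive.\<close>

lemma primitive_cong_grid:
  assumes T: "0 < T" and k: "k \<in> L2_space T" "k' \<in> L2_space T"
    and eq: "\<And>K i j. i \<le> 2 ^ K \<Longrightarrow> primitive T k (grid T K i) j = primitive T k' (grid T K i) j"
  shows "primitive T k = primitive T k'"
proof (intro ext)
  fix t j
  let ?N = "horizon T"
  note k' = k[unfolded L2_space_eq]
  show "primitive T k t j = primitive T k' t j"
  proof (cases "t \<in> {0..T}")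
    case t: True
    define D where "D s = k s - k' s" for s
    have D: "D \<in> square_integrable ?N" unfolding D_def using k' by (rule square_integrable_diff)
    have prim: "ip ?N D (window t j) = primitive T k t j - primitive T k' t j" if "t \<in> {0..T}" for t
      unfolding D_def using k k' that by (simp add: ip_diff window_L2 primitive_eq_ip)
    have near: "(ip ?N D (window t j))\<^sup>2 \<le> ip ?N D D * (T / 2 ^ K)" for K
    proof -
      define i where "i = nat \<lfloor>t * 2 ^ K / T\<rfloor>"
      have s0: "0 \<le> t * 2 ^ K / T" using t T by simp
      then have i: "real i \<le> t * 2 ^ K / T" "t * 2 ^ K / T < real i + 1" unfolding i_def by linarith+
      then have g: "grid T K i \<le> t" "t < grid T K i + T / 2 ^ K" using T by (simp_all add: grid_def field_simps)
      have iK: "i \<le> 2 ^ K"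
      proof -
        have "t * 2 ^ K / T \<le> 2 ^ K" using t T by (simp add: divide_simps)
        then have "real i \<le> 2 ^ K" using i(1) by linarith
        then show ?thesis by (metis of_nat_le_iff of_nat_numeral of_nat_power)
      qed
      have gT: "grid T K i \<in> {0..T}" using T iK by (intro grid_in) auto
      let ?w = "\<lambda>s. window t j s - window (grid T K i) j s"
      have w: "?w \<in> square_integrable ?N" by (intro square_integrable_diff window_L2)
      have "ip ?N D ?w = ip ?N D (window t j) - ip ?N D (window (grid T K i) j)"
        using ip_diff[OF window_L2 window_L2 D, of t j "grid T K i" j] by (simp add: ip_commute)
      also have "ip ?N D (window (grid T K i) j) = 0"
        unfolding prim[OF gT] by (simp add: eq[OF iK])
      finally have "(ip ?N D (window t j))\<^sup>2 = (ip ?N D ?w)\<^sup>2" by simp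
      also have "\<dots> \<le> ip ?N D D * ip ?N ?w ?w" by (rule ip_Cauchy_Schwarz[OF D w])
      also have "ip ?N ?w ?w \<le> T / 2 ^ K"
      proof -
        have "ip ?N ?w ?w = (\<integral>s. indicator {grid T K i<..t} s \<partial>?N)"
          unfolding ip_def using g(1) gT
          by (intro Bochner_Integration.integral_cong refl)
             (auto simp: window_def indicator_def inner_l2_units)
        also have "\<dots> = measure ?N {grid T K i<..t}"
          using gT t by (simp add: space_restrict_space measure_restrict_space Int_absorb2 subset_eq)
        also have "\<dots> = t - grid T K i"
          using g(1) gT t by (subst measure_restrict_space) (auto simp: subset_eq)
        finally show ?thesis using g(2) by simp
      qed
      finally show ?thesis using ip_self_nonneg[of ?N D] by (simp add: mult_left_mono)
    qed
    have "(\<lambda>K. ip ?N D D * (T * (1 / 2) ^ K)) \<longlonglongrightarrow> ip ?N D D * (T * 0)"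
      by (intro tendsto_intros LIMSEQ_power_zero) simp
    then have "(\<lambda>K. ip ?N D D * (T / 2 ^ K)) \<longlonglongrightarrow> 0" by (simp add: power_one_over)
    then have "(ip ?N D (window t j))\<^sup>2 \<le> 0"
      by (rule LIMSEQ_le_const) (use near in blast)
    then show ?thesis using prim[OF t] by simp
  next
    case False
    then show ?thesis by (simp add: primitive_def restrict_def del: atLeastAtMost_iff)
  qed
qed

text \<open>Open on the left, to match the rectangles that generate the predictable
  sigma-algebra.\<close>

definition block :: "real \<Rightarrow> nat \<Rightarrow> nat \<Rightarrow> real set" where
  "block T K a = {grid T K a<..grid T K (Suc a)}"

definition block_unit :: "real \<Rightarrow> nat \<Rightarrow> nat \<times> nat \<Rightarrow> real \<Rightarrow> l2" where
  "block_unit T K q s = indicator (block T K (fst q)) s *\<^sub>R l2_unit (snd q)"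

definition step :: "real \<Rightarrow> nat \<Rightarrow> nat \<Rightarrow> (nat \<times> nat \<Rightarrow> real) \<Rightarrow> real \<Rightarrow> l2" where
  "step T K n \<kappa> s = (\<Sum>q\<in>{..<2 ^ K} \<times> {..<n}. \<kappa> q *\<^sub>R block_unit T K q s)"

lemma block_unit_L2: "block_unit T K q \<in> square_integrable (horizon T)"
  unfolding block_unit_def[abs_def] by (rule square_integrable_indicator) (simp add: block_def)

lemma square_integrable_zero: "(\<lambda>s. 0) \<in> square_integrable N"
  by (simp add: square_integrable_def)

lemma square_integrable_sum:
  assumes "\<And>q. u q \<in> square_integrable N"
  shows "(\<lambda>s. \<Sum>q\<in>Q. c q *\<^sub>R u q s) \<in> square_integrable N"
proof (cases "finite Q")
  case True
  then show ?thesis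
  proof induction
    case (insert q Q)
    then show ?case
      using square_integrable_add[OF square_integrable_scaleR[OF assms[of q], of "c q"] insert.IH] by simp
  qed (simp add: square_integrable_zero)
qed (simp add: square_integrable_zero)

lemma ip_sum:
  assumes u: "\<And>q. u q \<in> square_integrable N" and h: "h \<in> square_integrable N" and Q: "finite Q"
  shows "ip N (\<lambda>s. \<Sum>q\<in>Q. c q *\<^sub>R u q s) h = (\<Sum>q\<in>Q. c q * ip N (u q) h)"
  using Q
proof induction
  case (insert q Q)
  then show ?case
    using ip_add[OF square_integrable_scaleR[OF u[of q], of "c q"] square_integrable_sum[of u N c Q, OF u] h]
    by (simp add: ip_scaleR)
qed (simp add: ip_def)

lemma step_L2: "step T K n \<kappa> \<in> square_integrable (horizon T)"
  unfolding step_def[abs_def] by (intro square_integrable_sum block_unit_L2)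

lemma ip_step:
  assumes "h \<in> square_integrable (horizon T)"
  shows "ip (horizon T) (step T K n \<kappa>) h = (\<Sum>q\<in>{..<2 ^ K} \<times> {..<n}. \<kappa> q * ip (horizon T) (block_unit T K q) h)"
  unfolding step_def[abs_def] by (intro ip_sum block_unit_L2 assms) simp

lemma block_disjoint: "0 < T \<Longrightarrow> a \<noteq> b \<Longrightarrow> block T K a \<inter> block T K b = {}"
proof -
  assume T: "0 < T" and "a \<noteq> b"
  have "block T K a \<inter> block T K b = {}" if "a < b" for a b
  proof -
    have "grid T K (Suc a) \<le> grid T K b" using that T by (intro grid_mono) auto
    then show ?thesis by (auto simp: block_def)
  qed
  then show "block T K a \<inter> block T K b = {}" using \<open>a \<noteq> b\<close> by (metis inf_commute nat_neq_iff)
qed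

lemma block_subset: "0 < T \<Longrightarrow> a < 2 ^ K \<Longrightarrow> block T K a \<subseteq> {0..T}"
  using grid_in[of T a K] grid_in[of T "Suc a" K] by (auto simp: block_def)

lemma measure_horizon: "A \<in> sets borel \<Longrightarrow> A \<subseteq> {0..T} \<Longrightarrow> measure (horizon T) A = measure lborel A"
  by (rule measure_restrict_space) auto

lemma ip_block_units:
  assumes T: "0 < T" and q: "fst q < 2 ^ K"
  shows "ip (horizon T) (block_unit T K q) (block_unit T K q') = (if q = q' then T / 2 ^ K else 0)"
proof (cases "q = q'")
  case True
  have "ip (horizon T) (block_unit T K q) (block_unit T K q) = (\<integral>s. indicator (block T K (fst q)) s \<partial>horizon T)"
    unfolding ip_def by (intro Bochner_Integration.integral_cong refl) (auto simp: block_unit_def indicator_def inner_l2_units)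
  also have "\<dots> = measure (horizon T) (block T K (fst q))"
    using block_subset[OF T q] by (simp add: space_restrict_space Int_absorb2)
  also have "\<dots> = measure lborel (block T K (fst q))"
    using block_subset[OF T q] by (intro measure_horizon) (auto simp: block_def)
  also have "\<dots> = T / 2 ^ K"
    using T by (simp add: block_def grid_Suc)
  finally show ?thesis using True by simp
next
  case False
  have "inner (block_unit T K q s) (block_unit T K q' s) = 0" for s
  proof (cases "fst q = fst q'")
    case True
    then have "snd q \<noteq> snd q'" using False by (auto simp: prod_eq_iff)
    then show ?thesis by (simp add: block_unit_def inner_l2_units)
  next
    case False
    then show ?thesis using block_disjoint[OF T False, of K] by (auto simp: block_unit_def indicator_def)
  qed
  then show ?thesis using False by (simp add: ip_def)
qed

lemma energy_step:
  assumes T: "0 < T"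
  shows "L2_energy T (step T K n \<kappa>) = T / 2 ^ K * (\<Sum>q\<in>{..<2 ^ K} \<times> {..<n}. (\<kappa> q)\<^sup>2)"
proof -
  let ?Q = "{..<2 ^ K} \<times> {..<n} :: (nat \<times> nat) set"
  have "ip (horizon T) (block_unit T K q) (step T K n \<kappa>) = T / 2 ^ K * \<kappa> q" if q: "q \<in> ?Q" for q
  proof -
    have "ip (horizon T) (block_unit T K q) (step T K n \<kappa>) = (\<Sum>q'\<in>?Q. \<kappa> q' * ip (horizon T) (block_unit T K q') (block_unit T K q))"
      by (subst ip_commute) (rule ip_step[OF block_unit_L2])
    also have "\<dots> = (\<Sum>q'\<in>?Q. if q' = q then \<kappa> q' * (T / 2 ^ K) else 0)"
      by (intro sum.cong refl) (auto simp: ip_block_units[OF T])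
    also have "\<dots> = T / 2 ^ K * \<kappa> q" using q by (simp add: sum.delta)
    finally show ?thesis .
  qed
  then have "ip (horizon T) (step T K n \<kappa>) (step T K n \<kappa>) = (\<Sum>q\<in>?Q. \<kappa> q * (T / 2 ^ K * \<kappa> q))"
    unfolding ip_step[OF step_L2] by (intro sum.cong) auto
  then show ?thesis
    by (simp add: L2_energy_eq sum_distrib_left power2_eq_square ac_simps)
qed

text \<open>The length of the part of block \<open>a\<close> that lies before time \<open>t\<close>,
  for \<open>t \<ge> 0\<close>.\<close>

definition overlap :: "real \<Rightarrow> nat \<Rightarrow> real \<Rightarrow> nat \<Rightarrow> real" where
  "overlap T K t a = max 0 (min t (grid T K (Suc a)) - grid T K a)"

lemma primitive_step:
  assumes T: "0 < T" and t: "t \<in> {0..T}"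
  shows "primitive T (step T K n \<kappa>) t j = (if j < n then \<Sum>a<2 ^ K. \<kappa> (a, j) * overlap T K t a else 0)"
proof -
  have ip: "ip (horizon T) (block_unit T K q) (window t j) = (if snd q = j then overlap T K t (fst q) else 0)"
    if q: "fst q < 2 ^ K" for q
  proof (cases "snd q = j")
    case True
    have g0: "0 \<le> grid T K (fst q)" using grid_in[of T "fst q" K] T q by auto
    have sub: "block T K (fst q) \<inter> {0..t} \<subseteq> {0..T}" using t by auto
    have "ip (horizon T) (block_unit T K q) (window t j) = (\<integral>s. indicator (block T K (fst q) \<inter> {0..t}) s \<partial>horizon T)"
      unfolding ip_def using True by (intro Bochner_Integration.integral_cong refl) (auto simp: block_unit_def window_def indicator_def inner_l2_units)
    also have "\<dots> = measure (horizon T) (block T K (fst q) \<inter> {0..t})"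
      using sub by (simp add: space_restrict_space Int_absorb2)
    also have "\<dots> = measure lborel (block T K (fst q) \<inter> {0..t})"
      using sub by (intro measure_horizon) (auto simp: block_def)
    also have "block T K (fst q) \<inter> {0..t} = {grid T K (fst q)<..min t (grid T K (Suc (fst q)))}"
      using g0 by (auto simp: block_def)
    also have "measure lborel \<dots> = overlap T K t (fst q)"
      by (cases "grid T K (fst q) \<le> min t (grid T K (Suc (fst q)))") (auto simp: overlap_def)
    finally show ?thesis using True by simp
  next
    case False
    then show ?thesis by (simp add: ip_def block_unit_def window_def inner_l2_units)
  qed
  have "primitive T (step T K n \<kappa>) t j = (\<Sum>q\<in>{..<2 ^ K} \<times> {..<n}. \<kappa> q * (if snd q = j then overlap T K t (fst q) else 0))"
    unfolding primitive_eq_ip[OF step_L2[folded L2_space_eq] t] ip_step[OF window_L2]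
    by (intro sum.cong refl) (auto simp: ip)
  also have "\<dots> = (\<Sum>a<2 ^ K. \<Sum>b<n. if b = j then \<kappa> (a, b) * overlap T K t a else 0)"
    by (subst sum.cartesian_product) (auto intro!: sum.cong)
  finally show ?thesis by (simp add: sum.delta)
qed

lemma overlap_grid:
  assumes T: "0 < T"
  shows "overlap T K (grid T K m) a = (if a < m then T / 2 ^ K else 0)"
proof (cases "a < m")
  case True
  then have "grid T K (Suc a) \<le> grid T K m" using T by (intro grid_mono) auto
  then show ?thesis using True T by (simp add: overlap_def grid_Suc)
next
  case False
  then have "grid T K m \<le> grid T K a" using T by (intro grid_mono) auto
  then show ?thesis using False by (simp add: overlap_def)
qed

lemma overlap_refined_increment:
  assumes T: "0 < T"
  shows "overlap T K (grid T (K + L) (Suc b)) a - overlap T K (grid T (K + L) b) a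
    = (if b div 2 ^ L = a then T / 2 ^ (K + L) else 0)"
proof -
  let ?g = "grid T (K + L)"
  \<comment> \<open>The coarse block that contains the fine interval with index \<open>b\<close>;
    every other coarse block lies entirely before or after that interval.\<close>
  define a0 where "a0 = b div 2 ^ L"
  have "a0 * 2 ^ L \<le> b" by (simp add: a0_def)
  moreover have "Suc b \<le> Suc a0 * 2 ^ L" unfolding a0_def
    using div_less_iff_less_mult[of "2 ^ L" b "Suc (b div 2 ^ L)"] by simp
  ultimately have g: "grid T K a0 \<le> ?g b" "?g (Suc b) \<le> grid T K (Suc a0)"
    using T by (simp_all only: grid_refine[of T K L, symmetric] grid_mono less_imp_le)
  have bb: "?g b \<le> ?g (Suc b)" "?g (Suc b) = ?g b + T / 2 ^ (K + L)"
    using T by (auto intro: grid_mono simp: grid_Suc)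
  consider "a < a0" | "a = a0" | "a0 < a" by linarith
  then show ?thesis
  proof cases
    case 1
    then have "grid T K (Suc a) \<le> grid T K a0" using T by (intro grid_mono) auto
    then have "grid T K (Suc a) \<le> ?g b" "grid T K (Suc a) \<le> ?g (Suc b)" using g bb by linarith+
    then show ?thesis using 1 by (simp add: overlap_def a0_def)
  next
    case 2
    then show ?thesis using g bb by (simp add: overlap_def a0_def)
  next
    case 3
    then have "grid T K (Suc a0) \<le> grid T K a" using T by (intro grid_mono) auto
    then have "?g b \<le> grid T K a" "?g (Suc b) \<le> grid T K a" using g bb by linarith+
    then show ?thesis using 3 by (simp add: overlap_def a0_def)
  qed
qed

text \<open>Since the block units have squared norm \<open>T / 2 ^ K\<close>, these block averages
  are the coefficients of an orthogonal projection.\<close>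

definition dyadic_mean :: "real \<Rightarrow> (real \<Rightarrow> l2) \<Rightarrow> nat \<Rightarrow> nat \<times> nat \<Rightarrow> real" where
  "dyadic_mean T k K q = 2 ^ K / T * ip (horizon T) k (block_unit T K q)"

text \<open>Bessel's inequality: the step function \<open>s\<close> satisfies
  \<open>ip k s = ip s s\<close>, so the squared norm of \<open>k - s\<close> is
  \<open>ip k k - ip s s\<close>.\<close>

lemma step_dyadic_mean_energy:
  assumes T: "0 < T" and k: "k \<in> L2_space T"
  shows "L2_energy T (step T K n (dyadic_mean T k K)) \<le> L2_energy T k"
proof -
  let ?s = "step T K n (dyadic_mean T k K)" and ?N = "horizon T"
  note k' = k[unfolded L2_space_eq]
  have "ip ?N ?s k = (\<Sum>q\<in>{..<2 ^ K} \<times> {..<n}. dyadic_mean T k K q * (T / 2 ^ K * dyadic_mean T k K q))"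
    unfolding ip_step[OF k'] using T
    by (intro sum.cong refl) (simp add: dyadic_mean_def ip_commute)
  then have "ip ?N k ?s = ip ?N ?s ?s"
    using energy_step[OF T, of K n "dyadic_mean T k K"]
    by (simp add: L2_energy_eq sum_distrib_left power2_eq_square ac_simps ip_commute[of ?N k])
  moreover have "0 \<le> ip ?N (\<lambda>s. k s - ?s s) (\<lambda>s. k s - ?s s)" by (rule ip_self_nonneg)
  ultimately show ?thesis
    unfolding ip_diff_self[OF k' step_L2] by (simp add: L2_energy_eq)
qed

lemma ip_window_grid:
  assumes T: "0 < T" and k: "k \<in> square_integrable (horizon T)"
  shows "m \<le> 2 ^ K \<Longrightarrow> ip (horizon T) k (window (grid T K m) j) = (\<Sum>a<m. ip (horizon T) k (block_unit T K (a, j)))"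
proof (induction m)
  case 0
  \<comment> \<open>A window is closed at 0 while the blocks omit 0, so the base case concerns a
    function carried by a null set.\<close>
  have "ip (horizon T) (window 0 j) (window 0 j) = (\<integral>s. indicator {0} s \<partial>horizon T)"
    unfolding ip_def by (intro Bochner_Integration.integral_cong refl) (auto simp: window_def indicator_def inner_l2_units)
  also have "\<dots> = measure (horizon T) {0}"
    using T by (simp add: space_restrict_space Int_absorb2)
  also have "\<dots> = 0" using T by (subst measure_horizon) auto
  finally have "(ip (horizon T) k (window 0 j))\<^sup>2 \<le> 0"
    using ip_Cauchy_Schwarz[OF k window_L2, of 0 j] by simp
  then show ?case by simp
next
  case (Suc m)
  have g: "0 \<le> grid T K m" "grid T K m \<le> grid T K (Suc m)" using T Suc.prems by (auto simp: grid_def intro!: grid_mono divide_right_mono)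
  have "(\<lambda>s. window (grid T K (Suc m)) j s - window (grid T K m) j s) = block_unit T K (m, j)"
    using g by (auto simp: window_def block_unit_def block_def indicator_def fun_eq_iff)
  then have "ip (horizon T) k (block_unit T K (m, j)) = ip (horizon T) k (window (grid T K (Suc m)) j) - ip (horizon T) k (window (grid T K m) j)"
    using ip_diff[OF window_L2 window_L2 k, of "grid T K (Suc m)" j "grid T K m" j] by (simp add: ip_commute)
  then show ?case using Suc by simp
qed

text \<open>Averaging preserves the integral over each block, and the grid of level \<open>L\<close>
  is contained in the finer grid of level \<open>K\<close>.\<close>

lemma primitive_step_dyadic_mean:
  assumes T: "0 < T" and k: "k \<in> L2_space T" and i: "i \<le> 2 ^ L" and j: "j < n" and L: "L \<le> K"
  shows "primitive T (step T K n (dyadic_mean T k K)) (grid T L i) j = primitive T k (grid T L i) j"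
proof -
  define m where "m = i * 2 ^ (K - L)"
  have g: "grid T L i = grid T K m"
    using grid_refine[of T L "K - L" i] L by (simp add: m_def)
  have m: "m \<le> 2 ^ K"
  proof -
    have "m \<le> 2 ^ L * 2 ^ (K - L)" unfolding m_def using i by (intro mult_right_mono) auto
    also have "\<dots> = 2 ^ K" using L by (simp add: power_add[symmetric])
    finally show ?thesis .
  qed
  have t: "grid T K m \<in> {0..T}" using T m by (intro grid_in) auto
  have "primitive T (step T K n (dyadic_mean T k K)) (grid T K m) j = (\<Sum>a<2 ^ K. dyadic_mean T k K (a, j) * (if a < m then T / 2 ^ K else 0))"
    using primitive_step[OF T t] j by (simp add: overlap_grid[OF T])
  also have "\<dots> = (\<Sum>a<m. ip (horizon T) k (block_unit T K (a, j)))"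
    using m T by (intro sum.mono_neutral_cong_right) (auto simp: dyadic_mean_def)
  also have "\<dots> = ip (horizon T) k (window (grid T K m) j)"
    by (rule ip_window_grid[OF T k[unfolded L2_space_eq] m, symmetric])
  also have "\<dots> = primitive T k (grid T K m) j"
    by (rule primitive_eq_ip[OF k t, symmetric])
  finally show ?thesis by (simp add: g)
qed

text \<open>The weak limit need not be identified with \<open>k\<close>: it suffices that it has the same primitive.\<close>

lemma step_approximation:
  assumes T: "0 < T" and k: "k \<in> L2_space T"
  shows "\<exists>r x. strict_mono (r :: nat \<Rightarrow> nat) \<and> x \<in> L2_space T \<and> primitive T x = primitive T k \<and>
    L2_weak_tendsto T (\<lambda>m. step T (r m) (r m) (dyadic_mean T k (r m))) x sequentially"
proof -
  define S where "S K = step T K K (dyadic_mean T k K)" for K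
  have "S K \<in> L2_ball T (L2_energy T k)" for K
    using step_dyadic_mean_energy[OF T k] step_L2 by (simp add: L2_ball_def L2_space_eq S_def)
  then obtain r x where r: "strict_mono (r :: nat \<Rightarrow> nat)" and x: "x \<in> L2_ball T (L2_energy T k)"
    and lim: "L2_weak_tendsto T (\<lambda>m. S (r m)) x sequentially"
    using L2_ball_weakly_compact by blast
  have xs: "x \<in> L2_space T" using x by (simp add: L2_ball_def)
  have "primitive T x = primitive T k"
  proof (rule primitive_cong_grid[OF T xs k])
    fix L i j :: nat assume i: "i \<le> 2 ^ L"
    have t: "grid T L i \<in> {0..T}" using T i by (intro grid_in) auto
    have "(\<lambda>m. primitive T (S (r m)) (grid T L i) j) \<longlonglongrightarrow> primitive T x (grid T L i) j"
      using lim window_L2[of "grid T L i" j T]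
      by (simp add: L2_weak_tendsto_def L2_space_eq L2_inner_eq primitive_eq_ip[OF _ t] xs[unfolded L2_space_eq] S_def step_L2)
    \<comment> \<open>Refinement level and number of components are both \<open>r m\<close>, so
      eventually \<open>L\<close> and \<open>j\<close> are covered and the value at the grid point
      no longer depends on \<open>m\<close>.\<close>
    moreover have "\<forall>\<^sub>F m in sequentially. primitive T (S (r m)) (grid T L i) j = primitive T k (grid T L i) j"
    proof (rule eventually_sequentiallyI)
      fix m assume "max L (Suc j) \<le> m"
      then have "L \<le> r m" "j < r m" using seq_suble[OF r, of m] by auto
      then show "primitive T (S (r m)) (grid T L i) j = primitive T k (grid T L i) j"
        unfolding S_def by (intro primitive_step_dyadic_mean[OF T k i])
    qed
    ultimately have "(\<lambda>m. primitive T k (grid T L i) j) \<longlonglongrightarrow> primitive T x (grid T L i) j"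
      by (rule Lim_transform_eventually)
    then show "primitive T x (grid T L i) j = primitive T k (grid T L i) j"
      by (simp add: LIMSEQ_const_iff)
  qed
  then show ?thesis using r xs lim unfolding S_def by blast
qed

section \<open>Brownian motion on dyadic grids\<close>

context gaussian_family
begin

text \<open>Redrawing coordinate \<open>q\<close> freezes \<open>c\<close> and leaves a centred
  Gaussian factor: martingale differences have mean zero.\<close>

lemma expectation_adapted_zero:
  fixes c :: "('i \<Rightarrow> real) \<Rightarrow> real"
  assumes c[measurable]: "c \<in> borel_measurable borel" and bound: "\<And>y. \<bar>c y\<bar> \<le> C"
    and indep: "\<And>y x. c (y(q := x)) = c y"
  shows "integrable M (\<lambda>\<omega>. c (Z \<omega>) * Z \<omega> q)" "expectation (\<lambda>\<omega>. c (Z \<omega>) * Z \<omega> q) = 0"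
proof -
  show int: "integrable M (\<lambda>\<omega>. c (Z \<omega>) * Z \<omega> q)"
  proof (rule Bochner_Integration.integrable_bound)
    show "integrable M (\<lambda>\<omega>. C * Z \<omega> q)" using expectation_coord by simp
    have "\<bar>c y\<bar> * \<bar>x\<bar> \<le> \<bar>C\<bar> * \<bar>x\<bar>" for y x
      using bound[of y] by (intro mult_right_mono) auto
    then show "AE \<omega> in M. norm (c (Z \<omega>) * Z \<omega> q) \<le> norm (C * Z \<omega> q)" by (auto simp: abs_mult)
  qed measurable
  have "expectation (\<lambda>\<omega>. c (Z \<omega>) * Z \<omega> q)
      = expectation (\<lambda>\<omega>. expectation (\<lambda>\<omega>'. c (\<lambda>r. if r \<in> {q} then Z \<omega>' r else Z \<omega> r) * (if q \<in> {q} then Z \<omega>' q else Z \<omega> q)))"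
    by (rule integral_resample(1)[where f = "\<lambda>y. c y * y q" and C = "{q}"])
       (auto intro!: borel_measurable_times measurable_product_then_coordinatewise int)
  also have "\<dots> = expectation (\<lambda>\<omega>. expectation (\<lambda>\<omega>'. c (Z \<omega>) * Z \<omega>' q))"
  proof -
    have "(\<lambda>r. if r \<in> {q} then Z \<omega>' r else Z \<omega> r) = (Z \<omega>)(q := Z \<omega>' q)" for \<omega> \<omega>' by auto
    then show ?thesis by (simp only: indep) simp
  qed
  also have "\<dots> = 0" by (simp add: expectation_coord)
  finally show "expectation (\<lambda>\<omega>. c (Z \<omega>) * Z \<omega> q) = 0" .
qed

end

locale brownian = prob_space M for M :: "'w measure" +
  fixes T :: real and B :: "nat \<Rightarrow> real \<Rightarrow> 'w \<Rightarrow> real"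
  assumes T: "0 < T" and BM: "independent_BMs M T B"
begin

lemma BMj: "standard_BM M T (B j)"
  using BM by (simp add: independent_BMs_def)

lemma measurable_B: "t \<in> {0..T} \<Longrightarrow> B j t \<in> borel_measurable M"
  using BMj[of j] by (simp add: standard_BM_def)

lemma measurable_B_grid[measurable]: "i \<le> 2 ^ K \<Longrightarrow> B j (grid T K i) \<in> borel_measurable M"
  using T by (intro measurable_B grid_in) auto

lemma B_0: "AE \<omega> in M. \<forall>j. B j 0 \<omega> = 0"
  using BMj by (simp add: standard_BM_def AE_all_countable)

lemma continuous_B: "\<omega> \<in> space M \<Longrightarrow> continuous_on {0..T} (\<lambda>t. B j t \<omega>)"
  using BMj[of j] by (simp add: standard_BM_def)

definition inc :: "nat \<Rightarrow> nat \<Rightarrow> 'w \<Rightarrow> nat \<times> nat \<Rightarrow> real" where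
  "inc K n \<omega> q = (if fst q < 2 ^ K \<and> snd q < n
     then B (snd q) (grid T K (Suc (fst q))) \<omega> - B (snd q) (grid T K (fst q)) \<omega> else 0)"

lemma measurable_increment:
  assumes "a < 2 ^ K"
  shows "(\<lambda>\<omega>. B b (grid T K (Suc a)) \<omega> - B b (grid T K a) \<omega>) \<in> borel_measurable M"
  using assms by (intro borel_measurable_diff measurable_B_grid) auto

text \<open>Two sources of independence are combined: between the components, given for whole paths,
  and between the increments of one component. The joint event is an intersection over components of
  path events \<open>S b\<close>, and each of these factorizes over time.\<close>

lemma indep_increments:
  "indep_vars (\<lambda>_. borel) (\<lambda>q \<omega>. B (snd q) (grid T K (Suc (fst q))) \<omega> - B (snd q) (grid T K (fst q)) \<omega>)
    ({..<2 ^ K} \<times> {..<n})"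
proof (cases "n = 0")
  case True
  then show ?thesis by (simp add: indep_vars_def indep_sets_def)
next
  case False
  define X where "X q \<omega> = B (snd q) (grid T K (Suc (fst q))) \<omega> - B (snd q) (grid T K (fst q)) \<omega>" for q \<omega>
  let ?I = "{..<2 ^ K} \<times> {..<n} :: (nat \<times> nat) set" and ?m = "2 ^ K :: nat"
  define F where "F q = {X q -` A \<inter> space M |A. A \<in> sets borel}" for q
  have rv: "X q \<in> borel_measurable M" if "q \<in> ?I" for q
    unfolding X_def using that by (intro measurable_increment) auto
  have "indep_sets F ?I"
  proof (subst indep_sets_finite)
    have "(0, 0) \<in> ?I" using False by simp
    then show "?I \<noteq> {}" by blast
    show "finite ?I" by simp
    show "F q \<subseteq> events" if "q \<in> ?I" for q using rv[OF that] by (auto simp: F_def)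
    show "space M \<in> F q" if "q \<in> ?I" for q by (auto simp: F_def intro!: exI[of _ UNIV])
    show "\<forall>A\<in>Pi ?I F. prob (\<Inter>j\<in>?I. A j) = (\<Prod>j\<in>?I. prob (A j))"
    proof
      fix A assume A: "A \<in> Pi ?I F"
      then have "\<forall>q\<in>?I. \<exists>D. D \<in> sets borel \<and> A q = X q -` D \<inter> space M"
        unfolding Pi_def F_def by blast
      then obtain D where D: "\<And>q. q \<in> ?I \<Longrightarrow> D q \<in> sets borel" "\<And>q. q \<in> ?I \<Longrightarrow> A q = X q -` D q \<inter> space M"
        by metis
      let ?P = "Pi\<^sub>M {0..T} (\<lambda>_. borel :: real measure)"
      define S where "S b = {f \<in> space ?P. \<forall>a\<in>{..<?m}. f (grid T K (Suc a)) - f (grid T K a) \<in> D (a, b)}" for b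
      define W where "W b \<omega> = (\<lambda>t\<in>{0..T}. B b t \<omega>)" for b \<omega>
      have ind: "indep_vars (\<lambda>_. ?P) W UNIV"
        using BM by (simp add: independent_BMs_def W_def[abs_def])
      have gr: "grid T K a \<in> {0..T}" if "a \<le> ?m" for a using T that by (intro grid_in) auto
      have S: "S b \<in> sets ?P" if b: "b < n" for b
      proof -
        have "{f \<in> space ?P. f (grid T K (Suc a)) - f (grid T K a) \<in> D (a, b)} \<in> sets ?P" if "a < ?m" for a
        proof -
          have "(\<lambda>f. f (grid T K (Suc a)) - f (grid T K a)) \<in> borel_measurable ?P"
            using gr[of a] gr[of "Suc a"] that
            by (intro borel_measurable_diff measurable_component_singleton) auto
          from measurable_sets[OF this D(1)[of "(a, b)"]] show ?thesis
            using that b by (simp add: vimage_def Int_def conj_commute)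
        qed
        then show ?thesis unfolding S_def by (intro sets.sets_Collect_finite_All) auto
      qed
      have E: "W b -` S b \<inter> space M = (\<Inter>a\<in>{..<?m}. A (a, b))" if b: "b < n" for b
      proof -
        have "W b \<omega> \<in> space ?P" for \<omega> by (auto simp: W_def space_PiM)
        then have "W b -` S b \<inter> space M = {\<omega>\<in>space M. \<forall>a<?m. X (a, b) \<omega> \<in> D (a, b)}"
          using gr by (auto simp: S_def W_def X_def Suc_le_eq less_imp_le)
        also have "\<dots> = (\<Inter>a\<in>{..<?m}. X (a, b) -` D (a, b) \<inter> space M)"
        proof -
          \<comment> \<open>Moving \<open>space M\<close> inside the intersection is legitimate
            because the index set is nonempty.\<close>
          have z: "0 \<in> {..<?m}" by simp
          show ?thesis by (auto dest: bspec[OF _ z] simp: lessThan_empty_iff)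
        qed
        also have "\<dots> = (\<Inter>a\<in>{..<?m}. A (a, b))"
          using b D(2) by simp
        finally show ?thesis .
      qed
      have "(\<Inter>j\<in>?I. A j) = (\<Inter>b\<in>{..<n}. W b -` S b \<inter> space M)"
        using E by auto
      also have "prob \<dots> = (\<Prod>b\<in>{..<n}. prob (W b -` S b \<inter> space M))"
        by (rule indep_varsD[OF ind]) (use False S in auto)
      also have "\<dots> = (\<Prod>b<n. \<Prod>a<?m. prob (A (a, b)))"
      proof (rule prod.cong[OF refl])
        fix b assume b: "b \<in> {..<n}"
        have "mono_on {..?m} (grid T K)" "grid T K ` {..?m} \<subseteq> {0..T}"
          using T gr by (auto intro!: mono_onI grid_mono)
        then have "indep_vars (\<lambda>_. borel) (\<lambda>i \<omega>. B b (grid T K (Suc i)) \<omega> - B b (grid T K i) \<omega>) {..<?m}"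
          using BMj[of b] unfolding standard_BM_def by blast
        then have "indep_vars (\<lambda>_. borel) (\<lambda>i. X (i, b)) {..<?m}"
          by (simp add: X_def[abs_def])
        from indep_varsD[OF this, of "{..<?m}" "\<lambda>a. D (a, b)"]
        have "prob (\<Inter>a\<in>{..<?m}. X (a, b) -` D (a, b) \<inter> space M) = (\<Prod>a<?m. prob (X (a, b) -` D (a, b) \<inter> space M))"
          using D(1) b by (auto simp: lessThan_empty_iff)
        then show "prob (W b -` S b \<inter> space M) = (\<Prod>a<?m. prob (A (a, b)))"
          using E[of b] D(2) b by simp
      qed
      also have "\<dots> = (\<Prod>a<?m. \<Prod>b<n. prob (A (a, b)))" by (rule prod.swap)
      also have "\<dots> = (\<Prod>j\<in>?I. prob (A j))" by (simp add: prod.cartesian_product)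
      finally show "prob (\<Inter>j\<in>?I. A j) = (\<Prod>j\<in>?I. prob (A j))" .
    qed
  qed
  then show ?thesis using rv unfolding indep_vars_def2 F_def X_def by blast
qed

lemma gaussian_family_inc: "gaussian_family M (inc K n) ({..<2 ^ K} \<times> {..<n}) (T / 2 ^ K)"
proof
  show "indep_vars (\<lambda>_. borel) (\<lambda>q \<omega>. inc K n \<omega> q) ({..<2 ^ K} \<times> {..<n})"
    using indep_increments[of K n] by (subst indep_vars_cong[OF refl _ refl]) (auto simp: inc_def fun_eq_iff)
  fix q :: "nat \<times> nat" assume q: "q \<in> {..<2 ^ K} \<times> {..<n}"
  then obtain a b where [simp]: "q = (a, b)" and ab: "a < 2 ^ K" "b < n" by auto
  have "0 \<le> grid T K a" "grid T K a < grid T K (Suc a)" "grid T K (Suc a) \<le> T"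
    using T ab grid_in[of T a K] grid_in[of T "Suc a" K] by (auto intro!: grid_strict_mono)
  then have "distributed M lborel (\<lambda>\<omega>. B b (grid T K (Suc a)) \<omega> - B b (grid T K a) \<omega>) (normal_density 0 (sqrt (grid T K (Suc a) - grid T K a)))"
    using BMj[of b] unfolding standard_BM_def by blast
  then show "distributed M lborel (\<lambda>\<omega>. inc K n \<omega> q) (\<lambda>x. ennreal (normal_density 0 (sqrt (T / 2 ^ K)) x))"
    using ab by (simp add: inc_def grid_Suc)
next
  show "inc K n \<omega> q = 0" if "q \<notin> {..<2 ^ K} \<times> {..<n}" for q \<omega>
    using that by (cases q) (auto simp: inc_def)
qed (use T in auto)

lemma measurable_inc[measurable]: "inc K n \<in> borel_measurable M"
proof -
  interpret gaussian_family M "inc K n" "{..<2 ^ K} \<times> {..<n}" "T / 2 ^ K" by (rule gaussian_family_inc)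
  show ?thesis by (rule measurable_Z)
qed

lemma path_in_mspace:
  assumes "\<And>j. continuous_on {0..T} (\<lambda>t. f t j)"
  shows "(\<lambda>t\<in>{0..T}. f t) \<in> mspace (path_metric T)"
proof -
  have "continuous_on {0..T} f" using assms by (rule continuous_seqI)
  then have "continuous_on {0..T} (\<lambda>t\<in>{0..T}. f t)" by (rule continuous_on_eq) auto
  then show ?thesis by (simp add: mspace_path_metric)
qed

lemma measurable_BM_path[measurable]: "BM_path T B \<in> M \<rightarrow>\<^sub>M path_space T"
proof (rule measurable_path_space[OF T])
  show "BM_path T B \<in> space M \<rightarrow> mspace (path_metric T)"
    unfolding BM_path_def by (auto intro: path_in_mspace continuous_B)
  show "(\<lambda>\<omega>. BM_path T B \<omega> (grid T K i) j) \<in> borel_measurable M" if "i \<le> 2 ^ K" for K i j :: nat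
  proof -
    have "grid T K i \<in> {0..T}" using T that by (intro grid_in) auto
    then show ?thesis unfolding BM_path_def using measurable_B_grid[OF that] by simp
  qed
qed

definition controlled_path :: "nat \<Rightarrow> nat \<Rightarrow> (nat \<times> nat \<Rightarrow> real) \<Rightarrow> 'w \<Rightarrow> real \<Rightarrow> nat \<Rightarrow> real" where
  "controlled_path K n \<kappa> \<omega> = (\<lambda>t\<in>{0..T}. \<lambda>j. B j t \<omega> + primitive T (step T K n \<kappa>) t j)"

lemma continuous_primitive_step: "continuous_on {0..T} (\<lambda>t. primitive T (step T K n \<kappa>) t j)"
proof (rule continuous_on_eq)
  show "continuous_on {0..T} (\<lambda>t. if j < n then \<Sum>a<2 ^ K. \<kappa> (a, j) * overlap T K t a else 0)"
    by (cases "j < n") (auto simp: overlap_def intro!: continuous_intros)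
qed (simp add: primitive_step[OF T])

lemma measurable_primitive_step:
  assumes "\<And>q. (\<lambda>\<omega>. \<kappa> \<omega> q) \<in> borel_measurable M"
  shows "(\<lambda>\<omega>. primitive T (step T K n (\<kappa> \<omega>))) \<in> M \<rightarrow>\<^sub>M path_space T"
proof (rule measurable_path_space[OF T])
  show "(\<lambda>\<omega>. primitive T (step T K n (\<kappa> \<omega>))) \<in> space M \<rightarrow> mspace (path_metric T)"
    using continuous_primitive_step by (auto simp: mspace_path_metric primitive_def intro!: continuous_seqI)
  show "(\<lambda>\<omega>. primitive T (step T K n (\<kappa> \<omega>)) (grid T L i) j) \<in> borel_measurable M" if "i \<le> 2 ^ L" for L i j :: nat
  proof -
    have t: "grid T L i \<in> {0..T}" using T that by (intro grid_in) auto
    show ?thesis unfolding primitive_step[OF T t] using assms by simp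
  qed
qed

lemma measurable_controlled_path:
  assumes "\<And>q. (\<lambda>\<omega>. \<kappa> \<omega> q) \<in> borel_measurable M"
  shows "(\<lambda>\<omega>. controlled_path K n (\<kappa> \<omega>) \<omega>) \<in> M \<rightarrow>\<^sub>M path_space T"
proof (rule measurable_path_space[OF T])
  show "(\<lambda>\<omega>. controlled_path K n (\<kappa> \<omega>) \<omega>) \<in> space M \<rightarrow> mspace (path_metric T)"
    unfolding controlled_path_def by (auto intro!: path_in_mspace continuous_intros continuous_B continuous_primitive_step)
  show "(\<lambda>\<omega>. controlled_path K n (\<kappa> \<omega>) \<omega> (grid T L i) j) \<in> borel_measurable M" if "i \<le> 2 ^ L" for L i j :: nat
  proof -
    have t: "grid T L i \<in> {0..T}" using T that by (intro grid_in) auto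
    show ?thesis unfolding controlled_path_def
      using assms t measurable_B_grid[OF that] by (simp add: primitive_step[OF T t])
  qed
qed

end

section \<open>Cylinder events of grid values and refinement of grids\<close>

definition grid_values :: "real \<Rightarrow> nat \<Rightarrow> nat \<Rightarrow> (real \<Rightarrow> nat \<Rightarrow> real) \<Rightarrow> nat \<times> nat \<Rightarrow> real" where
  "grid_values T L m w = (\<lambda>(i, j). if i \<le> 2 ^ L \<and> j < m then w (grid T L i) j else 0)"

definition grid_events :: "real \<Rightarrow> (real \<Rightarrow> nat \<Rightarrow> real) set set" where
  "grid_events T = {grid_values T L m -` D \<inter> mspace (path_metric T) | L m D. D \<in> sets borel}"

lemma grid_values_refine:
  assumes "L \<le> L'" "m \<le> m'"
  shows "grid_values T L m w = (\<lambda>(i, j). if i \<le> 2 ^ L \<and> j < m then grid_values T L' m' w (i * 2 ^ (L' - L), j) else 0)"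
proof -
  have "i * 2 ^ (L' - L) \<le> 2 ^ L'" if "i \<le> 2 ^ L" for i :: nat
  proof -
    have "i * 2 ^ (L' - L) \<le> 2 ^ L * 2 ^ (L' - L)" using that by (rule mult_right_mono) simp
    then show ?thesis using assms(1) by (simp add: power_add[symmetric])
  qed
  moreover have "grid T L' (i * 2 ^ (L' - L)) = grid T L i" for i
    using grid_refine[of T L "L' - L" i] assms(1) by simp
  ultimately show ?thesis using assms(2) by (auto simp: grid_values_def fun_eq_iff)
qed

text \<open>Coarse grid values are a measurable function of finer ones, so a cylinder event can be
  moved to any finer grid with more components.\<close>

lemma grid_event_refine:
  assumes "L \<le> L'" "m \<le> m'" "D \<in> sets borel"
  shows "\<exists>D'. D' \<in> sets borel \<and> grid_values T L m -` D = grid_values T L' m' -` D'"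
proof -
  let ?r = "\<lambda>y :: nat \<times> nat \<Rightarrow> real. \<lambda>(i, j). if i \<le> 2 ^ L \<and> j < m then y (i * 2 ^ (L' - L), j) else 0"
  have "?r \<in> borel_measurable borel"
    by (rule measurable_coordinatewise_then_product) (simp add: case_prod_beta measurable_product_then_coordinatewise)
  then have "?r -` D \<in> sets borel" using measurable_sets[OF _ assms(3), of ?r borel] by simp
  moreover have "grid_values T L m -` D = grid_values T L' m' -` (?r -` D)"
  proof -
    have "grid_values T L m = ?r \<circ> grid_values T L' m'"
      by (rule ext) (unfold comp_def, rule grid_values_refine[OF assms(1,2)])
    then show ?thesis by (simp only: vimage_comp)
  qed
  ultimately show ?thesis by blast
qed

lemma Int_stable_grid_events: "Int_stable (grid_events T)"
proof (rule Int_stableI)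
  fix a b assume "a \<in> grid_events T" "b \<in> grid_events T"
  then obtain L m D L' m' D' where a: "a = grid_values T L m -` D \<inter> mspace (path_metric T)" "D \<in> sets borel"
    and b: "b = grid_values T L' m' -` D' \<inter> mspace (path_metric T)" "D' \<in> sets borel"
    by (auto simp: grid_events_def)
  let ?L = "max L L'" and ?m = "max m m'"
  obtain E where E: "E \<in> sets borel" "grid_values T L m -` D = grid_values T ?L ?m -` E"
    using grid_event_refine[OF max.cobounded1[of L L'] max.cobounded1[of m m'] a(2), of T] by blast
  obtain E' where E': "E' \<in> sets borel" "grid_values T L' m' -` D' = grid_values T ?L ?m -` E'"
    using grid_event_refine[OF max.cobounded2[of L' L] max.cobounded2[of m' m] b(2), of T] by blast
  have "a \<inter> b = grid_values T ?L ?m -` (E \<inter> E') \<inter> mspace (path_metric T)"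
    unfolding a b E(2) E'(2) by auto
  then show "a \<inter> b \<in> grid_events T"
    unfolding grid_events_def using E(1) E'(1) by blast
qed

lemma measurable_grid_values:
  assumes "0 < T"
  shows "grid_values T L m \<in> borel_measurable (path_space T)"
proof (rule measurable_coordinatewise_then_product)
  fix q
  have "(\<lambda>w. w (grid T L (fst q)) (snd q)) \<in> borel_measurable (path_space T)" if "fst q \<le> 2 ^ L"
    using assms that by (intro measurable_eval grid_in) auto
  then show "(\<lambda>w. grid_values T L m w q) \<in> borel_measurable (path_space T)"
    by (cases "fst q \<le> 2 ^ L") (auto simp: grid_values_def case_prod_beta)
qed

lemma sets_path_space_grid_events:
  assumes T: "0 < T"
  shows "sets (path_space T) = sigma_sets (mspace (path_metric T)) (grid_events T)"
proof
  have "eval_events T \<subseteq> grid_events T"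
  proof
    fix E assume "E \<in> eval_events T"
    then obtain K i j x where i: "i \<le> 2 ^ K" and E: "E = {w \<in> mspace (path_metric T). w (grid T K i) j \<le> x}"
      by (auto simp: eval_events_def)
    have [measurable]: "(\<lambda>y. y (i, j)) \<in> borel_measurable (borel :: (nat \<times> nat \<Rightarrow> real) measure)"
      by (rule measurable_product_then_coordinatewise) simp
    have "{y :: nat \<times> nat \<Rightarrow> real. y (i, j) \<le> x} \<in> sets borel" by measurable
    moreover have "E = grid_values T K (Suc j) -` {y. y (i, j) \<le> x} \<inter> mspace (path_metric T)"
      using i by (auto simp: E grid_values_def)
    ultimately show "E \<in> grid_events T" unfolding grid_events_def by blast
  qed
  then show "sets (path_space T) \<subseteq> sigma_sets (mspace (path_metric T)) (grid_events T)"
    unfolding sets_path_space_eq[OF T] by (rule sigma_sets_mono')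
  show "sigma_sets (mspace (path_metric T)) (grid_events T) \<subseteq> sets (path_space T)"
    unfolding space_path_space[symmetric]
  proof (rule sets.sigma_sets_subset, safe)
    fix E assume "E \<in> grid_events T"
    then show "E \<in> sets (path_space T)"
      using measurable_sets[OF measurable_grid_values[OF T]] by (auto simp: grid_events_def space_path_space)
  qed
qed

lemma sum_blocks:
  fixes f :: "nat \<Rightarrow> real"
  shows "(\<Sum>a<2 ^ (K + L). f a) = (\<Sum>a<2 ^ K. \<Sum>i<2 ^ L. f (a * 2 ^ L + i))"
proof -
  have "(\<Sum>i<2 ^ L. f (a * 2 ^ L + i)) = sum f {a * 2 ^ L..<a * 2 ^ L + 2 ^ L}" for a
    by (simp add: sum.shift_bounds_nat_ivl[of f 0 "a * 2 ^ L" "2 ^ L", simplified] lessThan_atLeast0 add.commute)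
  then show ?thesis
    by (simp add: sum.nat_group power_add)
qed

text \<open>Recovers the increments of a coarse grid from those of a grid that is \<open>L\<close>
  levels finer; it lets a functional or a control designed on one grid be read on a finer
  one.\<close>

definition coarsen :: "nat \<Rightarrow> nat \<Rightarrow> nat \<Rightarrow> (nat \<times> nat \<Rightarrow> real) \<Rightarrow> nat \<times> nat \<Rightarrow> real" where
  "coarsen K L n y q = (if fst q < 2 ^ K \<and> snd q < n then \<Sum>i<2 ^ L. y (fst q * 2 ^ L + i, snd q) else 0)"

lemma measurable_coarsen[measurable]: "coarsen K L n \<in> borel_measurable borel"
  by (rule measurable_coordinatewise_then_product)
     (auto simp: coarsen_def intro!: measurable_If borel_measurable_sum measurable_product_then_coordinatewise)

text \<open>The inequality is strict: the value in a block is known at its left end point, which is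
  what makes the step control predictable.\<close>

definition causal :: "(nat \<times> nat \<Rightarrow> (nat \<times> nat \<Rightarrow> real) \<Rightarrow> real) \<Rightarrow> bool" where
  "causal c \<longleftrightarrow> (\<forall>q z z'. (\<forall>a<fst q. \<forall>b. z (a, b) = z' (a, b)) \<longrightarrow> c q z = c q z')"

lemma causal_upd: "causal c \<Longrightarrow> fst r \<le> fst q \<Longrightarrow> c r (y(q := x)) = c r y"
  unfolding causal_def by (metis fst_conv fun_upd_other not_le)

text \<open>The analogue of \<open>inc\<close> for an arbitrary path, so that the same functional
  can be evaluated along a steered path.\<close>

definition path_inc :: "real \<Rightarrow> nat \<Rightarrow> nat \<Rightarrow> (real \<Rightarrow> nat \<Rightarrow> real) \<Rightarrow> nat \<times> nat \<Rightarrow> real" where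
  "path_inc T K n w q = (if fst q < 2 ^ K \<and> snd q < n
     then w (grid T K (Suc (fst q))) (snd q) - w (grid T K (fst q)) (snd q) else 0)"

lemma coarsen_path_inc:
  assumes n: "n \<le> n'"
  shows "coarsen K L n (path_inc T (K + L) n' w) = path_inc T K n w"
proof
  fix q :: "nat \<times> nat"
  obtain a b where [simp]: "q = (a, b)" by (cases q)
  show "coarsen K L n (path_inc T (K + L) n' w) q = path_inc T K n w q"
  proof (cases "a < 2 ^ K \<and> b < n")
    case True
    have lt: "a * 2 ^ L + i < 2 ^ (K + L)" if "i < 2 ^ L" for i
    proof -
      have "a * 2 ^ L + i < Suc a * 2 ^ L" using that by simp
      also have "\<dots> \<le> 2 ^ K * 2 ^ L" using True by (intro mult_right_mono) auto
      finally show ?thesis by (simp add: power_add)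
    qed
    let ?f = "\<lambda>i. w (grid T (K + L) (a * 2 ^ L + i)) b"
    have "coarsen K L n (path_inc T (K + L) n' w) q = (\<Sum>i<2 ^ L. ?f (Suc i) - ?f i)"
      using True n lt by (auto simp: coarsen_def path_inc_def intro!: sum.cong)
    also have "\<dots> = ?f (2 ^ L) - ?f 0" by (rule sum_lessThan_telescope)
    also have "a * 2 ^ L + 2 ^ L = Suc a * 2 ^ L" by simp
    finally show ?thesis using True by (simp only: grid_refine) (simp add: path_inc_def grid_refine)
  qed (auto simp: coarsen_def path_inc_def)
qed

section \<open>The Girsanov identity and the entropy bound on path space\<close>

context brownian
begin

lemma inc_eq_path_inc: "inc K n \<omega> = path_inc T K n (\<lambda>t j. B j t \<omega>)"
  by (simp add: inc_def path_inc_def fun_eq_iff)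

lemma coarsen_inc:
  assumes "n \<le> n'"
  shows "coarsen K L n (inc (K + L) n' \<omega>) = inc K n \<omega>"
  unfolding inc_eq_path_inc by (rule coarsen_path_inc[OF assms])

text \<open>Logarithm of the density that undoes the drift: weighted by its exponential, the steered
  path has the law of \<open>B\<close>. The quadratic term is half the energy of the
  control.\<close>

definition density_weight :: "nat \<Rightarrow> nat \<Rightarrow> (nat \<times> nat \<Rightarrow> (nat \<times> nat \<Rightarrow> real) \<Rightarrow> real) \<Rightarrow> 'w \<Rightarrow> real" where
  "density_weight K n c \<omega> = - (\<Sum>q\<in>{..<2 ^ K} \<times> {..<n}. c q (inc K n \<omega>) * inc K n \<omega> q)
     - T / 2 ^ K / 2 * (\<Sum>q\<in>{..<2 ^ K} \<times> {..<n}. (c q (inc K n \<omega>))\<^sup>2)"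

definition steered_path :: "nat \<Rightarrow> nat \<Rightarrow> (nat \<times> nat \<Rightarrow> (nat \<times> nat \<Rightarrow> real) \<Rightarrow> real) \<Rightarrow> 'w \<Rightarrow> real \<Rightarrow> nat \<Rightarrow> real" where
  "steered_path K n c \<omega> = controlled_path K n (\<lambda>q. c q (inc K n \<omega>)) \<omega>"

lemma measurable_steered_path:
  assumes c[measurable]: "\<And>q. c q \<in> borel_measurable borel"
  shows "steered_path K n c \<in> M \<rightarrow>\<^sub>M path_space T"
  unfolding steered_path_def by (rule measurable_controlled_path) simp

lemma measurable_density_weight:
  assumes c[measurable]: "\<And>q. c q \<in> borel_measurable borel"
  shows "density_weight K n c \<in> borel_measurable M"
proof -
  have [measurable]: "(\<lambda>\<omega>. inc K n \<omega> q) \<in> borel_measurable M" for q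
    by (rule measurable_product_then_coordinatewise) simp
  have [measurable]: "(\<lambda>\<omega>. c q (inc K n \<omega>)) \<in> borel_measurable M" for q
    by (rule measurable_compose[OF measurable_inc c])
  show ?thesis unfolding density_weight_def by simp
qed

text \<open>The paths of \<open>B\<close> start at 0 almost surely, so grid values are partial sums
  of increments.\<close>

definition rebuild :: "nat \<Rightarrow> nat \<Rightarrow> (nat \<times> nat \<Rightarrow> real) \<Rightarrow> nat \<times> nat \<Rightarrow> real" where
  "rebuild L m y = (\<lambda>(i, j). if i \<le> 2 ^ L \<and> j < m then \<Sum>a<i. y (a, j) else 0)"

lemma measurable_rebuild[measurable]: "rebuild L m \<in> borel_measurable borel"
  unfolding rebuild_def[abs_def]
  by (rule measurable_coordinatewise_then_product)
     (simp add: case_prod_beta measurable_product_then_coordinatewise)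

lemma grid_values_eq_rebuild:
  assumes "\<And>j. w 0 j = 0" and "\<And>a j. a < 2 ^ L \<Longrightarrow> j < m \<Longrightarrow> w (grid T L (Suc a)) j - w (grid T L a) j = y (a, j)"
  shows "grid_values T L m w = rebuild L m y"
proof -
  have "w (grid T L i) j = (\<Sum>a<i. y (a, j))" if "i \<le> 2 ^ L" "j < m" for i j
    using that(1)
  proof (induction i)
    case (Suc i)
    then show ?case using assms(2)[of i j] that(2) by simp
  qed (simp add: assms(1))
  then show ?thesis by (auto simp: grid_values_def rebuild_def fun_eq_iff)
qed

text \<open>The control lives on the grid of level \<open>K\<close> with \<open>n\<close>
  components, the event on a finer one. The control is copied to the fine grid, constant in time
  within each coarse block and 0 in the added components, and the finite-dimensional identity is
  applied there.\<close>

lemma girsanov_grid_event: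
  assumes c[measurable]: "\<And>q. c q \<in> borel_measurable borel" and causal: "causal c" and D: "D \<in> sets borel"
  shows "(\<integral>\<^sup>+\<omega>. indicator (grid_values T (K + L) (n + m) -` D) (steered_path K n c \<omega>) * ennreal (exp (density_weight K n c \<omega>)) \<partial>M)
    = (\<integral>\<^sup>+\<omega>. indicator (grid_values T (K + L) (n + m) -` D) (BM_path T B \<omega>) \<partial>M)"
proof -
  let ?K = "K + L" and ?n = "n + m"
  let ?h = "T / 2 ^ ?K" and ?Q = "{..<2 ^ ?K} \<times> {..<?n} :: (nat \<times> nat) set"
  let ?Z = "inc ?K ?n"
  interpret G: gaussian_family M ?Z ?Q ?h by (rule gaussian_family_inc)
  define c' where "c' q y = (if snd q < n then c (fst q div 2 ^ L, snd q) (coarsen K L n y) else 0)" for q y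
  have c'_meas: "c' q \<in> borel_measurable borel" for q
    unfolding c'_def by (cases "snd q < n") (simp_all add: measurable_compose[OF measurable_coarsen c])
  have coarsen: "coarsen K L n (?Z \<omega>) = inc K n \<omega>" for \<omega> by (rule coarsen_inc) simp
  have div: "a div 2 ^ L < 2 ^ K" if "a < 2 ^ ?K" for a :: nat
    using that by (simp add: power_add less_mult_imp_div_less)
  have c'_Z: "c' (a, b) (?Z \<omega>) = (if b < n then c (a div 2 ^ L, b) (inc K n \<omega>) else 0)" for a b \<omega>
    by (simp add: c'_def coarsen)
  \<comment> \<open>All fine indices of a coarse block strictly before that of \<open>r\<close> are
    below \<open>fst r\<close>, so a change at or after \<open>fst r\<close> is invisible to the
    coarse increments that \<open>c\<close> reads.\<close>
  have dep: "c' r (y(q := x)) = c' r y" if "fst r \<le> fst q" for r q y x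
  proof (cases "snd r < n")
    case True
    have "c (fst r div 2 ^ L, snd r) (coarsen K L n (y(q := x))) = c (fst r div 2 ^ L, snd r) (coarsen K L n y)"
    proof (rule causal[unfolded causal_def, rule_format])
      fix a b assume "a < fst (fst r div 2 ^ L, snd r)"
      then have "Suc a \<le> fst r div 2 ^ L" by simp
      then have "Suc a * 2 ^ L \<le> fst r" by (metis div_times_less_eq_dividend mult_le_mono1 order_trans)
      then have ne: "((a * 2 ^ L + i, b) = q) = False" if "i < 2 ^ L" for i
        using that \<open>fst r \<le> fst q\<close> by (auto simp: prod_eq_iff)
      then show "coarsen K L n (y(q := x)) (a, b) = coarsen K L n y (a, b)"
        by (simp add: coarsen_def fun_upd_def ne)
    qed
    then show ?thesis using True by (simp add: c'_def)
  qed (simp add: c'_def)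
  define f :: "(nat \<times> nat \<Rightarrow> real) \<Rightarrow> ennreal" where "f y = indicator D (rebuild ?K ?n y)" for y
  have f_meas: "f \<in> borel_measurable borel"
    unfolding f_def using D by measurable
  have gir: "(\<integral>\<^sup>+\<omega>. f (\<lambda>q. ?Z \<omega> q + (if q \<in> ?Q then ?h * c' q (?Z \<omega>) else 0))
      * ennreal (exp (- (\<Sum>q\<in>?Q. c' q (?Z \<omega>) * ?Z \<omega> q) - ?h / 2 * (\<Sum>q\<in>?Q. (c' q (?Z \<omega>))\<^sup>2))) \<partial>M)
    = (\<integral>\<^sup>+\<omega>. f (?Z \<omega>) \<partial>M)"
  proof (rule G.girsanov[where rk = fst, OF c'_meas _ order_refl _ f_meas])
    show "c' r (y(q := x)) = c' r y" if "fst r \<le> fst q" for q r y x using that by (rule dep)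
  qed simp
  \<comment> \<open>Refinement does not change the weight: fine increments sum to coarse ones, and
    \<open>2 ^ L\<close> fine blocks of length \<open>T / 2 ^ (K + L)\<close> carry the energy of
    one coarse block.\<close>
  have weight: "- (\<Sum>q\<in>?Q. c' q (?Z \<omega>) * ?Z \<omega> q) - ?h / 2 * (\<Sum>q\<in>?Q. (c' q (?Z \<omega>))\<^sup>2) = density_weight K n c \<omega>" for \<omega>
  proof -
    let ?c = "\<lambda>a b. c (a, b) (inc K n \<omega>)"
    have Q: "(\<Sum>q\<in>?Q. g q) = (\<Sum>b<n. \<Sum>a<2 ^ K. \<Sum>i<2 ^ L. g (a * 2 ^ L + i, b))"
      if "\<And>a b. n \<le> b \<Longrightarrow> g (a, b) = 0" for g :: "nat \<times> nat \<Rightarrow> real"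
    proof -
      have "(\<Sum>q\<in>?Q. g q) = (\<Sum>a<2 ^ ?K. \<Sum>b<?n. g (a, b))" by (simp add: sum.cartesian_product)
      also have "\<dots> = (\<Sum>a<2 ^ ?K. \<Sum>b<n. g (a, b))"
        using that by (intro sum.cong refl sum.mono_neutral_right) auto
      also have "\<dots> = (\<Sum>b<n. \<Sum>a<2 ^ ?K. g (a, b))" by (rule sum.swap)
      also have "\<dots> = (\<Sum>b<n. \<Sum>a<2 ^ K. \<Sum>i<2 ^ L. g (a * 2 ^ L + i, b))" by (simp only: sum_blocks)
      finally show ?thesis .
    qed
    have R: "(\<Sum>q\<in>{..<2 ^ K} \<times> {..<n}. g q) = (\<Sum>b<n. \<Sum>a<2 ^ K. g (a, b))" for g :: "nat \<times> nat \<Rightarrow> real"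
      using sum.swap[of "\<lambda>a b. g (a, b)" "{..<n}" "{..<2 ^ K}"] by (simp add: sum.cartesian_product)
    have dv: "(a * 2 ^ L + i) div 2 ^ L = a" if "i < 2 ^ L" for a i :: nat using that by simp
    have "(\<Sum>q\<in>?Q. c' q (?Z \<omega>) * ?Z \<omega> q) = (\<Sum>b<n. \<Sum>a<2 ^ K. ?c a b * (\<Sum>i<2 ^ L. ?Z \<omega> (a * 2 ^ L + i, b)))"
      by (subst Q) (auto simp: c'_Z dv sum_distrib_left intro!: sum.cong)
    also have "\<dots> = (\<Sum>b<n. \<Sum>a<2 ^ K. ?c a b * inc K n \<omega> (a, b))"
      unfolding coarsen[of \<omega>, symmetric] by (intro sum.cong refl) (simp add: coarsen_def)
    finally have 1: "(\<Sum>q\<in>?Q. c' q (?Z \<omega>) * ?Z \<omega> q) = (\<Sum>q\<in>{..<2 ^ K} \<times> {..<n}. c q (inc K n \<omega>) * inc K n \<omega> q)"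
      by (simp add: R)
    have "(\<Sum>q\<in>?Q. (c' q (?Z \<omega>))\<^sup>2) = (\<Sum>b<n. \<Sum>a<2 ^ K. 2 ^ L * (?c a b)\<^sup>2)"
      by (subst Q) (auto simp: c'_Z dv intro!: sum.cong)
    then have "(\<Sum>q\<in>?Q. (c' q (?Z \<omega>))\<^sup>2) = 2 ^ L * (\<Sum>q\<in>{..<2 ^ K} \<times> {..<n}. (c q (inc K n \<omega>))\<^sup>2)"
      by (simp add: R sum_distrib_left)
    then show ?thesis unfolding density_weight_def 1 by (simp add: power_add)
  qed
  have vB: "AE \<omega> in M. grid_values T ?K ?n (BM_path T B \<omega>) = rebuild ?K ?n (?Z \<omega>)"
    using B_0
  proof eventually_elim
    case (elim \<omega>)
    show ?case
    proof (rule grid_values_eq_rebuild)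
      show "BM_path T B \<omega> 0 j = 0" for j using elim T by (simp add: BM_path_def)
      fix a j :: nat assume "a < 2 ^ ?K" "j < ?n"
      then show "BM_path T B \<omega> (grid T ?K (Suc a)) j - BM_path T B \<omega> (grid T ?K a) j = ?Z \<omega> (a, j)"
        using grid_in[of T a ?K] grid_in[of T "Suc a" ?K] T by (simp add: BM_path_def inc_def)
    qed
  qed
  have vY: "AE \<omega> in M. grid_values T ?K ?n (steered_path K n c \<omega>)
    = rebuild ?K ?n (\<lambda>q. ?Z \<omega> q + (if q \<in> ?Q then ?h * c' q (?Z \<omega>) else 0))"
    using B_0
  proof eventually_elim
    case (elim \<omega>)
    let ?\<kappa> = "\<lambda>q. c q (inc K n \<omega>)"
    show ?case
    proof (rule grid_values_eq_rebuild)
      have "overlap T K 0 a = 0" for a using overlap_grid[OF T, of K 0 a] by simp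
      then show "steered_path K n c \<omega> 0 j = 0" for j
        using elim T by (simp add: steered_path_def controlled_path_def primitive_step[OF T])
      fix a j :: nat assume aj: "a < 2 ^ ?K" "j < ?n"
      let ?t = "grid T ?K a" and ?t' = "grid T ?K (Suc a)"
      have t: "?t \<in> {0..T}" "?t' \<in> {0..T}" using aj T by (auto intro!: grid_in simp del: atLeastAtMost_iff)
      have "primitive T (step T K n ?\<kappa>) ?t' j - primitive T (step T K n ?\<kappa>) ?t j
        = (if j < n then \<Sum>b<2 ^ K. ?\<kappa> (b, j) * (overlap T K ?t' b - overlap T K ?t b) else 0)"
        using primitive_step[OF T t(1)] primitive_step[OF T t(2)] by (simp add: sum_subtractf right_diff_distrib)
      also have "\<dots> = (if j < n then \<Sum>b<2 ^ K. if a div 2 ^ L = b then ?h * ?\<kappa> (b, j) else 0 else 0)"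
        by (intro if_cong refl sum.cong) (simp add: overlap_refined_increment[OF T] del: power_add)
      also have "\<dots> = ?h * c' (a, j) (?Z \<omega>)"
        using div[OF aj(1)] by (simp add: c'_Z sum.delta)
      finally have p: "primitive T (step T K n ?\<kappa>) ?t' j - primitive T (step T K n ?\<kappa>) ?t j = ?h * c' (a, j) (?Z \<omega>)" .
      have "steered_path K n c \<omega> ?t' j - steered_path K n c \<omega> ?t j
        = (B j ?t' \<omega> - B j ?t \<omega>) + (primitive T (step T K n ?\<kappa>) ?t' j - primitive T (step T K n ?\<kappa>) ?t j)"
        using t by (simp add: steered_path_def controlled_path_def)
      then show "steered_path K n c \<omega> ?t' j - steered_path K n c \<omega> ?t j
        = ?Z \<omega> (a, j) + (if (a, j) \<in> ?Q then ?h * c' (a, j) (?Z \<omega>) else 0)"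
        unfolding p using aj by (simp add: inc_def)
    qed
  qed
  have "(\<integral>\<^sup>+\<omega>. indicator (grid_values T ?K ?n -` D) (steered_path K n c \<omega>) * ennreal (exp (density_weight K n c \<omega>)) \<partial>M)
    = (\<integral>\<^sup>+\<omega>. f (\<lambda>q. ?Z \<omega> q + (if q \<in> ?Q then ?h * c' q (?Z \<omega>) else 0)) * ennreal (exp (density_weight K n c \<omega>)) \<partial>M)"
    using vY by (intro nn_integral_cong_AE) (auto elim!: eventually_mono simp: f_def indicator_def)
  also have "\<dots> = (\<integral>\<^sup>+\<omega>. f (?Z \<omega>) \<partial>M)"
    using gir unfolding weight .
  also have "\<dots> = (\<integral>\<^sup>+\<omega>. indicator (grid_values T ?K ?n -` D) (BM_path T B \<omega>) \<partial>M)"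
    using vB by (intro nn_integral_cong_AE) (auto elim!: eventually_mono simp: f_def indicator_def)
  finally show ?thesis .
qed

text \<open>Grid events are stable under intersection and generate the path sigma-algebra, so the
  identity on them determines the weighted law of the steered path.\<close>

theorem girsanov_path:
  assumes c: "\<And>q. c q \<in> borel_measurable borel" and causal: "causal c"
    and g: "g \<in> borel_measurable (path_space T)"
  shows "(\<integral>\<^sup>+\<omega>. g (steered_path K n c \<omega>) * ennreal (exp (density_weight K n c \<omega>)) \<partial>M)
    = (\<integral>\<^sup>+\<omega>. g (BM_path T B \<omega>) \<partial>M)"
proof -
  note [measurable] = measurable_steered_path[OF c] measurable_density_weight[OF c] g
  let ?W = "\<lambda>\<omega>. ennreal (exp (density_weight K n c \<omega>))"
  let ?\<mu> = "distr (density M ?W) (path_space T) (steered_path K n c)"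
  let ?\<nu> = "distr M (path_space T) (BM_path T B)"
  let ?S = "mspace (path_metric T)"
  have steered: "steered_path K n c \<omega> \<in> ?S" and bm: "BM_path T B \<omega> \<in> ?S" if "\<omega> \<in> space M" for \<omega>
    using measurable_space[OF measurable_steered_path[OF c] that] measurable_space[OF measurable_BM_path that]
    by (simp_all add: space_path_space)
  have eq: "emeasure ?\<mu> A = emeasure ?\<nu> A" if A_in: "A \<in> grid_events T" for A
  proof -
    obtain L m D where A: "A = grid_values T L m -` D \<inter> ?S" and "D \<in> sets borel"
      using A_in by (auto simp: grid_events_def)
    then obtain D' where D': "D' \<in> sets borel" "grid_values T L m -` D = grid_values T (K + L) (n + m) -` D'"
      using grid_event_refine[OF le_add2[of L K] le_add2[of m n], of D T] by blast
    have [measurable]: "A \<in> sets (path_space T)"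
      using A_in sets_path_space_grid_events[OF T] by (auto intro: sigma_sets.Basic)
    have "emeasure ?\<mu> A = (\<integral>\<^sup>+\<omega>. ?W \<omega> * indicator (steered_path K n c -` A \<inter> space M) \<omega> \<partial>M)"
      by (subst emeasure_distr) (auto simp: emeasure_density)
    also have "\<dots> = (\<integral>\<^sup>+\<omega>. indicator (grid_values T (K + L) (n + m) -` D') (steered_path K n c \<omega>) * ?W \<omega> \<partial>M)"
      unfolding A D'(2) by (intro nn_integral_cong) (auto simp: indicator_def steered)
    also have "\<dots> = (\<integral>\<^sup>+\<omega>. indicator (grid_values T (K + L) (n + m) -` D') (BM_path T B \<omega>) \<partial>M)"
      by (rule girsanov_grid_event[OF c causal D'(1)])
    also have "\<dots> = (\<integral>\<^sup>+\<omega>. indicator (BM_path T B -` A \<inter> space M) \<omega> \<partial>M)"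
      unfolding A D'(2) by (intro nn_integral_cong) (auto simp: indicator_def bm)
    also have "\<dots> = emeasure ?\<nu> A"
      by (subst emeasure_distr) auto
    finally show ?thesis .
  qed
  have "?\<mu> = ?\<nu>"
  proof (rule measure_eqI_generator_eq[OF Int_stable_grid_events _ eq])
    show "grid_events T \<subseteq> Pow ?S" by (auto simp: grid_events_def)
    show "sets ?\<mu> = sigma_sets ?S (grid_events T)" "sets ?\<nu> = sigma_sets ?S (grid_events T)"
      by (simp_all add: sets_path_space_grid_events[OF T])
    have S: "?S \<in> grid_events T"
      unfolding grid_events_def by (rule CollectI, rule exI[of _ 0], rule exI[of _ 0], rule exI[of _ UNIV]) auto
    then show "range (\<lambda>i :: nat. ?S) \<subseteq> grid_events T" by auto
    show "(\<Union>i :: nat. ?S) = ?S" by simp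
    interpret N: prob_space ?\<nu> by (rule prob_space_distr) measurable
    show "emeasure ?\<mu> ?S \<noteq> \<infinity>" using eq[OF S] by simp
  qed
  have "(\<integral>\<^sup>+\<omega>. g (steered_path K n c \<omega>) * ?W \<omega> \<partial>M) = (\<integral>\<^sup>+w. g w \<partial>?\<mu>)"
    by (subst nn_integral_distr) (simp_all add: nn_integral_density mult.commute)
  also have "\<dots> = (\<integral>\<^sup>+w. g w \<partial>?\<nu>)" unfolding \<open>?\<mu> = ?\<nu>\<close> ..
  also have "\<dots> = (\<integral>\<^sup>+\<omega>. g (BM_path T B \<omega>) \<partial>M)" by (simp add: nn_integral_distr)
  finally show ?thesis .
qed

text \<open>Jensen's inequality in the form \<open>1 + E X \<le> E exp X\<close>, applied after the Girsanov identity.\<close>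

lemma entropy_bound:
  assumes c: "\<And>q. c q \<in> borel_measurable borel" and causal: "causal c" and bound: "\<And>q z. \<bar>c q z\<bar> \<le> C"
    and E: "E \<in> sets (path_space T)" and L: "0 \<le> L"
    and small: "prob {\<omega>\<in>space M. BM_path T B \<omega> \<in> E} \<le> exp (- L)"
  shows "prob {\<omega>\<in>space M. steered_path K n c \<omega> \<in> E} * L
    \<le> T / 2 ^ K / 2 * (\<Sum>q\<in>{..<2 ^ K} \<times> {..<n}. expectation (\<lambda>\<omega>. (c q (inc K n \<omega>))\<^sup>2)) + ln 2"
proof -
  interpret G: gaussian_family M "inc K n" "{..<2 ^ K} \<times> {..<n}" "T / 2 ^ K" by (rule gaussian_family_inc)
  note [measurable] = measurable_steered_path[OF c] measurable_density_weight[OF c] E c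
  define A where "A = {\<omega>\<in>space M. steered_path K n c \<omega> \<in> E}"
  define A' where "A' = {\<omega>\<in>space M. BM_path T B \<omega> \<in> E}"
  have [measurable]: "A \<in> events" "A' \<in> events" unfolding A_def A'_def by measurable
  define g :: "(real \<Rightarrow> nat \<Rightarrow> real) \<Rightarrow> ennreal" where "g w = ennreal (exp (L * indicator E w))" for w
  have g[measurable]: "g \<in> borel_measurable (path_space T)" unfolding g_def by measurable
  define X where "X \<omega> = L * indicator A \<omega> + density_weight K n c \<omega>" for \<omega>
  have sq: "integrable M (\<lambda>\<omega>. (c q (inc K n \<omega>))\<^sup>2)" for q
  proof (rule integrable_const_bound[where B = "C\<^sup>2"])
    have "(c q z)\<^sup>2 \<le> C\<^sup>2" for z
      using bound[of q z] by (simp add: abs_le_square_iff[symmetric])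
    then show "AE \<omega> in M. norm ((c q (inc K n \<omega>))\<^sup>2) \<le> C\<^sup>2" by simp
  qed measurable
  \<comment> \<open>By causality the linear part of the weight has mean zero, so the mean of the
    weight is minus half the expected energy.\<close>
  note cz = G.expectation_adapted_zero[OF c bound causal_upd[OF causal order_refl]]
  have w_int: "integrable M (density_weight K n c)"
    and w_exp: "expectation (density_weight K n c) = - (T / 2 ^ K / 2 * (\<Sum>q\<in>{..<2 ^ K} \<times> {..<n}. expectation (\<lambda>\<omega>. (c q (inc K n \<omega>))\<^sup>2)))"
    unfolding density_weight_def by (simp_all add: cz sq)
  have X_int: "integrable M X" unfolding X_def
    by (intro Bochner_Integration.integrable_add w_int integrable_mult_right) (simp add: emeasure_eq_measure)
  have "(\<integral>\<^sup>+\<omega>. ennreal (exp (X \<omega>)) \<partial>M) = (\<integral>\<^sup>+\<omega>. g (steered_path K n c \<omega>) * ennreal (exp (density_weight K n c \<omega>)) \<partial>M)"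
    by (intro nn_integral_cong) (simp add: X_def A_def g_def exp_add ennreal_mult indicator_def)
  also have "\<dots> = (\<integral>\<^sup>+\<omega>. g (BM_path T B \<omega>) \<partial>M)"
    by (rule girsanov_path[OF c causal g])
  \<comment> \<open>After the change of measure the exponential moment is at most
    \<open>1 + exp L * exp (- L) = 2\<close>, the origin of \<open>ln 2\<close>.\<close>
  also have "(\<integral>\<^sup>+\<omega>. g (BM_path T B \<omega>) \<partial>M) \<le> (\<integral>\<^sup>+\<omega>. 1 + ennreal (exp L) * indicator A' \<omega> \<partial>M)"
    by (intro nn_integral_mono) (auto simp: g_def A'_def indicator_def)
  also have "\<dots> = 1 + ennreal (exp L) * emeasure M A'"
    by (subst nn_integral_add) (simp_all add: nn_integral_cmult emeasure_space_1)
  also have "\<dots> \<le> 1 + ennreal (exp L) * ennreal (exp (- L))"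
    using small by (intro add_left_mono mult_left_mono) (auto simp: A'_def emeasure_eq_measure ennreal_leI)
  also have "\<dots> = ennreal 2" by (simp add: ennreal_mult[symmetric] exp_minus)
  finally have nn: "(\<integral>\<^sup>+\<omega>. ennreal (exp (X \<omega>)) \<partial>M) \<le> ennreal 2" .
  have [measurable]: "X \<in> borel_measurable M" unfolding X_def by measurable
  have eX: "integrable M (\<lambda>\<omega>. exp (X \<omega>))"
    by (rule integrableI_nonneg) (use nn in \<open>auto simp: less_top[symmetric] top_unique\<close>)
  have "expectation (\<lambda>\<omega>. exp (X \<omega>)) \<le> 2"
    using nn by (subst (asm) nn_integral_eq_integral[OF eX]) (auto simp: ennreal_le_iff simp del: ennreal_numeral)
  moreover have "expectation (\<lambda>\<omega>. 1 + (X \<omega> - ln 2)) \<le> expectation (\<lambda>\<omega>. exp (X \<omega>) / 2)"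
  proof (rule integral_mono)
    show "1 + (X \<omega> - ln 2) \<le> exp (X \<omega>) / 2" for \<omega>
      using exp_ge_add_one_self[of "X \<omega> - ln 2"] by (simp add: exp_diff)
  qed (use X_int eX in auto)
  ultimately have "expectation X \<le> ln 2" using X_int eX by (simp add: prob_space)
  moreover have "expectation X = L * prob A + expectation (density_weight K n c)"
    unfolding X_def using w_int by (simp add: emeasure_eq_measure)
  ultimately show ?thesis unfolding w_exp A_def by (simp add: mult.commute)
qed

end

section \<open>Smooth cylinder functions\<close>

text \<open>The sum norm over \<open>J\<close> is not increased by \<open>coarsen\<close>, so the
  same \<open>C\<close> survives refinement of the grid; values in \<open>[0, 1]\<close> make the
  class stable under products.\<close>

definition smooth_with :: "real \<Rightarrow> 'i set \<Rightarrow> (('i::countable \<Rightarrow> real) \<Rightarrow> real) \<Rightarrow> ('i \<Rightarrow> ('i \<Rightarrow> real) \<Rightarrow> real) \<Rightarrow> bool" where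
  "smooth_with C J f D \<longleftrightarrow> f \<in> borel_measurable borel \<and> (\<forall>q. D q \<in> borel_measurable borel) \<and>
     (\<forall>y. 0 \<le> f y \<and> f y \<le> 1) \<and> 0 \<le> C \<and> (\<forall>q y. \<bar>D q y\<bar> \<le> C) \<and>
     (\<forall>y v. \<bar>f (\<lambda>q. y q + v q) - f y\<bar> \<le> C * (\<Sum>q\<in>J. \<bar>v q\<bar>)) \<and>
     (\<forall>y v. \<bar>f (\<lambda>q. y q + v q) - f y - (\<Sum>q\<in>J. D q y * v q)\<bar> \<le> C * (\<Sum>q\<in>J. \<bar>v q\<bar>)\<^sup>2)"

lemma smooth_withD:
  assumes "smooth_with C J f D"
  shows "f \<in> borel_measurable borel" "D q \<in> borel_measurable borel" "0 \<le> f y" "f y \<le> 1" "0 \<le> C" "\<bar>D q y\<bar> \<le> C"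
    "\<bar>f (\<lambda>q. y q + v q) - f y\<bar> \<le> C * (\<Sum>q\<in>J. \<bar>v q\<bar>)"
    "\<bar>f (\<lambda>q. y q + v q) - f y - (\<Sum>q\<in>J. D q y * v q)\<bar> \<le> C * (\<Sum>q\<in>J. \<bar>v q\<bar>)\<^sup>2"
  using assms unfolding smooth_with_def by blast+

lemma smooth_with_const: "0 \<le> a \<Longrightarrow> a \<le> 1 \<Longrightarrow> smooth_with 0 J (\<lambda>_. a) (\<lambda>_ _. 0)"
  by (simp add: smooth_with_def)

lemma smooth_with_compl:
  assumes "smooth_with C J f D"
  shows "smooth_with C J (\<lambda>y. 1 - f y) (\<lambda>q y. - D q y)"
  unfolding smooth_with_def
proof (intro conjI allI)
  note s = smooth_withD[OF assms]
  show "(\<lambda>y. 1 - f y) \<in> borel_measurable borel" using s(1) by simp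
  show "(\<lambda>y. - D q y) \<in> borel_measurable borel" for q using s(2) by simp
  show "0 \<le> 1 - f y" "1 - f y \<le> 1" "0 \<le> C" "\<bar>- D q y\<bar> \<le> C" for q y using s(3-6) by simp_all
  show "\<bar>1 - f (\<lambda>q. y q + v q) - (1 - f y)\<bar> \<le> C * (\<Sum>q\<in>J. \<bar>v q\<bar>)" for y v
    using s(7)[of y v] by (simp add: abs_minus_commute)
  show "\<bar>1 - f (\<lambda>q. y q + v q) - (1 - f y) - (\<Sum>q\<in>J. - D q y * v q)\<bar> \<le> C * (\<Sum>q\<in>J. \<bar>v q\<bar>)\<^sup>2" for y v
  proof -
    have "1 - f (\<lambda>q. y q + v q) - (1 - f y) - (\<Sum>q\<in>J. - D q y * v q)
        = - (f (\<lambda>q. y q + v q) - f y - (\<Sum>q\<in>J. D q y * v q))"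
      by (simp add: sum_negf)
    then show ?thesis using s(8)[of y v] by (simp only: abs_minus_cancel)
  qed
qed

text \<open>Product rule; the mixed term \<open>(f' - f y) * (g' - g y)\<close> is the source of
  \<open>C1 * C2\<close>.\<close>

lemma smooth_with_mult:
  assumes f: "smooth_with C1 J f D1" and g: "smooth_with C2 J g D2"
  shows "smooth_with (C1 + C2 + C1 * C2) J (\<lambda>y. f y * g y) (\<lambda>q y. D1 q y * g y + f y * D2 q y)"
  unfolding smooth_with_def
proof (intro conjI allI)
  note sf = smooth_withD[OF f] and sg = smooth_withD[OF g]
  have C: "0 \<le> C1" "0 \<le> C2" "0 \<le> C1 * C2" using sf(5) sg(5) by auto
  show "(\<lambda>y. f y * g y) \<in> borel_measurable borel" using sf(1) sg(1) by simp
  show "(\<lambda>y. D1 q y * g y + f y * D2 q y) \<in> borel_measurable borel" for q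
    using sf(1,2) sg(1,2) by simp
  show "0 \<le> f y * g y" "f y * g y \<le> 1" for y using sf(3,4) sg(3,4) by (simp_all add: mult_le_one)
  show "0 \<le> C1 + C2 + C1 * C2" using C by simp
  have bd: "\<bar>a * b\<bar> \<le> c" if "\<bar>a\<bar> \<le> c" "0 \<le> b" "b \<le> 1" for a b c :: real
    using mult_mono[OF that(1) that(3)] that by (auto simp: abs_mult)
  have bd': "\<bar>b * a\<bar> \<le> c" if "\<bar>a\<bar> \<le> c" "0 \<le> b" "b \<le> 1" for a b c :: real
    using bd[OF that] by (simp add: mult.commute)
  show "\<bar>D1 q y * g y + f y * D2 q y\<bar> \<le> C1 + C2 + C1 * C2" for q y
    using abs_triangle_ineq[of "D1 q y * g y" "f y * D2 q y"] bd[OF sf(6)[of q y] sg(3)[of y] sg(4)[of y]]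
      bd'[OF sg(6)[of q y] sf(3)[of y] sf(4)[of y]] C by linarith
  fix y v :: "_ \<Rightarrow> real"
  define s where "s = (\<Sum>q\<in>J. \<bar>v q\<bar>)"
  define f' g' a b where "f' = f (\<lambda>q. y q + v q)" and "g' = g (\<lambda>q. y q + v q)"
    and "a = (\<Sum>q\<in>J. D1 q y * v q)" and "b = (\<Sum>q\<in>J. D2 q y * v q)"
  have s: "0 \<le> s" by (simp add: s_def sum_nonneg)
  have fl: "\<bar>f' - f y\<bar> \<le> C1 * s" and gl: "\<bar>g' - g y\<bar> \<le> C2 * s"
    and fr: "\<bar>f' - f y - a\<bar> \<le> C1 * s\<^sup>2" and gr: "\<bar>g' - g y - b\<bar> \<le> C2 * s\<^sup>2"
    using sf(7,8)[of y v] sg(7,8)[of y v] by (simp_all add: f'_def g'_def a_def b_def s_def)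
  have g'1: "0 \<le> g'" "g' \<le> 1" by (simp_all add: g'_def sg)
  have "f' * g' - f y * g y = (f' - f y) * g' + f y * (g' - g y)" by (simp add: algebra_simps)
  then have "\<bar>f' * g' - f y * g y\<bar> \<le> \<bar>(f' - f y) * g'\<bar> + \<bar>f y * (g' - g y)\<bar>"
    using abs_triangle_ineq by simp
  also have "\<dots> \<le> C1 * s + C2 * s"
    by (intro add_mono bd[OF fl g'1] bd'[OF gl sf(3,4)])
  also have "\<dots> \<le> (C1 + C2 + C1 * C2) * s" using C s by (simp add: algebra_simps)
  finally show "\<bar>f (\<lambda>q. y q + v q) * g (\<lambda>q. y q + v q) - f y * g y\<bar> \<le> (C1 + C2 + C1 * C2) * (\<Sum>q\<in>J. \<bar>v q\<bar>)"
    by (simp add: f'_def g'_def s_def)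
  have lin: "(\<Sum>q\<in>J. (D1 q y * g y + f y * D2 q y) * v q) = a * g y + f y * b"
    by (simp add: a_def b_def sum_distrib_left sum_distrib_right sum.distrib[symmetric] algebra_simps)
  have "f' * g' - f y * g y - (a * g y + f y * b)
      = (f' - f y - a) * g y + f y * (g' - g y - b) + (f' - f y) * (g' - g y)"
    by (simp add: algebra_simps)
  then have "\<bar>f' * g' - f y * g y - (a * g y + f y * b)\<bar>
      \<le> \<bar>(f' - f y - a) * g y\<bar> + \<bar>f y * (g' - g y - b)\<bar> + \<bar>(f' - f y) * (g' - g y)\<bar>"
    using abs_triangle_ineq[of "(f' - f y - a) * g y + f y * (g' - g y - b)" "(f' - f y) * (g' - g y)"]
      abs_triangle_ineq[of "(f' - f y - a) * g y" "f y * (g' - g y - b)"] by simp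
  also have "\<dots> \<le> C1 * s\<^sup>2 + C2 * s\<^sup>2 + (C1 * s) * (C2 * s)"
    using C s by (intro add_mono bd[OF fr sg(3,4)] bd'[OF gr sf(3,4)]) (simp add: abs_mult mult_mono fl gl)
  also have "\<dots> = (C1 + C2 + C1 * C2) * s\<^sup>2" by (simp add: algebra_simps power2_eq_square)
  finally show "\<bar>f (\<lambda>q. y q + v q) * g (\<lambda>q. y q + v q) - f y * g y - (\<Sum>q\<in>J. (D1 q y * g y + f y * D2 q y) * v q)\<bar>
      \<le> (C1 + C2 + C1 * C2) * (\<Sum>q\<in>J. \<bar>v q\<bar>)\<^sup>2"
    unfolding lin by (simp add: f'_def g'_def s_def)
qed

text \<open>Its derivative is a polynomial in the function itself, so Lipschitz and remainder bounds
  follow from the values lying in \<open>[0, 1]\<close>.\<close>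

definition logistic :: "real \<Rightarrow> real" where
  "logistic t = 1 / (1 + exp (- t))"

lemma logistic_bounds: "0 \<le> logistic t" "logistic t \<le> 1"
  by (auto simp: logistic_def add_pos_pos)

lemma DERIV_logistic: "(logistic has_real_derivative logistic t * (1 - logistic t)) (at t)"
proof -
  have ne: "1 + exp (- t) \<noteq> 0" using exp_gt_zero[of "- t"] by linarith
  show ?thesis unfolding logistic_def[abs_def]
    by (rule derivative_eq_intros refl ne | simp add: ne field_simps power2_eq_square)+
qed

lemma mean_value:
  fixes f f' :: "real \<Rightarrow> real"
  assumes "\<And>t. (f has_real_derivative f' t) (at t)"
  shows "\<exists>z. \<bar>z - x\<bar> \<le> \<bar>d\<bar> \<and> f (x + d) - f x = d * f' z"
proof -
  consider "d = 0" | "0 < d" | "d < 0" by linarith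
  then show ?thesis
  proof cases
    case 2
    then obtain z where "x < z" "z < x + d" "f (x + d) - f x = (x + d - x) * f' z"
      using MVT2[of x "x + d" f f'] assms by auto
    then show ?thesis by (intro exI[of _ z]) auto
  next
    case 3
    then obtain z where "x + d < z" "z < x" "f x - f (x + d) = (x - (x + d)) * f' z"
      using MVT2[of "x + d" x f f'] assms by auto
    then show ?thesis by (intro exI[of _ z]) auto
  qed auto
qed

lemma logistic_lip: "\<bar>logistic (x + d) - logistic x\<bar> \<le> \<bar>d\<bar>"
proof -
  obtain z where "logistic (x + d) - logistic x = d * (logistic z * (1 - logistic z))"
    using mean_value[OF DERIV_logistic] by blast
  moreover have "\<bar>logistic z * (1 - logistic z)\<bar> \<le> 1"
    using logistic_bounds[of z] by (simp add: abs_mult mult_le_one)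
  ultimately show ?thesis by (simp add: abs_mult mult_left_le)
qed

text \<open>The derivative is again 1-Lipschitz: its differences factor through
  \<open>1 - logistic z - logistic x\<close>, which has modulus at most 1.\<close>

lemma logistic_remainder: "\<bar>logistic (x + d) - logistic x - d * (logistic x * (1 - logistic x))\<bar> \<le> d\<^sup>2"
proof -
  obtain z where z: "\<bar>z - x\<bar> \<le> \<bar>d\<bar>" "logistic (x + d) - logistic x = d * (logistic z * (1 - logistic z))"
    using mean_value[OF DERIV_logistic] by blast
  have "logistic z * (1 - logistic z) - logistic x * (1 - logistic x) = (logistic z - logistic x) * (1 - logistic z - logistic x)"
    by (simp add: algebra_simps)
  also have "\<bar>\<dots>\<bar> \<le> \<bar>d\<bar> * 1"
    unfolding abs_mult
    using logistic_lip[of x "z - x"] z(1) logistic_bounds[of z] logistic_bounds[of x]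
    by (intro mult_mono) auto
  finally have "\<bar>d\<bar> * \<bar>logistic z * (1 - logistic z) - logistic x * (1 - logistic x)\<bar> \<le> \<bar>d\<bar> * \<bar>d\<bar>"
    by (intro mult_left_mono) auto
  then show ?thesis unfolding z(2) right_diff_distrib[symmetric] abs_mult by (simp add: power2_eq_square)
qed

lemma smooth_with_logistic:
  fixes J A :: "'i::countable set"
  assumes J: "finite J" "A \<subseteq> J"
  shows "smooth_with (\<bar>c\<bar> + c\<^sup>2) J (\<lambda>y. logistic (c * (\<Sum>q\<in>A. y q) + b))
    (\<lambda>q y. if q \<in> A then c * (logistic (c * (\<Sum>q\<in>A. y q) + b) * (1 - logistic (c * (\<Sum>q\<in>A. y q) + b))) else 0)"
  unfolding smooth_with_def
proof (intro conjI allI)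
  let ?l = "\<lambda>y. logistic (c * (\<Sum>q\<in>A. y q) + b)"
  have [measurable]: "(\<lambda>y. y q) \<in> borel_measurable (borel :: ('i \<Rightarrow> real) measure)" for q
    by (rule measurable_product_then_coordinatewise) simp
  have m: "?l \<in> borel_measurable borel"
    unfolding logistic_def by measurable
  then show "?l \<in> borel_measurable borel" .
  show "(\<lambda>y. if q \<in> A then c * (?l y * (1 - ?l y)) else 0) \<in> borel_measurable borel" for q
    using m by (cases "q \<in> A") simp_all
  show "0 \<le> ?l y" "?l y \<le> 1" for y by (rule logistic_bounds)+
  show "0 \<le> \<bar>c\<bar> + c\<^sup>2" by simp
  have l1: "\<bar>logistic t * (1 - logistic t)\<bar> \<le> 1" for t
    using logistic_bounds[of t] by (simp add: abs_mult mult_le_one)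
  show "\<bar>if q \<in> A then c * (?l y * (1 - ?l y)) else 0\<bar> \<le> \<bar>c\<bar> + c\<^sup>2" for q y
    using mult_left_mono[OF l1[of "c * (\<Sum>q\<in>A. y q) + b"], of "\<bar>c\<bar>"]
    by (auto simp: abs_mult intro: add_increasing2)
  fix y v :: "_ \<Rightarrow> real"
  let ?t = "c * (\<Sum>q\<in>A. y q) + b" and ?d = "c * (\<Sum>q\<in>A. v q)" and ?s = "\<Sum>q\<in>J. \<bar>v q\<bar>"
  have eq: "c * (\<Sum>q\<in>A. y q + v q) + b = ?t + ?d" by (simp add: sum.distrib algebra_simps)
  have s: "0 \<le> ?s" by (simp add: sum_nonneg)
  have "\<bar>\<Sum>q\<in>A. v q\<bar> \<le> (\<Sum>q\<in>A. \<bar>v q\<bar>)" by (rule sum_abs)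
  also have "\<dots> \<le> ?s" by (rule sum_mono2) (use J in auto)
  finally have vs: "\<bar>\<Sum>q\<in>A. v q\<bar> \<le> ?s" .
  then have d: "\<bar>?d\<bar> \<le> \<bar>c\<bar> * ?s" by (simp add: abs_mult mult_left_mono)
  show "\<bar>logistic (c * (\<Sum>q\<in>A. y q + v q) + b) - logistic ?t\<bar> \<le> (\<bar>c\<bar> + c\<^sup>2) * ?s"
    unfolding eq using logistic_lip[of ?t ?d] d s by (simp add: distrib_right add_increasing2)
  have lin: "(\<Sum>q\<in>J. (if q \<in> A then c * (logistic ?t * (1 - logistic ?t)) else 0) * v q) = ?d * (logistic ?t * (1 - logistic ?t))"
  proof -
    have "(\<Sum>q\<in>J. (if q \<in> A then c * (logistic ?t * (1 - logistic ?t)) else 0) * v q)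
        = (\<Sum>q\<in>A. c * (logistic ?t * (1 - logistic ?t)) * v q)"
      using J by (intro sum.mono_neutral_cong_right) auto
    then show ?thesis by (simp add: sum_distrib_left sum_distrib_right ac_simps)
  qed
  have "\<bar>logistic (?t + ?d) - logistic ?t - ?d * (logistic ?t * (1 - logistic ?t))\<bar> \<le> ?d\<^sup>2"
    by (rule logistic_remainder)
  also have "\<dots> \<le> (\<bar>c\<bar> * ?s)\<^sup>2" using d s by (simp add: abs_le_square_iff[symmetric])
  also have "\<dots> \<le> (\<bar>c\<bar> + c\<^sup>2) * ?s\<^sup>2" by (simp add: power_mult_distrib distrib_right)
  finally show "\<bar>logistic (c * (\<Sum>q\<in>A. y q + v q) + b) - logistic ?t
      - (\<Sum>q\<in>J. (if q \<in> A then c * (logistic ?t * (1 - logistic ?t)) else 0) * v q)\<bar> \<le> (\<bar>c\<bar> + c\<^sup>2) * ?s\<^sup>2"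
    unfolding eq lin .
qed

text \<open>The slope \<open>(real m)\<^sup>2\<close> dominates the shift \<open>real m\<close> when
  \<open>c < 0\<close>, while the shift alone forces the limit 1 in the boundary case
  \<open>c = 0\<close>.\<close>

lemma logistic_near_indicator:
  "(\<lambda>m. logistic ((real m)\<^sup>2 * c + real m)) \<longlonglongrightarrow> (if 0 \<le> c then 1 else 0)"
proof (rule LIM_zero_cancel, rule Lim_null_comparison)
  have "(\<lambda>m. exp (-1 :: real) ^ m) \<longlonglongrightarrow> 0" by (rule LIMSEQ_power_zero) simp
  then show "(\<lambda>m. exp (- real m)) \<longlonglongrightarrow> 0" by (simp add: exp_of_nat_mult[symmetric])
  show "\<forall>\<^sub>F m in sequentially. norm (logistic ((real m)\<^sup>2 * c + real m) - (if 0 \<le> c then 1 else 0)) \<le> exp (- real m)"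
  proof (cases "0 \<le> c")
    case True
    have "\<bar>logistic ((real m)\<^sup>2 * c + real m) - 1\<bar> \<le> exp (- real m)" for m
    proof -
      define E where "E = exp (- ((real m)\<^sup>2 * c + real m))"
      have E: "0 < E" by (simp add: E_def)
      have "logistic ((real m)\<^sup>2 * c + real m) = 1 / (1 + E)" by (simp only: logistic_def E_def)
      then have "logistic ((real m)\<^sup>2 * c + real m) - 1 = - (E / (1 + E))"
        using E by (simp add: field_simps)
      also have "\<bar>\<dots>\<bar> \<le> E" using E by (simp add: field_simps)
      also have "\<dots> \<le> exp (- real m)" using True by (simp add: E_def)
      finally show ?thesis .
    qed
    then show ?thesis using True by simp
  next
    case False
    obtain N where N: "2 / (- c) \<le> real N" using real_arch_simple by blast
    have "\<bar>logistic ((real m)\<^sup>2 * c + real m)\<bar> \<le> exp (- real m)" if "N \<le> m" for m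
    proof -
      have "2 / (- c) \<le> real m" using N that by (meson of_nat_mono order_trans)
      then have "2 \<le> real m * (- c)" using False by (simp add: field_simps)
      then have "real m * 2 \<le> real m * (real m * (- c))" by (intro mult_left_mono) auto
      then have le: "(real m)\<^sup>2 * c + real m \<le> - real m" by (simp add: power2_eq_square)
      have "logistic ((real m)\<^sup>2 * c + real m) \<le> 1 / exp (- ((real m)\<^sup>2 * c + real m))"
        unfolding logistic_def by (intro divide_left_mono) (auto intro!: mult_pos_pos add_pos_pos)
      also have "\<dots> = exp ((real m)\<^sup>2 * c + real m)"
        by (subst exp_minus) (simp only: inverse_eq_divide divide_divide_eq_right mult_1 div_by_1)
      also have "\<dots> \<le> exp (- real m)" using le by simp
      finally show ?thesis using logistic_bounds by simp
    qed
    then show ?thesis using False by (auto simp: eventually_sequentially)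
  qed
qed

lemma abs_coarsen_sum_le:
  "(\<Sum>q\<in>{..<2 ^ K} \<times> {..<n}. \<bar>coarsen K L n v q\<bar>) \<le> (\<Sum>q\<in>{..<2 ^ (K + L)} \<times> {..<n}. \<bar>v q\<bar>)"
  and coarsen_sum: "(\<Sum>q\<in>{..<2 ^ K} \<times> {..<n}. d q * coarsen K L n v q)
    = (\<Sum>q\<in>{..<2 ^ (K + L)} \<times> {..<n}. d (fst q div 2 ^ L, snd q) * v q)"
proof -
  have R: "(\<Sum>q\<in>{..<2 ^ k} \<times> {..<n}. g q) = (\<Sum>b<n. \<Sum>a<2 ^ k. g (a, b))" for g :: "nat \<times> nat \<Rightarrow> real" and k
    using sum.swap[of "\<lambda>a b. g (a, b)" "{..<n}" "{..<2 ^ k}"] by (simp add: sum.cartesian_product)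
  have dv: "(a * 2 ^ L + i) div 2 ^ L = a" if "i < 2 ^ L" for a i :: nat using that by simp
  have "(\<Sum>b<n. \<Sum>a<2 ^ K. \<bar>coarsen K L n v (a, b)\<bar>) \<le> (\<Sum>b<n. \<Sum>a<2 ^ K. \<Sum>i<2 ^ L. \<bar>v (a * 2 ^ L + i, b)\<bar>)"
    by (intro sum_mono) (simp add: coarsen_def)
  then show "(\<Sum>q\<in>{..<2 ^ K} \<times> {..<n}. \<bar>coarsen K L n v q\<bar>) \<le> (\<Sum>q\<in>{..<2 ^ (K + L)} \<times> {..<n}. \<bar>v q\<bar>)"
    unfolding R sum_blocks .
  have "(\<Sum>b<n. \<Sum>a<2 ^ K. d (a, b) * coarsen K L n v (a, b)) = (\<Sum>b<n. \<Sum>a<2 ^ K. \<Sum>i<2 ^ L. d ((a * 2 ^ L + i) div 2 ^ L, b) * v (a * 2 ^ L + i, b))"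
    by (intro sum.cong refl) (simp add: coarsen_def sum_distrib_left dv)
  then show "(\<Sum>q\<in>{..<2 ^ K} \<times> {..<n}. d q * coarsen K L n v q)
    = (\<Sum>q\<in>{..<2 ^ (K + L)} \<times> {..<n}. d (fst q div 2 ^ L, snd q) * v q)"
    unfolding R sum_blocks by simp
qed

lemma coarsen_add: "coarsen K L n (\<lambda>q. y q + v q) = (\<lambda>q. coarsen K L n y q + coarsen K L n v q)"
  by (auto simp: coarsen_def fun_eq_iff sum.distrib)

text \<open>Chain rule through block sums: a fine coordinate inherits the derivative of the coarse
  coordinate that contains it.\<close>

lemma smooth_with_coarsen:
  assumes "smooth_with C ({..<2 ^ K} \<times> {..<n}) f D"
  shows "smooth_with C ({..<2 ^ (K + L)} \<times> {..<n}) (\<lambda>y. f (coarsen K L n y))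
    (\<lambda>q y. D (fst q div 2 ^ L, snd q) (coarsen K L n y))"
  unfolding smooth_with_def
proof (intro conjI allI)
  note s = smooth_withD[OF assms]
  show "(\<lambda>y. f (coarsen K L n y)) \<in> borel_measurable borel"
    by (rule measurable_compose[OF measurable_coarsen s(1)])
  show "(\<lambda>y. D (fst q div 2 ^ L, snd q) (coarsen K L n y)) \<in> borel_measurable borel" for q
    by (rule measurable_compose[OF measurable_coarsen s(2)])
  show "0 \<le> f (coarsen K L n y)" "f (coarsen K L n y) \<le> 1" "0 \<le> C" "\<bar>D (fst q div 2 ^ L, snd q) (coarsen K L n y)\<bar> \<le> C" for q y
    using s(3-6) by simp_all
  fix y v :: "_ \<Rightarrow> real"
  let ?u = "coarsen K L n v"
  have le: "(\<Sum>q\<in>{..<2 ^ K} \<times> {..<n}. \<bar>?u q\<bar>) \<le> (\<Sum>q\<in>{..<2 ^ (K + L)} \<times> {..<n}. \<bar>v q\<bar>)"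
    by (rule abs_coarsen_sum_le)
  show "\<bar>f (coarsen K L n (\<lambda>q. y q + v q)) - f (coarsen K L n y)\<bar> \<le> C * (\<Sum>q\<in>{..<2 ^ (K + L)} \<times> {..<n}. \<bar>v q\<bar>)"
    unfolding coarsen_add by (rule order_trans[OF s(7) mult_left_mono[OF le s(5)]])
  show "\<bar>f (coarsen K L n (\<lambda>q. y q + v q)) - f (coarsen K L n y)
      - (\<Sum>q\<in>{..<2 ^ (K + L)} \<times> {..<n}. D (fst q div 2 ^ L, snd q) (coarsen K L n y) * v q)\<bar>
      \<le> C * (\<Sum>q\<in>{..<2 ^ (K + L)} \<times> {..<n}. \<bar>v q\<bar>)\<^sup>2"
    unfolding coarsen_add coarsen_sum[where d = "\<lambda>q. D q (coarsen K L n y)", symmetric]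
    by (rule order_trans[OF s(8)], rule mult_left_mono[OF power_mono[OF le] s(5)]) (simp add: sum_nonneg)
qed

lemma smooth_with_mono:
  assumes "smooth_with C J f D" "J \<subseteq> J'" "finite J'"
  shows "smooth_with C J' f (\<lambda>q y. if q \<in> J then D q y else 0)"
  unfolding smooth_with_def
proof (intro conjI allI)
  note s = smooth_withD[OF assms(1)]
  show "f \<in> borel_measurable borel" by (rule s)
  show "(\<lambda>y. if q \<in> J then D q y else 0) \<in> borel_measurable borel" for q
    using s(2) by (cases "q \<in> J") simp_all
  show "0 \<le> f y" "f y \<le> 1" "0 \<le> C" "\<bar>if q \<in> J then D q y else 0\<bar> \<le> C" for q y
    using s(3-6) by simp_all
  fix y v :: "_ \<Rightarrow> real"
  have le: "(\<Sum>q\<in>J. \<bar>v q\<bar>) \<le> (\<Sum>q\<in>J'. \<bar>v q\<bar>)" by (rule sum_mono2) (use assms in auto)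
  show "\<bar>f (\<lambda>q. y q + v q) - f y\<bar> \<le> C * (\<Sum>q\<in>J'. \<bar>v q\<bar>)"
    by (rule order_trans[OF s(7) mult_left_mono[OF le s(5)]])
  have lin: "(\<Sum>q\<in>J'. (if q \<in> J then D q y else 0) * v q) = (\<Sum>q\<in>J. D q y * v q)"
    using assms(2,3) by (intro sum.mono_neutral_cong_right) auto
  show "\<bar>f (\<lambda>q. y q + v q) - f y - (\<Sum>q\<in>J'. (if q \<in> J then D q y else 0) * v q)\<bar> \<le> C * (\<Sum>q\<in>J'. \<bar>v q\<bar>)\<^sup>2"
    unfolding lin
    by (rule order_trans[OF s(8)], rule mult_left_mono[OF power_mono[OF le] s(5)]) (simp add: sum_nonneg)
qed

context brownian
begin

definition smooth_cylinder :: "nat \<Rightarrow> nat \<Rightarrow> ('w \<Rightarrow> real) \<Rightarrow> bool" where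
  "smooth_cylinder K n X \<longleftrightarrow> (\<exists>C f D. smooth_with C ({..<2 ^ K} \<times> {..<n}) f D \<and> X = (\<lambda>\<omega>. f (inc K n \<omega>)))"

lemma smooth_cylinder_const: "0 \<le> a \<Longrightarrow> a \<le> 1 \<Longrightarrow> smooth_cylinder K n (\<lambda>_. a)"
  unfolding smooth_cylinder_def using smooth_with_const[of a] by blast

lemma smooth_cylinder_compl: "smooth_cylinder K n X \<Longrightarrow> smooth_cylinder K n (\<lambda>\<omega>. 1 - X \<omega>)"
  unfolding smooth_cylinder_def using smooth_with_compl by blast

lemma smooth_cylinder_mult:
  "smooth_cylinder K n X \<Longrightarrow> smooth_cylinder K n Y \<Longrightarrow> smooth_cylinder K n (\<lambda>\<omega>. X \<omega> * Y \<omega>)"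
  unfolding smooth_cylinder_def using smooth_with_mult by blast

lemma smooth_cylinder_refine:
  assumes "smooth_cylinder K n X" "K \<le> K'" "n \<le> n'"
  shows "smooth_cylinder K' n' X"
proof -
  obtain C f D where s: "smooth_with C ({..<2 ^ K} \<times> {..<n}) f D" and X: "X = (\<lambda>\<omega>. f (inc K n \<omega>))"
    using assms(1) by (auto simp: smooth_cylinder_def)
  define L where "L = K' - K"
  have K': "K' = K + L" using assms(2) by (simp add: L_def)
  have "smooth_with C ({..<2 ^ K'} \<times> {..<n'}) (\<lambda>y. f (coarsen K L n y))
    (\<lambda>q y. if q \<in> {..<2 ^ K'} \<times> {..<n} then D (fst q div 2 ^ L, snd q) (coarsen K L n y) else 0)"
    unfolding K' by (rule smooth_with_mono[OF smooth_with_coarsen[OF s]]) (use assms(3) in auto)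
  moreover have "X = (\<lambda>\<omega>. f (coarsen K L n (inc K' n' \<omega>)))"
    unfolding X K' coarsen_inc[OF assms(3)] ..
  ultimately show ?thesis unfolding smooth_cylinder_def by blast
qed

lemma smooth_cylinderD:
  assumes "smooth_cylinder K n X"
  shows "X \<in> borel_measurable M" "0 \<le> X \<omega>" "X \<omega> \<le> 1"
proof -
  obtain C f D where s: "smooth_with C ({..<2 ^ K} \<times> {..<n}) f D" and X: "X = (\<lambda>\<omega>. f (inc K n \<omega>))"
    using assms by (auto simp: smooth_cylinder_def)
  show "X \<in> borel_measurable M" unfolding X by (rule measurable_compose[OF measurable_inc smooth_withD(1)[OF s]])
  show "0 \<le> X \<omega>" "X \<omega> \<le> 1" unfolding X by (rule smooth_withD[OF s])+
qed

text \<open>Closeness is measured under the law of \<open>B\<close> only; nothing is claimed yet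
  about drifted paths.\<close>

definition approximable :: "(real \<Rightarrow> nat \<Rightarrow> real) set \<Rightarrow> bool" where
  "approximable A \<longleftrightarrow> (\<forall>\<eta>>0. \<exists>K n X. smooth_cylinder K n X \<and> expectation (\<lambda>\<omega>. \<bar>X \<omega> - indicator A (BM_path T B \<omega>)\<bar>) \<le> \<eta>)"

lemma measurable_indicator_path[measurable]:
  assumes [measurable]: "A \<in> sets (path_space T)"
  shows "(\<lambda>\<omega>. indicator A (BM_path T B \<omega>) :: real) \<in> borel_measurable M"
  by measurable

lemma integrable_gap:
  assumes X: "smooth_cylinder K n X" and A: "A \<in> sets (path_space T)"
  shows "integrable M (\<lambda>\<omega>. \<bar>X \<omega> - indicator A (BM_path T B \<omega>)\<bar>)"
proof (rule integrable_const_bound[where B = 1])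
  have "\<bar>X \<omega> - indicator A (BM_path T B \<omega>)\<bar> \<le> 1" for \<omega>
    using smooth_cylinderD(2,3)[OF X, of \<omega>] by (simp add: indicator_def abs_le_iff)
  then show "AE \<omega> in M. norm \<bar>X \<omega> - indicator A (BM_path T B \<omega>)\<bar> \<le> 1" by simp
  show "(\<lambda>\<omega>. \<bar>X \<omega> - indicator A (BM_path T B \<omega>)\<bar>) \<in> borel_measurable M"
    using smooth_cylinderD(1)[OF X] measurable_indicator_path[OF A] by simp
qed

lemma approximable_Compl:
  assumes A: "A \<in> sets (path_space T)" "approximable A"
  shows "approximable (mspace (path_metric T) - A)"
  unfolding approximable_def
proof (intro allI impI)
  fix \<eta> :: real assume "0 < \<eta>"
  then obtain K n X where X: "smooth_cylinder K n X" "expectation (\<lambda>\<omega>. \<bar>X \<omega> - indicator A (BM_path T B \<omega>)\<bar>) \<le> \<eta>"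
    using A(2) by (auto simp: approximable_def)
  have "expectation (\<lambda>\<omega>. \<bar>(1 - X \<omega>) - indicator (mspace (path_metric T) - A) (BM_path T B \<omega>)\<bar>)
      = expectation (\<lambda>\<omega>. \<bar>X \<omega> - indicator A (BM_path T B \<omega>)\<bar>)"
    using measurable_space[OF measurable_BM_path]
    by (intro Bochner_Integration.integral_cong refl) (auto simp: indicator_def space_path_space abs_minus_commute)
  then show "\<exists>K n Y. smooth_cylinder K n Y \<and> expectation (\<lambda>\<omega>. \<bar>Y \<omega> - indicator (mspace (path_metric T) - A) (BM_path T B \<omega>)\<bar>) \<le> \<eta>"
    using smooth_cylinder_compl[OF X(1)] X(2)
    by (intro exI[of _ K] exI[of _ n] exI[of _ "\<lambda>\<omega>. 1 - X \<omega>"]) simp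
qed

lemma approximable_Un:
  assumes A: "A \<in> sets (path_space T)" "approximable A" and A': "A' \<in> sets (path_space T)" "approximable A'"
  shows "approximable (A \<union> A')"
  unfolding approximable_def
proof (intro allI impI)
  fix \<eta> :: real assume "0 < \<eta>"
  then have \<eta>: "0 < \<eta> / 2" by simp
  obtain K n X where X: "smooth_cylinder K n X" "expectation (\<lambda>\<omega>. \<bar>X \<omega> - indicator A (BM_path T B \<omega>)\<bar>) \<le> \<eta> / 2"
    using A(2) \<eta> unfolding approximable_def by blast
  obtain K' n' X' where X': "smooth_cylinder K' n' X'" "expectation (\<lambda>\<omega>. \<bar>X' \<omega> - indicator A' (BM_path T B \<omega>)\<bar>) \<le> \<eta> / 2"
    using A'(2) \<eta> unfolding approximable_def by blast
  \<comment> \<open>The complement of the product of complements is the smooth counterpart of a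
    union.\<close>
  define Y where "Y \<omega> = 1 - (1 - X \<omega>) * (1 - X' \<omega>)" for \<omega>
  have Y: "smooth_cylinder (max K K') (max n n') Y"
    unfolding Y_def
    by (intro smooth_cylinder_compl smooth_cylinder_mult smooth_cylinder_refine[OF X(1)] smooth_cylinder_refine[OF X'(1)]) auto
  have prod: "\<bar>u * v - u' * v'\<bar> \<le> \<bar>u - u'\<bar> + \<bar>v - v'\<bar>"
    if "0 \<le> u'" "u' \<le> 1" "0 \<le> v" "v \<le> 1" for u v u' v' :: real
  proof -
    have "u * v - u' * v' = (u - u') * v + u' * (v - v')" by (simp add: algebra_simps)
    then have "\<bar>u * v - u' * v'\<bar> \<le> \<bar>u - u'\<bar> * v + u' * \<bar>v - v'\<bar>"
      using abs_triangle_ineq[of "(u - u') * v" "u' * (v - v')"] that by (simp add: abs_mult)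
    also have "\<dots> \<le> \<bar>u - u'\<bar> + \<bar>v - v'\<bar>"
      using that by (intro add_mono mult_left_le mult_left_le_one_le) auto
    finally show ?thesis .
  qed
  have "expectation (\<lambda>\<omega>. \<bar>Y \<omega> - indicator (A \<union> A') (BM_path T B \<omega>)\<bar>)
      \<le> expectation (\<lambda>\<omega>. \<bar>X \<omega> - indicator A (BM_path T B \<omega>)\<bar> + \<bar>X' \<omega> - indicator A' (BM_path T B \<omega>)\<bar>)"
  proof (rule integral_mono)
    fix \<omega>
    let ?a = "indicator A (BM_path T B \<omega>) :: real" and ?a' = "indicator A' (BM_path T B \<omega>) :: real"
    have "Y \<omega> - indicator (A \<union> A') (BM_path T B \<omega>) = - ((1 - X \<omega>) * (1 - X' \<omega>) - (1 - ?a) * (1 - ?a'))"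
      by (simp add: Y_def indicator_def)
    then have "\<bar>Y \<omega> - indicator (A \<union> A') (BM_path T B \<omega>)\<bar> = \<bar>(1 - X \<omega>) * (1 - X' \<omega>) - (1 - ?a) * (1 - ?a')\<bar>"
      by (simp only: abs_minus_cancel)
    also have "\<dots> \<le> \<bar>(1 - X \<omega>) - (1 - ?a)\<bar> + \<bar>(1 - X' \<omega>) - (1 - ?a')\<bar>"
      using smooth_cylinderD[OF X'(1)] by (intro prod) (auto simp: indicator_def)
    finally show "\<bar>Y \<omega> - indicator (A \<union> A') (BM_path T B \<omega>)\<bar> \<le> \<bar>X \<omega> - ?a\<bar> + \<bar>X' \<omega> - ?a'\<bar>"
      by (simp add: abs_minus_commute)
  qed (intro integrable_gap[OF Y] sets.Un A A' Bochner_Integration.integrable_add integrable_gap[OF X(1)] integrable_gap[OF X'(1)])+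
  also have "\<dots> \<le> \<eta>"
    using X X' integrable_gap[OF X(1) A(1)] integrable_gap[OF X'(1) A'(1)] by simp
  finally show "\<exists>K n Y. smooth_cylinder K n Y \<and> expectation (\<lambda>\<omega>. \<bar>Y \<omega> - indicator (A \<union> A') (BM_path T B \<omega>)\<bar>) \<le> \<eta>"
    using Y by blast
qed

lemma approximable_empty: "approximable {}"
  unfolding approximable_def
  by (intro allI impI exI[of _ 0] exI[of _ "\<lambda>_. 0"] conjI smooth_cylinder_const) simp_all

text \<open>Finite unions approach the countable union in mean by dominated convergence, and a
  finite union is approximated by a cylinder; each error takes half of
  \<open>\<eta>\<close>.\<close>

lemma approximable_UN:
  fixes A :: "nat \<Rightarrow> (real \<Rightarrow> nat \<Rightarrow> real) set"
  assumes A: "\<And>i. A i \<in> sets (path_space T)" "\<And>i. approximable (A i)"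
  shows "approximable (\<Union>i. A i)"
  unfolding approximable_def
proof (intro allI impI)
  fix \<eta> :: real assume "0 < \<eta>"
  then have \<eta>: "0 < \<eta> / 2" by simp
  have fin: "approximable (\<Union>i<m. A i)" for m
  proof (induction m)
    case (Suc m)
    then show ?case using A approximable_Un[of "A m" "\<Union>i<m. A i"] by (simp add: lessThan_Suc)
  qed (simp add: approximable_empty)
  have UN: "(\<Union>i. A i) \<in> sets (path_space T)" "(\<Union>i<m. A i) \<in> sets (path_space T)" for m using A(1) by auto
  let ?B = "BM_path T B"
  have "(\<lambda>m. expectation (\<lambda>\<omega>. \<bar>indicator (\<Union>i<m. A i) (?B \<omega>) - indicator (\<Union>i. A i) (?B \<omega>) :: real\<bar>)) \<longlonglongrightarrow> expectation (\<lambda>\<omega>. 0 :: real)"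
  proof (rule integral_dominated_convergence[where w = "\<lambda>_. 1"])
    show "AE \<omega> in M. (\<lambda>m. \<bar>indicator (\<Union>i<m. A i) (?B \<omega>) - indicator (\<Union>i. A i) (?B \<omega>) :: real\<bar>) \<longlonglongrightarrow> (0 :: real)"
    proof (rule AE_I2)
      fix \<omega>
      have "(\<lambda>m. \<bar>indicator (\<Union>i<m. A i) (?B \<omega>) - indicator (\<Union>i. A i) (?B \<omega>) :: real\<bar>) \<longlonglongrightarrow> \<bar>indicator (\<Union>i. A i) (?B \<omega>) - indicator (\<Union>i. A i) (?B \<omega>) :: real\<bar>"
        by (intro tendsto_intros LIMSEQ_indicator_UN)
      then show "(\<lambda>m. \<bar>indicator (\<Union>i<m. A i) (?B \<omega>) - indicator (\<Union>i. A i) (?B \<omega>) :: real\<bar>) \<longlonglongrightarrow> (0 :: real)" by simp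
    qed
    show "AE \<omega> in M. norm \<bar>indicator (\<Union>i<m. A i) (?B \<omega>) - indicator (\<Union>i. A i) (?B \<omega>) :: real\<bar> \<le> 1" for m
      by (auto simp: indicator_def)
    show "(\<lambda>\<omega>. \<bar>indicator (\<Union>i<m. A i) (?B \<omega>) - indicator (\<Union>i. A i) (?B \<omega>) :: real\<bar>) \<in> borel_measurable M" for m
      using measurable_indicator_path[OF UN(1)] measurable_indicator_path[OF UN(2)] by simp
  qed simp_all
  then have "(\<lambda>m. expectation (\<lambda>\<omega>. \<bar>indicator (\<Union>i<m. A i) (?B \<omega>) - indicator (\<Union>i. A i) (?B \<omega>) :: real\<bar>)) \<longlonglongrightarrow> 0" by simp
  from order_tendstoD(2)[OF this \<eta>] obtain m where m: "expectation (\<lambda>\<omega>. \<bar>indicator (\<Union>i<m. A i) (?B \<omega>) - indicator (\<Union>i. A i) (?B \<omega>) :: real\<bar>) < \<eta> / 2"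
    by (auto simp: eventually_sequentially)
  obtain K n X where X: "smooth_cylinder K n X" "expectation (\<lambda>\<omega>. \<bar>X \<omega> - indicator (\<Union>i<m. A i) (?B \<omega>)\<bar>) \<le> \<eta> / 2"
    using fin[of m] \<eta> unfolding approximable_def by blast
  have int: "integrable M (\<lambda>\<omega>. \<bar>indicator (\<Union>i<m. A i) (?B \<omega>) - indicator (\<Union>i. A i) (?B \<omega>) :: real\<bar>)"
    using measurable_indicator_path[OF UN(1)] measurable_indicator_path[OF UN(2)]
    by (intro integrable_const_bound[where B = 1]) (auto simp: indicator_def)
  have "expectation (\<lambda>\<omega>. \<bar>X \<omega> - indicator (\<Union>i. A i) (?B \<omega>) :: real\<bar>)
      \<le> expectation (\<lambda>\<omega>. \<bar>X \<omega> - indicator (\<Union>i<m. A i) (?B \<omega>)\<bar> + \<bar>indicator (\<Union>i<m. A i) (?B \<omega>) - indicator (\<Union>i. A i) (?B \<omega>) :: real\<bar>)"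
    by (rule integral_mono) (auto intro!: integrable_gap[OF X(1)] UN Bochner_Integration.integrable_add int)
  also have "\<dots> \<le> \<eta>"
    using X(2) m integrable_gap[OF X(1) UN(2)] int by simp
  finally show "\<exists>K n Y. smooth_cylinder K n Y \<and> expectation (\<lambda>\<omega>. \<bar>Y \<omega> - indicator (\<Union>i. A i) (?B \<omega>) :: real\<bar>) \<le> \<eta>"
    using X(1) by blast
qed

text \<open>A grid value of \<open>B\<close> is almost surely a sum of increments, so a steep
  logistic function of that sum approximates the half-line event.\<close>

lemma approximable_eval_event:
  assumes "E \<in> eval_events T"
  shows "approximable E"
  unfolding approximable_def
proof (intro allI impI)
  fix \<eta> :: real assume \<eta>: "0 < \<eta>"
  obtain K i j x where i: "i \<le> 2 ^ K" and E: "E = {w \<in> mspace (path_metric T). w (grid T K i) j \<le> x}"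
    using assms by (auto simp: eval_events_def)
  have E_sets: "E \<in> sets (path_space T)" using assms unfolding sets_path_space_eq[OF T] by (rule sigma_sets.Basic)
  let ?J = "{..<2 ^ K} \<times> {..<Suc j} :: (nat \<times> nat) set" and ?A = "(\<lambda>a. (a, j)) ` {..<i}"
  have AJ: "?A \<subseteq> ?J" using i by auto
  have sum_A: "(\<Sum>q\<in>?A. y q) = (\<Sum>a<i. y (a, j))" for y :: "nat \<times> nat \<Rightarrow> real"
    by (simp add: sum.reindex inj_on_def)
  define S where "S \<omega> = (\<Sum>q\<in>?A. inc K (Suc j) \<omega> q)" for \<omega>
  have S: "AE \<omega> in M. B j (grid T K i) \<omega> = S \<omega>"
    using B_0
  proof eventually_elim
    case (elim \<omega>)
    have "S \<omega> = (\<Sum>a<i. B j (grid T K (Suc a)) \<omega> - B j (grid T K a) \<omega>)"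
      unfolding S_def sum_A using i by (intro sum.cong) (auto simp: inc_def)
    also have "\<dots> = B j (grid T K i) \<omega> - B j (grid T K 0) \<omega>"
      by (rule sum_lessThan_telescope)
    finally show ?case using elim by simp
  qed
  define X where "X m \<omega> = logistic ((real m)\<^sup>2 * (x - S \<omega>) + real m)" for m \<omega>
  have X: "smooth_cylinder K (Suc j) (X m)" for m
  proof -
    have "X m = (\<lambda>\<omega>. logistic (- (real m)\<^sup>2 * (\<Sum>q\<in>?A. inc K (Suc j) \<omega> q) + ((real m)\<^sup>2 * x + real m)))"
      by (simp add: X_def S_def fun_eq_iff algebra_simps)
    then show ?thesis
      unfolding smooth_cylinder_def using smooth_with_logistic[OF _ AJ] by blast
  qed
  have "(\<lambda>m. expectation (\<lambda>\<omega>. \<bar>X m \<omega> - indicator E (BM_path T B \<omega>)\<bar>)) \<longlonglongrightarrow> expectation (\<lambda>\<omega>. 0 :: real)"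
  proof (rule integral_dominated_convergence[where w = "\<lambda>_. 1"])
    show "AE \<omega> in M. (\<lambda>m. \<bar>X m \<omega> - indicator E (BM_path T B \<omega>)\<bar>) \<longlonglongrightarrow> (0 :: real)"
      using S AE_space
    proof eventually_elim
      case (elim \<omega>)
      have "grid T K i \<in> {0..T}" using T i by (intro grid_in) auto
      then have "indicator E (BM_path T B \<omega>) = (if 0 \<le> x - S \<omega> then 1 else 0 :: real)"
        using elim measurable_space[OF measurable_BM_path elim(2)]
        by (auto simp: E indicator_def space_path_space BM_path_def)
      moreover have "(\<lambda>m. \<bar>X m \<omega> - (if 0 \<le> x - S \<omega> then 1 else 0)\<bar>) \<longlonglongrightarrow> \<bar>(if 0 \<le> x - S \<omega> then 1 else 0) - (if 0 \<le> x - S \<omega> then 1 else 0)\<bar>"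
        unfolding X_def by (intro tendsto_intros logistic_near_indicator)
      ultimately show ?case by simp
    qed
    have "\<bar>X m \<omega> - indicator E (BM_path T B \<omega>)\<bar> \<le> 1" for m \<omega>
      using smooth_cylinderD(2,3)[OF X, of m \<omega>] by (simp add: indicator_def abs_le_iff)
    then show "AE \<omega> in M. norm \<bar>X m \<omega> - indicator E (BM_path T B \<omega>)\<bar> \<le> 1" for m by simp
    show "(\<lambda>\<omega>. \<bar>X m \<omega> - indicator E (BM_path T B \<omega>)\<bar>) \<in> borel_measurable M" for m
      using smooth_cylinderD(1)[OF X] measurable_indicator_path[OF E_sets] by simp
  qed simp_all
  then have "(\<lambda>m. expectation (\<lambda>\<omega>. \<bar>X m \<omega> - indicator E (BM_path T B \<omega>)\<bar>)) \<longlonglongrightarrow> 0" by simp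
  from order_tendstoD(2)[OF this \<eta>] obtain m where "expectation (\<lambda>\<omega>. \<bar>X m \<omega> - indicator E (BM_path T B \<omega>)\<bar>) < \<eta>"
    by (auto simp: eventually_sequentially)
  then show "\<exists>K n Y. smooth_cylinder K n Y \<and> expectation (\<lambda>\<omega>. \<bar>Y \<omega> - indicator E (BM_path T B \<omega>)\<bar>) \<le> \<eta>"
    using X less_imp_le by blast
qed

theorem approximable_sets:
  assumes "A \<in> sets (path_space T)"
  shows "approximable A"
proof -
  have sets: "sets (path_space T) = sigma_sets (mspace (path_metric T)) (eval_events T)"
    by (rule sets_path_space_eq[OF T])
  show ?thesis
    using assms unfolding sets
  proof induction
    case (Compl a)
    then show ?case by (intro approximable_Compl) (simp_all add: sets)
  next
    case (Union a)
    then show ?case by (intro approximable_UN) (simp_all add: sets)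
  qed (simp_all add: approximable_eval_event approximable_empty)
qed

end

section \<open>Steering Brownian motion into an event\<close>

context brownian
begin

lemma path_inc_BM_path: "path_inc T K n (BM_path T B \<omega>) = inc K n \<omega>"
  using T grid_in[of T _ K] by (auto simp: path_inc_def inc_def BM_path_def fun_eq_iff Suc_le_eq less_imp_le)

text \<open>On the grid of the control itself the drift adds exactly mesh times control to each
  increment, which is the argument of \<open>F\<close> in
  \<open>control_near_optimal\<close>.\<close>

lemma path_inc_steered_path:
  "path_inc T K n (steered_path K n c \<omega>)
    = (\<lambda>q. inc K n \<omega> q + (if q \<in> {..<2 ^ K} \<times> {..<n} then T / 2 ^ K * c q (inc K n \<omega>) else 0))"
proof
  fix q :: "nat \<times> nat"
  obtain a j where [simp]: "q = (a, j)" by (cases q)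
  show "path_inc T K n (steered_path K n c \<omega>) q
    = inc K n \<omega> q + (if q \<in> {..<2 ^ K} \<times> {..<n} then T / 2 ^ K * c q (inc K n \<omega>) else 0)"
  proof (cases "a < 2 ^ K \<and> j < n")
    case True
    let ?\<kappa> = "\<lambda>q. c q (inc K n \<omega>)" and ?t = "grid T K a" and ?t' = "grid T K (Suc a)"
    have t: "?t \<in> {0..T}" "?t' \<in> {0..T}" using True T by (auto intro!: grid_in simp del: atLeastAtMost_iff)
    have "primitive T (step T K n ?\<kappa>) ?t' j - primitive T (step T K n ?\<kappa>) ?t j
        = (\<Sum>b<2 ^ K. ?\<kappa> (b, j) * (overlap T K ?t' b - overlap T K ?t b))"
      using primitive_step[OF T t(1)] primitive_step[OF T t(2)] True by (simp add: sum_subtractf right_diff_distrib)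
    also have "\<dots> = (\<Sum>b<2 ^ K. if b = a then T / 2 ^ K * ?\<kappa> (b, j) else 0)"
      by (intro sum.cong refl) (auto simp: overlap_grid[OF T])
    also have "\<dots> = T / 2 ^ K * ?\<kappa> (a, j)" using True by (simp add: sum.delta)
    finally show ?thesis
      using True t by (simp add: path_inc_def inc_def steered_path_def controlled_path_def)
  qed (auto simp: path_inc_def inc_def)
qed

lemma measurable_path_inc[measurable]: "path_inc T K n \<in> borel_measurable (path_space T)"
proof (rule measurable_coordinatewise_then_product)
  fix q :: "nat \<times> nat"
  show "(\<lambda>w. path_inc T K n w q) \<in> borel_measurable (path_space T)"
  proof (cases "fst q < 2 ^ K")
    case True
    then have "grid T K (fst q) \<in> {0..T}" "grid T K (Suc (fst q)) \<in> {0..T}" using T by (auto intro!: grid_in simp del: atLeastAtMost_iff)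
    then have "(\<lambda>w. w (grid T K (Suc (fst q))) (snd q) - w (grid T K (fst q)) (snd q)) \<in> borel_measurable (path_space T)"
      by (intro borel_measurable_diff measurable_eval)
    then show ?thesis unfolding path_inc_def by (cases "snd q < n") (simp_all add: True)
  qed (simp add: path_inc_def)
qed

text \<open>The functional \<open>f\<close> keeps its grid of level \<open>K\<close>, while the
  drift is built on a finer one. \<open>coarsen\<close> transports \<open>f\<close> without changing
  \<open>C\<close>, so the loss, at most \<open>T\<close> times a fixed constant times the mesh,
  falls below \<open>s\<close> by refinement.\<close>

lemma near_optimal_control:
  assumes f: "smooth_with C ({..<2 ^ K} \<times> {..<n}) f D" and \<kappa>: "0 < \<kappa>" "\<kappa> \<le> 1" and s: "0 < s"
  shows "\<exists>L c Cb. (\<forall>q. c q \<in> borel_measurable borel) \<and> causal c \<and> (\<forall>q z. \<bar>c q z\<bar> \<le> Cb) \<and>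
    ln (expectation (\<lambda>\<omega>. \<kappa> + (1 - \<kappa>) * f (inc K n \<omega>)))
      + T / 2 ^ L / 2 * (\<Sum>q\<in>{..<2 ^ L} \<times> {..<n}. expectation (\<lambda>\<omega>. (c q (inc L n \<omega>))\<^sup>2)) - s
    \<le> expectation (\<lambda>\<omega>. ln (\<kappa> + (1 - \<kappa>) * f (path_inc T K n (steered_path L n c \<omega>))))"
proof -
  note sf = smooth_withD[OF f]
  \<comment> \<open>This constant depends on \<open>n\<close>, \<open>C\<close> and
    \<open>\<kappa>\<close> only, so it is available before the mesh is chosen.\<close>
  define R where "R = gaussian_drift.rem_const n C \<kappa>"
  have "(\<lambda>L. T * (1 / 2) ^ L * (1 / 2 ^ K)) \<longlonglongrightarrow> T * 0 * (1 / 2 ^ K)"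
    by (intro tendsto_intros LIMSEQ_power_zero) simp
  then have lim: "(\<lambda>L. T / 2 ^ (K + L)) \<longlonglongrightarrow> 0" by (simp add: power_add power_one_over mult.commute)
  then have "(\<lambda>L. T * (R * (T / 2 ^ (K + L)))) \<longlonglongrightarrow> T * (R * 0)" by (intro tendsto_intros)
  then have lim': "(\<lambda>L. T * (R * (T / 2 ^ (K + L)))) \<longlonglongrightarrow> 0" by simp
  have "\<forall>\<^sub>F L in sequentially. T * (R * (T / 2 ^ (K + L))) < s \<and> T / 2 ^ (K + L) < 1"
    using order_tendstoD(2)[OF lim' s] order_tendstoD(2)[OF lim zero_less_one] by (rule eventually_conj)
  then obtain L where L: "T * (R * (T / 2 ^ (K + L))) < s" "T / 2 ^ (K + L) < 1"
    by (auto simp: eventually_sequentially)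
  let ?K = "K + L"
  let ?J = "{..<2 ^ ?K} \<times> {..<n} :: (nat \<times> nat) set" and ?h = "T / 2 ^ ?K"
  define g where "g y = f (coarsen K L n y)" for y
  define E where "E q y = D (fst q div 2 ^ L, snd q) (coarsen K L n y)" for q y
  have sg: "smooth_with C ?J g E" unfolding g_def[abs_def] E_def[abs_def] by (rule smooth_with_coarsen[OF f])
  note sg = smooth_withD[OF sg]
  have add: "(\<lambda>(a, b). y (a, b) + (if a = i \<and> b < n then v b else 0)) = (\<lambda>q. y q + (if fst q = i \<and> snd q < n then v (snd q) else 0))"
    for y :: "nat \<times> nat \<Rightarrow> real" and v i by (auto simp: fun_eq_iff)
  have blk: "(\<Sum>q\<in>?J. F q (if fst q = i \<and> snd q < n then v (snd q) else 0)) = (\<Sum>b<n. F (i, b) (v b))"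
    if i: "i < 2 ^ ?K" and F0: "\<And>q. F q 0 = 0" for F :: "nat \<times> nat \<Rightarrow> real \<Rightarrow> real" and v :: "nat \<Rightarrow> real" and i
  proof -
    have "(\<Sum>q\<in>?J. F q (if fst q = i \<and> snd q < n then v (snd q) else 0)) = (\<Sum>q\<in>Pair i ` {..<n}. F q (v (snd q)))"
      using i F0 by (intro sum.mono_neutral_cong_right) auto
    then show ?thesis by (simp add: sum.reindex inj_on_def)
  qed
  interpret G: gaussian_drift M "inc ?K n" "2 ^ ?K" n ?h "\<lambda>y. \<kappa> + (1 - \<kappa>) * g y" "\<lambda>i b y. (1 - \<kappa>) * E (i, b) y" C \<kappa>
  proof (intro gaussian_drift.intro gaussian_family_inc gaussian_drift_axioms.intro)
    show "?h \<le> 1" "0 < \<kappa>" "0 \<le> C" using L \<kappa> sg by simp_all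
    show "(\<lambda>y. \<kappa> + (1 - \<kappa>) * g y) \<in> borel_measurable borel" "(\<lambda>y. (1 - \<kappa>) * E (i, b) y) \<in> borel_measurable borel" for i b
      using sg(1,2) by simp_all
    show "\<kappa> \<le> \<kappa> + (1 - \<kappa>) * g y" for y using sg(3) \<kappa> by simp
    show "\<kappa> + (1 - \<kappa>) * g y \<le> 1" for y using mult_left_mono[OF sg(4)[of y], of "1 - \<kappa>"] \<kappa> by simp
    have le: "\<bar>(1 - \<kappa>) * x\<bar> \<le> z" if "\<bar>x\<bar> \<le> z" for x z :: real
    proof -
      have "(1 - \<kappa>) * \<bar>x\<bar> \<le> 1 * \<bar>x\<bar>" using \<kappa> by (intro mult_right_mono) auto
      then show ?thesis using that \<kappa> by (simp add: abs_mult)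
    qed
    show "\<bar>(1 - \<kappa>) * E (i, b) y\<bar> \<le> C" for i b y by (rule le[OF sg(6)])
    fix i :: nat and y :: "nat \<times> nat \<Rightarrow> real" and v :: "nat \<Rightarrow> real" assume i: "i < 2 ^ ?K"
    let ?v = "\<lambda>q. if fst q = i \<and> snd q < n then v (snd q) else 0"
    have s1: "(\<Sum>q\<in>?J. \<bar>?v q\<bar>) = (\<Sum>b<n. \<bar>v b\<bar>)" by (rule blk[OF i, of "\<lambda>q x. \<bar>x\<bar>" v]) simp
    have s2: "(\<Sum>q\<in>?J. E q y * ?v q) = (\<Sum>b<n. E (i, b) y * v b)" by (rule blk[OF i, of "\<lambda>q x. E q y * x" v]) simp
    show "\<bar>\<kappa> + (1 - \<kappa>) * g (\<lambda>(a, b). y (a, b) + (if a = i \<and> b < n then v b else 0)) - (\<kappa> + (1 - \<kappa>) * g y)\<bar>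
        \<le> C * (\<Sum>b<n. \<bar>v b\<bar>)"
      using le[OF sg(7)[of y ?v]] unfolding add s1 by (simp add: right_diff_distrib)
    have "(\<Sum>b<n. (1 - \<kappa>) * E (i, b) y * v b) = (1 - \<kappa>) * (\<Sum>b<n. E (i, b) y * v b)"
      by (simp add: sum_distrib_left mult.assoc)
    then show "\<bar>\<kappa> + (1 - \<kappa>) * g (\<lambda>(a, b). y (a, b) + (if a = i \<and> b < n then v b else 0)) - (\<kappa> + (1 - \<kappa>) * g y)
        - (\<Sum>b<n. (1 - \<kappa>) * E (i, b) y * v b)\<bar> \<le> C * (\<Sum>b<n. \<bar>v b\<bar>)\<^sup>2"
      using le[OF sg(8)[of y ?v]] unfolding add s1 s2 by (simp add: right_diff_distrib)
  qed
  have inc_eq: "g (inc ?K n \<omega>) = f (inc K n \<omega>)" for \<omega>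
    by (simp add: g_def coarsen_inc)
  have path_eq: "g (\<lambda>q. inc ?K n \<omega> q + (if q \<in> ?J then ?h * G.control q (inc ?K n \<omega>) else 0))
      = f (path_inc T K n (steered_path ?K n G.control \<omega>))" for \<omega>
    unfolding g_def path_inc_steered_path[symmetric] by (simp add: coarsen_path_inc)
  have "real (2 ^ ?K) * (G.rem_const * ?h\<^sup>2) = T * (R * ?h)"
    using T by (simp add: R_def power2_eq_square)
  then have "ln (expectation (\<lambda>\<omega>. \<kappa> + (1 - \<kappa>) * f (inc K n \<omega>)))
      + ?h / 2 * (\<Sum>q\<in>?J. expectation (\<lambda>\<omega>. (G.control q (inc ?K n \<omega>))\<^sup>2)) - s
    \<le> expectation (\<lambda>\<omega>. ln (\<kappa> + (1 - \<kappa>) * f (path_inc T K n (steered_path ?K n G.control \<omega>))))"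
    using G.control_near_optimal L(1) unfolding inc_eq path_eq by linarith
  moreover have "causal G.control" unfolding causal_def using G.control_cong by blast
  ultimately show ?thesis
    using G.measurable_control G.abs_control_le by blast
qed

text \<open>A sample point fails for one of three reasons: the drift is too expensive
  (\<open>?A1\<close>), the smooth functional is small along the steered path (\<open>?A2\<close>),
  or it is not small although the path misses \<open>A\<close> (\<open>?A3\<close>). The first two
  are Markov's inequality for the bound \<open>l + s\<close> on mean cost plus mean penalty; the
  third is rare for \<open>B\<close>, and the entropy bound transfers this to the steered
  path.\<close>

lemma steering:
  assumes A: "A \<in> sets (path_space T)" and p: "p = prob {\<omega>\<in>space M. BM_path T B \<omega> \<in> A}" "0 < p"
    and R: "0 < R" and \<eta>: "0 < \<eta>"
  shows "\<exists>K n c. (\<forall>q. c q \<in> borel_measurable borel) \<and> causal c \<and>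
    1 - ln (1 / p) / R - \<eta> \<le> prob {\<omega>\<in>space M. steered_path K n c \<omega> \<in> A \<and>
      T / 2 ^ K / 2 * (\<Sum>q\<in>{..<2 ^ K} \<times> {..<n}. (c q (inc K n \<omega>))\<^sup>2) \<le> R}"
proof -
  note [measurable] = A
  have p1: "p \<le> 1" using p(1) by simp
  define l where "l = ln (1 / p)"
  have l: "0 \<le> l" "l = - ln p" using p(2) p1 by (simp_all add: l_def ln_div)
  \<comment> \<open>The slack \<open>\<eta>\<close> is shared in thirds: \<open>s\<close> makes
    \<open>(l + s) / R = l / R + \<eta> / 3\<close>, \<open>U\<close> makes
    \<open>(l + s) / (U - ln 2) = \<eta> / 3\<close>, and \<open>L\<close> makes
    \<open>(l + s + ln 2) / L = \<eta> / 3\<close>. The first entry of \<open>e\<close> guarantees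
    \<open>p - e \<ge> p * exp (- (s / 2))\<close>, the second that \<open>B\<close> lies in the set
    \<open>E\<close> below with probability at most \<open>exp (- L)\<close>.\<close>
  define s where "s = \<eta> * R / 3"
  have s: "0 < s" using R \<eta> by (simp add: s_def)
  define U where "U = ln 2 + 3 * (l + s) / \<eta>"
  define L where "L = 3 * (l + s + ln 2) / \<eta>"
  have U: "0 < U" using l s \<eta> by (simp add: U_def add_pos_pos)
  have L: "0 < L" using l s \<eta> by (simp add: L_def add_nonneg_pos)
  define \<kappa> where "\<kappa> = exp (- U)"
  have \<kappa>: "0 < \<kappa>" "\<kappa> \<le> 1" using U by (simp_all add: \<kappa>_def)
  define e where "e = min (p * (1 - exp (- (s / 2)))) (\<kappa> * exp (- L))"
  have e: "0 < e" using p(2) s \<kappa> by (simp add: e_def)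
  obtain K0 n X where X: "smooth_cylinder K0 n X" and Xe: "expectation (\<lambda>\<omega>. \<bar>X \<omega> - indicator A (BM_path T B \<omega>)\<bar>) \<le> e"
    using approximable_sets[OF A] e unfolding approximable_def by blast
  obtain C f D where f: "smooth_with C ({..<2 ^ K0} \<times> {..<n}) f D" and X_eq: "X = (\<lambda>\<omega>. f (inc K0 n \<omega>))"
    using X by (auto simp: smooth_cylinder_def)
  note sf = smooth_withD[OF f]
  have [measurable]: "f \<in> borel_measurable borel" by (rule sf)
  obtain K c Cb where c: "\<And>q. c q \<in> borel_measurable borel" "causal c" "\<And>q z. \<bar>c q z\<bar> \<le> Cb"
    and opt: "ln (expectation (\<lambda>\<omega>. \<kappa> + (1 - \<kappa>) * f (inc K0 n \<omega>)))
      + T / 2 ^ K / 2 * (\<Sum>q\<in>{..<2 ^ K} \<times> {..<n}. expectation (\<lambda>\<omega>. (c q (inc K n \<omega>))\<^sup>2)) - s / 2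
    \<le> expectation (\<lambda>\<omega>. ln (\<kappa> + (1 - \<kappa>) * f (path_inc T K0 n (steered_path K n c \<omega>))))"
    using near_optimal_control[OF f \<kappa>, of "s / 2"] s by auto
  note [measurable] = c(1) measurable_steered_path[OF c(1)]
  let ?J = "{..<2 ^ K} \<times> {..<n} :: (nat \<times> nat) set"
  define Y where "Y = steered_path K n c"
  have [measurable]: "Y \<in> M \<rightarrow>\<^sub>M path_space T" unfolding Y_def by measurable
  define cost where "cost \<omega> = T / 2 ^ K / 2 * (\<Sum>q\<in>?J. (c q (inc K n \<omega>))\<^sup>2)" for \<omega>
  have [measurable]: "cost \<in> borel_measurable M" unfolding cost_def by measurable
  define H where "H = expectation cost"
  have sq: "integrable M (\<lambda>\<omega>. (c q (inc K n \<omega>))\<^sup>2)" for q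
  proof (rule integrable_const_bound[where B = "Cb\<^sup>2"])
    have "(c q z)\<^sup>2 \<le> Cb\<^sup>2" for z
      using c(3)[of q z] by (simp add: abs_le_square_iff[symmetric])
    then show "AE \<omega> in M. norm ((c q (inc K n \<omega>))\<^sup>2) \<le> Cb\<^sup>2" by simp
  qed measurable
  have cost_int: "integrable M cost" and H_eq: "H = T / 2 ^ K / 2 * (\<Sum>q\<in>?J. expectation (\<lambda>\<omega>. (c q (inc K n \<omega>))\<^sup>2))"
    unfolding H_def cost_def by (simp_all add: sq)
  have cost0: "0 \<le> cost \<omega>" for \<omega> using T by (simp add: cost_def sum_nonneg)
  define V where "V \<omega> = - ln (\<kappa> + (1 - \<kappa>) * f (path_inc T K0 n (Y \<omega>)))" for \<omega>
  have Fb: "\<kappa> \<le> \<kappa> + (1 - \<kappa>) * f y" "\<kappa> + (1 - \<kappa>) * f y \<le> 1" for y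
    using sf(3)[of y] mult_left_mono[OF sf(4)[of y], of "1 - \<kappa>"] \<kappa> by simp_all
  have V0: "0 \<le> V \<omega>" "V \<omega> \<le> U" for \<omega>
  proof -
    let ?F = "\<kappa> + (1 - \<kappa>) * f (path_inc T K0 n (Y \<omega>))"
    have F: "\<kappa> \<le> ?F" "?F \<le> 1" by (rule Fb)+
    then have "ln \<kappa> \<le> ln ?F" "ln ?F \<le> 0" using \<kappa> by simp_all
    then show "0 \<le> V \<omega>" "V \<omega> \<le> U" by (simp_all add: V_def \<kappa>_def)
  qed
  have [measurable]: "V \<in> borel_measurable M" unfolding V_def by measurable
  have V_int: "integrable M V"
    by (rule integrable_const_bound[where B = U]) (use V0 in auto)
  \<comment> \<open>One half of \<open>s\<close> pays for the discretization, the other for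
    replacing the indicator by \<open>f\<close>.\<close>
  have HV: "H + expectation V \<le> l + s"
  proof -
    have intX: "integrable M (\<lambda>\<omega>. f (inc K0 n \<omega>))"
      by (rule integrable_const_bound[where B = 1]) (use sf(3,4) in auto)
    have intA: "integrable M (\<lambda>\<omega>. indicator A (BM_path T B \<omega>) :: real)"
      by (rule integrable_const_bound[where B = 1]) auto
    have "p - e \<le> expectation (\<lambda>\<omega>. indicator A (BM_path T B \<omega>)) - expectation (\<lambda>\<omega>. \<bar>X \<omega> - indicator A (BM_path T B \<omega>)\<bar>)"
    proof -
      have "expectation (\<lambda>\<omega>. indicator A (BM_path T B \<omega>) :: real) = expectation (indicator {\<omega>\<in>space M. BM_path T B \<omega> \<in> A})"
        by (intro Bochner_Integration.integral_cong refl) (auto simp: indicator_def)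
      then have "expectation (\<lambda>\<omega>. indicator A (BM_path T B \<omega>) :: real) = p" by (simp add: p(1))
      then show ?thesis using Xe by simp
    qed
    also have "\<dots> = expectation (\<lambda>\<omega>. indicator A (BM_path T B \<omega>) - \<bar>X \<omega> - indicator A (BM_path T B \<omega>)\<bar>)"
      using intA integrable_gap[OF X A] by simp
    also have "\<dots> \<le> expectation (\<lambda>\<omega>. \<kappa> + (1 - \<kappa>) * f (inc K0 n \<omega>))"
    proof (rule integral_mono)
      fix \<omega>
      have "indicator A (BM_path T B \<omega>) - \<bar>X \<omega> - indicator A (BM_path T B \<omega>)\<bar> \<le> X \<omega>" by linarith
      also have "X \<omega> \<le> \<kappa> + (1 - \<kappa>) * f (inc K0 n \<omega>)"
      proof -
        have "0 \<le> \<kappa> * (1 - f (inc K0 n \<omega>))" using sf(4) \<kappa> by simp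
        then show ?thesis by (simp add: X_eq algebra_simps)
      qed
      finally show "indicator A (BM_path T B \<omega>) - \<bar>X \<omega> - indicator A (BM_path T B \<omega>)\<bar> \<le> \<kappa> + (1 - \<kappa>) * f (inc K0 n \<omega>)" .
    qed (use intA integrable_gap[OF X A] intX in auto)
    finally have "p - e \<le> expectation (\<lambda>\<omega>. \<kappa> + (1 - \<kappa>) * f (inc K0 n \<omega>))" .
    moreover have "p * exp (- (s / 2)) \<le> p - e"
      by (simp add: e_def right_diff_distrib min_le_iff_disj)
    ultimately have "p * exp (- (s / 2)) \<le> expectation (\<lambda>\<omega>. \<kappa> + (1 - \<kappa>) * f (inc K0 n \<omega>))" by linarith
    then have "ln (p * exp (- (s / 2))) \<le> ln (expectation (\<lambda>\<omega>. \<kappa> + (1 - \<kappa>) * f (inc K0 n \<omega>)))"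
      using p(2) by (intro ln_mono) (auto intro: less_le_trans[rotated])
    moreover have "ln (p * exp (- (s / 2))) = - l - s / 2" using p(2) by (simp add: ln_mult l)
    moreover have "expectation (\<lambda>\<omega>. ln (\<kappa> + (1 - \<kappa>) * f (path_inc T K0 n (steered_path K n c \<omega>)))) = - expectation V"
      by (simp add: V_def[abs_def] Y_def)
    ultimately show ?thesis using opt H_eq by linarith
  qed
  have H0: "0 \<le> H" unfolding H_def using cost0 by simp
  have EV0: "0 \<le> expectation V" using V0 by simp
  let ?A1 = "{\<omega>\<in>space M. R \<le> cost \<omega>}" and ?A2 = "{\<omega>\<in>space M. U - ln 2 \<le> V \<omega>}"
  define E where "E = {w \<in> space (path_space T). w \<notin> A \<and> \<kappa> < f (path_inc T K0 n w)}"
  have [measurable]: "E \<in> sets (path_space T)" unfolding E_def by measurable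
  let ?A3 = "{\<omega>\<in>space M. Y \<omega> \<in> E}"
  have 1: "prob ?A1 \<le> l / R + \<eta> / 3"
  proof -
    have "prob ?A1 \<le> H / R"
      unfolding H_def by (rule integral_Markov_inequality_measure[where A = "{}"]) (use cost_int cost0 R in auto)
    also have "\<dots> \<le> (l + s) / R" using HV EV0 R by (intro divide_right_mono) auto
    also have "\<dots> = l / R + \<eta> / 3" using R by (simp add: s_def add_divide_distrib)
    finally show ?thesis .
  qed
  have 2: "prob ?A2 \<le> \<eta> / 3"
  proof -
    have Upos: "0 < U - ln 2" using l s \<eta> by (simp add: U_def)
    have "prob ?A2 \<le> expectation V / (U - ln 2)"
      by (rule integral_Markov_inequality_measure[where A = "{}"]) (use V_int V0 Upos in auto)
    also have "\<dots> \<le> (l + s) / (U - ln 2)" using HV H0 Upos by (intro divide_right_mono) auto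
    also have "\<dots> = \<eta> / 3"
    proof -
      have *: "u / (ln 2 + 3 * u / \<eta> - ln 2) = \<eta> / 3" if "0 < u" for u using that \<eta> by simp
      show ?thesis unfolding U_def by (rule *) (use l(1) s in simp)
    qed
    finally show ?thesis .
  qed
  have 3: "prob ?A3 \<le> \<eta> / 3"
  proof -
    have "prob {\<omega>\<in>space M. BM_path T B \<omega> \<in> E} \<le> prob {\<omega>\<in>space M. \<kappa> \<le> \<bar>X \<omega> - indicator A (BM_path T B \<omega>)\<bar>}"
    proof (rule finite_measure_mono)
      show "{\<omega>\<in>space M. BM_path T B \<omega> \<in> E} \<subseteq> {\<omega>\<in>space M. \<kappa> \<le> \<bar>X \<omega> - indicator A (BM_path T B \<omega>)\<bar>}"
        by (auto simp: E_def X_eq path_inc_BM_path)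
      have [measurable]: "X \<in> borel_measurable M" by (rule smooth_cylinderD[OF X])
      show "{\<omega>\<in>space M. \<kappa> \<le> \<bar>X \<omega> - indicator A (BM_path T B \<omega>)\<bar>} \<in> events" by measurable
    qed
    also have "\<dots> \<le> expectation (\<lambda>\<omega>. \<bar>X \<omega> - indicator A (BM_path T B \<omega>)\<bar>) / \<kappa>"
      by (rule integral_Markov_inequality_measure[where A = "{}"]) (use integrable_gap[OF X A] \<kappa> in auto)
    also have "\<dots> \<le> (\<kappa> * exp (- L)) / \<kappa>"
      using Xe \<kappa> by (intro divide_right_mono) (auto simp: e_def)
    also have "\<dots> = exp (- L)" using \<kappa> by simp
    finally have "prob ?A3 * L \<le> H + ln 2"
      unfolding H_eq Y_def by (intro entropy_bound[OF c]) (use L in auto)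
    also have "\<dots> \<le> \<eta> / 3 * L" using HV EV0 \<eta> by (simp add: L_def)
    finally show ?thesis using L by simp
  qed
  let ?G = "{\<omega>\<in>space M. Y \<omega> \<in> A \<and> cost \<omega> \<le> R}"
  have G: "?G \<in> events" by measurable
  \<comment> \<open>Outside the three bad events a path that misses \<open>A\<close> would have
    \<open>f \<le> \<kappa>\<close>, hence a functional of at most \<open>2 * \<kappa>\<close>,
    contradicting \<open>V \<omega> < U - ln 2\<close>.\<close>
  have "space M \<subseteq> ?G \<union> (?A1 \<union> (?A2 \<union> ?A3))"
  proof
    fix \<omega> assume \<omega>: "\<omega> \<in> space M"
    show "\<omega> \<in> ?G \<union> (?A1 \<union> (?A2 \<union> ?A3))"
    proof (rule ccontr)
      assume n: "\<omega> \<notin> ?G \<union> (?A1 \<union> (?A2 \<union> ?A3))"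
      then have "Y \<omega> \<notin> A" "Y \<omega> \<notin> E" and V: "V \<omega> < U - ln 2" using \<omega> by auto
      moreover have "Y \<omega> \<in> space (path_space T)" using \<omega> by (rule measurable_space[rotated]) measurable
      ultimately have fk: "f (path_inc T K0 n (Y \<omega>)) \<le> \<kappa>" by (auto simp: E_def)
      let ?y = "f (path_inc T K0 n (Y \<omega>))"
      have "(1 - \<kappa>) * ?y \<le> 1 * \<kappa>" using fk \<kappa> sf(3) by (intro mult_mono) auto
      then have "ln (\<kappa> + (1 - \<kappa>) * ?y) \<le> ln (2 * \<kappa>)" using Fb(1) \<kappa> by (intro ln_mono) (auto intro: less_le_trans)
      also have "\<dots> = ln 2 - U" using \<kappa> by (simp add: ln_mult \<kappa>_def)
      finally show False using V by (simp add: V_def)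
    qed
  qed
  then have "1 \<le> prob (?G \<union> (?A1 \<union> (?A2 \<union> ?A3)))"
    using finite_measure_mono[of "space M" "?G \<union> (?A1 \<union> (?A2 \<union> ?A3))"] prob_space by simp
  also have "\<dots> \<le> prob ?G + (prob ?A1 + (prob ?A2 + prob ?A3))"
    by (intro order_trans[OF measure_Un_le] add_mono order_refl) measurable
  finally have "1 - ln (1 / p) / R - \<eta> \<le> prob ?G" using 1 2 3 by (simp add: l_def)
  then show ?thesis using c(1,2) unfolding Y_def cost_def by blast
qed

end

section \<open>Lower semicontinuity, predictability, and stopped controls\<close>

lemma weak_limit_energy_le:
  assumes k: "\<And>n. k n \<in> L2_space T" and x: "x \<in> L2_space T"
    and lim: "L2_weak_tendsto T k x sequentially" and N: "\<forall>\<^sub>F n in sequentially. L2_energy T (k n) \<le> N"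
  shows "L2_energy T x \<le> N"
proof -
  have k': "k n \<in> square_integrable (horizon T)" and x': "x \<in> square_integrable (horizon T)" for n
    using k x by (simp_all add: L2_space_eq)
  have "(\<lambda>n. ip (horizon T) (k n) x) \<longlonglongrightarrow> ip (horizon T) x x"
    using lim x by (simp add: L2_weak_tendsto_def L2_inner_eq)
  moreover have "\<forall>\<^sub>F n in sequentially. ip (horizon T) (k n) x \<le> (N + ip (horizon T) x x) / 2"
    using N
  proof eventually_elim
    case (elim n)
    \<comment> \<open>Passing to the limit in \<open>2 * ip k x \<le> ip k k + ip x x\<close> gives
      the lower semicontinuity of the energy.\<close>
    have "0 \<le> ip (horizon T) (\<lambda>s. k n s - x s) (\<lambda>s. k n s - x s)" by (rule ip_self_nonneg)
    then show ?case using elim unfolding ip_diff_self[OF k' x'] L2_energy_eq by argo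
  qed
  ultimately have "ip (horizon T) x x \<le> (N + ip (horizon T) x x) / 2"
    by (rule tendsto_upperbound) simp
  then show ?thesis by (simp add: L2_energy_eq)
qed

lemma step_cong:
  assumes "\<And>q. q \<in> {..<2 ^ K} \<times> {..<n} \<Longrightarrow> \<kappa> q = \<kappa>' q"
  shows "step T K n \<kappa> = step T K n \<kappa>'"
  unfolding step_def[abs_def] using assms by (intro ext sum.cong) auto

lemma primitive_step_scale:
  assumes "0 < T" "t \<in> {0..T}"
  shows "a * primitive T (step T K n \<kappa>) t j = primitive T (step T K n (\<lambda>q. a * \<kappa> q)) t j"
  by (simp add: primitive_step[OF assms] sum_distrib_left mult.assoc)

lemma space_augmented: "space (augmented_filtration M B t) = space M"
  by (simp add: augmented_filtration_def space_measure_of_conv)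

lemma sets_augmented:
  "sets (augmented_filtration M B t) = sigma_sets (space M)
       ({B i s -` A \<inter> space M | i s A. s \<in> {0..t} \<and> A \<in> sets borel} \<union> null_sets (completion M))"
  unfolding augmented_filtration_def
  using sets.sets_into_space[of _ "completion M"] by (intro sets_measure_of) (fastforce dest: null_setsD2)

lemma measurable_augmented:
  assumes "s \<in> {0..t}"
  shows "B i s \<in> borel_measurable (augmented_filtration M B t)"
proof (rule measurableI)
  fix A :: "real set" assume "A \<in> sets borel"
  then show "B i s -` A \<inter> space (augmented_filtration M B t) \<in> sets (augmented_filtration M B t)"
    unfolding space_augmented sets_augmented using assms by (intro sigma_sets.Basic) blast
qed simp

text \<open>For a nonnegative threshold the superlevel set is a rectangle, for a negative one the
  complement of a rectangle, since the process is 0 elsewhere.\<close>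

lemma predictable_rectangle:
  assumes "0 \<le> s" "s < u" "u \<le> T" "k \<in> borel_measurable (F s)" "\<And>t. space (F t) = \<Omega>"
  shows "(\<lambda>(t, \<omega>). indicator {s<..u} t * k \<omega> :: real) \<in> borel_measurable (predictable_sigma T \<Omega> F)"
proof -
  let ?G = "{{0} \<times> A | A. A \<in> sets (F 0)} \<union> {{s<..t} \<times> A | s t A. 0 \<le> s \<and> s < t \<and> t \<le> T \<and> A \<in> sets (F s)}"
  let ?P = "predictable_sigma T \<Omega> F"
  have into: "A \<subseteq> \<Omega>" if "A \<in> sets (F t)" for A t
    using sets.sets_into_space[OF that] assms(5) by simp
  have sub: "?G \<subseteq> Pow ({0..T} \<times> \<Omega>)"
    using into assms(1-3) by (auto dest!: into)
  have sp: "space ?P = {0..T} \<times> \<Omega>" and st: "sets ?P = sigma_sets ({0..T} \<times> \<Omega>) ?G"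
    unfolding predictable_sigma_def by (rule space_measure_of[OF sub], rule sets_measure_of[OF sub])
  have rect: "{s<..u} \<times> A \<in> sets ?P" if "A \<in> sets (F s)" for A
    unfolding st using that assms(1-3) by (intro sigma_sets.Basic) blast
  show ?thesis
    unfolding borel_measurable_iff_greater
  proof
    fix a :: real
    have k: "{\<omega>\<in>\<Omega>. a < k \<omega>} \<in> sets (F s)" "{\<omega>\<in>\<Omega>. k \<omega> \<le> a} \<in> sets (F s)"
      using assms(4) assms(5)[of s] borel_measurable_iff_greater[of k "F s"] borel_measurable_iff_le[of k "F s"] by simp_all
    show "{x \<in> space ?P. a < (case x of (t, \<omega>) \<Rightarrow> indicator {s<..u} t * k \<omega>)} \<in> sets ?P"
    proof (cases "0 \<le> a")
      case True
      then have "{x \<in> space ?P. a < (case x of (t, \<omega>) \<Rightarrow> indicator {s<..u} t * k \<omega>)} = {s<..u} \<times> {\<omega>\<in>\<Omega>. a < k \<omega>}"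
        using assms(1-3) unfolding sp by (auto split: split_indicator split_indicator_asm)
      then show ?thesis using rect[OF k(1)] by simp
    next
      case False
      then have "{x \<in> space ?P. a < (case x of (t, \<omega>) \<Rightarrow> indicator {s<..u} t * k \<omega>)} = space ?P - {s<..u} \<times> {\<omega>\<in>\<Omega>. k \<omega> \<le> a}"
        using assms(1-3) unfolding sp by (auto split: split_indicator split_indicator_asm)
      then show ?thesis using rect[OF k(2)] by auto
    qed
  qed
qed

context brownian
begin

lemma predictable_step:
  assumes \<kappa>: "\<And>q. fst q < 2 ^ K \<Longrightarrow> (\<lambda>\<omega>. \<kappa> \<omega> q) \<in> borel_measurable (augmented_filtration M B (grid T K (fst q)))"
  shows "(\<lambda>(t, \<omega>). step T K n (\<kappa> \<omega>) t) \<in> borel_measurable (predictable_sigma T (space M) (augmented_filtration M B))"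
proof -
  let ?P = "predictable_sigma T (space M) (augmented_filtration M B)"
  have "(\<lambda>(t, \<omega>). indicator (block T K (fst q)) t * \<kappa> \<omega> q :: real) \<in> borel_measurable ?P"
    if "q \<in> {..<2 ^ K} \<times> {..<n}" for q
    unfolding block_def
  proof (rule predictable_rectangle)
    show "0 \<le> grid T K (fst q)" "grid T K (Suc (fst q)) \<le> T"
      using grid_in[of T "fst q" K] grid_in[of T "Suc (fst q)" K] that T by auto
    show "grid T K (fst q) < grid T K (Suc (fst q))" using T by (simp add: grid_strict_mono)
    show "(\<lambda>\<omega>. \<kappa> \<omega> q) \<in> borel_measurable (augmented_filtration M B (grid T K (fst q)))" using that by (intro \<kappa>) auto
  qed (simp add: space_augmented)
  then have "(\<lambda>x. \<Sum>q\<in>{..<2 ^ K} \<times> {..<n}. (case x of (t, \<omega>) \<Rightarrow> indicator (block T K (fst q)) t * \<kappa> \<omega> q) *\<^sub>R l2_unit (snd q)) \<in> borel_measurable ?P"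
    by (intro borel_measurable_sum borel_measurable_scaleR borel_measurable_const)
  then show ?thesis
    by (simp add: step_def block_unit_def split_beta' mult.commute)
qed

lemma step_bounded_control:
  assumes \<kappa>: "\<And>q. fst q < 2 ^ K \<Longrightarrow> (\<lambda>\<omega>. \<kappa> \<omega> q) \<in> borel_measurable (augmented_filtration M B (grid T K (fst q)))"
    and N: "\<And>\<omega>. L2_energy T (step T K n (\<kappa> \<omega>)) \<le> N"
  shows "(\<lambda>t \<omega>. step T K n (\<kappa> \<omega>) t) \<in> bounded_controls M T B N"
proof -
  have "(\<lambda>t. step T K n (\<kappa> \<omega>) t) \<in> L2_space T" for \<omega>
    using step_L2[of T K n "\<kappa> \<omega>"] by (simp add: L2_space_eq)
  then show ?thesis
    using predictable_step[of K \<kappa> n, OF \<kappa>] N by (simp add: bounded_controls_def L2_controls_def L2_ball_def)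
qed

lemma shifted_BM_path_step:
  "shifted_BM_path T B \<epsilon> (\<lambda>s. step T K n \<kappa> s) \<omega> = controlled_path K n (\<lambda>q. 1 / sqrt \<epsilon> * \<kappa> q) \<omega>"
  unfolding shifted_BM_path_def controlled_path_def
  using primitive_step_scale[OF T, of _ "1 / sqrt \<epsilon>" K n \<kappa>]
  by (intro ext) (simp add: restrict_def del: atLeastAtMost_iff)

text \<open>By causality the increments from block \<open>a\<close> on may be replaced by 0 without
  changing \<open>c q\<close>; the earlier ones are known at time \<open>grid T K a\<close>.\<close>

lemma augmented_measurable_control:
  assumes c: "c q \<in> borel_measurable borel" and causal: "causal c" and a: "fst q \<le> a" "a < 2 ^ K"
  shows "(\<lambda>\<omega>. c q (inc K n \<omega>)) \<in> borel_measurable (augmented_filtration M B (grid T K a))"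
proof -
  let ?F = "augmented_filtration M B (grid T K a)"
  have "(\<lambda>\<omega>. if fst r < a then inc K n \<omega> r else 0) \<in> borel_measurable ?F" for r
  proof (cases "fst r < a \<and> snd r < n")
    case True
    then have "grid T K (fst r) \<in> {0..grid T K a}" "grid T K (Suc (fst r)) \<in> {0..grid T K a}"
      using T by (auto simp: Suc_le_eq intro!: grid_mono) (simp_all add: grid_def)
    then have "(\<lambda>\<omega>. B (snd r) (grid T K (Suc (fst r))) \<omega> - B (snd r) (grid T K (fst r)) \<omega>) \<in> borel_measurable ?F"
      by (intro borel_measurable_diff measurable_augmented)
    then show ?thesis using True a by (simp add: inc_def)
  next
    case False
    then have "(\<lambda>\<omega>. if fst r < a then inc K n \<omega> r else 0) = (\<lambda>\<omega>. 0)" by (auto simp: inc_def)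
    then show ?thesis by simp
  qed
  then have "(\<lambda>\<omega> r. if fst r < a then inc K n \<omega> r else 0) \<in> borel_measurable ?F"
    by (rule measurable_coordinatewise_then_product)
  then have "(\<lambda>\<omega>. c q (\<lambda>r. if fst r < a then inc K n \<omega> r else 0)) \<in> borel_measurable ?F"
    by (rule measurable_compose[OF _ c])
  moreover have "c q (\<lambda>r. if fst r < a then inc K n \<omega> r else 0) = c q (inc K n \<omega>)" for \<omega>
    by (rule causal[unfolded causal_def, rule_format]) (use a in auto)
  ultimately show ?thesis by simp
qed

definition cost :: "nat \<Rightarrow> nat \<Rightarrow> (nat \<times> nat \<Rightarrow> (nat \<times> nat \<Rightarrow> real) \<Rightarrow> real) \<Rightarrow> nat \<Rightarrow> 'w \<Rightarrow> real" where
  "cost K n c a \<omega> = T / 2 ^ K / 2 * (\<Sum>i<a. \<Sum>b<n. (c (i, b) (inc K n \<omega>))\<^sup>2)"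

text \<open>The control is switched off just before its energy would exceed \<open>R\<close>; the energy of a block is
  already known at its left end point, so the result is still predictable.\<close>

definition stopped :: "nat \<Rightarrow> nat \<Rightarrow> real \<Rightarrow> (nat \<times> nat \<Rightarrow> (nat \<times> nat \<Rightarrow> real) \<Rightarrow> real) \<Rightarrow> 'w \<Rightarrow> nat \<times> nat \<Rightarrow> real" where
  "stopped K n R c \<omega> q = (if cost K n c (Suc (fst q)) \<omega> \<le> R then c q (inc K n \<omega>) else 0)"

lemma cost_Suc: "cost K n c (Suc a) \<omega> = cost K n c a \<omega> + T / 2 ^ K / 2 * (\<Sum>b<n. (c (a, b) (inc K n \<omega>))\<^sup>2)"
  by (simp add: cost_def distrib_left)

lemma cost_mono: "a \<le> a' \<Longrightarrow> cost K n c a \<omega> \<le> cost K n c a' \<omega>"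
  unfolding cost_def using T by (intro mult_left_mono sum_mono2) (auto intro: sum_nonneg)

lemma stopped_cost_le:
  assumes R: "0 \<le> R"
  shows "T / 2 ^ K / 2 * (\<Sum>q\<in>{..<2 ^ K} \<times> {..<n}. (stopped K n R c \<omega> q)\<^sup>2) \<le> R"
proof -
  let ?S = "\<lambda>a. T / 2 ^ K / 2 * (\<Sum>i<a. \<Sum>b<n. (stopped K n R c \<omega> (i, b))\<^sup>2)"
  \<comment> \<open>The comparison with \<open>cost\<close> is carried along because it yields the
    bound by \<open>R\<close> in blocks where the control is still on.\<close>
  have "?S a \<le> R \<and> ?S a \<le> cost K n c a \<omega>" for a
  proof (induction a)
    case 0
    then show ?case using R by (simp add: cost_def)
  next
    case (Suc a)
    show ?case
    proof (cases "cost K n c (Suc a) \<omega> \<le> R")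
      case True
      then have "?S (Suc a) = ?S a + T / 2 ^ K / 2 * (\<Sum>b<n. (c (a, b) (inc K n \<omega>))\<^sup>2)"
        by (simp add: stopped_def distrib_left)
      then show ?thesis using Suc True by (simp add: cost_Suc)
    next
      case False
      then have "(\<Sum>b<n. (stopped K n R c \<omega> (a, b))\<^sup>2) = 0" by (simp add: stopped_def)
      then have "?S (Suc a) = ?S a" by (simp only: sum.lessThan_Suc add_0_right)
      moreover have "cost K n c a \<omega> \<le> cost K n c (Suc a) \<omega>" by (rule cost_mono) simp
      ultimately show ?thesis using Suc by linarith
    qed
  qed
  from this[of "2 ^ K"] show ?thesis by (simp add: sum.cartesian_product)
qed

lemma stopped_eq:
  assumes "T / 2 ^ K / 2 * (\<Sum>q\<in>{..<2 ^ K} \<times> {..<n}. (c q (inc K n \<omega>))\<^sup>2) \<le> R" "fst q < 2 ^ K"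
  shows "stopped K n R c \<omega> q = c q (inc K n \<omega>)"
proof -
  have "cost K n c (Suc (fst q)) \<omega> \<le> cost K n c (2 ^ K) \<omega>" using assms(2) by (intro cost_mono) auto
  also have "\<dots> \<le> R" using assms(1) by (simp add: cost_def sum.cartesian_product)
  finally show ?thesis by (simp add: stopped_def)
qed

text \<open>The weights are scaled by \<open>sqrt \<epsilon>\<close>, so the energy is surely at
  most \<open>2 * \<epsilon> * R\<close>, and the factor \<open>1 / sqrt \<epsilon>\<close> of the
  shift undoes the scaling. On the event of \<open>steering\<close> the cost never exceeds
  \<open>R\<close>, the stopping does not act, and the shifted path is the steered one.\<close>

lemma control_for_event:
  assumes A: "A \<in> sets (path_space T)" and p: "p = prob {\<omega>\<in>space M. BM_path T B \<omega> \<in> A}" "0 < p"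
    and R: "0 < R" and \<eta>: "0 < \<eta>" and \<epsilon>: "0 < \<epsilon>"
  shows "\<exists>k\<in>bounded_controls M T B (2 * \<epsilon> * R).
    (\<lambda>\<omega>. shifted_BM_path T B \<epsilon> (\<lambda>s. k s \<omega>) \<omega>) \<in> M \<rightarrow>\<^sub>M path_space T \<and>
    (\<lambda>\<omega>. primitive T (\<lambda>s. k s \<omega>)) \<in> M \<rightarrow>\<^sub>M path_space T \<and>
    (\<forall>\<omega>. (\<lambda>s. k s \<omega>) \<in> L2_ball T (2 * \<epsilon> * R)) \<and>
    1 - ln (1 / p) / R - \<eta> \<le> prob {\<omega>\<in>space M. shifted_BM_path T B \<epsilon> (\<lambda>s. k s \<omega>) \<omega> \<in> A}"
proof -
  obtain K n c where c: "\<And>q. c q \<in> borel_measurable borel" "causal c"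
    and good: "1 - ln (1 / p) / R - \<eta> \<le> prob {\<omega>\<in>space M. steered_path K n c \<omega> \<in> A \<and>
      T / 2 ^ K / 2 * (\<Sum>q\<in>{..<2 ^ K} \<times> {..<n}. (c q (inc K n \<omega>))\<^sup>2) \<le> R}"
    using steering[OF A p R \<eta>] by blast
  define \<kappa> where "\<kappa> \<omega> q = sqrt \<epsilon> * stopped K n R c \<omega> q" for \<omega> q
  define k where "k t \<omega> = step T K n (\<kappa> \<omega>) t" for t \<omega>
  have aug: "(\<lambda>\<omega>. \<kappa> \<omega> q) \<in> borel_measurable (augmented_filtration M B (grid T K (fst q)))" if q: "fst q < 2 ^ K" for q
  proof -
    let ?F = "augmented_filtration M B (grid T K (fst q))"
    have [measurable]: "(\<lambda>\<omega>. c r (inc K n \<omega>)) \<in> borel_measurable ?F" if "fst r \<le> fst q" for r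
      by (rule augmented_measurable_control[OF c(1) c(2) that q])
    have [measurable]: "(\<lambda>\<omega>. cost K n c (Suc (fst q)) \<omega>) \<in> borel_measurable ?F"
      unfolding cost_def by (intro borel_measurable_times borel_measurable_const borel_measurable_sum borel_measurable_power) simp
    show ?thesis unfolding \<kappa>_def stopped_def by measurable
  qed
  have [measurable]: "(\<lambda>\<omega>. c q (inc K n \<omega>)) \<in> borel_measurable M" for q
    by (rule measurable_compose[OF measurable_inc c(1)])
  have [measurable]: "(\<lambda>\<omega>. cost K n c a \<omega>) \<in> borel_measurable M" for a
    unfolding cost_def by measurable
  have \<kappa>_meas[measurable]: "(\<lambda>\<omega>. \<kappa> \<omega> q) \<in> borel_measurable M" for q
    unfolding \<kappa>_def stopped_def by measurable
  have energy: "L2_energy T (step T K n (\<kappa> \<omega>)) \<le> 2 * \<epsilon> * R" for \<omega>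
  proof -
    have "L2_energy T (step T K n (\<kappa> \<omega>)) = 2 * \<epsilon> * (T / 2 ^ K / 2 * (\<Sum>q\<in>{..<2 ^ K} \<times> {..<n}. (stopped K n R c \<omega> q)\<^sup>2))"
      using \<epsilon> by (simp add: energy_step[OF T] \<kappa>_def power_mult_distrib sum_distrib_left[symmetric])
    also have "\<dots> \<le> 2 * \<epsilon> * R"
      using stopped_cost_le[of R K n c \<omega>] R \<epsilon> by (intro mult_left_mono) auto
    finally show ?thesis .
  qed
  have k: "k \<in> bounded_controls M T B (2 * \<epsilon> * R)"
    unfolding k_def[abs_def] by (rule step_bounded_control[OF aug energy])
  have ball: "(\<lambda>s. k s \<omega>) \<in> L2_ball T (2 * \<epsilon> * R)" for \<omega>
    using energy step_L2[of T K n "\<kappa> \<omega>"] by (simp add: k_def L2_ball_def L2_space_eq)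
  have path: "shifted_BM_path T B \<epsilon> (\<lambda>s. k s \<omega>) \<omega> = controlled_path K n (stopped K n R c \<omega>) \<omega>" for \<omega>
    unfolding k_def shifted_BM_path_step using \<epsilon> by (simp add: \<kappa>_def)
  have stopped_meas: "(\<lambda>\<omega>. stopped K n R c \<omega> q) \<in> borel_measurable M" for q
    unfolding stopped_def by measurable
  have Ym[measurable]: "(\<lambda>\<omega>. shifted_BM_path T B \<epsilon> (\<lambda>s. k s \<omega>) \<omega>) \<in> M \<rightarrow>\<^sub>M path_space T"
    unfolding path by (rule measurable_controlled_path[OF stopped_meas])
  have Pm: "(\<lambda>\<omega>. primitive T (\<lambda>s. k s \<omega>)) \<in> M \<rightarrow>\<^sub>M path_space T"
    unfolding k_def using measurable_primitive_step[OF \<kappa>_meas, of K n] by simp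
  note good
  also have "prob {\<omega>\<in>space M. steered_path K n c \<omega> \<in> A \<and>
      T / 2 ^ K / 2 * (\<Sum>q\<in>{..<2 ^ K} \<times> {..<n}. (c q (inc K n \<omega>))\<^sup>2) \<le> R}
    \<le> prob {\<omega>\<in>space M. shifted_BM_path T B \<epsilon> (\<lambda>s. k s \<omega>) \<omega> \<in> A}"
  proof (rule finite_measure_mono)
    show "{\<omega>\<in>space M. steered_path K n c \<omega> \<in> A \<and>
      T / 2 ^ K / 2 * (\<Sum>q\<in>{..<2 ^ K} \<times> {..<n}. (c q (inc K n \<omega>))\<^sup>2) \<le> R}
      \<subseteq> {\<omega>\<in>space M. shifted_BM_path T B \<epsilon> (\<lambda>s. k s \<omega>) \<omega> \<in> A}"
    proof safe
      fix \<omega> assume "steered_path K n c \<omega> \<in> A"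
        and le: "T / 2 ^ K / 2 * (\<Sum>q\<in>{..<2 ^ K} \<times> {..<n}. (c q (inc K n \<omega>))\<^sup>2) \<le> R"
      have "step T K n (stopped K n R c \<omega>) = step T K n (\<lambda>q. c q (inc K n \<omega>))"
        by (rule step_cong) (use stopped_eq[where K = K and n = n and c = c and \<omega> = \<omega> and R = R, OF le] in auto)
      then have "controlled_path K n (stopped K n R c \<omega>) \<omega> = steered_path K n c \<omega>"
        by (simp add: steered_path_def controlled_path_def)
      then show "shifted_BM_path T B \<epsilon> (\<lambda>s. k s \<omega>) \<omega> \<in> A"
        using \<open>steered_path K n c \<omega> \<in> A\<close> by (simp add: path)
    qed
    show "{\<omega>\<in>space M. shifted_BM_path T B \<epsilon> (\<lambda>s. k s \<omega>) \<omega> \<in> A} \<in> events"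
      using A by measurable
  qed
  finally show ?thesis using k ball Ym Pm by blast
qed

end

section \<open>The large deviation principle\<close>

lemma filterlim_nat_floor_inverse: "filterlim (\<lambda>\<epsilon> :: real. nat \<lfloor>1 / \<epsilon>\<rfloor>) sequentially (at_right 0)"
proof -
  have "filterlim (\<lambda>\<epsilon> :: real. inverse \<epsilon>) at_top (at_right 0)" by (rule filterlim_inverse_at_top_right)
  then have "filterlim (\<lambda>\<epsilon> :: real. 1 / \<epsilon>) at_top (at_right 0)" by (simp add: inverse_eq_divide)
  moreover have "filterlim (\<lambda>x :: real. nat \<lfloor>x\<rfloor>) sequentially at_top"
    by (intro filterlim_compose[OF filterlim_nat_sequentially] filterlim_floor_sequentially)
  ultimately show ?thesis by (rule filterlim_compose[rotated])
qed

locale small_noise = brownian M T B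
  for M :: "'w measure" and T and B +
  fixes \<Gamma> :: "real \<Rightarrow> (real \<Rightarrow> nat \<Rightarrow> real) \<Rightarrow> 'e::polish_space"
    and \<Gamma>0 :: "(real \<Rightarrow> nat \<Rightarrow> real) \<Rightarrow> 'e"
  assumes \<Gamma>: "\<And>\<epsilon>. 0 < \<epsilon> \<Longrightarrow> \<Gamma> \<epsilon> \<in> path_space T \<rightarrow>\<^sub>M borel"
    and \<Gamma>0: "\<Gamma>0 \<in> path_space T \<rightarrow>\<^sub>M borel"
    and i: "\<And>(N::real) (k :: real \<Rightarrow> real \<Rightarrow> 'w \<Rightarrow> l2) (\<delta>::real).
      (\<forall>\<epsilon>>0. k \<epsilon> \<in> bounded_controls M T B N) \<Longrightarrow> 0 < \<delta> \<Longrightarrow>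
      ((\<lambda>\<epsilon>. measure (completion M) {\<omega> \<in> space M.
          dist (\<Gamma> \<epsilon> (shifted_BM_path T B \<epsilon> (\<lambda>s. k \<epsilon> s \<omega>) \<omega>))
               (\<Gamma>0 (primitive T (\<lambda>s. k \<epsilon> s \<omega>))) > \<delta>}) \<longlongrightarrow> 0) (at_right 0)"
    and ii: "\<And>(N::real) (k :: real \<Rightarrow> real \<Rightarrow> l2) k0.
      (\<forall>\<epsilon>>0. k \<epsilon> \<in> L2_ball T N) \<Longrightarrow> k0 \<in> L2_space T \<Longrightarrow>
      L2_weak_tendsto T k k0 (at_right 0) \<Longrightarrow>
      ((\<lambda>\<epsilon>. \<Gamma>0 (primitive T (k \<epsilon>))) \<longlongrightarrow> \<Gamma>0 (primitive T k0)) (at_right 0)"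
begin

definition rate :: "'e \<Rightarrow> ennreal" where
  "rate g = (INF k\<in>{k \<in> L2_space T. g = \<Gamma>0 (primitive T k)}. ennreal (1 / 2 * L2_energy T k))"

text \<open>Condition (ii) concerns families indexed by \<open>\<epsilon>\<close>: a sequence
  becomes such a family through \<open>n = nat \<lfloor>1 / \<epsilon>\<rfloor>\<close>, and its
  limit is read off along \<open>\<epsilon> = 1 / real (Suc n)\<close>.\<close>

lemma skeleton_continuous:
  assumes k: "\<And>n. k n \<in> L2_ball T N" and x: "x \<in> L2_space T" and lim: "L2_weak_tendsto T k x sequentially"
  shows "(\<lambda>n. \<Gamma>0 (primitive T (k n))) \<longlonglongrightarrow> \<Gamma>0 (primitive T x)"
proof -
  let ?n = "\<lambda>\<epsilon> :: real. nat \<lfloor>1 / \<epsilon>\<rfloor>"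
  have "((\<lambda>\<epsilon>. \<Gamma>0 (primitive T (k (?n \<epsilon>)))) \<longlongrightarrow> \<Gamma>0 (primitive T x)) (at_right 0)"
  proof (rule ii[OF _ x])
    show "\<forall>\<epsilon>>0. k (?n \<epsilon>) \<in> L2_ball T N" using k by simp
    show "L2_weak_tendsto T (\<lambda>\<epsilon>. k (?n \<epsilon>)) x (at_right 0)"
      unfolding L2_weak_tendsto_def
    proof
      fix h assume "h \<in> L2_space T"
      then have "(\<lambda>n. L2_inner T (k n) h) \<longlonglongrightarrow> L2_inner T x h" using lim by (simp add: L2_weak_tendsto_def)
      then show "((\<lambda>\<epsilon>. L2_inner T (k (?n \<epsilon>)) h) \<longlongrightarrow> L2_inner T x h) (at_right 0)"
        by (rule filterlim_compose[OF _ filterlim_nat_floor_inverse])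
    qed
  qed
  moreover have "filterlim (\<lambda>n. 1 / real (Suc n)) (at_right 0) sequentially"
    unfolding filterlim_at using LIMSEQ_inverse_real_of_nat by (auto simp: inverse_eq_divide)
  ultimately have "((\<lambda>n. \<Gamma>0 (primitive T (k (?n (1 / real (Suc n)))))) \<longlongrightarrow> \<Gamma>0 (primitive T x)) sequentially"
    by (rule filterlim_compose)
  then have "((\<lambda>n. \<Gamma>0 (primitive T (k (Suc n)))) \<longlongrightarrow> \<Gamma>0 (primitive T x)) sequentially"
  proof -
    have "?n (1 / real (Suc n)) = Suc n" for n
    proof -
      have "1 / (1 / real (Suc n)) = real (Suc n)" by simp
      then show ?thesis by (simp only: floor_of_nat nat_int)
    qed
    then show ?thesis using \<open>((\<lambda>n. \<Gamma>0 (primitive T (k (?n (1 / real (Suc n)))))) \<longlongrightarrow> \<Gamma>0 (primitive T x)) sequentially\<close>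
      by (simp only:)
  qed
  then show ?thesis by (rule LIMSEQ_imp_Suc)
qed

lemma rate_le:
  assumes "k \<in> L2_space T" "L2_energy T k \<le> 2 * a"
  shows "rate (\<Gamma>0 (primitive T k)) \<le> ennreal a"
proof -
  have "rate (\<Gamma>0 (primitive T k)) \<le> ennreal (1 / 2 * L2_energy T k)"
    unfolding rate_def by (rule INF_lower) (use assms in auto)
  also have "\<dots> \<le> ennreal a" using assms(2) by (intro ennreal_leI) simp
  finally show ?thesis .
qed

text \<open>Near-minimizers lie in one weakly compact ball; along a weakly convergent subsequence
  the skeletons converge by (ii) and the energy is lower semicontinuous, so the excess
  \<open>1 / real (Suc n)\<close> disappears in the limit.\<close>

lemma compact_sublevel:
  assumes "L < \<infinity>"
  shows "compact {x. rate x \<le> L}"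
  unfolding compact_eq_seq_compact_metric seq_compact_def
proof (intro allI impI)
  fix f :: "nat \<Rightarrow> 'e" assume f: "\<forall>n. f n \<in> {x. rate x \<le> L}"
  obtain l where l: "0 \<le> l" "L = ennreal l" using assms by (cases L) auto
  have "\<exists>k\<in>L2_space T. f n = \<Gamma>0 (primitive T k) \<and> L2_energy T k \<le> 2 * (l + 1 / real (Suc n))" for n
  proof -
    have "rate (f n) \<le> ennreal l" using f l by auto
    also have "\<dots> < ennreal (l + 1 / real (Suc n))" using l by (intro ennreal_lessI add_nonneg_pos) auto
    finally obtain k where k: "k \<in> L2_space T" "f n = \<Gamma>0 (primitive T k)" "ennreal (1 / 2 * L2_energy T k) < ennreal (l + 1 / real (Suc n))"
      unfolding rate_def INF_less_iff by auto
    then have "1 / 2 * L2_energy T k < l + 1 / real (Suc n)"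
      by (subst (asm) ennreal_less_iff) (simp_all add: L2_energy_eq ip_self_nonneg)
    then show ?thesis using k by (intro bexI[of _ k]) auto
  qed
  then obtain k where k: "\<And>n. k n \<in> L2_space T" "\<And>n. f n = \<Gamma>0 (primitive T (k n))" "\<And>n. L2_energy T (k n) \<le> 2 * (l + 1 / real (Suc n))"
    by metis
  have ball: "k n \<in> L2_ball T (2 * (l + 1))" for n
  proof -
    have "1 / real (Suc n) \<le> 1" by simp
    then have "L2_energy T (k n) \<le> 2 * (l + 1)" using k(3)[of n] by argo
    then show ?thesis using k(1) by (simp add: L2_ball_def)
  qed
  obtain r x where r: "strict_mono (r :: nat \<Rightarrow> nat)" and x: "x \<in> L2_ball T (2 * (l + 1))"
    and lim: "L2_weak_tendsto T (\<lambda>n. k (r n)) x sequentially"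
    using L2_ball_weakly_compact[of k T "2 * (l + 1)", OF ball] by (elim exE conjE) (rule that)
  have xs: "x \<in> L2_space T" using x by (simp add: L2_ball_def)
  have conv: "(\<lambda>n. \<Gamma>0 (primitive T (k (r n)))) \<longlonglongrightarrow> \<Gamma>0 (primitive T x)"
    by (rule skeleton_continuous[OF ball xs lim])
  have "L2_energy T x \<le> 2 * l + 2 * (1 / real (Suc m))" for m
  proof (rule weak_limit_energy_le[OF k(1) xs lim], rule eventually_sequentiallyI)
    fix n assume "m \<le> n"
    then have "m \<le> r n" using seq_suble[OF r, of n] by simp
    then have "1 / real (Suc (r n)) \<le> 1 / real (Suc m)" by (intro divide_left_mono) auto
    then show "L2_energy T (k (r n)) \<le> 2 * l + 2 * (1 / real (Suc m))" using k(3)[of "r n"] by argo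
  qed
  moreover have "(\<lambda>m. 2 * l + 2 * (1 / real (Suc m))) \<longlonglongrightarrow> 2 * l + 2 * 0"
    using LIMSEQ_inverse_real_of_nat by (intro tendsto_intros) (simp add: inverse_eq_divide)
  ultimately have "L2_energy T x \<le> 2 * l + 2 * 0" by (intro LIMSEQ_le_const) auto
  then have "rate (\<Gamma>0 (primitive T x)) \<le> L" unfolding l(2) by (intro rate_le[OF xs]) simp
  then show "\<exists>l\<in>{x. rate x \<le> L}. \<exists>r. strict_mono r \<and> (f \<circ> r) \<longlonglongrightarrow> l"
    using r conv by (intro bexI[of _ "\<Gamma>0 (primitive T x)"] exI[of _ r]) (simp_all add: comp_def k(2)[symmetric])
qed

section \<open>The two large deviation bounds\<close>

definition level :: "real \<Rightarrow> 'e set \<Rightarrow> real" where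
  "level \<epsilon> A = prob {\<omega>\<in>space M. \<Gamma> \<epsilon> (BM_path T B \<omega>) \<in> A}"

lemma measurable_gap:
  assumes "0 < \<epsilon>" and Y: "Y \<in> M \<rightarrow>\<^sub>M path_space T" and Z: "Z \<in> M \<rightarrow>\<^sub>M path_space T"
  shows "{\<omega>\<in>space M. \<delta> < dist (\<Gamma> \<epsilon> (Y \<omega>)) (\<Gamma>0 (Z \<omega>))} \<in> events"
proof -
  have [measurable]: "(\<lambda>\<omega>. \<Gamma> \<epsilon> (Y \<omega>)) \<in> borel_measurable M" "(\<lambda>\<omega>. \<Gamma>0 (Z \<omega>)) \<in> borel_measurable M"
    using measurable_compose[OF Y \<Gamma>[OF assms(1)]] measurable_compose[OF Z \<Gamma>0] by auto
  show ?thesis by measurable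
qed

text \<open>A filler: condition (i) asks for a control at every \<open>\<epsilon>\<close>, also
  where the event is not likely enough for steering.\<close>

lemma zero_control: "0 \<le> N \<Longrightarrow> (\<lambda>_ _. 0) \<in> bounded_controls M T B N"
  by (auto simp: bounded_controls_def L2_controls_def L2_ball_def L2_space_eq square_integrable_zero L2_energy_def split_beta')

text \<open>On the event that the noise produces a point of \<open>F\<close>, steering turns the exponential lower
  bound on its probability into skeleton points near \<open>F\<close> of comparable energy.\<close>

lemma skeleton_near_closed_set:
  assumes F: "closed F" and a: "0 \<le> a'" "a' < a"
    and freq: "\<exists>\<^sub>F \<epsilon> in at_right 0. exp (- a' / \<epsilon>) \<le> level \<epsilon> F" and \<delta>: "0 < \<delta>"
  shows "\<exists>k\<in>L2_ball T (2 * a). \<exists>x\<in>F. dist x (\<Gamma>0 (primitive T k)) \<le> \<delta>"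
proof -
  \<comment> \<open>Chosen so that \<open>1 - a' / a - \<eta> = \<eta>\<close>, the hitting
    probability that steering guarantees.\<close>
  define \<eta> where "\<eta> = (1 - a' / a) / 2"
  have \<eta>: "0 < \<eta>" using a by (simp add: \<eta>_def)
  define P where "P \<epsilon> k \<longleftrightarrow> k \<in> bounded_controls M T B (2 * a) \<and>
      (0 < \<epsilon> \<and> exp (- a' / \<epsilon>) \<le> level \<epsilon> F \<longrightarrow>
        (\<lambda>\<omega>. shifted_BM_path T B \<epsilon> (\<lambda>s. k s \<omega>) \<omega>) \<in> M \<rightarrow>\<^sub>M path_space T \<and>
        (\<lambda>\<omega>. primitive T (\<lambda>s. k s \<omega>)) \<in> M \<rightarrow>\<^sub>M path_space T \<and>
        (\<forall>\<omega>. (\<lambda>s. k s \<omega>) \<in> L2_ball T (2 * a)) \<and>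
        \<eta> \<le> prob {\<omega>\<in>space M. \<Gamma> \<epsilon> (shifted_BM_path T B \<epsilon> (\<lambda>s. k s \<omega>) \<omega>) \<in> F})" for \<epsilon> k
  have "\<exists>k. P \<epsilon> k" for \<epsilon>
  proof (cases "0 < \<epsilon> \<and> exp (- a' / \<epsilon>) \<le> level \<epsilon> F")
    case True
    let ?A = "\<Gamma> \<epsilon> -` F \<inter> space (path_space T)"
    have A: "?A \<in> sets (path_space T)" using \<Gamma>[of \<epsilon>] True F by (intro measurable_sets[of _ _ borel]) auto
    have A_iff: "Y \<omega> \<in> ?A \<longleftrightarrow> \<Gamma> \<epsilon> (Y \<omega>) \<in> F" if "Y \<in> M \<rightarrow>\<^sub>M path_space T" "\<omega> \<in> space M" for Y \<omega>
      using measurable_space[OF that] by simp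
    have p: "level \<epsilon> F = prob {\<omega>\<in>space M. BM_path T B \<omega> \<in> ?A}"
      unfolding level_def by (intro arg_cong[where f = prob] Collect_cong) (use A_iff[OF measurable_BM_path] in auto)
    have p0: "0 < level \<epsilon> F" using True exp_gt_zero less_le_trans by blast
    \<comment> \<open>The budget \<open>a / \<epsilon>\<close> for steering gives the
      \<open>\<epsilon>\<close>-free energy bound \<open>2 * a\<close>, while
      \<open>ln (1 / level \<epsilon> F)\<close> is at most \<open>a' / \<epsilon>\<close>.\<close>
    have R: "0 < a / \<epsilon>" using a True by simp
    obtain k where k: "k \<in> bounded_controls M T B (2 * \<epsilon> * (a / \<epsilon>))"
      and m: "(\<lambda>\<omega>. shifted_BM_path T B \<epsilon> (\<lambda>s. k s \<omega>) \<omega>) \<in> M \<rightarrow>\<^sub>M path_space T"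
        "(\<lambda>\<omega>. primitive T (\<lambda>s. k s \<omega>)) \<in> M \<rightarrow>\<^sub>M path_space T"
      and ball: "\<forall>\<omega>. (\<lambda>s. k s \<omega>) \<in> L2_ball T (2 * \<epsilon> * (a / \<epsilon>))"
      and pr: "1 - ln (1 / level \<epsilon> F) / (a / \<epsilon>) - \<eta> \<le> prob {\<omega>\<in>space M. shifted_BM_path T B \<epsilon> (\<lambda>s. k s \<omega>) \<omega> \<in> ?A}"
      using control_for_event[OF A p p0 R \<eta>, of \<epsilon>] True by blast
    have eq: "2 * \<epsilon> * (a / \<epsilon>) = 2 * a" using True by simp
    have "ln (exp (- a' / \<epsilon>)) \<le> ln (level \<epsilon> F)" using True p0 by (subst ln_le_cancel_iff) auto
    then have "ln (1 / level \<epsilon> F) \<le> a' / \<epsilon>" using p0 by (simp add: ln_div)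
    then have "ln (1 / level \<epsilon> F) / (a / \<epsilon>) \<le> (a' / \<epsilon>) / (a / \<epsilon>)" using R by (intro divide_right_mono) auto
    also have "\<dots> = a' / a" using True a by simp
    finally have "\<eta> \<le> 1 - ln (1 / level \<epsilon> F) / (a / \<epsilon>) - \<eta>" unfolding \<eta>_def by argo
    also note pr
    also have "{\<omega>\<in>space M. shifted_BM_path T B \<epsilon> (\<lambda>s. k s \<omega>) \<omega> \<in> ?A} = {\<omega>\<in>space M. \<Gamma> \<epsilon> (shifted_BM_path T B \<epsilon> (\<lambda>s. k s \<omega>) \<omega>) \<in> F}"
      using A_iff[OF m(1)] by blast
    finally show ?thesis using k m ball unfolding P_def eq by blast
  next
    case False
    have "0 \<le> 2 * a" using a by simp
    from zero_control[OF this] show ?thesis using False unfolding P_def by blast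
  qed
  then obtain k where k: "\<And>\<epsilon>. P \<epsilon> (k \<epsilon>)" by metis
  let ?D = "\<lambda>\<epsilon>. {\<omega>\<in>space M. \<delta> < dist (\<Gamma> \<epsilon> (shifted_BM_path T B \<epsilon> (\<lambda>s. k \<epsilon> s \<omega>) \<omega>)) (\<Gamma>0 (primitive T (\<lambda>s. k \<epsilon> s \<omega>)))}"
  have "((\<lambda>\<epsilon>. measure (completion M) (?D \<epsilon>)) \<longlongrightarrow> 0) (at_right 0)"
    by (rule i[OF _ \<delta>, of k "2 * a"]) (use k in \<open>auto simp: P_def\<close>)
  from order_tendstoD(2)[OF this \<eta>]
  have "\<exists>\<^sub>F \<epsilon> in at_right 0. (measure (completion M) (?D \<epsilon>) < \<eta> \<and> 0 < \<epsilon>) \<and> exp (- a' / \<epsilon>) \<le> level \<epsilon> F"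
    by (intro frequently_eventually_conj[OF freq] eventually_conj eventually_at_right_less)
  from frequently_ex[OF this] obtain \<epsilon> where \<epsilon>: "exp (- a' / \<epsilon>) \<le> level \<epsilon> F" "measure (completion M) (?D \<epsilon>) < \<eta>" "0 < \<epsilon>"
    by blast
  note good = mp[OF conjunct2[OF k[of \<epsilon>, unfolded P_def]] conjI[OF \<epsilon>(3) \<epsilon>(1)]]
  have m: "(\<lambda>\<omega>. shifted_BM_path T B \<epsilon> (\<lambda>s. k \<epsilon> s \<omega>) \<omega>) \<in> M \<rightarrow>\<^sub>M path_space T"
        "(\<lambda>\<omega>. primitive T (\<lambda>s. k \<epsilon> s \<omega>)) \<in> M \<rightarrow>\<^sub>M path_space T"
      and ball: "\<And>\<omega>. (\<lambda>s. k \<epsilon> s \<omega>) \<in> L2_ball T (2 * a)"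
      and pr: "\<eta> \<le> prob {\<omega>\<in>space M. \<Gamma> \<epsilon> (shifted_BM_path T B \<epsilon> (\<lambda>s. k \<epsilon> s \<omega>) \<omega>) \<in> F}"
    by (rule conjunct1[OF good] conjunct1[OF conjunct2[OF good]] spec[OF conjunct1[OF conjunct2[OF conjunct2[OF good]]]]
      conjunct2[OF conjunct2[OF conjunct2[OF good]]])+
  have D: "?D \<epsilon> \<in> events" by (rule measurable_gap[OF \<epsilon>(3) m])
  \<comment> \<open>An event of probability at least \<open>\<eta>\<close> cannot lie inside one of
    probability below \<open>\<eta>\<close>; a sample point in the difference has its image in
    \<open>F\<close> and within \<open>\<delta>\<close> of its skeleton.\<close>
  have "\<not> {\<omega>\<in>space M. \<Gamma> \<epsilon> (shifted_BM_path T B \<epsilon> (\<lambda>s. k \<epsilon> s \<omega>) \<omega>) \<in> F} \<subseteq> ?D \<epsilon>"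
  proof
    assume "{\<omega>\<in>space M. \<Gamma> \<epsilon> (shifted_BM_path T B \<epsilon> (\<lambda>s. k \<epsilon> s \<omega>) \<omega>) \<in> F} \<subseteq> ?D \<epsilon>"
    note mono = finite_measure_mono[OF this D]
    note pr
    also note mono
    also note measure_completion[OF D, symmetric]
    also note \<epsilon>(2)
    finally show False by simp
  qed
  then obtain \<omega> where "\<omega> \<in> {\<omega>\<in>space M. \<Gamma> \<epsilon> (shifted_BM_path T B \<epsilon> (\<lambda>s. k \<epsilon> s \<omega>) \<omega>) \<in> F}" "\<omega> \<notin> ?D \<epsilon>"
    by blast
  then have "\<Gamma> \<epsilon> (shifted_BM_path T B \<epsilon> (\<lambda>s. k \<epsilon> s \<omega>) \<omega>) \<in> F"
    "dist (\<Gamma> \<epsilon> (shifted_BM_path T B \<epsilon> (\<lambda>s. k \<epsilon> s \<omega>) \<omega>)) (\<Gamma>0 (primitive T (\<lambda>s. k \<epsilon> s \<omega>))) \<le> \<delta>"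
    by (auto simp: not_less)
  then show ?thesis using ball[of \<omega>] by blast
qed

text \<open>Tolerances \<open>1 / real (Suc n)\<close> give points of \<open>F\<close> next to
  skeletons of controls in one ball; a weak limit of the controls has its skeleton in
  \<open>F\<close> because \<open>F\<close> is closed.\<close>

lemma rate_on_closed_set:
  assumes F: "closed F" and a: "0 \<le> a'" "a' < a"
    and freq: "\<exists>\<^sub>F \<epsilon> in at_right 0. exp (- a' / \<epsilon>) \<le> level \<epsilon> F"
  shows "\<exists>x\<in>F. rate x \<le> ennreal a"
proof -
  have "\<exists>k x. k \<in> L2_ball T (2 * a) \<and> x \<in> F \<and> dist x (\<Gamma>0 (primitive T k)) \<le> 1 / real (Suc n)" for n
    using skeleton_near_closed_set[OF F a freq, of "1 / real (Suc n)"] by auto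
  then obtain k y where k: "\<And>n. k n \<in> L2_ball T (2 * a)" and y: "\<And>n. y n \<in> F"
    and d: "\<And>n. dist (y n) (\<Gamma>0 (primitive T (k n))) \<le> 1 / real (Suc n)"
    by metis
  obtain r x where r: "strict_mono (r :: nat \<Rightarrow> nat)" and x: "x \<in> L2_ball T (2 * a)"
    and lim: "L2_weak_tendsto T (\<lambda>n. k (r n)) x sequentially"
    using L2_ball_weakly_compact[of k T "2 * a", OF k] by (elim exE conjE) (rule that)
  have xs: "x \<in> L2_space T" using x by (simp add: L2_ball_def)
  have conv: "(\<lambda>n. \<Gamma>0 (primitive T (k (r n)))) \<longlonglongrightarrow> \<Gamma>0 (primitive T x)"
    by (rule skeleton_continuous[OF k xs lim])
  have "(\<lambda>n. dist (y (r n)) (\<Gamma>0 (primitive T (k (r n))))) \<longlonglongrightarrow> 0"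
  proof (rule Lim_null_comparison)
    show "(\<lambda>n. 1 / real (Suc n)) \<longlonglongrightarrow> 0"
      using LIMSEQ_inverse_real_of_nat by (simp add: inverse_eq_divide)
    have "dist (y (r n)) (\<Gamma>0 (primitive T (k (r n)))) \<le> 1 / real (Suc n)" for n
    proof -
      have "1 / real (Suc (r n)) \<le> 1 / real (Suc n)" using seq_suble[OF r, of n] by (intro divide_left_mono) auto
      then show ?thesis using d[of "r n"] by linarith
    qed
    then show "\<forall>\<^sub>F n in sequentially. norm (dist (y (r n)) (\<Gamma>0 (primitive T (k (r n))))) \<le> 1 / real (Suc n)" by simp
  qed
  from tendsto_add[OF this conv[unfolded tendsto_dist_iff[of _ "\<Gamma>0 (primitive T x)"]]]
  have "(\<lambda>n. dist (y (r n)) (\<Gamma>0 (primitive T (k (r n)))) + dist (\<Gamma>0 (primitive T (k (r n)))) (\<Gamma>0 (primitive T x))) \<longlonglongrightarrow> 0"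
    by simp
  then have "(\<lambda>n. dist (y (r n)) (\<Gamma>0 (primitive T x))) \<longlonglongrightarrow> 0"
    by (rule Lim_null_comparison[rotated]) (simp add: dist_triangle)
  then have "(\<lambda>n. y (r n)) \<longlonglongrightarrow> \<Gamma>0 (primitive T x)" by (rule tendsto_dist_iff[THEN iffD2])
  then have "\<Gamma>0 (primitive T x) \<in> F"
    using F y by (auto dest: closed_sequentially[of F "\<lambda>n. y (r n)"])
  moreover have "rate (\<Gamma>0 (primitive T x)) \<le> ennreal a"
    by (rule rate_le[OF xs]) (use x in \<open>simp add: L2_ball_def\<close>)
  ultimately show ?thesis by blast
qed

lemma level_bounds: "0 \<le> level \<epsilon> A" "level \<epsilon> A \<le> 1"
  by (simp_all add: level_def)

lemma scaled_log_ge_iff: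
  assumes "0 < \<epsilon>" "0 \<le> p"
  shows "ereal (- b) \<le> ereal \<epsilon> * ext_ln p \<longleftrightarrow> exp (- b / \<epsilon>) \<le> p"
proof (cases "p = 0")
  case True
  then show ?thesis using assms by (simp add: ext_ln_def)
next
  case False
  then have p: "0 < p" using assms by simp
  have "ereal (- b) \<le> ereal \<epsilon> * ext_ln p \<longleftrightarrow> - b / \<epsilon> \<le> ln p"
    unfolding pos_divide_le_eq[OF assms(1)] using False by (simp add: ext_ln_def mult.commute)
  also have "\<dots> \<longleftrightarrow> exp (- b / \<epsilon>) \<le> p" using p by (metis exp_le_cancel_iff exp_ln)
  finally show ?thesis .
qed

text \<open>If the bound failed frequently at a level \<open>y = - b\<close>, then
  \<open>rate_on_closed_set\<close> would give a point of \<open>F\<close> with rate at most some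
  \<open>a\<close> strictly below the infimum. The gap \<open>b < a\<close> is the room that
  steering needs.\<close>

lemma upper_bound:
  assumes F: "closed F"
  shows "Limsup (at_right 0) (\<lambda>\<epsilon>. ereal \<epsilon> * ext_ln (level \<epsilon> F)) \<le> - (INF x\<in>F. enn2ereal (rate x))"
  unfolding Limsup_le_iff
proof (intro allI impI)
  fix y :: ereal assume y: "- (INF x\<in>F. enn2ereal (rate x)) < y"
  define m where "m = (INF x\<in>F. enn2ereal (rate x))"
  have m: "- y < m" using y by (metis ereal_uminus_less_reorder m_def)
  show "\<forall>\<^sub>F \<epsilon> in at_right 0. ereal \<epsilon> * ext_ln (level \<epsilon> F) < y"
  proof (cases "0 < y")
    case True
    \<comment> \<open>A positive \<open>y\<close> exceeds the scaled logarithm of any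
      probability.\<close>
    have "ereal \<epsilon> * ext_ln (level \<epsilon> F) < y" if "0 < \<epsilon>" for \<epsilon>
    proof -
      have "ereal \<epsilon> * ext_ln (level \<epsilon> F) \<le> 0"
      proof (cases "level \<epsilon> F = 0")
        case False
        then have "ln (level \<epsilon> F) \<le> 0" using level_bounds[of \<epsilon> F] by (subst ln_le_zero_iff) auto
        then show ?thesis using False that by (simp add: ext_ln_def mult_nonneg_nonpos)
      qed (use that in \<open>simp add: ext_ln_def\<close>)
      then show ?thesis using True by (rule le_less_trans)
    qed
    then show ?thesis by (intro eventually_mono[OF eventually_at_right_less]) auto
  next
    case False
    then have "y \<noteq> \<infinity>" "y \<noteq> - \<infinity>" using m y by auto
    then obtain b where b: "y = ereal (- b)" by (metis ereal_cases ereal_uminus_uminus uminus_ereal.simps(1))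
    have b0: "0 \<le> b" using False b by simp
    have "ereal b < m" using m b by simp
    then obtain a where a: "ereal b < ereal a" "ereal a < m" using ereal_dense2[of "ereal b" m] by auto
    show ?thesis
    proof (rule ccontr)
      assume "\<not> ?thesis"
      then have "\<exists>\<^sub>F \<epsilon> in at_right 0. y \<le> ereal \<epsilon> * ext_ln (level \<epsilon> F)"
        by (simp add: not_eventually not_less)
      then have "\<exists>\<^sub>F \<epsilon> in at_right 0. 0 < \<epsilon> \<and> y \<le> ereal \<epsilon> * ext_ln (level \<epsilon> F)"
        by (intro frequently_eventually_conj[OF _ eventually_at_right_less])
      then have "\<exists>\<^sub>F \<epsilon> in at_right 0. exp (- b / \<epsilon>) \<le> level \<epsilon> F"
        by (rule frequently_elim1) (use scaled_log_ge_iff[OF _ level_bounds(1)] b in auto)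
      from rate_on_closed_set[OF F b0 _ this, of a] a obtain x where x: "x \<in> F" "rate x \<le> ennreal a" by auto
      have "m \<le> enn2ereal (rate x)" unfolding m_def by (rule INF_lower[OF x(1)])
      also have "\<dots> \<le> enn2ereal (ennreal a)" using x(2) by (simp add: less_eq_ennreal.rep_eq)
      also have "\<dots> = ereal a" using a b0 by (subst enn2ereal_ennreal) auto
      finally show False using a(2) by simp
    qed
  qed
qed

text \<open>If \<open>level \<epsilon> G\<close> were below \<open>exp (- b / \<epsilon>)\<close>,
  the entropy bound with \<open>L = b / \<epsilon>\<close> would make the hitting probability times
  \<open>b\<close> at most half the energy plus \<open>\<epsilon> * ln 2\<close>. By (i) the hitting
  probability tends to 1, and half the energy is below \<open>b\<close>: impossible for small
  \<open>\<epsilon>\<close>.\<close>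

lemma lower_bound_step:
  assumes G: "open G" and S: "\<Gamma>0 (primitive T (step T K n \<kappa>)) \<in> G"
    and b: "1 / 2 * L2_energy T (step T K n \<kappa>) < b"
  shows "\<forall>\<^sub>F \<epsilon> in at_right 0. ereal (- b) \<le> ereal \<epsilon> * ext_ln (level \<epsilon> G)"
proof -
  let ?S = "step T K n \<kappa>" and ?E = "L2_energy T (step T K n \<kappa>)"
  let ?x = "\<Gamma>0 (primitive T ?S)"
  have E0: "0 \<le> ?E" by (simp add: L2_energy_eq ip_self_nonneg)
  have b0: "0 < b" using b E0 by linarith
  obtain e where e: "0 < e" "\<And>y. dist y ?x < e \<Longrightarrow> y \<in> G" using G S by (metis open_dist)
  define k where "k \<epsilon> s \<omega> = ?S s" for \<epsilon> :: real and s and \<omega> :: 'w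
  have k: "k \<epsilon> \<in> bounded_controls M T B ?E" for \<epsilon>
    unfolding k_def[abs_def] by (rule step_bounded_control[of K "\<lambda>_. \<kappa>"]) simp_all
  define Y where "Y \<epsilon> \<omega> = shifted_BM_path T B \<epsilon> (\<lambda>s. k \<epsilon> s \<omega>) \<omega>" for \<epsilon> \<omega>
  define c where "c \<epsilon> q z = 1 / sqrt \<epsilon> * \<kappa> q" for \<epsilon> :: real and q and z :: "nat \<times> nat \<Rightarrow> real"
  have Y: "Y \<epsilon> = steered_path K n (c \<epsilon>)" for \<epsilon>
    unfolding Y_def k_def shifted_BM_path_step by (simp add: steered_path_def c_def fun_eq_iff)
  have c: "c \<epsilon> q \<in> borel_measurable borel" "causal (c \<epsilon>)" for \<epsilon> q by (simp_all add: c_def[abs_def] causal_def)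
  have Ym: "Y \<epsilon> \<in> M \<rightarrow>\<^sub>M path_space T" for \<epsilon> unfolding Y by (rule measurable_steered_path[OF c(1)])
  have Zm: "(\<lambda>\<omega>. primitive T (\<lambda>s. k \<epsilon> s \<omega>)) \<in> M \<rightarrow>\<^sub>M path_space T" for \<epsilon>
    unfolding k_def using measurable_primitive_step[of "\<lambda>_. \<kappa>" K n] by simp
  let ?D = "\<lambda>\<epsilon>. {\<omega>\<in>space M. e / 2 < dist (\<Gamma> \<epsilon> (shifted_BM_path T B \<epsilon> (\<lambda>s. k \<epsilon> s \<omega>) \<omega>)) (\<Gamma>0 (primitive T (\<lambda>s. k \<epsilon> s \<omega>)))}"
  have lim: "((\<lambda>\<epsilon>. measure (completion M) (?D \<epsilon>)) \<longlongrightarrow> 0) (at_right 0)"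
    by (rule i[of k ?E "e / 2"]) (use k e in auto)
  have "((\<lambda>\<epsilon>. (1 - measure (completion M) (?D \<epsilon>)) * b - \<epsilon> * ln 2) \<longlongrightarrow> (1 - 0) * b - 0 * ln 2) (at_right 0)"
    by (rule tendsto_diff[OF tendsto_mult[OF tendsto_diff[OF tendsto_const lim] tendsto_const]
          tendsto_mult[OF tendsto_ident_at tendsto_const]])
  from order_tendstoD(1)[OF this, of "1 / 2 * ?E"]
  have "\<forall>\<^sub>F \<epsilon> in at_right 0. 1 / 2 * ?E < (1 - measure (completion M) (?D \<epsilon>)) * b - \<epsilon> * ln 2"
    using b by argo
  then show ?thesis
    using eventually_at_right_less
  proof eventually_elim
    case (elim \<epsilon>)
    let ?A = "\<Gamma> \<epsilon> -` G \<inter> space (path_space T)"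
    have A: "?A \<in> sets (path_space T)" using \<Gamma>[OF elim(2)] G by (intro measurable_sets[of _ _ borel]) auto
    have A_iff: "Y' \<omega> \<in> ?A \<longleftrightarrow> \<Gamma> \<epsilon> (Y' \<omega>) \<in> G" if "Y' \<in> M \<rightarrow>\<^sub>M path_space T" "\<omega> \<in> space M"
      for Y' :: "'w \<Rightarrow> real \<Rightarrow> nat \<Rightarrow> real" and \<omega>
      using measurable_space[OF that] by simp
    have p: "level \<epsilon> G = prob {\<omega>\<in>space M. BM_path T B \<omega> \<in> ?A}"
      unfolding level_def by (intro arg_cong[where f = prob] Collect_cong) (use A_iff[OF measurable_BM_path] in auto)
    have D: "?D \<epsilon> \<in> events" by (rule measurable_gap[OF elim(2) Ym[unfolded Y_def] Zm])
    have Q: "1 - measure (completion M) (?D \<epsilon>) \<le> prob {\<omega>\<in>space M. steered_path K n (c \<epsilon>) \<omega> \<in> ?A}"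
    proof -
      have "space M - ?D \<epsilon> \<subseteq> {\<omega>\<in>space M. Y \<epsilon> \<omega> \<in> ?A}"
      proof
        fix \<omega> assume "\<omega> \<in> space M - ?D \<epsilon>"
        then have \<omega>: "\<omega> \<in> space M" and d: "dist (\<Gamma> \<epsilon> (Y \<epsilon> \<omega>)) ?x \<le> e / 2" by (auto simp: Y_def k_def)
        have "\<Gamma> \<epsilon> (Y \<epsilon> \<omega>) \<in> G" by (rule e(2)) (use d e(1) in linarith)
        then show "\<omega> \<in> {\<omega>\<in>space M. Y \<epsilon> \<omega> \<in> ?A}" using A_iff[OF Ym \<omega>] \<omega> by blast
      qed
      moreover have "{\<omega>\<in>space M. Y \<epsilon> \<omega> \<in> ?A} \<in> events" using Ym A by measurable
      ultimately have "prob (space M - ?D \<epsilon>) \<le> prob {\<omega>\<in>space M. Y \<epsilon> \<omega> \<in> ?A}" by (rule finite_measure_mono)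
      then show ?thesis unfolding Y prob_compl[OF D] measure_completion[OF D] .
    qed
    show ?case
      unfolding scaled_log_ge_iff[OF elim(2) level_bounds(1)]
    proof (rule ccontr)
      assume "\<not> exp (- b / \<epsilon>) \<le> level \<epsilon> G"
      then have small: "prob {\<omega>\<in>space M. BM_path T B \<omega> \<in> ?A} \<le> exp (- (b / \<epsilon>))" by (simp add: p)
      \<comment> \<open>The entropy bound asks for one bound valid at all indices; cutting
        \<open>c \<epsilon>\<close> off outside the finite index set provides it and leaves the path
        unchanged.\<close>
      define c' where "c' q z = (if q \<in> {..<2 ^ K} \<times> {..<n} then c \<epsilon> q z else 0)" for q and z :: "nat \<times> nat \<Rightarrow> real"
      have same: "steered_path K n c' = steered_path K n (c \<epsilon>)"
      proof -
        have "step T K n (\<lambda>q. c' q z) = step T K n (\<lambda>q. c \<epsilon> q z)" for z by (rule step_cong) (simp add: c'_def)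
        then show ?thesis by (intro ext) (simp only: steered_path_def controlled_path_def)
      qed
      have c'b: "\<bar>c' q z\<bar> \<le> (\<Sum>q\<in>{..<2 ^ K} \<times> {..<n}. \<bar>1 / sqrt \<epsilon> * \<kappa> q\<bar>)" for q z
      proof (cases "q \<in> {..<2 ^ K} \<times> {..<n}")
        case True
        then show ?thesis unfolding c'_def c_def
          using member_le_sum[of q "{..<2 ^ K} \<times> {..<n}" "\<lambda>q. \<bar>1 / sqrt \<epsilon> * \<kappa> q\<bar>"] by auto
      next
        case False
        have "0 \<le> (\<Sum>q\<in>{..<2 ^ K} \<times> {..<n}. \<bar>1 / sqrt \<epsilon> * \<kappa> q\<bar>)" by (rule sum_nonneg) simp
        then show ?thesis using False by (simp only: c'_def if_False abs_zero)
      qed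
      have c'm: "c' q \<in> borel_measurable borel" "causal c'" for q
      proof -
        have eq: "c' = (\<lambda>q z. if q \<in> {..<2 ^ K} \<times> {..<n} then 1 / sqrt \<epsilon> * \<kappa> q else 0)"
          by (intro ext) (simp only: c'_def c_def)
        show "c' q \<in> borel_measurable borel" unfolding eq by (rule borel_measurable_const)
        show "causal c'" unfolding eq causal_def by simp
      qed
      have "prob {\<omega>\<in>space M. steered_path K n c' \<omega> \<in> ?A} * (b / \<epsilon>)
        \<le> T / 2 ^ K / 2 * (\<Sum>q\<in>{..<2 ^ K} \<times> {..<n}. expectation (\<lambda>\<omega>. (c' q (inc K n \<omega>))\<^sup>2)) + ln 2"
        by (rule entropy_bound[OF c'm c'b A _ small]) (use b0 elim(2) in simp)
      also have "(\<Sum>q\<in>{..<2 ^ K} \<times> {..<n}. expectation (\<lambda>\<omega>. (c' q (inc K n \<omega>))\<^sup>2)) = (\<Sum>q\<in>{..<2 ^ K} \<times> {..<n}. (\<kappa> q)\<^sup>2 / \<epsilon>)"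
        using elim(2) by (intro sum.cong refl) (simp add: c'_def c_def prob_space power_mult_distrib power_divide)
      also have "T / 2 ^ K / 2 * \<dots> = ?E / (2 * \<epsilon>)"
        by (simp add: energy_step[OF T] sum_divide_distrib[symmetric])
      finally have "prob {\<omega>\<in>space M. steered_path K n (c \<epsilon>) \<omega> \<in> ?A} * (b / \<epsilon>) \<le> ?E / (2 * \<epsilon>) + ln 2" unfolding same .
      moreover have "q * b \<le> 1 / 2 * u + \<epsilon> * l" if "q * (b / \<epsilon>) \<le> u / (2 * \<epsilon>) + l" for q u l :: real
      proof -
        have "(q * (b / \<epsilon>)) * \<epsilon> \<le> (u / (2 * \<epsilon>) + l) * \<epsilon>" using that elim(2) by (intro mult_right_mono) auto
        moreover have "(q * (b / \<epsilon>)) * \<epsilon> = q * b" "(u / (2 * \<epsilon>) + l) * \<epsilon> = 1 / 2 * u + \<epsilon> * l"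
          using elim(2) by (simp_all add: distrib_right)
        ultimately show ?thesis by simp
      qed
      ultimately have "prob {\<omega>\<in>space M. steered_path K n (c \<epsilon>) \<omega> \<in> ?A} * b \<le> 1 / 2 * ?E + \<epsilon> * ln 2"
        by blast
      moreover have "(1 - measure (completion M) (?D \<epsilon>)) * b \<le> prob {\<omega>\<in>space M. steered_path K n (c \<epsilon>) \<omega> \<in> ?A} * b"
        using Q b0 by (intro mult_right_mono) auto
      ultimately show False using elim(1) by linarith
    qed
  qed
qed

text \<open>The entropy bound reaches only dyadic step controls. The projections of a nearly optimal
  \<open>k\<close> have no larger energy, and along a subsequence their skeletons converge to that
  of \<open>k\<close>, so one of them already lies in the open set.\<close>

lemma lower_bound:
  assumes G: "open G"
  shows "- (INF x\<in>G. enn2ereal (rate x)) \<le> Liminf (at_right 0) (\<lambda>\<epsilon>. ereal \<epsilon> * ext_ln (level \<epsilon> G))"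
  unfolding le_Liminf_iff
proof (intro allI impI)
  fix y :: ereal assume "y < - (INF x\<in>G. enn2ereal (rate x))"
  then have "(INF x\<in>G. enn2ereal (rate x)) < - y" by (metis ereal_less_uminus_reorder)
  then obtain x where x: "x \<in> G" "enn2ereal (rate x) < - y" unfolding INF_less_iff by blast
  then have y0: "0 < - y" using enn2ereal_nonneg[of "rate x"] by (rule_tac le_less_trans)
  have "rate x < e2ennreal (- y)"
    using x(2) y0 by (simp add: less_ennreal.rep_eq enn2ereal_e2ennreal)
  then obtain k where k: "k \<in> L2_space T" "x = \<Gamma>0 (primitive T k)" "ennreal (1 / 2 * L2_energy T k) < e2ennreal (- y)"
    unfolding rate_def INF_less_iff by auto
  have "ereal (1 / 2 * L2_energy T k) < - y"
    using k(3) y0 by (simp add: less_ennreal.rep_eq enn2ereal_e2ennreal enn2ereal_ennreal L2_energy_eq ip_self_nonneg)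
  then obtain b where b: "ereal (1 / 2 * L2_energy T k) < ereal b" "ereal b < - y"
    using ereal_dense2 by blast
  obtain r z where r: "strict_mono (r :: nat \<Rightarrow> nat)" and z: "z \<in> L2_space T" "primitive T z = primitive T k"
    and lim: "L2_weak_tendsto T (\<lambda>m. step T (r m) (r m) (dyadic_mean T k (r m))) z sequentially"
    using step_approximation[OF T k(1)] by blast
  let ?S = "\<lambda>m. step T (r m) (r m) (dyadic_mean T k (r m))"
  have "?S m \<in> L2_ball T (L2_energy T k)" for m
    using step_dyadic_mean_energy[OF T k(1)] step_L2 by (simp add: L2_ball_def L2_space_eq)
  then have "(\<lambda>m. \<Gamma>0 (primitive T (?S m))) \<longlonglongrightarrow> \<Gamma>0 (primitive T z)"
    by (rule skeleton_continuous[OF _ z(1) lim])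
  then have "\<forall>\<^sub>F m in sequentially. \<Gamma>0 (primitive T (?S m)) \<in> G"
    by (rule topological_tendstoD[OF _ G]) (use x(1) k(2) z(2) in simp)
  then obtain m where m: "\<Gamma>0 (primitive T (?S m)) \<in> G" by (auto simp: eventually_sequentially)
  have "1 / 2 * L2_energy T (?S m) < b"
    using step_dyadic_mean_energy[OF T k(1), of "r m" "r m"] b(1) by simp
  from lower_bound_step[OF G m this]
  show "\<forall>\<^sub>F \<epsilon> in at_right 0. y < ereal \<epsilon> * ext_ln (level \<epsilon> G)"
  proof eventually_elim
    case (elim \<epsilon>)
    have "y < ereal (- b)" using b(2) by (metis ereal_uminus_uminus ereal_less_uminus_reorder uminus_ereal.simps(1))
    then show ?case using elim by (rule less_le_trans)
  qed
qed

lemma large_deviations: "satisfies_LDP M (\<lambda>\<epsilon> \<omega>. \<Gamma> \<epsilon> (BM_path T B \<omega>)) rate"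
  unfolding satisfies_LDP_def rate_function_def
proof (intro conjI allI impI)
  show "(\<lambda>\<omega>. \<Gamma> \<epsilon> (BM_path T B \<omega>)) \<in> borel_measurable M" if "0 < \<epsilon>" for \<epsilon>
    by (rule measurable_compose[OF measurable_BM_path \<Gamma>[OF that]])
  show "compact {x. rate x \<le> L}" if "L < \<infinity>" for L by (rule compact_sublevel[OF that])
  show "Limsup (at_right 0) (\<lambda>\<epsilon>. ereal \<epsilon> * ext_ln (measure M {\<omega> \<in> space M. \<Gamma> \<epsilon> (BM_path T B \<omega>) \<in> F}))
          \<le> - (INF x\<in>F. enn2ereal (rate x))" if "closed F" for F
    using upper_bound[OF that] by (simp add: level_def)
  show "- (INF x\<in>G. enn2ereal (rate x))
          \<le> Liminf (at_right 0) (\<lambda>\<epsilon>. ereal \<epsilon> * ext_ln (measure M {\<omega> \<in> space M. \<Gamma> \<epsilon> (BM_path T B \<omega>) \<in> G}))" if "open G" for G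
    using lower_bound[OF that] by (simp add: level_def)
qed

end

theorem theorem3p2:
  fixes M :: "'w measure" and T :: real
    and B :: "nat \<Rightarrow> real \<Rightarrow> 'w \<Rightarrow> real"
    and \<Gamma> :: "real \<Rightarrow> (real \<Rightarrow> nat \<Rightarrow> real) \<Rightarrow> 'e::polish_space"
    and \<Gamma>0 :: "(real \<Rightarrow> nat \<Rightarrow> real) \<Rightarrow> 'e"
  assumes "prob_space M" and "0 < T" and "independent_BMs M T B"
    and "\<And>\<epsilon>. 0 < \<epsilon> \<Longrightarrow> \<Gamma> \<epsilon> \<in> path_space T \<rightarrow>\<^sub>M borel"
    and "\<Gamma>0 \<in> path_space T \<rightarrow>\<^sub>M borel"
    and i: "\<And>(N::real) (k :: real \<Rightarrow> real \<Rightarrow> 'w \<Rightarrow> l2) (\<delta>::real).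
      (\<forall>\<epsilon>>0. k \<epsilon> \<in> bounded_controls M T B N) \<Longrightarrow> 0 < \<delta> \<Longrightarrow>
      ((\<lambda>\<epsilon>. measure (completion M) {\<omega> \<in> space M.
          dist (\<Gamma> \<epsilon> (shifted_BM_path T B \<epsilon> (\<lambda>s. k \<epsilon> s \<omega>) \<omega>))
               (\<Gamma>0 (primitive T (\<lambda>s. k \<epsilon> s \<omega>))) > \<delta>}) \<longlongrightarrow> 0) (at_right 0)"
    and ii: "\<And>(N::real) (k :: real \<Rightarrow> real \<Rightarrow> l2) k0.
      (\<forall>\<epsilon>>0. k \<epsilon> \<in> L2_ball T N) \<Longrightarrow> k0 \<in> L2_space T \<Longrightarrow>
      L2_weak_tendsto T k k0 (at_right 0) \<Longrightarrow>
      ((\<lambda>\<epsilon>. \<Gamma>0 (primitive T (k \<epsilon>))) \<longlongrightarrow> \<Gamma>0 (primitive T k0)) (at_right 0)"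
  shows "satisfies_LDP M (\<lambda>\<epsilon> \<omega>. \<Gamma> \<epsilon> (BM_path T B \<omega>))
           (\<lambda>g. INF k\<in>{k \<in> L2_space T. g = \<Gamma>0 (primitive T k)}. ennreal (1 / 2 * L2_energy T k))"
proof -
  interpret prob_space M by (rule assms(1))
  interpret small_noise M T B \<Gamma> \<Gamma>0
    by unfold_locales (fact assms)+
  show ?thesis using large_deviations unfolding rate_def[abs_def] .
qed

end
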